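(* For every positive integer $m$ let $\mathfrak{P}_m$ be a prime ideal of $\mathcal{O}_{K_m}$, where $K_m=\mathbb{Q}[\zeta_m]$, lying over a prime number that does not divide $m$, and let $q_m=|\mathcal{O}_{K_m}/\mathfrak{P}_m|$. Let $\mathcal{L}_{\mathcal{C},m}$ be the associated family of lattices in $(K_m\otimes_{\mathbb{Q}}\mathbb{R})^2\cong\mathbb{R}^{2\phi(m)}$ defined in the context. Assume that $\phi(m)^2 m=o\big(q_m^{1/\phi(m)}\big)$ as $m\to\infty$. Then for infinitely many dimensions $n$ there is an $m$ with $n=2\phi(m)$ such that the family $\mathcal{L}_{\mathcal{C},m}$ contains a symplectic lattice $\Lambda\subset\mathbb{R}^n$ satisfying $$\Delta(\Lambda)\geq\frac{0.89\,n\log\log n}{2^n}.$$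
   Context: $\phi$ is Euler's totient function, $\zeta_m$ a primitive $m$-th root of unity, $K=\mathbb{Q}[\zeta_m]$ with ring of integers $\mathcal{O}_K$ and discriminant $d_K$, and $K_{\mathbb{R}}=K\otimes_{\mathbb{Q}}\mathbb{R}$ is a Euclidean space of dimension $\phi(m)$ for the scalar product $\langle x,y\rangle=\mathrm{tr}(x\overline{y})$ induced by the trace form of $K/\mathbb{Q}$ and complex conjugation. $E=K_{\mathbb{R}}^2$ carries the scalar product $\langle x,y\rangle=\langle x_1,y_1\rangle+\langle x_2,y_2\rangle$ and is identified isometrically with $\mathbb{R}^{2\phi(m)}$. The dual of a lattice $\Lambda$ in a Euclidean space $E$ is $\Lambda^\#=\{x\in E: \langle x,y\rangle\in\mathbb{Z}\ \forall y\in\Lambda\}$. $\Lambda$ is symplectic if there is an isometry $\sigma$ of $E$ with $\sigma(\Lambda)=\Lambda^\#$ and $\sigma^2=-\mathrm{Id}$. Let $\mathfrak{P}$ be a prime ideal of $\mathcal{O}_K$ over a prime number not dividing $m$, $F=\mathcal{O}_K/\mathfrak{P}$, $q=|F|$. Put $\alpha=(q|d_K|)^{1/(2\phi(m))}$ and $\Lambda_0=\alpha^{-1}\mathcal{O}_K\times\alpha\,\mathfrak{P}^{-1}\mathcal{O}_K^\#\subset E$, where $\mathcal{O}_K^\#$ is the dual of $\mathcal{O}_K$ in $K_{\mathbb{R}}$. Let $\pi:\Lambda_0\to\Lambda_0/\mathfrak{P}\Lambda_0$ be the canonical surjection onto this $2$-dimensional $F$-vector space. $\mathcal{C}$ is the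 set of its $q+1$ one-dimensional $F$-subspaces; for $C\in\mathcal{C}$, $\Lambda_C=\pi^{-1}(C)$; and $\mathcal{L}_{\mathcal{C}}=\{\Lambda_C:C\in\mathcal{C}\}$. $\mathcal{L}_{\mathcal{C},m}$ denotes this family for the given $m$ and $\mathfrak{P}=\mathfrak{P}_m$. For a lattice $\Lambda$ in an $n$-dimensional Euclidean space, $\mathrm{Vol}(\Lambda)$ is the volume of a fundamental region, $\mu_\Lambda=\min\{\|x\|:x\in\Lambda\setminus\{0\}\}$, $B(r)$ is the closed ball of radius $r$ centered at $0$, and $\Delta(\Lambda)=\frac{\mathrm{Vol}(B(\mu_\Lambda))}{2^n\mathrm{Vol}(\Lambda)}$. *)

theory Defs
  imports
    "HOL-Analysis.Analysis"
    "HOL-Library.Function_Algebras"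
    "HOL-Library.Landau_Symbols"
    "HOL-Number_Theory.Totient"
    "HOL-Algebra.QuotRing"
    "Jordan_Normal_Form.Determinant"
    "Jordan_Normal_Form.Missing_VectorSpace"
begin

instantiation "fun" :: (type, real_vector) real_vector
begin

definition scaleR_fun :: "real \<Rightarrow> ('a \<Rightarrow> 'b) \<Rightarrow> 'a \<Rightarrow> 'b" where
  "scaleR_fun r f = (\<lambda>x. r *\<^sub>R f x)"

instance
  by standard
    (simp_all add: scaleR_fun_def fun_eq_iff scaleR_add_right scaleR_add_left)

end

text \<open>
  A Euclidean space is given by a finite-dimensional subspace \<open>V\<close> of a real vector space together
  with a function \<open>ip\<close> whose restriction to \<open>V\<close> is a scalar product. The dimension is not
  reflected in a type, so that it may be quantified over.
\<close>

definition orthonormal_basis :: "'v::real_vector set \<Rightarrow> ('v \<Rightarrow> 'v \<Rightarrow> real) \<Rightarrow> 'v set \<Rightarrow> bool" where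
  "orthonormal_basis V ip B \<longleftrightarrow>
     finite B \<and> Real_Vector_Spaces.span B = V \<and>
     (\<forall>x\<in>B. \<forall>y\<in>B. ip x y = (if x = y then 1 else 0))"

text \<open>
  Lebesgue measure on \<open>V\<close>, transported from the product Lebesgue measure on \<open>\<real>\<^sup>B\<close> along the
  isometry given by an orthonormal basis \<open>B\<close>. It does not depend on \<open>B\<close>, because Lebesgue
  measure is invariant under orthogonal maps.
\<close>
definition volume :: "'v::real_vector set \<Rightarrow> ('v \<Rightarrow> 'v \<Rightarrow> real) \<Rightarrow> 'v set \<Rightarrow> real" where
  "volume V ip A =
     (let B = (SOME B. orthonormal_basis V ip B) in
      measure (Pi\<^sub>M B (\<lambda>_. lborel)) {c \<in> extensional B. (\<Sum>b\<in>B. c b *\<^sub>R b) \<in> A})"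

definition lattice_basis :: "'v::real_vector set \<Rightarrow> 'v set \<Rightarrow> 'v set \<Rightarrow> bool" where
  "lattice_basis V \<Lambda> B \<longleftrightarrow>
     finite B \<and> Real_Vector_Spaces.independent B \<and> Real_Vector_Spaces.span B = V \<and>
     \<Lambda> = range (\<lambda>c. \<Sum>b\<in>B. real_of_int (c b) *\<^sub>R b)"

definition is_lattice :: "'v::real_vector set \<Rightarrow> 'v set \<Rightarrow> bool" where
  "is_lattice V \<Lambda> \<longleftrightarrow> (\<exists>B. lattice_basis V \<Lambda> B)"

text \<open>
  The volume of a fundamental parallelepiped; any two fundamental regions have the same volume.
\<close>
definition covolume :: "'v::real_vector set \<Rightarrow> ('v \<Rightarrow> 'v \<Rightarrow> real) \<Rightarrow> 'v set \<Rightarrow> real" where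
  "covolume V ip \<Lambda> =
     (let B = (SOME B. lattice_basis V \<Lambda> B) in
      volume V ip {\<Sum>b\<in>B. t b *\<^sub>R b | t. \<forall>b\<in>B. 0 \<le> t b \<and> t b < 1})"

definition ip_norm :: "('v \<Rightarrow> 'v \<Rightarrow> real) \<Rightarrow> 'v \<Rightarrow> real" where
  "ip_norm ip x = sqrt (ip x x)"

text \<open>The infimum is attained when \<open>\<Lambda>\<close> is a lattice in a nonzero space.\<close>
definition lattice_min :: "('v::real_vector \<Rightarrow> 'v \<Rightarrow> real) \<Rightarrow> 'v set \<Rightarrow> real" where
  "lattice_min ip \<Lambda> = (INF x\<in>\<Lambda> - {0}. ip_norm ip x)"

definition packing_density :: "'v::real_vector set \<Rightarrow> ('v \<Rightarrow> 'v \<Rightarrow> real) \<Rightarrow> 'v set \<Rightarrow> real" where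
  "packing_density V ip \<Lambda> =
     volume V ip {x \<in> V. ip_norm ip x \<le> lattice_min ip \<Lambda>} /
     (2 ^ Real_Vector_Spaces.dim V * covolume V ip \<Lambda>)"

definition dual_lattice :: "'v set \<Rightarrow> ('v \<Rightarrow> 'v \<Rightarrow> real) \<Rightarrow> 'v set \<Rightarrow> 'v set" where
  "dual_lattice V ip \<Lambda> = {x \<in> V. \<forall>y\<in>\<Lambda>. ip x y \<in> \<int>}"

definition linear_isometry :: "'v::real_vector set \<Rightarrow> ('v \<Rightarrow> 'v \<Rightarrow> real) \<Rightarrow> ('v \<Rightarrow> 'v) \<Rightarrow> bool" where
  "linear_isometry V ip s \<longleftrightarrow>
     bij_betw s V V \<and>
     (\<forall>x\<in>V. \<forall>y\<in>V. s (x + y) = s x + s y) \<and>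
     (\<forall>r. \<forall>x\<in>V. s (r *\<^sub>R x) = r *\<^sub>R s x) \<and>
     (\<forall>x\<in>V. \<forall>y\<in>V. ip (s x) (s y) = ip x y)"

definition symplectic :: "'v::real_vector set \<Rightarrow> ('v \<Rightarrow> 'v \<Rightarrow> real) \<Rightarrow> 'v set \<Rightarrow> bool" where
  "symplectic V ip \<Lambda> \<longleftrightarrow>
     is_lattice V \<Lambda> \<and>
     (\<exists>s. linear_isometry V ip s \<and> s ` \<Lambda> = dual_lattice V ip \<Lambda> \<and> (\<forall>x\<in>V. s (s x) = - x))"

definition complex_ring :: "complex set \<Rightarrow> complex ring" where
  "complex_ring S = \<lparr>carrier = S, mult = (*), one = 1, zero = 0, add = (+)\<rparr>"

definition ring_of_integers :: "complex set \<Rightarrow> complex set" where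
  "ring_of_integers K = {x \<in> K. algebraic_int x}"

text \<open>Extensionality makes an embedding determined by its values on \<open>K\<close>, so that none is counted twice.\<close>
definition embeddings :: "complex set \<Rightarrow> (complex \<Rightarrow> complex) set" where
  "embeddings K = Ring.ring_hom (complex_ring K) (complex_ring UNIV) \<inter> extensional K"

definition field_trace :: "complex set \<Rightarrow> complex \<Rightarrow> complex" where
  "field_trace K x = (\<Sum>\<sigma>\<in>embeddings K. \<sigma> x)"

definition integral_basis :: "complex set \<Rightarrow> complex list \<Rightarrow> bool" where
  "integral_basis K bs \<longleftrightarrow>
     set bs \<subseteq> ring_of_integers K \<and>
     (\<forall>x\<in>ring_of_integers K. \<exists>!c :: int list.
        length c = length bs \<and> x = (\<Sum>i<length bs. of_int (c ! i) * bs ! i))"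

definition discriminant :: "complex set \<Rightarrow> complex" where
  "discriminant K =
     (let bs = (SOME bs. integral_basis K bs); n = length bs in
      Determinant.det (Matrix.mat n n (\<lambda>(i, j). field_trace K (bs ! i * bs ! j))))"

definition residue_field :: "complex set \<Rightarrow> complex set \<Rightarrow> complex set ring" where
  "residue_field K P = complex_ring (ring_of_integers K) Quot P"

definition residue_card :: "complex set \<Rightarrow> complex set \<Rightarrow> nat" where
  "residue_card K P = card (carrier (residue_field K P))"

text \<open>\<open>P \<inter> \<int> = p\<int>\<close> expresses that \<open>P\<close> lies over \<open>p\<close>.\<close>
definition prime_over :: "complex set \<Rightarrow> complex set \<Rightarrow> nat \<Rightarrow> bool" where
  "prime_over K P p \<longleftrightarrow>
     primeideal P (complex_ring (ring_of_integers K)) \<and>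
     P \<inter> \<int> = range (\<lambda>k::int. of_nat p * of_int k)"

definition inverse_ideal :: "complex set \<Rightarrow> complex set \<Rightarrow> complex set" where
  "inverse_ideal K P = {x \<in> K. \<forall>a\<in>P. x * a \<in> ring_of_integers K}"

text \<open>
  \<open>K \<otimes>\<^sub>\<rat> \<real>\<close> is identified, as a real algebra, with the real span of the image of \<open>K\<close> in the
  product of copies of the complex numbers indexed by the embeddings of \<open>K\<close>: the map sending
  \<open>x \<otimes> r\<close> to \<open>(r \<sigma>(x))\<^sub>\<sigma>\<close> is injective. Multiplication is componentwise, and the trace extends
  to the sum of the components. When \<open>K\<close> is a cyclotomic field, complex conjugation on \<open>K\<close> commutes
  with all embeddings, so it extends to componentwise conjugation.
\<close>

type_synonym mink = "(complex \<Rightarrow> complex) \<Rightarrow> complex"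

definition mink_emb :: "complex set \<Rightarrow> complex \<Rightarrow> mink" where
  "mink_emb K x = (\<lambda>\<sigma>. if \<sigma> \<in> embeddings K then \<sigma> x else 0)"

definition mink_space :: "complex set \<Rightarrow> mink set" where
  "mink_space K = Real_Vector_Spaces.span (mink_emb K ` K)"

text \<open>The sum is real whenever \<open>x\<close> and \<open>y\<close> lie in \<open>mink_space K\<close>; \<open>Re\<close> only adjusts the type.\<close>
definition mink_ip :: "complex set \<Rightarrow> mink \<Rightarrow> mink \<Rightarrow> real" where
  "mink_ip K x y = Re (\<Sum>\<sigma>\<in>embeddings K. x \<sigma> * cnj (y \<sigma>))"

definition plane :: "complex set \<Rightarrow> (mink \<times> mink) set" where
  "plane K = mink_space K \<times> mink_space K"

definition plane_ip :: "complex set \<Rightarrow> mink \<times> mink \<Rightarrow> mink \<times> mink \<Rightarrow> real" where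
  "plane_ip K x y = mink_ip K (fst x) (fst y) + mink_ip K (snd x) (snd y)"

definition plane_smult :: "complex set \<Rightarrow> complex \<Rightarrow> mink \<times> mink \<Rightarrow> mink \<times> mink" where
  "plane_smult K a x = (mink_emb K a * fst x, mink_emb K a * snd x)"

text \<open>The additive group generated by all \<open>act a x\<close>; used for products of ideals with modules.\<close>
definition module_prod :: "(complex \<Rightarrow> 'v \<Rightarrow> 'v) \<Rightarrow> complex set \<Rightarrow> 'v::ab_group_add set \<Rightarrow> 'v set" where
  "module_prod act A X = {\<Sum>(a, x)\<leftarrow>ps. act a x | ps. set ps \<subseteq> A \<times> X}"

definition cyclotomic_field :: "nat \<Rightarrow> complex set" where
  "cyclotomic_field m =
     range (\<lambda>p :: rat poly. poly (map_poly of_rat p) (cis (2 * pi / real m)))"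

definition scaling :: "nat \<Rightarrow> complex set \<Rightarrow> real" where
  "scaling m P =
     (real (residue_card (cyclotomic_field m) P) * cmod (discriminant (cyclotomic_field m)))
       powr (1 / (2 * real (totient m)))"

definition Lambda0 :: "nat \<Rightarrow> complex set \<Rightarrow> (mink \<times> mink) set" where
  "Lambda0 m P =
     (let K = cyclotomic_field m; \<alpha> = scaling m P;
          OK = mink_emb K ` ring_of_integers K;
          OK_dual = dual_lattice (mink_space K) (mink_ip K) OK
      in (\<lambda>x. inverse \<alpha> *\<^sub>R x) ` OK \<times>
         (\<lambda>x. \<alpha> *\<^sub>R x) ` module_prod (\<lambda>a x. mink_emb K a * x) (inverse_ideal K P) OK_dual)"

definition P_Lambda0 :: "nat \<Rightarrow> complex set \<Rightarrow> (mink \<times> mink) set" where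
  "P_Lambda0 m P = module_prod (plane_smult (cyclotomic_field m)) P (Lambda0 m P)"

text \<open>
  The fields \<open>mult\<close> and \<open>one\<close> are inherited from rings and play no role in a module.
\<close>
definition Lambda0_module :: "nat \<Rightarrow> complex set \<Rightarrow> (complex, mink \<times> mink) module" where
  "Lambda0_module m P =
     \<lparr>carrier = Lambda0 m P, mult = undefined, one = undefined, zero = 0, add = (+),
      smult = plane_smult (cyclotomic_field m)\<rparr>"

definition reduction :: "nat \<Rightarrow> complex set \<Rightarrow> mink \<times> mink \<Rightarrow> (mink \<times> mink) set" where
  "reduction m P x = P_Lambda0 m P +>\<^bsub>Lambda0_module m P\<^esub> x"

text \<open>
  In \<open>smult\<close> all the sets in the union coincide, since \<open>P\<close> annihilates the quotient.
\<close>
definition quotient_space :: "nat \<Rightarrow> complex set \<Rightarrow> (complex set, (mink \<times> mink) set) module" where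
  "quotient_space m P =
     \<lparr>carrier = a_rcosets\<^bsub>Lambda0_module m P\<^esub> (P_Lambda0 m P),
      mult = undefined, one = undefined, zero = P_Lambda0 m P,
      add = set_add (Lambda0_module m P),
      smult = (\<lambda>A X. \<Union>a\<in>A. \<Union>x\<in>X. reduction m P (plane_smult (cyclotomic_field m) a x))\<rparr>"

definition lines :: "nat \<Rightarrow> complex set \<Rightarrow> (mink \<times> mink) set set set" where
  "lines m P =
     (let F = residue_field (cyclotomic_field m) P; V = quotient_space m P in
      {C. VectorSpace.subspace F C V \<and> vectorspace.dim F (V\<lparr>carrier := C\<rparr>) = 1})"

definition lattice_family :: "nat \<Rightarrow> complex set \<Rightarrow> (mink \<times> mink) set set" where
  "lattice_family m P = (\<lambda>C. {x \<in> Lambda0 m P. reduction m P x \<in> C}) ` lines m P"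

end

theory Submission
  imports Defs "HOL-Number_Theory.Residues" "HOL-Real_Asymp.Real_Asymp" "Jordan_Normal_Form.Char_Poly"
begin

text \<open>
  For \<open>t \<in> \<O>\<close>, the points \<open>(\<alpha>\<^sup>-\<^sup>1 x, \<alpha> y)\<close> of \<open>\<Lambda>\<^sub>0\<close> with \<open>y \<equiv> t x y\<^sub>0\<close> modulo \<open>\<O>\<^sup>#\<close>, where \<open>y\<^sub>0\<close> generates
  \<open>P\<^sup>-\<^sup>1\<O>\<^sup>#/\<O>\<^sup>#\<close>, form the lattice \<open>\<Lambda>\<^sub>t\<close> of a line. The trace form pairs the two coordinates, so that
  \<open>(u, v) \<mapsto> (-cnj v, cnj u)\<close> maps \<open>\<Lambda>\<^sub>t\<close> onto its dual. Hence \<open>\<Lambda>\<^sub>t\<close> is symplectic of covolume 1.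

  The \<open>q\<close> lattices \<open>\<Lambda>\<^sub>t\<close>, \<open>t\<close> modulo \<open>P\<close>, meet only in \<open>P\<Lambda>\<^sub>0\<close>, whose nonzero vectors are long since \<open>q\<close> is
  large, and \<open>\<Lambda>\<^sub>0\<close> is so dense that a ball of volume \<open>(1 - \<epsilon>) m\<close> contains less than \<open>q m\<close> of its points. The \<open>m\<close>-th
  roots of unity act freely on the nonzero vectors of \<open>\<Lambda>\<^sub>t\<close> by isometries. If every \<open>\<Lambda>\<^sub>t\<close> had a nonzero vector
  in the ball, the ball would therefore contain at least \<open>q m\<close> points of \<open>\<Lambda>\<^sub>0\<close>. So some \<open>\<Lambda>\<^sub>t\<close> has density
  at least \<open>(1 - \<epsilon>) m / 2\<^sup>n\<close>.

  If \<open>m\<close> is the product of all primes up to \<open>x\<close>, then \<open>m / \<phi>(m)\<close> is the Mertens product, which exceeds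
  \<open>c ln x\<close> for arbitrarily large \<open>x\<close> if \<open>ln c < \<gamma>\<close>: otherwise partial summation bounds
  \<open>\<Sum>\<^sub>p -ln (1 - 1/p) p\<^bsup>-s\<^esup> \<ge> ln \<zeta>(1 + s) \<ge> ln (1/s)\<close> by \<open>ln c - \<gamma> + ln (1/s) + o(1)\<close> as \<open>s\<close> tends to 0.
  The constant is explained by \<open>exp \<gamma> > 1.78 = 2 \<cdot> 0.89\<close>.
\<close>

section \<open>Lebesgue measure under linear maps\<close>

text \<open>The arithmetic is carried by covolumes instead of the ideal theory of Dedekind domains:
  an index is a quotient of covolumes, and \<open>P\<close> is inverted by means of the congruence
  x^Q = x modulo p for all integers x of K, which says that p is unramified and also supplies
  inverses modulo \<open>P\<close>. Write d = phi(m). An ideal lattice offers two estimates. A short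
  vector times the powers of \<open>zeta\<close> gives d independent vectors of equal length, hence
  a small covering radius. A vector times all integers of K gives a sublattice whose covolume is
  scaled by the norm, hence by AM-GM a lower bound for its length. The first makes the covering
  radius of Lambda_0 of order d q^(-1/(2d)). It must be small against r/d for a ball of radius r,
  where r^2 is at least of order d, or enlarging the ball by it would spoil the constant. This asks
  for q^(1/d) large against d^3. The second, applied to P Lambda_0, asks for q^(1/d) at least d^2 m.
  Since d <= m, both follow from the growth hypothesis.\<close>

lemma elementary_row_induct [consumes 2, case_names one addrow multrow]:
  fixes A :: "'a::field Matrix.mat"
  assumes A: "A \<in> carrier_mat n n" and det: "Determinant.det A \<noteq> 0"
    and one: "P (1\<^sub>m n)"
    and addrow: "\<And>A a k l. A \<in> carrier_mat n n \<Longrightarrow> k < n \<Longrightarrow> l < n \<Longrightarrow> k \<noteq> l \<Longrightarrow> P A \<Longrightarrow> P (addrow a k l A)"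
    and multrow: "\<And>A a k. A \<in> carrier_mat n n \<Longrightarrow> k < n \<Longrightarrow> a \<noteq> 0 \<Longrightarrow> P A \<Longrightarrow> P (multrow k a A)"
  shows "P A"
proof -
  \<comment> \<open>Each operation is undone by one of the same kind, so \<open>P\<close> also
    passes from the result back to \<open>A\<close>. This lets the elimination run forwards,
    starting from \<open>A\<close>.\<close>
  have R1: "P A" if "P (addrow a k l A)" "A \<in> carrier_mat n n" "k < n" "l < n" "k \<noteq> l" for A a k l
  proof -
    have "addrow (-a) k l (addrow a k l A) = A"
      using that by (intro eq_matI) auto
    then show ?thesis using addrow[of "addrow a k l A" k l "-a"] that by simp
  qed
  have R2: "P A" if "P (multrow k a A)" "A \<in> carrier_mat n n" "k < n" "a \<noteq> 0" for A a k
  proof -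
    have "multrow k (inverse a) (multrow k a A) = A"
      using that by (intro eq_matI) auto
    then show ?thesis using multrow[of "multrow k a A" k "inverse a"] that by simp
  qed
  \<comment> \<open>The first \<open>j\<close> columns are already those of the identity. The
    induction runs from \<open>j = n\<close> downwards, so each step has to clear one more
    column.\<close>
  define unitcols where "unitcols j A \<longleftrightarrow> (\<forall>i<n. \<forall>c<j. A $$ (i,c) = (if i = c then 1 else 0))"
    for j and A :: "'a Matrix.mat"
  have "P A" if "unitcols j A" "j \<le> n" "A \<in> carrier_mat n n" "Determinant.det A \<noteq> 0" for j A
    using that(2,1,3,4)
  proof (induction j arbitrary: A rule: inc_induct)
    case base
    then have "A = 1\<^sub>m n" by (intro eq_matI) (auto simp: unitcols_def)
    then show ?case using one by simp
  next
    case (step j)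
    have pivot_one: "P B" if B: "unitcols j B" "B \<in> carrier_mat n n" "Determinant.det B \<noteq> 0" "B $$ (j,j) = 1" for B
    proof -
      \<comment> \<open>\<open>B\<close> after clearing column \<open>j\<close> in the rows of
        \<open>S\<close> by means of the pivot row; enlarging \<open>S\<close> by one row is a
        single \<open>addrow\<close>.\<close>
      define el where "el S = Matrix.mat n n (\<lambda>(i,c). if i \<in> S then B $$ (i,c) - B $$ (i,j) * B $$ (j,c) else B $$ (i,c))" for S
      have "Determinant.det (el S) = Determinant.det B \<and> (P (el S) \<longrightarrow> P B)"
        if "finite S" "S \<subseteq> {..<n} - {j}" for S
        using that
      proof (induction S)
        case empty
        have "el {} = B" unfolding el_def using B by (intro eq_matI) auto
        then show ?case by simp
      next
        case (insert k S)
        have c: "el S \<in> carrier_mat n n" by (simp add: el_def)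
        have eq: "el (insert k S) = addrow (- B $$ (k,j)) k j (el S)"
          unfolding el_def using insert.prems insert.hyps step.hyps by (intro eq_matI) auto
        have k: "k < n" "j < n" "k \<noteq> j" using insert step.hyps by auto
        show ?case unfolding eq
          using insert R1[of "- B $$ (k,j)" k j "el S"] c k det_addrow[OF k(2,3) c] by auto
      qed
      note * = this[of "{..<n} - {j}"]
      have "unitcols (Suc j) (el ({..<n} - {j}))"
        unfolding unitcols_def
      proof (intro allI impI)
        fix i c assume ic: "i < n" "c < Suc j"
        show "el ({..<n} - {j}) $$ (i, c) = (if i = c then 1 else 0)"
          using ic B step.hyps by (cases "c = j") (auto simp: el_def unitcols_def)
      qed
      moreover have "el ({..<n} - {j}) \<in> carrier_mat n n" by (simp add: el_def)
      ultimately have "P (el ({..<n} - {j}))"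
        using step.IH * B by simp
      then show ?thesis using * by simp
    qed
    have pivot_ne: "P B" if B: "unitcols j B" "B \<in> carrier_mat n n" "Determinant.det B \<noteq> 0" "B $$ (j,j) \<noteq> 0" for B
    proof (rule R2[OF pivot_one])
      show "unitcols j (multrow j (inverse (B $$ (j,j))) B)"
        using B step.hyps by (auto simp: unitcols_def)
      show "Determinant.det (multrow j (inverse (B $$ (j,j))) B) \<noteq> 0"
        using det_multrow[OF step.hyps(2) B(2)] B by simp
    qed (use B step.hyps in auto)
    show ?case
    proof (cases "A $$ (j,j) = 0")
      case False
      then show ?thesis using pivot_ne step by blast
    next
      case True
      have "\<exists>i<n. i > j \<and> A $$ (i,j) \<noteq> 0"
      proof (rule ccontr)
        assume no: "\<not> ?thesis"
        \<comment> \<open>With no nonzero entry on or below the diagonal, column \<open>j\<close> is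
          a combination of the unit columns before it; \<open>v\<close> records this relation and
          lies in the kernel.\<close>
        define v where "v = Matrix.vec n (\<lambda>c. if c = j then 1 else if c < j then - A $$ (c,j) else 0)"
        have "A *\<^sub>v v = 0\<^sub>v n"
        proof (rule eq_vecI)
          fix i assume "i < dim_vec (0\<^sub>v n :: 'a Matrix.vec)"
          then have i: "i < n" by simp
          have "vec_index (A *\<^sub>v v) i = (\<Sum>c<n. A $$ (i,c) * vec_index v c)"
            using i step.prems by (auto simp: scalar_prod_def v_def atLeast0LessThan)
          also have "\<dots> = (\<Sum>c<n. (if c = j then A $$ (i,j) else 0) + (if c = i then (if i < j then - A $$ (i,j) else 0) else 0))"
            using i step.prems step.hyps no by (intro sum.cong) (auto simp: v_def unitcols_def)
          also have "\<dots> = A $$ (i,j) + (if i < j then - A $$ (i,j) else 0)"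
            using i step.hyps by (simp add: sum.distrib)
          also have "\<dots> = 0"
            using no i True by (cases "i = j"; cases "i < j") auto
          finally show "vec_index (A *\<^sub>v v) i = vec_index (0\<^sub>v n) i" using i by simp
        qed (use step.prems in simp)
        moreover have "v \<noteq> 0\<^sub>v n"
        proof
          assume "v = 0\<^sub>v n"
          then have "vec_index v j = 0" using step.hyps by simp
          then show False using step.hyps by (simp add: v_def)
        qed
        moreover have "v \<in> carrier_vec n" by (simp add: v_def)
        ultimately show False
          using det_0_iff_vec_prod_zero_field[OF step.prems(2)] step.prems(3) by blast
      qed
      then obtain i where i: "i < n" "i > j" "A $$ (i,j) \<noteq> 0" by blast
      \<comment> \<open>A pivot is created by adding row \<open>i\<close> to row \<open>j\<close>,
        which replaces the row swap of the usual elimination.\<close>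
      show ?thesis
      proof (rule R1[OF pivot_ne])
        show "unitcols j (addrow 1 j i A)"
          using step.prems step.hyps i by (auto simp: unitcols_def)
        show "Determinant.det (addrow 1 j i A) \<noteq> 0"
          using det_addrow[of i n j A 1] step.prems i by simp
      qed (use i step True in auto)
    qed
  qed
  from this[of 0 A] show ?thesis using A det by (simp add: unitcols_def)
qed

interpretation lborel_product: product_sigma_finite "\<lambda>_. lborel :: real measure"
  by standard

text \<open>By Fubini it is enough to look at the coordinate \<open>i\<close> alone, where the map
  is affine with slope \<open>s\<close>. This one map covers shears (\<open>s = 1\<close>),
  dilations (\<open>g = 0\<close>) and translations, from which all maps below are composed.\<close>

lemma emeasure_PiM_vimage_affine_upd:
  fixes g :: "('i \<Rightarrow> real) \<Rightarrow> real"
  assumes "finite I" "i \<in> I" "s \<noteq> 0"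
    and g [measurable]: "g \<in> borel_measurable (PiM (I - {i}) (\<lambda>_. lborel))"
    and X [measurable]: "X \<in> sets (PiM I (\<lambda>_. lborel))"
  defines "U \<equiv> \<lambda>c. c(i := g (restrict c (I - {i})) + s * c i)"
  shows "U \<in> measurable (PiM I (\<lambda>_. lborel)) (PiM I (\<lambda>_. lborel))"
    and "emeasure (PiM I (\<lambda>_. lborel)) (U -` X \<inter> space (PiM I (\<lambda>_. lborel))) * ennreal \<bar>s\<bar> =
      emeasure (PiM I (\<lambda>_. lborel)) X"
proof -
  define J where "J = I - {i}"
  have I: "I = insert i J" "finite J" "i \<notin> J" using assms by (auto simp: J_def)
  let ?M = "\<lambda>I. PiM I (\<lambda>_. lborel :: real measure)"
  have gJ [measurable]: "g \<in> borel_measurable (?M J)" using g by (simp add: J_def)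
  have res [measurable]: "(\<lambda>c. restrict c J) \<in> measurable (?M I) (?M J)"
    by (rule measurable_restrict_subset) (use I in auto)
  have ci [measurable]: "(\<lambda>c. c i) \<in> borel_measurable (?M I)"
    using assms(2) measurable_component_singleton[of i I "\<lambda>_. lborel :: real measure"] by simp
  have "(\<lambda>c. \<lambda>x\<in>I. if x = i then g (restrict c J) + s * c i else c x) \<in> measurable (?M I) (?M I)"
  proof (rule measurable_restrict)
    fix x assume "x \<in> I"
    show "(\<lambda>c. if x = i then g (restrict c J) + s * c i else c x) \<in> measurable (?M I) lborel"
    proof (cases "x = i")
      case False
      then show ?thesis using \<open>x \<in> I\<close> measurable_component_singleton[of x I "\<lambda>_. lborel :: real measure"] by simp
    qed simp
  qed
  moreover have "U c = (\<lambda>x\<in>I. if x = i then g (restrict c J) + s * c i else c x)" if "c \<in> space (?M I)" for c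
    using that assms(2) by (auto simp: U_def J_def space_PiM PiE_iff extensional_def fun_eq_iff)
  ultimately show U [measurable]: "U \<in> measurable (?M I) (?M I)"
    by (simp cong: measurable_cong)
  have meas: "U -` X \<inter> space (?M I) \<in> sets (?M I)" using U X by (rule measurable_sets)
  have "emeasure (?M I) X = (\<integral>\<^sup>+x. indicator X x \<partial>?M (insert i J))"
    using I X by (simp add: nn_integral_indicator)
  also have "\<dots> = (\<integral>\<^sup>+x. (\<integral>\<^sup>+y. indicator X (x(i := y)) \<partial>lborel) \<partial>?M J)"
    using I X by (intro lborel_product.product_nn_integral_insert) auto
  also have "\<dots> = (\<integral>\<^sup>+x. (\<integral>\<^sup>+y. indicator (U -` X \<inter> space (?M I)) (x(i := y)) \<partial>lborel) * \<bar>s\<bar> \<partial>?M J)"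
  proof (rule nn_integral_cong)
    fix x assume x: "x \<in> space (?M J)"
    have upd: "(\<lambda>y. x(i := y)) \<in> measurable lborel (?M I)"
      using x I(1) by (simp add: measurable_fun_upd[where I="insert i J" and J = J] space_PiM)
    have "(\<integral>\<^sup>+y. indicator X (x(i := y)) \<partial>lborel) = \<bar>s\<bar> * (\<integral>\<^sup>+y. indicator X (x(i := g x + s * y)) \<partial>lborel)"
    proof (rule nn_integral_real_affine)
      show "(\<lambda>y. indicator X (x(i := y)) :: ennreal) \<in> borel_measurable borel"
        using measurable_compose[OF upd borel_measurable_indicator[OF X]] by simp
    qed (use assms in auto)
    also have "(\<integral>\<^sup>+y. indicator X (x(i := g x + s * y)) \<partial>lborel) =
       (\<integral>\<^sup>+y. indicator (U -` X \<inter> space (?M I)) (x(i := y)) \<partial>lborel)"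
    proof (rule nn_integral_cong)
      fix y :: real
      have sp: "x(i := y) \<in> space (?M I)" using x I by (auto simp: space_PiM PiE_iff extensional_def)
      have "restrict (x(i := y)) (I - {i}) = x"
        using x I by (auto simp: space_PiM PiE_iff extensional_def fun_eq_iff)
      then have "U (x(i := y)) = x(i := g x + s * y)" by (simp add: U_def)
      then show "indicator X (x(i := g x + s * y)) = (indicator (U -` X \<inter> space (?M I)) (x(i := y)) :: ennreal)"
        using sp by (simp add: indicator_def)
    qed
    finally show "(\<integral>\<^sup>+y. indicator X (x(i := y)) \<partial>lborel) =
      (\<integral>\<^sup>+y. indicator (U -` X \<inter> space (?M I)) (x(i := y)) \<partial>lborel) * \<bar>s\<bar>"
      by (simp only: mult.commute[of _ "ennreal \<bar>s\<bar>"])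
  qed
  also have "\<dots> = (\<integral>\<^sup>+x. (\<integral>\<^sup>+y. indicator (U -` X \<inter> space (?M I)) (x(i := y)) \<partial>lborel) \<partial>?M J) * \<bar>s\<bar>"
  proof (rule nn_integral_multc)
    have "(\<lambda>(x, y). indicator (U -` X \<inter> space (?M I)) (x(i := y)) :: ennreal) \<in>
       borel_measurable (?M J \<Otimes>\<^sub>M lborel)"
      using measurable_compose[OF measurable_add_dim borel_measurable_indicator[OF meas[unfolded I(1)]]]
      by (simp add: split_beta' I(1)[symmetric])
    from lborel.borel_measurable_nn_integral_fst[OF this]
    show "(\<lambda>x. \<integral>\<^sup>+y. indicator (U -` X \<inter> space (?M I)) (x(i := y)) \<partial>lborel) \<in> borel_measurable (?M J)"
      by simp
  qed
  also have "(\<integral>\<^sup>+x. (\<integral>\<^sup>+y. indicator (U -` X \<inter> space (?M I)) (x(i := y)) \<partial>lborel) \<partial>?M J) =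
     (\<integral>\<^sup>+x. indicator (U -` X \<inter> space (?M I)) x \<partial>?M (insert i J))"
    using I meas by (intro lborel_product.product_nn_integral_insert[symmetric]) auto
  also have "\<dots> = emeasure (?M I) (U -` X \<inter> space (?M I))"
    using I meas by (simp add: nn_integral_indicator)
  finally show "emeasure (?M I) (U -` X \<inter> space (?M I)) * ennreal \<bar>s\<bar> = emeasure (?M I) X" ..
qed

text \<open>One coordinate is shifted after the other, each time with slope 1.\<close>

lemma emeasure_PiM_vimage_translate:
  fixes a :: "'i \<Rightarrow> real"
  assumes "finite I" and X: "X \<in> sets (PiM I (\<lambda>_. lborel))"
  shows "emeasure (PiM I (\<lambda>_. lborel)) ((\<lambda>c. \<lambda>i\<in>I. a i + c i) -` X \<inter> space (PiM I (\<lambda>_. lborel))) =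
    emeasure (PiM I (\<lambda>_. lborel)) X"
    and "(\<lambda>c. \<lambda>i\<in>I. a i + c i) \<in> measurable (PiM I (\<lambda>_. lborel)) (PiM I (\<lambda>_. lborel))"
proof -
  let ?M = "PiM I (\<lambda>_. lborel :: real measure)"
  define T where "T J = (\<lambda>c. \<lambda>i\<in>I. (if i \<in> J then a i else 0) + c i)" for J
  have "T J \<in> measurable ?M ?M \<and> (\<forall>X\<in>sets ?M. emeasure ?M (T J -` X \<inter> space ?M) = emeasure ?M X)"
    if "finite J" "J \<subseteq> I" for J
    using that
  proof (induction J)
    case empty
    have id: "T {} c = c" if "c \<in> space ?M" for c
      using that by (auto simp: T_def space_PiM PiE_iff extensional_def fun_eq_iff)
    have "T {} -` X \<inter> space ?M = X" if "X \<in> sets ?M" for X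
      using id sets.sets_into_space[OF that] by (auto simp: id)
    moreover have "T {} \<in> measurable ?M ?M \<longleftrightarrow> (\<lambda>x. x) \<in> measurable ?M ?M"
      by (rule measurable_cong) (simp add: id)
    ultimately show ?case by simp
  next
    case (insert i J)
    define U where "U = (\<lambda>c. c(i := (\<lambda>_. a i) (restrict c (I - {i})) + 1 * c i))"
    have i: "i \<in> I" using insert by auto
    note U = emeasure_PiM_vimage_affine_upd[OF assms(1) i, of 1 "\<lambda>_. a i", folded U_def]
    have eq: "T (insert i J) = U \<circ> T J"
      using insert i by (auto simp: T_def U_def fun_eq_iff)
    have mU: "U \<in> measurable ?M ?M" using U(1) by simp
    have mT: "T J \<in> measurable ?M ?M" using insert by simp
    show ?case
    proof (intro conjI ballI)
      show "T (insert i J) \<in> measurable ?M ?M"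
        unfolding eq using mT mU by (rule measurable_comp)
      fix X assume X: "X \<in> sets ?M"
      have "T (insert i J) -` X \<inter> space ?M = T J -` (U -` X \<inter> space ?M) \<inter> space ?M"
        unfolding eq using measurable_space[OF mT] by auto
      then show "emeasure ?M (T (insert i J) -` X \<inter> space ?M) = emeasure ?M X"
        using insert U(2)[OF _ _ X] measurable_sets[OF mU X] by auto
    qed
  qed
  from this[of I] assms have "T I \<in> measurable ?M ?M \<and> (\<forall>X\<in>sets ?M. emeasure ?M (T I -` X \<inter> space ?M) = emeasure ?M X)"
    by simp
  moreover have "T I = (\<lambda>c. \<lambda>i\<in>I. a i + c i)" by (auto simp: T_def fun_eq_iff)
  ultimately show "emeasure ?M ((\<lambda>c. \<lambda>i\<in>I. a i + c i) -` X \<inter> space ?M) = emeasure ?M X"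
    "(\<lambda>c. \<lambda>i\<in>I. a i + c i) \<in> measurable ?M ?M"
    using X by auto
qed

text \<open>Change of variables for linear maps: each row operation amounts to following the map by
  an update of one coordinate. With preimages, measurability is that of the map itself and no
  inverse matrix appears.\<close>

lemma emeasure_PiM_vimage_matrix:
  fixes A :: "real Matrix.mat"
  assumes A: "A \<in> carrier_mat n n" and det: "Determinant.det A \<noteq> 0"
  defines "M \<equiv> PiM {..<n} (\<lambda>_. lborel :: real measure)"
  defines "T \<equiv> (\<lambda>A::real Matrix.mat. \<lambda>c. \<lambda>i\<in>{..<n}. \<Sum>j<n. A $$ (i,j) * c j)"
  shows "T A \<in> measurable M M \<and>
    (\<forall>X\<in>sets M. emeasure M (T A -` X \<inter> space M) * ennreal \<bar>Determinant.det A\<bar> = emeasure M X)"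
  using A det
proof (induction rule: elementary_row_induct)
  case one
  have id: "T (1\<^sub>m n) c = c" if "c \<in> space M" for c
  proof (rule extensionalityI[of _ "{..<n}"])
    fix i assume i: "i \<in> {..<n}"
    have "(\<Sum>j<n. (1\<^sub>m n :: real Matrix.mat) $$ (i,j) * c j) = (\<Sum>j<n. if j = i then c j else 0)"
      using i by (intro sum.cong) auto
    then show "T (1\<^sub>m n) c i = c i" using i by (simp add: T_def)
  qed (use that in \<open>auto simp: T_def M_def space_PiM PiE_iff\<close>)
  have "T (1\<^sub>m n) -` X \<inter> space M = X" if "X \<in> sets M" for X
    using id sets.sets_into_space[OF that] by (auto simp: id)
  moreover have "T (1\<^sub>m n) \<in> measurable M M \<longleftrightarrow> (\<lambda>x. x) \<in> measurable M M"
    by (rule measurable_cong) (simp add: id)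
  ultimately show ?case by simp
next
  case (addrow B a k l)
  define g where "g = (\<lambda>c::nat \<Rightarrow> real. a * c l)"
  define U where "U = (\<lambda>c. c(k := g (restrict c ({..<n} - {k})) + 1 * c k))"
  have [measurable]: "(\<lambda>c. c l) \<in> borel_measurable (PiM ({..<n} - {k}) (\<lambda>_. lborel :: real measure))"
    using addrow measurable_component_singleton[of l "{..<n} - {k}" "\<lambda>_. lborel :: real measure"] by simp
  have g: "g \<in> borel_measurable (PiM ({..<n} - {k}) (\<lambda>_. lborel))"
    unfolding g_def by measurable
  note U = emeasure_PiM_vimage_affine_upd[of "{..<n}" k 1 g, folded U_def M_def]
  have mU: "U \<in> measurable M M" using U(1) addrow g by auto
  have mT: "T B \<in> measurable M M" using addrow by simp
  have eq: "T (addrow a k l B) c = (U \<circ> T B) c" for c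
  proof (rule extensionalityI[of _ "{..<n}"])
    fix i assume "i \<in> {..<n}"
    then show "T (addrow a k l B) c i = (U \<circ> T B) c i"
      using addrow by (auto simp: T_def U_def g_def sum.distrib sum_distrib_left algebra_simps)
  qed (use addrow in \<open>auto simp: T_def U_def extensional_def\<close>)
  have deteq: "Determinant.det (addrow a k l B) = Determinant.det B"
    using det_addrow[of l n k B a] addrow by simp
  show ?case
  proof (intro conjI ballI)
    show "T (addrow a k l B) \<in> measurable M M"
      using measurable_comp[OF mT mU] eq by presburger
    fix X assume X: "X \<in> sets M"
    have "T (addrow a k l B) -` X \<inter> space M = T B -` (U -` X \<inter> space M) \<inter> space M"
      using measurable_space[OF mT] by (auto simp: eq)
    then show "emeasure M (T (addrow a k l B) -` X \<inter> space M) * ennreal \<bar>Determinant.det (addrow a k l B)\<bar> = emeasure M X"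
      using addrow U(2)[OF _ _ _ g X] measurable_sets[OF mU X] deteq by auto
  qed
next
  case (multrow B a k)
  define U where "U = (\<lambda>c. c(k := (\<lambda>_. 0) (restrict c ({..<n} - {k})) + a * c k))"
  note U = emeasure_PiM_vimage_affine_upd[of "{..<n}" k a "\<lambda>_. 0", folded U_def M_def]
  have mU: "U \<in> measurable M M" using U(1) multrow by auto
  have mT: "T B \<in> measurable M M" using multrow by simp
  have eq: "T (multrow k a B) c = (U \<circ> T B) c" for c
  proof (rule extensionalityI[of _ "{..<n}"])
    fix i assume "i \<in> {..<n}"
    then show "T (multrow k a B) c i = (U \<circ> T B) c i"
      using multrow by (auto simp: T_def U_def sum_distrib_left algebra_simps)
  qed (use multrow in \<open>auto simp: T_def U_def extensional_def\<close>)
  have deteq: "Determinant.det (multrow k a B) = a * Determinant.det B"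
    using det_multrow[of k n B a] multrow by simp
  show ?case
  proof (intro conjI ballI)
    show "T (multrow k a B) \<in> measurable M M"
      using measurable_comp[OF mT mU] eq by presburger
    fix X assume X: "X \<in> sets M"
    have s: "T (multrow k a B) -` X \<inter> space M = T B -` (U -` X \<inter> space M) \<inter> space M"
      using measurable_space[OF mT] by (auto simp: eq)
    have "emeasure M (T (multrow k a B) -` X \<inter> space M) * ennreal \<bar>a * Determinant.det B\<bar> =
       (emeasure M (T B -` (U -` X \<inter> space M) \<inter> space M) * ennreal \<bar>Determinant.det B\<bar>) * ennreal \<bar>a\<bar>"
      unfolding s by (simp add: abs_mult ennreal_mult mult_ac)
    also have "\<dots> = emeasure M X"
      using multrow U(2)[OF _ _ multrow(3) _ X] measurable_sets[OF mU X] by auto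
    finally show "emeasure M (T (multrow k a B) -` X \<inter> space M) * ennreal \<bar>Determinant.det (multrow k a B)\<bar> = emeasure M X"
      unfolding deteq .
  qed
qed

text \<open>\<open>volume\<close> integrates over functions on a set of vectors, while matrices need
  coordinates indexed by numbers; this passes between the two index sets.\<close>

lemma emeasure_PiM_reindex:
  fixes X :: "('i \<Rightarrow> real) set"
  assumes h: "bij_betw h J I" and fin: "finite I" and X: "X \<in> sets (PiM I (\<lambda>_. lborel))"
  defines "R \<equiv> \<lambda>c. \<lambda>i\<in>I. c (the_inv_into J h i)"
  shows "emeasure (PiM J (\<lambda>_. lborel)) (R -` X \<inter> space (PiM J (\<lambda>_. lborel))) = emeasure (PiM I (\<lambda>_. lborel)) X"
    and "R \<in> measurable (PiM J (\<lambda>_. lborel)) (PiM I (\<lambda>_. lborel))"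
proof -
  let ?J = "PiM J (\<lambda>_. lborel :: real measure)" and ?I = "PiM I (\<lambda>_. lborel :: real measure)"
  have inv: "the_inv_into J h i \<in> J" "h (the_inv_into J h i) = i" if "i \<in> I" for i
    using f_the_inv_into_f_bij_betw[OF h] bij_betw_the_inv_into[OF h] bij_betwE that by blast+
  have inv': "the_inv_into J h (h j) = j" "h j \<in> I" if "j \<in> J" for j
    using the_inv_into_f_f[OF bij_betw_imp_inj_on[OF h] that] bij_betwE[OF h] that by blast+
  have finJ: "finite J" using h fin bij_betw_finite by blast
  show R: "R \<in> measurable ?J ?I"
    unfolding R_def
    by (intro measurable_restrict measurable_component_singleton inv)
  have "distr ?J ?I R = ?I"
  proof (rule lborel_product.PiM_eqI[OF fin])
    fix A :: "'i \<Rightarrow> real set" assume A: "\<And>i. i \<in> I \<Longrightarrow> A i \<in> sets lborel"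
    have "emeasure (distr ?J ?I R) (Pi\<^sub>E I A) = emeasure ?J (R -` (Pi\<^sub>E I A) \<inter> space ?J)"
      using A fin by (intro emeasure_distr R sets_PiM_I_finite) auto
    also have "R -` (Pi\<^sub>E I A) \<inter> space ?J = Pi\<^sub>E J (\<lambda>j. A (h j))"
    proof (intro Set.set_eqI iffI)
      fix c assume "c \<in> R -` (Pi\<^sub>E I A) \<inter> space ?J"
      then have c: "\<And>i. i \<in> I \<Longrightarrow> c (the_inv_into J h i) \<in> A i" "c \<in> extensional J"
        by (auto simp: R_def space_PiM PiE_iff)
      then have "c j \<in> A (h j)" if "j \<in> J" for j
        using inv'[OF that] c(1)[of "h j"] by simp
      with c(2) show "c \<in> Pi\<^sub>E J (\<lambda>j. A (h j))" by (simp add: PiE_iff)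
    next
      fix c assume "c \<in> Pi\<^sub>E J (\<lambda>j. A (h j))"
      then have c: "\<And>j. j \<in> J \<Longrightarrow> c j \<in> A (h j)" "c \<in> extensional J"
        by (auto simp: PiE_iff)
      then have "c (the_inv_into J h i) \<in> A i" if "i \<in> I" for i
        using inv[OF that] c(1)[of "the_inv_into J h i"] by simp
      with c(2) show "c \<in> R -` (Pi\<^sub>E I A) \<inter> space ?J"
        by (simp add: R_def space_PiM PiE_iff)
    qed
    also have "emeasure ?J \<dots> = (\<Prod>j\<in>J. emeasure lborel (A (h j)))"
      using A finJ inv' by (intro lborel_product.emeasure_PiM) auto
    also have "\<dots> = (\<Prod>i\<in>I. emeasure lborel (A i))"
      by (rule prod.reindex_bij_betw[OF h])
    finally show "emeasure (distr ?J ?I R) (Pi\<^sub>E I A) = (\<Prod>i\<in>I. emeasure lborel (A i))" .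
  qed simp
  then show "emeasure ?J (R -` X \<inter> space ?J) = emeasure ?I X"
    using emeasure_distr[OF R X] by simp
qed

section \<open>Lattices in Euclidean spaces\<close>

text \<open>Positivity is required on \<open>V\<close> only: the form used later is bilinear on the
  whole ambient type, but vanishes on functions supported away from the embeddings of K.\<close>

locale euclidean_subspace =
  fixes V :: "'v::real_vector set" and ip :: "'v \<Rightarrow> 'v \<Rightarrow> real"
  assumes subspace_V: "Real_Vector_Spaces.subspace V"
    and finite_dim: "\<exists>S. finite S \<and> Real_Vector_Spaces.span S = V"
    and ip_add_left: "ip (x + y) z = ip x z + ip y z"
    and ip_scale_left: "ip (r *\<^sub>R x) z = r * ip x z"
    and ip_commute: "ip x y = ip y x"
    and ip_pos: "x \<in> V \<Longrightarrow> x \<noteq> 0 \<Longrightarrow> ip x x > 0"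
begin

lemma ip_add_right: "ip z (x + y) = ip z x + ip z y"
  using ip_add_left ip_commute by metis

lemma ip_scale_right: "ip z (r *\<^sub>R x) = r * ip z x"
  using ip_scale_left ip_commute by metis

lemma ip_zero_left [simp]: "ip 0 z = 0"
  using ip_scale_left[of 0 0 z] by simp

lemma ip_zero_right [simp]: "ip z 0 = 0"
  using ip_zero_left ip_commute by metis

lemma ip_minus_left [simp]: "ip (- x) z = - ip x z"
  using ip_scale_left[of "-1" x z] by simp

lemma ip_minus_right [simp]: "ip z (- x) = - ip z x"
  using ip_minus_left ip_commute by metis

lemma ip_diff_left: "ip (x - y) z = ip x z - ip y z"
  using ip_add_left[of x "-y" z] by simp

lemma ip_diff_right: "ip z (x - y) = ip z x - ip z y"
  using ip_add_right[of z x "-y"] by simp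

lemma ip_sum_left: "ip (\<Sum>i\<in>I. f i) z = (\<Sum>i\<in>I. ip (f i) z)"
  by (induction I rule: infinite_finite_induct) (auto simp: ip_add_left)

lemma ip_sum_right: "ip z (\<Sum>i\<in>I. f i) = (\<Sum>i\<in>I. ip z (f i))"
  by (induction I rule: infinite_finite_induct) (auto simp: ip_add_right)

lemmas ip_linear = ip_add_left ip_add_right ip_scale_left ip_scale_right ip_diff_left ip_diff_right

lemma ip_nonneg: "x \<in> V \<Longrightarrow> ip x x \<ge> 0"
  using ip_pos[of x] by (cases "x = 0") auto

lemma ip_eq_0: "x \<in> V \<Longrightarrow> ip x x = 0 \<longleftrightarrow> x = 0"
  using ip_pos[of x] by (cases "x = 0") auto

lemma V_closed [simp, intro]:
  "0 \<in> V" "x \<in> V \<Longrightarrow> y \<in> V \<Longrightarrow> x + y \<in> V" "x \<in> V \<Longrightarrow> y \<in> V \<Longrightarrow> x - y \<in> V"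
  "x \<in> V \<Longrightarrow> r *\<^sub>R x \<in> V"
  using subspace_V by (auto simp: real_vector.subspace_0 real_vector.subspace_add
    real_vector.subspace_diff real_vector.subspace_scale)

lemma V_uminus [simp]: "x \<in> V \<Longrightarrow> - x \<in> V"
  using V_closed(4)[of x "-1"] by simp

lemma V_sum: "(\<And>i. i \<in> I \<Longrightarrow> f i \<in> V) \<Longrightarrow> (\<Sum>i\<in>I. f i) \<in> V"
  using real_vector.subspace_sum[OF subspace_V] by blast

lemma Cauchy_Schwarz: "x \<in> V \<Longrightarrow> y \<in> V \<Longrightarrow> (ip x y)\<^sup>2 \<le> ip x x * ip y y"
proof (cases "y = 0")
  case False
  assume xy: "x \<in> V" "y \<in> V"
  have pos: "ip y y > 0" using ip_pos xy False by blast
  let ?t = "ip x y / ip y y"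
  have "0 \<le> ip (x - ?t *\<^sub>R y) (x - ?t *\<^sub>R y)"
    using xy by (intro ip_nonneg) auto
  also have "\<dots> = ip x x - 2 * ?t * ip x y + ?t * ?t * ip y y"
    using ip_commute[of y x] by (simp add: ip_linear algebra_simps)
  also have "\<dots> = ip x x - (ip x y)\<^sup>2 / ip y y"
    using pos by (simp add: power2_eq_square field_simps)
  finally show ?thesis using pos by (simp add: field_simps)
qed simp

lemma norm_triangle:
  assumes "x \<in> V" "y \<in> V" "ip x x \<le> a\<^sup>2" "ip y y \<le> b\<^sup>2" "a \<ge> 0" "b \<ge> 0"
  shows "ip (x + y) (x + y) \<le> (a + b)\<^sup>2"
proof -
  have "(ip x y)\<^sup>2 \<le> a\<^sup>2 * b\<^sup>2"
    using Cauchy_Schwarz[OF assms(1,2)] mult_mono[OF assms(3,4)] ip_nonneg[OF assms(2)] by simp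
  then have "(ip x y)\<^sup>2 \<le> (a * b)\<^sup>2" by (simp add: power_mult_distrib)
  then have "ip x y \<le> a * b" by (rule power2_le_imp_le) (use assms in simp)
  then show ?thesis
    using assms ip_commute[of y x] by (simp add: ip_linear power2_sum)
qed

section \<open>Orthonormal bases and coordinates\<close>

lemma orthonormal_independent:
  assumes "finite B" "\<And>x y. x \<in> B \<Longrightarrow> y \<in> B \<Longrightarrow> ip x y = (if x = y then 1 else 0)"
  shows "\<not> Real_Vector_Spaces.dependent B"
proof
  assume "Real_Vector_Spaces.dependent B"
  then obtain u v where u: "(\<Sum>v\<in>B. u v *\<^sub>R v) = 0" "v \<in> B" "u v \<noteq> 0"
    using real_vector.dependent_finite[OF assms(1)] by blast
  have "0 = ip (\<Sum>w\<in>B. u w *\<^sub>R w) v" using u by simp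
  also have "\<dots> = (\<Sum>w\<in>B. if w = v then u v else 0)"
    unfolding ip_sum_left using assms(2) u(2) by (intro sum.cong) (auto simp: ip_scale_left)
  also have "\<dots> = u v" using assms u by simp
  finally show False using u by simp
qed

text \<open>Gram-Schmidt; a new vector that equals its projection \<open>p\<close> onto the span so
  far adds nothing.\<close>

lemma orthonormal_basis_span:
  "finite S \<Longrightarrow> S \<subseteq> V \<Longrightarrow> \<exists>B. orthonormal_basis (Real_Vector_Spaces.span S) ip B"
proof (induction S rule: finite_induct)
  case empty
  have "orthonormal_basis (Real_Vector_Spaces.span {}) ip {}"
    by (simp add: orthonormal_basis_def)
  then show ?case ..
next
  case (insert x S)
  then obtain B where B: "orthonormal_basis (Real_Vector_Spaces.span S) ip B" by blast
  then have fin: "finite B" and sp: "Real_Vector_Spaces.span B = Real_Vector_Spaces.span S"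
    and on: "\<And>x y. x \<in> B \<Longrightarrow> y \<in> B \<Longrightarrow> ip x y = (if x = y then 1 else 0)"
    by (auto simp: orthonormal_basis_def)
  have SV: "Real_Vector_Spaces.span S \<subseteq> V"
    using real_vector.span_minimal[OF _ subspace_V] insert.prems by auto
  then have BV: "B \<subseteq> V" using real_vector.span_superset sp by blast
  define p where "p = (\<Sum>b\<in>B. ip x b *\<^sub>R b)"
  have p: "p \<in> Real_Vector_Spaces.span B"
    unfolding p_def by (intro real_vector.span_sum real_vector.span_scale real_vector.span_base)
  have orth: "ip (x - p) b = 0" if "b \<in> B" for b
  proof -
    have "ip p b = (\<Sum>w\<in>B. if w = b then ip x b else 0)"
      unfolding p_def ip_sum_left using on that by (intro sum.cong) (auto simp: ip_scale_left)
    then show ?thesis using fin that by (simp add: ip_diff_left)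
  qed
  show ?case
  proof (cases "x = p")
    case True
    then have "Real_Vector_Spaces.span (insert x S) = Real_Vector_Spaces.span S"
      using p sp by (metis real_vector.span_redundant)
    then show ?thesis using B by auto
  next
    case False
    have xV: "x - p \<in> V" using insert.prems p sp SV by auto
    define r where "r = 1 / sqrt (ip (x - p) (x - p))"
    have r0: "r \<noteq> 0" "r * r * ip (x - p) (x - p) = 1"
      using ip_pos[OF xV] False by (auto simp: r_def field_simps)
    define y where "y = r *\<^sub>R (x - p)"
    have yb: "ip y b = 0" "ip b y = 0" if "b \<in> B" for b
      using orth[OF that] ip_commute[of b y] by (auto simp: y_def ip_scale_left)
    have yy: "ip y y = 1" using r0 by (simp add: y_def ip_scale_left ip_scale_right)
    have "y \<notin> B" using yb(1)[of y] yy by auto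
    have "orthonormal_basis (Real_Vector_Spaces.span (insert x S)) ip (insert y B)"
      unfolding orthonormal_basis_def
    proof (intro conjI ballI)
      show "finite (insert y B)" using fin by simp
      show "ip u v = (if u = v then 1 else 0)" if "u \<in> insert y B" "v \<in> insert y B" for u v
        using that on yb yy \<open>y \<notin> B\<close> by auto
      have x: "x = (1 / r) *\<^sub>R y + p" using r0 by (simp add: y_def)
      have "x \<in> Real_Vector_Spaces.span (insert y B)"
      proof -
        have "p \<in> Real_Vector_Spaces.span (insert y B)"
          using p real_vector.span_mono[of B "insert y B"] by auto
        then show ?thesis unfolding x
          by (intro real_vector.span_add real_vector.span_scale) (auto intro: real_vector.span_base)
      qed
      moreover have "S \<subseteq> Real_Vector_Spaces.span (insert y B)"
        using sp real_vector.span_mono[of B "insert y B"] real_vector.span_superset[of S] by auto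
      ultimately have 1: "Real_Vector_Spaces.span (insert x S) \<subseteq> Real_Vector_Spaces.span (insert y B)"
        by (intro real_vector.span_minimal) auto
      have Bx: "B \<subseteq> Real_Vector_Spaces.span (insert x S)"
        using sp real_vector.span_mono[of S "insert x S"] real_vector.span_superset[of B] by auto
      have px: "p \<in> Real_Vector_Spaces.span (insert x S)"
        using p sp real_vector.span_mono[of S "insert x S"] by auto
      have "y \<in> Real_Vector_Spaces.span (insert x S)"
        unfolding y_def using px
        by (intro real_vector.span_scale real_vector.span_diff) (auto intro: real_vector.span_base)
      with Bx have "Real_Vector_Spaces.span (insert y B) \<subseteq> Real_Vector_Spaces.span (insert x S)"
        by (intro real_vector.span_minimal) auto
      with 1 show "Real_Vector_Spaces.span (insert y B) = Real_Vector_Spaces.span (insert x S)" by blast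
    qed
    then show ?thesis by blast
  qed
qed

text \<open>Literally the choice made inside \<open>volume\<close>, so that \<open>volume\<close>
  unfolds to coordinates with respect to \<open>E\<close>.\<close>

definition E where "E = (SOME B. orthonormal_basis V ip B)"

lemma orthonormal_basis_E: "orthonormal_basis V ip E"
proof -
  obtain S where "finite S" "Real_Vector_Spaces.span S = V" using finite_dim by blast
  then have "\<exists>B. orthonormal_basis V ip B"
    using orthonormal_basis_span[of S] real_vector.span_superset[of S] by auto
  then show ?thesis unfolding E_def by (rule someI_ex)
qed

definition N where "N = card E"

definition e where "e = (SOME e. bij_betw e {..<N} E)"

lemma bij_e: "bij_betw e {..<N} E"
proof -
  have "\<exists>e. bij_betw e {..<N} E"
    using orthonormal_basis_E ex_bij_betw_nat_finite[of E]
    by (auto simp: orthonormal_basis_def N_def atLeast0LessThan)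
  then show ?thesis unfolding e_def by (rule someI_ex)
qed

lemma e_in_V [simp]: "i < N \<Longrightarrow> e i \<in> V"
  using bij_betwE[OF bij_e] orthonormal_basis_E real_vector.span_superset[of E]
  by (auto simp: orthonormal_basis_def)

lemma ip_e: "i < N \<Longrightarrow> j < N \<Longrightarrow> ip (e i) (e j) = (if i = j then 1 else 0)"
  using bij_betwE[OF bij_e] orthonormal_basis_E bij_betw_imp_inj_on[OF bij_e]
  by (auto simp: orthonormal_basis_def inj_on_def)

lemma dim_V: "Real_Vector_Spaces.dim V = N"
proof -
  have "\<not> Real_Vector_Spaces.dependent E" "Real_Vector_Spaces.span E = V"
    using orthonormal_basis_E orthonormal_independent[of E] by (auto simp: orthonormal_basis_def)
  then show ?thesis using real_vector.dim_span_eq_card_independent[of E] by (simp add: N_def)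
qed

definition comb where "comb c = (\<Sum>i<N. c i *\<^sub>R e i)"

lemma comb_in_V [simp]: "comb c \<in> V"
  unfolding comb_def by (intro V_sum) auto

lemma ip_comb_e: "i < N \<Longrightarrow> ip (comb c) (e i) = c i"
proof -
  assume "i < N"
  then have "ip (comb c) (e i) = (\<Sum>j<N. if j = i then c j else 0)"
    unfolding comb_def ip_sum_left by (intro sum.cong) (auto simp: ip_scale_left ip_e)
  then show ?thesis using \<open>i < N\<close> by simp
qed

lemma expand_e: "x \<in> V \<Longrightarrow> x = (\<Sum>i<N. ip x (e i) *\<^sub>R e i)"
proof -
  assume x: "x \<in> V"
  then have "x \<in> Real_Vector_Spaces.span E" "finite E"
    using orthonormal_basis_E by (auto simp: orthonormal_basis_def)
  then obtain u where "x = (\<Sum>v\<in>E. u v *\<^sub>R v)"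
    using real_vector.span_finite[of E] by auto
  also have "\<dots> = comb (\<lambda>i. u (e i))"
    unfolding comb_def by (rule sum.reindex_bij_betw[OF bij_e, symmetric])
  finally have xc: "x = comb (\<lambda>i. u (e i))" .
  have "ip x (e i) = u (e i)" if "i < N" for i
    using ip_comb_e[OF that, of "\<lambda>i. u (e i)"] xc by simp
  then have "(\<Sum>i<N. ip x (e i) *\<^sub>R e i) = comb (\<lambda>i. u (e i))"
    unfolding comb_def by (intro sum.cong) auto
  then show ?thesis using xc by simp
qed

lemma parseval: "x \<in> V \<Longrightarrow> ip x y = (\<Sum>i<N. ip x (e i) * ip y (e i))"
proof -
  assume "x \<in> V"
  have "ip x y = ip (\<Sum>i<N. ip x (e i) *\<^sub>R e i) y" using expand_e[OF \<open>x \<in> V\<close>] by simp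
  also have "\<dots> = (\<Sum>i<N. ip x (e i) * ip (e i) y)" by (simp add: ip_sum_left ip_scale_left)
  finally show ?thesis by (simp only: ip_commute[of y])
qed

text \<open>A basis together with its dual basis. Coefficients become scalar products, so membership
  in a lattice or in a fundamental parallelepiped turns into conditions on
  \<open>ip x (b' i)\<close>, which are easy to add, translate and measure.\<close>

definition dual_pair where
  "dual_pair b b' \<longleftrightarrow> (\<forall>i<N. b i \<in> V \<and> b' i \<in> V) \<and>
     (\<forall>i<N. \<forall>j<N. ip (b i) (b' j) = (if i = j then 1 else 0))"

lemma dual_pair_sym: "dual_pair b b' \<Longrightarrow> dual_pair b' b"
  unfolding dual_pair_def by (metis ip_commute)

lemma dual_pairD:
  assumes "dual_pair b b'"
  shows "i < N \<Longrightarrow> b i \<in> V" "i < N \<Longrightarrow> b' i \<in> V"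
    "i < N \<Longrightarrow> j < N \<Longrightarrow> ip (b i) (b' j) = (if i = j then 1 else 0)"
    "i < N \<Longrightarrow> j < N \<Longrightarrow> ip (b' i) (b j) = (if i = j then 1 else 0)"
proof -
  show "i < N \<Longrightarrow> b i \<in> V" "i < N \<Longrightarrow> b' i \<in> V"
    and *: "i < N \<Longrightarrow> j < N \<Longrightarrow> ip (b i) (b' j) = (if i = j then 1 else 0)" for i j
    using assms by (auto simp: dual_pair_def)
  show "i < N \<Longrightarrow> j < N \<Longrightarrow> ip (b' i) (b j) = (if i = j then 1 else 0)"
    using *[of j i] ip_commute[of "b' i"] by auto
qed

lemma ip_dual_sum:
  assumes "dual_pair b b'" "j < N"
  shows "ip (\<Sum>i<N. c i *\<^sub>R b i) (b' j) = c j"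
proof -
  have "ip (\<Sum>i<N. c i *\<^sub>R b i) (b' j) = (\<Sum>i<N. if i = j then c i else 0)"
    unfolding ip_sum_left using dual_pairD(3)[OF assms(1)] assms(2)
    by (intro sum.cong) (auto simp: ip_scale_left)
  then show ?thesis using assms by simp
qed

lemma dual_pair_inj: "dual_pair b b' \<Longrightarrow> inj_on b {..<N}"
proof (rule inj_onI)
  fix i j assume *: "dual_pair b b'" "i \<in> {..<N}" "j \<in> {..<N}" "b i = b j"
  then have "ip (b i) (b' i) = 1" "ip (b j) (b' i) = (if j = i then 1 else 0)"
    using dual_pairD(3)[OF *(1), of i i] dual_pairD(3)[OF *(1), of j i] by simp_all
  then show "i = j" using *(4) by (metis zero_neq_one)
qed

lemma dual_pair_independent:
  assumes "dual_pair b b'"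
  shows "\<not> Real_Vector_Spaces.dependent (b ` {..<N})"
proof
  assume "Real_Vector_Spaces.dependent (b ` {..<N})"
  then obtain u v where u: "(\<Sum>v\<in>b ` {..<N}. u v *\<^sub>R v) = 0" "v \<in> b ` {..<N}" "u v \<noteq> 0"
    using real_vector.dependent_finite[of "b ` {..<N}"] by auto
  then obtain j where j: "j < N" "v = b j" by auto
  have "(\<Sum>i<N. u (b i) *\<^sub>R b i) = 0"
    using u(1) sum.reindex[OF dual_pair_inj[OF assms], of "\<lambda>v. u v *\<^sub>R v"] by simp
  then have "u (b j) = 0"
    using ip_dual_sum[OF assms j(1), of "\<lambda>i. u (b i)"] by simp
  then show False using u j by simp
qed

lemma independent_spans:
  assumes "b ` {..<N} \<subseteq> V" "inj_on b {..<N}" "\<not> Real_Vector_Spaces.dependent (b ` {..<N})"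
  shows "Real_Vector_Spaces.span (b ` {..<N}) = V"
proof
  show "Real_Vector_Spaces.span (b ` {..<N}) \<subseteq> V"
    using assms(1) subspace_V by (rule real_vector.span_minimal)
  have E: "finite E" "Real_Vector_Spaces.span E = V"
    using orthonormal_basis_E by (auto simp: orthonormal_basis_def)
  show "V \<subseteq> Real_Vector_Spaces.span (b ` {..<N})"
  proof (rule ccontr)
    assume "\<not> ?thesis"
    then obtain x where x: "x \<in> V" "x \<notin> Real_Vector_Spaces.span (b ` {..<N})" by blast
    then have "\<not> Real_Vector_Spaces.dependent (insert x (b ` {..<N}))"
      using assms(3) real_vector.independent_insertI by blast
    moreover have "insert x (b ` {..<N}) \<subseteq> Real_Vector_Spaces.span E" using x assms E by auto
    ultimately have "card (insert x (b ` {..<N})) \<le> card E"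
      using real_vector.independent_span_bound[OF E(1), of "insert x (b ` {..<N})"] by simp
    moreover have "x \<notin> b ` {..<N}" using x(2) real_vector.span_base[of x] by metis
    ultimately show False using assms(2) by (simp add: card_image N_def)
  qed
qed

lemma dual_pair_span: "dual_pair b b' \<Longrightarrow> Real_Vector_Spaces.span (b ` {..<N}) = V"
  using independent_spans[of b] dual_pair_inj dual_pair_independent dual_pairD(1) by blast

lemma expand_dual:
  assumes "dual_pair b b'" "x \<in> V"
  shows "x = (\<Sum>i<N. ip x (b' i) *\<^sub>R b i)"
proof -
  define y where "y = x - (\<Sum>i<N. ip x (b' i) *\<^sub>R b i)"
  have yV: "y \<in> V" unfolding y_def using assms dual_pairD(1)[OF assms(1)] by (intro V_closed V_sum) auto
  have "ip y z = 0" if "z \<in> Real_Vector_Spaces.span (b' ` {..<N})" for z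
    using that
  proof (induction z rule: real_vector.span_induct)
    show "Real_Vector_Spaces.subspace {z. ip y z = 0}"
      by (auto simp: real_vector.subspace_def ip_add_right ip_scale_right)
  qed (use assms ip_dual_sum[OF assms(1)] in \<open>auto simp: y_def ip_diff_left\<close>)
  then have "ip y y = 0" using dual_pair_span[OF dual_pair_sym[OF assms(1)]] yV by simp
  then show ?thesis using ip_eq_0[OF yV] by (simp add: y_def)
qed

text \<open>As many spanning vectors as the dimension are independent, and \<open>b' i\<close>
  represents the linear functional that takes the coefficient at \<open>b i\<close>; it is assembled
  from the values of that functional on the orthonormal basis.\<close>

lemma spanning_dual_pair:
  assumes "b ` {..<N} \<subseteq> V" "Real_Vector_Spaces.span (b ` {..<N}) = V"
  shows "\<exists>b'. dual_pair b b'"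
proof -
  obtain B where B: "B \<subseteq> b ` {..<N}" "\<not> Real_Vector_Spaces.dependent B" "b ` {..<N} \<subseteq> Real_Vector_Spaces.span B"
    using real_vector.maximal_independent_subset by blast
  have "Real_Vector_Spaces.span B = V"
    using B assms real_vector.span_mono[OF B(1)] real_vector.span_minimal[OF B(3)] real_vector.subspace_span by blast
  then have "card B = N" using dim_V real_vector.dim_span_eq_card_independent[OF B(2)] by simp
  moreover have "card B \<le> card (b ` {..<N})" "card (b ` {..<N}) \<le> N"
    using card_mono[OF _ B(1)] card_image_le[of "{..<N}" b] by auto
  ultimately have BN: "B = b ` {..<N}" "card (b ` {..<N}) = N"
    using card_subset_eq[OF _ B(1)] by auto
  then have inj: "inj_on b {..<N}" by (simp add: eq_card_imp_inj_on)
  let ?rep = "real_vector.representation B"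
  have rep_lin: "?rep (r *\<^sub>R x) v = r * ?rep x v" if "x \<in> V" for x r v
    using that B(2) \<open>Real_Vector_Spaces.span B = V\<close>
    by (simp add: real_vector.representation_scale)
  have rep_sum: "?rep (\<Sum>i\<in>I. f i) v = (\<Sum>i\<in>I. ?rep (f i) v)" if "\<And>i. i \<in> I \<Longrightarrow> f i \<in> V" for I and f :: "nat \<Rightarrow> 'v" and v
    using real_vector.representation_sum[OF B(2), of I f] that \<open>Real_Vector_Spaces.span B = V\<close> by simp
  define b' where "b' i = (\<Sum>j<N. ?rep (e j) (b i) *\<^sub>R e j)" for i
  have ipb: "ip x (b' i) = ?rep x (b i)" if "x \<in> V" for x i
  proof -
    have "?rep x (b i) = ?rep (\<Sum>j<N. ip x (e j) *\<^sub>R e j) (b i)" using expand_e[OF that] by simp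
    also have "\<dots> = (\<Sum>j<N. ip x (e j) * ?rep (e j) (b i))"
      by (subst rep_sum) (auto simp: rep_lin)
    also have "\<dots> = ip x (b' i)" unfolding b'_def ip_sum_right by (simp add: ip_scale_right mult.commute)
    finally show ?thesis ..
  qed
  have "dual_pair b b'"
    unfolding dual_pair_def
  proof (intro conjI allI impI)
    fix i j assume ij: "i < N" "j < N"
    then have "b i \<in> B" "b i \<in> V" using BN assms by auto
    then have "ip (b i) (b' j) = (if b j = b i then 1 else 0)"
      using ipb real_vector.representation_basis[OF B(2), of "b i"] by auto
    then show "ip (b i) (b' j) = (if i = j then 1 else 0)"
      using inj ij by (auto simp: inj_on_def)
  qed (use assms in \<open>auto simp: b'_def intro!: V_sum\<close>)
  then show ?thesis by blast
qed

section \<open>Volume in orthonormal coordinates\<close>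

definition pre where "pre A = {c \<in> extensional {..<N}. comb c \<in> A}"
definition M where "M = PiM {..<N} (\<lambda>_. lborel :: real measure)"
definition vol where "vol A = emeasure M (pre A)"
definition mble where "mble A \<longleftrightarrow> pre A \<in> sets M"

lemma space_M: "space M = extensional {..<N}"
  unfolding M_def space_PiM by (rule Set.set_eqI) (simp add: PiE_iff)

lemma volume_eq:
  assumes "mble A"
  shows "volume V ip A = measure M (pre A)"
proof -
  define XE where "XE = {c \<in> extensional E. (\<Sum>b\<in>E. c b *\<^sub>R b) \<in> A}"
  define R where "R = (\<lambda>c. \<lambda>i\<in>E. c (the_inv_into {..<N} e i) :: real)"
  define R' where "R' = (\<lambda>c. \<lambda>i\<in>{..<N}. c (the_inv_into E (the_inv_into {..<N} e) i) :: real)"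
  have finE: "finite E" using orthonormal_basis_E by (simp add: orthonormal_basis_def)
  have inv1: "the_inv_into {..<N} e (e i) = i" if "i < N" for i
    using the_inv_into_f_f[OF bij_betw_imp_inj_on[OF bij_e]] that by simp
  have inv2: "the_inv_into E (the_inv_into {..<N} e) i = e i" if "i < N" for i
    using the_inv_into_f_f[OF bij_betw_imp_inj_on[OF bij_betw_the_inv_into[OF bij_e]], of "e i"]
      bij_betwE[OF bij_e] inv1 that by simp
  have "XE = R' -` pre A \<inter> space (PiM E (\<lambda>_. lborel :: real measure))"
  proof -
    have "(\<Sum>b\<in>E. c b *\<^sub>R b) = comb (R' c)" for c
    proof -
      have "(\<Sum>b\<in>E. c b *\<^sub>R b) = (\<Sum>i<N. c (e i) *\<^sub>R e i)"
        by (rule sum.reindex_bij_betw[OF bij_e, symmetric])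
      also have "\<dots> = comb (R' c)" unfolding comb_def R'_def by (intro sum.cong) (auto simp: inv2)
      finally show ?thesis .
    qed
    then show ?thesis
      by (auto simp: XE_def pre_def space_PiM PiE_iff R'_def extensional_def)
  qed
  then have XE: "XE \<in> sets (PiM E (\<lambda>_. lborel))"
    using measurable_sets[OF emeasure_PiM_reindex(2)[OF bij_betw_the_inv_into[OF bij_e] finite_lessThan], of "pre A"]
      assms by (simp add: R'_def mble_def M_def)
  have "R -` XE \<inter> space (PiM {..<N} (\<lambda>_. lborel :: real measure)) = pre A"
  proof -
    have "(\<Sum>b\<in>E. R c b *\<^sub>R b) = comb c" for c
    proof -
      have "(\<Sum>b\<in>E. R c b *\<^sub>R b) = (\<Sum>i<N. R c (e i) *\<^sub>R e i)"
        by (rule sum.reindex_bij_betw[OF bij_e, symmetric])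
      also have "\<dots> = comb c" unfolding comb_def
        using bij_betwE[OF bij_e] by (intro sum.cong) (auto simp: inv1 R_def)
      finally show ?thesis .
    qed
    then show ?thesis by (auto simp: XE_def pre_def space_PiM PiE_iff R_def extensional_def)
  qed
  then have "emeasure M (pre A) = emeasure (PiM E (\<lambda>_. lborel)) XE"
    using emeasure_PiM_reindex(1)[OF bij_e finE XE] by (simp add: M_def R_def)
  then show ?thesis
    by (simp add: volume_def E_def[symmetric] XE_def measure_def Let_def)
qed

lemma mble_subset_level [intro]:
  assumes "A \<subseteq> V" "mble A" "mble B"
  shows "mble (A \<inter> B)" "mble (A - B)"
proof -
  have "pre (A \<inter> B) = pre A \<inter> pre B" "pre (A - B) = pre A - pre B" by (auto simp: pre_def)
  then show "mble (A \<inter> B)" "mble (A - B)" using assms by (auto simp: mble_def)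
qed

lemma measurable_coordinate [measurable]: "i < N \<Longrightarrow> (\<lambda>c. c i) \<in> borel_measurable M"
  using measurable_component_singleton[of i "{..<N}" "\<lambda>_. lborel :: real measure"] by (simp add: M_def)

lemma translate:
  assumes "a \<in> V" "mble A"
  shows "mble {x \<in> V. a + x \<in> A}" "vol {x \<in> V. a + x \<in> A} = vol A"
proof -
  let ?T = "\<lambda>c. \<lambda>i\<in>{..<N}. ip a (e i) + c i"
  have "comb (?T c) = a + comb c" for c
  proof -
    have "comb (?T c) = (\<Sum>i<N. ip a (e i) *\<^sub>R e i) + comb c"
      unfolding comb_def by (simp add: scaleR_add_left sum.distrib)
    then show ?thesis using expand_e[OF assms(1)] by simp
  qed
  then have eq: "pre {x \<in> V. a + x \<in> A} = ?T -` pre A \<inter> space M"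
    by (auto simp: pre_def space_M)
  show "mble {x \<in> V. a + x \<in> A}"
    unfolding mble_def eq
    using assms measurable_sets[OF emeasure_PiM_vimage_translate(2)[of "{..<N}" "pre A"]]
    by (simp add: M_def mble_def)
  show "vol {x \<in> V. a + x \<in> A} = vol A"
    unfolding vol_def eq using emeasure_PiM_vimage_translate(1)[of "{..<N}" "pre A"] assms
    by (simp add: M_def mble_def)
qed

lemma vol_ball:
  assumes "r > 0"
  shows "mble {x \<in> V. ip x x \<le> r\<^sup>2}" "vol {x \<in> V. ip x x \<le> r\<^sup>2} = ennreal (unit_ball_vol N * r ^ N)"
proof -
  have "pre {x \<in> V. ip x x \<le> r\<^sup>2} = {f. sqrt (\<Sum>i<N. (f i)\<^sup>2) \<le> r} \<inter> space M"
  proof -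
    have "ip (comb c) (comb c) = (\<Sum>i<N. (c i)\<^sup>2)" for c
    proof -
      have "ip (comb c) (comb c) = (\<Sum>i<N. ip (comb c) (e i) * ip (comb c) (e i))"
        by (rule parseval) simp
      also have "\<dots> = (\<Sum>i<N. (c i)\<^sup>2)"
        by (intro sum.cong) (auto simp: ip_comb_e power2_eq_square)
      finally show ?thesis .
    qed
    moreover have "sqrt (\<Sum>i<N. (f i)\<^sup>2) \<le> r \<longleftrightarrow> (\<Sum>i<N. (f i)\<^sup>2) \<le> r\<^sup>2" for f :: "nat \<Rightarrow> real"
      using assms by (metis less_eq_real_def real_sqrt_le_iff real_sqrt_unique)
    ultimately show ?thesis by (auto simp: pre_def space_M)
  qed
  moreover from this show "mble {x \<in> V. ip x x \<le> r\<^sup>2}"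
  proof -
    have "{f \<in> space M. sqrt (\<Sum>i<N. (f i)\<^sup>2) \<le> r} \<in> sets M"
      by measurable
    then show ?thesis unfolding mble_def \<open>pre _ = _\<close> by (simp add: Int_def conj_commute)
  qed
  ultimately show "vol {x \<in> V. ip x x \<le> r\<^sup>2} = ennreal (unit_ball_vol N * r ^ N)"
    unfolding vol_def M_def using emeasure_cball_aux[of "{..<N}" r] assms by simp
qed

section \<open>Fundamental parallelepipeds and Gram determinants\<close>

definition gram where "gram b = Matrix.mat N N (\<lambda>(i,j). ip (b i) (b j))"
definition fund where "fund b = {\<Sum>i<N. t i *\<^sub>R b i | t. \<forall>i<N. 0 \<le> t i \<and> t i < (1::real)}"
definition lat where "lat b = range (\<lambda>c::nat \<Rightarrow> int. \<Sum>i<N. real_of_int (c i) *\<^sub>R b i)"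

lemma fund_alt:
  assumes "dual_pair b b'"
  shows "fund b = {x \<in> V. \<forall>i<N. 0 \<le> ip x (b' i) \<and> ip x (b' i) < 1}"
proof (intro Set.set_eqI iffI)
  fix x assume "x \<in> fund b"
  then show "x \<in> {x \<in> V. \<forall>i<N. 0 \<le> ip x (b' i) \<and> ip x (b' i) < 1}"
    using dual_pairD(1)[OF assms] ip_dual_sum[OF assms] by (auto simp: fund_def intro!: V_sum)
next
  fix x assume x: "x \<in> {x \<in> V. \<forall>i<N. 0 \<le> ip x (b' i) \<and> ip x (b' i) < 1}"
  then show "x \<in> fund b"
    unfolding fund_def using expand_dual[OF assms, of x]
    by (auto intro!: exI[of _ "\<lambda>i. ip x (b' i)"])
qed

lemma lat_alt:
  assumes "dual_pair b b'"
  shows "lat b = {x \<in> V. \<forall>i<N. ip x (b' i) \<in> \<int>}"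
proof (intro Set.set_eqI iffI)
  fix x assume "x \<in> lat b"
  then show "x \<in> {x \<in> V. \<forall>i<N. ip x (b' i) \<in> \<int>}"
    using dual_pairD(1)[OF assms] ip_dual_sum[OF assms] by (auto simp: lat_def intro!: V_sum)
next
  fix x assume x: "x \<in> {x \<in> V. \<forall>i<N. ip x (b' i) \<in> \<int>}"
  then have "x = (\<Sum>i<N. real_of_int \<lfloor>ip x (b' i)\<rfloor> *\<^sub>R b i)"
    using expand_dual[OF assms, of x] by auto
  then show "x \<in> lat b"
    unfolding lat_def
    using rangeI[of "\<lambda>c::nat \<Rightarrow> int. \<Sum>i<N. real_of_int (c i) *\<^sub>R b i" "\<lambda>i. \<lfloor>ip x (b' i)\<rfloor>"] by metis
qed

lemma fund_covers:
  assumes "dual_pair b b'" "x \<in> V"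
  shows "\<exists>!l. l \<in> lat b \<and> x - l \<in> fund b"
proof
  let ?l = "\<Sum>i<N. real_of_int \<lfloor>ip x (b' i)\<rfloor> *\<^sub>R b i"
  have lV: "?l \<in> V" using dual_pairD(1)[OF assms(1)] by (intro V_sum) auto
  show "?l \<in> lat b \<and> x - ?l \<in> fund b"
    using assms(2) lV ip_dual_sum[OF assms(1)]
    by (auto simp: lat_def fund_alt[OF assms(1)] ip_diff_left; linarith)
  fix l assume l: "l \<in> lat b \<and> x - l \<in> fund b"
  then have *: "l \<in> V" "\<And>i. i < N \<Longrightarrow> ip l (b' i) \<in> \<int>"
    "\<And>i. i < N \<Longrightarrow> 0 \<le> ip x (b' i) - ip l (b' i) \<and> ip x (b' i) - ip l (b' i) < 1"
    by (auto simp: lat_alt[OF assms(1)] fund_alt[OF assms(1)] ip_diff_left)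
  have "ip l (b' i) = real_of_int \<lfloor>ip x (b' i)\<rfloor>" if "i < N" for i
    using *(2)[OF that] *(3)[OF that] by (elim Ints_cases) (simp, linarith)
  then show "l = ?l" using expand_dual[OF assms(1) *(1)] by (auto intro!: sum.cong)
qed

lemma lat_closed:
  assumes "dual_pair b b'"
  shows "0 \<in> lat b" "x \<in> lat b \<Longrightarrow> y \<in> lat b \<Longrightarrow> x + y \<in> lat b" "x \<in> lat b \<Longrightarrow> y \<in> lat b \<Longrightarrow> x - y \<in> lat b"
    "x \<in> lat b \<Longrightarrow> x \<in> V" "i < N \<Longrightarrow> b i \<in> lat b"
  unfolding lat_alt[OF assms] using dual_pairD[OF assms] by (auto simp: ip_linear)

text \<open>Let \<open>C b\<close> be the coordinate matrix of \<open>b\<close>. The Gram matrix is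
  \<open>C b\<close> times its transpose, duality says that \<open>C b\<close> and the transpose of
  \<open>C b'\<close> are inverse to each other, and \<open>fund b\<close> is the preimage of the
  unit cube under the map with matrix \<open>C b'\<close>, because scalar products with
  \<open>b'\<close> are the coefficients in \<open>b\<close>.\<close>

lemma gram_det:
  assumes "dual_pair b b'"
  shows "mble (fund b)" "vol (fund b) = ennreal (sqrt (Determinant.det (gram b)))"
    "Determinant.det (gram b) > 0" "Determinant.det (gram b) * Determinant.det (gram b') = 1"
proof -
  define C where "C b = Matrix.mat N N (\<lambda>(i,j). ip (b i) (e j))" for b :: "nat \<Rightarrow> 'v"
  have C: "C b \<in> carrier_mat N N" for b by (simp add: C_def)
  have mult: "C b * transpose_mat (C b') = Matrix.mat N N (\<lambda>(i,j). ip (b i) (b' j))"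
    if "\<And>i. i < N \<Longrightarrow> b i \<in> V" for b b'
  proof (rule eq_matI)
    fix i j assume ij: "i < dim_row (Matrix.mat N N (\<lambda>(i,j). ip (b i) (b' j)))"
      "j < dim_col (Matrix.mat N N (\<lambda>(i,j). ip (b i) (b' j)))"
    then show "(C b * transpose_mat (C b')) $$ (i,j) = Matrix.mat N N (\<lambda>(i,j). ip (b i) (b' j)) $$ (i,j)"
      using parseval[OF that, of i "b' j"] by (simp add: C_def scalar_prod_def atLeast0LessThan)
  qed (auto simp: C_def)
  have detG: "Determinant.det (gram b) = (Determinant.det (C b))\<^sup>2" if "\<And>i. i < N \<Longrightarrow> b i \<in> V" for b
    using mult[of b b, OF that] det_mult[OF C[of b] transpose_carrier_mat[THEN iffD2, OF C[of b]]] det_transpose[OF C[of b]]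
    by (simp add: gram_def power2_eq_square)
  note mult[of b b', OF dual_pairD(1)[OF assms]]
  also have "Matrix.mat N N (\<lambda>(i,j). ip (b i) (b' j)) = 1\<^sub>m N"
    using dual_pairD(3)[OF assms] by (intro eq_matI) auto
  finally have "C b * transpose_mat (C b') = 1\<^sub>m N" by simp
  then have det1: "Determinant.det (C b) * Determinant.det (C b') = 1"
    using det_mult[OF C[of b] transpose_carrier_mat[THEN iffD2, OF C[of b']]] det_transpose[OF C[of b']] by simp
  then have nz: "Determinant.det (C b) \<noteq> 0" "Determinant.det (C b') \<noteq> 0" by auto
  show "Determinant.det (gram b) > 0" using detG[OF dual_pairD(1)[OF assms]] nz by simp
  show "Determinant.det (gram b) * Determinant.det (gram b') = 1"
    using detG[OF dual_pairD(1)[OF assms]] detG[OF dual_pairD(2)[OF assms]] det1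
    by (simp add: power_mult_distrib[symmetric])
  define T where "T = (\<lambda>c. \<lambda>i\<in>{..<N}. \<Sum>j<N. C b' $$ (i,j) * c j)"
  note T = emeasure_PiM_vimage_matrix[OF C nz(2), folded T_def M_def]
  define Q where "Q = Pi\<^sub>E {..<N} (\<lambda>_. {0..<1::real})"
  have Q: "Q \<in> sets M" unfolding Q_def M_def by (intro sets_PiM_I_finite) auto
  have eQ: "emeasure M Q = 1"
    unfolding Q_def M_def by (subst lborel_product.emeasure_PiM) auto
  have Tc: "T c i = ip (comb c) (b' i)" if "i < N" for c i
    using that parseval[OF comb_in_V, of c "b' i"] by (simp add: T_def C_def ip_comb_e mult.commute)
  have eq: "pre (fund b) = T -` Q \<inter> space M"
  proof (intro Set.set_eqI)
    fix c
    have "T c \<in> extensional {..<N}" by (simp add: T_def)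
    then have "T c \<in> Q \<longleftrightarrow> (\<forall>i<N. 0 \<le> T c i \<and> T c i < 1)"
      unfolding Q_def PiE_iff by auto
    then show "c \<in> pre (fund b) \<longleftrightarrow> c \<in> T -` Q \<inter> space M"
      unfolding pre_def fund_alt[OF assms] space_M by (simp add: Tc conj_commute)
  qed
  have TM: "T \<in> measurable M M" and TX: "\<And>X. X \<in> sets M \<Longrightarrow>
      emeasure M (T -` X \<inter> space M) * ennreal \<bar>Determinant.det (C b')\<bar> = emeasure M X"
    using T by auto
  show "mble (fund b)" unfolding mble_def eq using TM Q by (rule measurable_sets)
  show "vol (fund b) = ennreal (sqrt (Determinant.det (gram b)))"
  proof -
    have 1: "vol (fund b) * ennreal \<bar>Determinant.det (C b')\<bar> = 1"
      unfolding vol_def eq TX[OF Q] by (rule eQ)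
    have 2: "ennreal \<bar>Determinant.det (C b')\<bar> * ennreal \<bar>Determinant.det (C b)\<bar> = 1"
    proof -
      have "\<bar>Determinant.det (C b')\<bar> * \<bar>Determinant.det (C b)\<bar> = 1"
        using arg_cong[OF det1, of abs] by (simp only: abs_mult mult.commute[of "\<bar>Determinant.det (C b')\<bar>"] abs_one)
      then show ?thesis
        using ennreal_mult[of "\<bar>Determinant.det (C b')\<bar>" "\<bar>Determinant.det (C b)\<bar>"] by simp
    qed
    have "(vol (fund b) * ennreal \<bar>Determinant.det (C b')\<bar>) * ennreal \<bar>Determinant.det (C b)\<bar> = vol (fund b)"
      unfolding mult.assoc 2 by simp
    then show "vol (fund b) = ennreal (sqrt (Determinant.det (gram b)))"
      unfolding 1 using detG[OF dual_pairD(1)[OF assms]] by simp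
  qed
qed

lemma range_image_eq_lat:
  assumes "inj_on b {..<N}"
  shows "range (\<lambda>c. \<Sum>v\<in>b ` {..<N}. real_of_int (c v) *\<^sub>R v) = lat b"
proof (intro subset_antisym subsetI)
  fix x assume "x \<in> range (\<lambda>c. \<Sum>v\<in>b ` {..<N}. real_of_int (c v) *\<^sub>R v)"
  then obtain c where "x = (\<Sum>v\<in>b ` {..<N}. real_of_int (c v) *\<^sub>R v)" by auto
  then have "x = (\<Sum>i<N. real_of_int (c (b i)) *\<^sub>R b i)"
    using sum.reindex[OF assms, of "\<lambda>v. real_of_int (c v) *\<^sub>R v"] by simp
  then show "x \<in> lat b" unfolding lat_def by auto
next
  fix x assume "x \<in> lat b"
  then obtain c where c: "x = (\<Sum>i<N. real_of_int (c i) *\<^sub>R b i)" by (auto simp: lat_def)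
  define c' where "c' v = c (the_inv_into {..<N} b v)" for v
  have "(\<Sum>v\<in>b ` {..<N}. real_of_int (c' v) *\<^sub>R v) = (\<Sum>i<N. real_of_int (c' (b i)) *\<^sub>R b i)"
    using sum.reindex[OF assms, of "\<lambda>v. real_of_int (c' v) *\<^sub>R v"] by simp
  also have "\<dots> = x" unfolding c c'_def using the_inv_into_f_f[OF assms] by (intro sum.cong) auto
  finally have eq: "x = (\<Sum>v\<in>b ` {..<N}. real_of_int (c' v) *\<^sub>R v)" by simp
  show "x \<in> range (\<lambda>c. \<Sum>v\<in>b ` {..<N}. real_of_int (c v) *\<^sub>R v)"
    by (rule range_eqI[where x = c' and f = "\<lambda>c. \<Sum>v\<in>b ` {..<N}. real_of_int (c v) *\<^sub>R v"]) (rule eq)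
qed

lemma lattice_basis_imp_dual_pair:
  assumes "lattice_basis V L B"
  obtains b b' where "dual_pair b b'" "bij_betw b {..<N} B" "L = lat b"
proof -
  have B: "finite B" "\<not> Real_Vector_Spaces.dependent B" "Real_Vector_Spaces.span B = V"
    and L: "L = range (\<lambda>c. \<Sum>b\<in>B. real_of_int (c b) *\<^sub>R b)"
    using assms by (auto simp: lattice_basis_def)
  have "card B = N"
    using real_vector.dim_span_eq_card_independent[OF B(2)] B(3) dim_V by simp
  then obtain b where b: "bij_betw b {..<N} B"
    using ex_bij_betw_nat_finite[OF B(1)] by (auto simp: atLeast0LessThan)
  then have im: "b ` {..<N} = B" "inj_on b {..<N}" by (auto simp: bij_betw_def)
  moreover have "B \<subseteq> V" using B(3) real_vector.span_superset[of B] by simp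
  ultimately obtain b' where b': "dual_pair b b'" using spanning_dual_pair[of b] B(3) by auto
  have "L = lat b" using range_image_eq_lat[OF im(2)] L im(1) by simp
  with b b' show ?thesis using that by blast
qed

lemma dual_pair_lattice_basis: "dual_pair b b' \<Longrightarrow> lattice_basis V (lat b) (b ` {..<N})"
  unfolding lattice_basis_def
  using dual_pair_independent[of b b'] dual_pair_span[of b b'] range_image_eq_lat[OF dual_pair_inj[of b b']] by simp

lemma is_lattice_iff: "is_lattice V L \<longleftrightarrow> (\<exists>b b'. dual_pair b b' \<and> L = lat b)"
proof
  assume "is_lattice V L"
  then obtain B where "lattice_basis V L B" by (auto simp: is_lattice_def)
  then show "\<exists>b b'. dual_pair b b' \<and> L = lat b" by (elim lattice_basis_imp_dual_pair) blast
next
  assume "\<exists>b b'. dual_pair b b' \<and> L = lat b"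
  then obtain b b' where "dual_pair b b'" "L = lat b" by blast
  then show "is_lattice V L" using dual_pair_lattice_basis by (auto simp: is_lattice_def)
qed

lemma lattice_closed:
  assumes "is_lattice V L"
  shows "0 \<in> L" "x \<in> L \<Longrightarrow> y \<in> L \<Longrightarrow> x + y \<in> L" "x \<in> L \<Longrightarrow> y \<in> L \<Longrightarrow> x - y \<in> L" "x \<in> L \<Longrightarrow> - x \<in> L"
    "x \<in> L \<Longrightarrow> x \<in> V" "L \<subseteq> V"
proof -
  obtain b b' where *: "dual_pair b b'" "L = lat b" using assms is_lattice_iff by blast
  note c = lat_closed[OF *(1), folded *(2)]
  show "0 \<in> L" "x \<in> L \<Longrightarrow> y \<in> L \<Longrightarrow> x + y \<in> L" "x \<in> L \<Longrightarrow> y \<in> L \<Longrightarrow> x - y \<in> L"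
    "x \<in> L \<Longrightarrow> x \<in> V" "L \<subseteq> V" using c by auto
  show "x \<in> L \<Longrightarrow> - x \<in> L" using c(3)[of 0 x] c(1) by simp
qed

section \<open>Counting lattice points in translates\<close>

lemma finite_lat_bounded:
  assumes "dual_pair b b'" "S \<subseteq> lat b" "\<And>i. i < N \<Longrightarrow> \<exists>K. \<forall>l\<in>S. \<bar>ip l (b' i)\<bar> \<le> K"
  shows "finite S"
proof -
  have "\<forall>i. \<exists>K. i < N \<longrightarrow> (\<forall>l\<in>S. \<bar>ip l (b' i)\<bar> \<le> K)" using assms(3) by blast
  then obtain K where K: "\<And>i l. i < N \<Longrightarrow> l \<in> S \<Longrightarrow> \<bar>ip l (b' i)\<bar> \<le> K i" by metis
  have "S \<subseteq> (\<lambda>c. \<Sum>i<N. real_of_int (c i) *\<^sub>R b i) ` Pi\<^sub>E {..<N} (\<lambda>i. {-\<lceil>K i\<rceil>..\<lceil>K i\<rceil>})"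
  proof
    fix l assume l: "l \<in> S"
    then obtain c where c: "l = (\<Sum>i<N. real_of_int (c i) *\<^sub>R b i)" using assms(2) by (auto simp: lat_def)
    have "\<bar>real_of_int (c i)\<bar> \<le> K i" if "i < N" for i
      using K[OF that l] ip_dual_sum[OF assms(1) that] c by simp
    then have "c i \<in> {-\<lceil>K i\<rceil>..\<lceil>K i\<rceil>}" if "i < N" for i
    proof -
      have "real_of_int (c i) \<le> real_of_int \<lceil>K i\<rceil>" "real_of_int (- \<lceil>K i\<rceil>) \<le> real_of_int (c i)"
        using \<open>\<And>i. i < N \<Longrightarrow> \<bar>real_of_int (c i)\<bar> \<le> K i\<close>[OF that] le_of_int_ceiling[of "K i"] by linarith+
      then show ?thesis unfolding of_int_le_iff by simp
    qed
    then have "restrict c {..<N} \<in> Pi\<^sub>E {..<N} (\<lambda>i. {-\<lceil>K i\<rceil>..\<lceil>K i\<rceil>})" by auto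
    moreover have "l = (\<Sum>i<N. real_of_int (restrict c {..<N} i) *\<^sub>R b i)" using c by simp
    ultimately show "l \<in> (\<lambda>c. \<Sum>i<N. real_of_int (c i) *\<^sub>R b i) ` Pi\<^sub>E {..<N} (\<lambda>i. {-\<lceil>K i\<rceil>..\<lceil>K i\<rceil>})"
      by (intro image_eqI[where x = "restrict c {..<N}"])
  qed
  moreover have "finite (Pi\<^sub>E {..<N} (\<lambda>i. {-\<lceil>K i\<rceil>..\<lceil>K i\<rceil>}))" by (intro finite_PiE) auto
  ultimately show ?thesis using finite_surj by blast
qed

lemma ip_bounded:
  assumes "\<forall>x\<in>S. x \<in> V \<and> ip x x \<le> R" "y \<in> V"
  shows "\<exists>K. \<forall>x\<in>S. \<bar>ip x y\<bar> \<le> K"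
proof (intro exI ballI)
  fix x assume x: "x \<in> S"
  have "(ip x y)\<^sup>2 \<le> ip x x * ip y y" using Cauchy_Schwarz assms x by blast
  also have "\<dots> \<le> \<bar>R\<bar> * ip y y" using bspec[OF assms(1) x] ip_nonneg[OF assms(2)] by (intro mult_right_mono) auto
  finally have "(ip x y)\<^sup>2 \<le> \<bar>R\<bar> * ip y y" .
  then show "\<bar>ip x y\<bar> \<le> sqrt (\<bar>R\<bar> * ip y y)" using real_sqrt_le_mono by fastforce
qed

lemma finite_lattice_ball:
  assumes "is_lattice V L"
  shows "finite {l \<in> L. ip l l \<le> R}"
proof -
  obtain b b' where *: "dual_pair b b'" "L = lat b" using assms is_lattice_iff by blast
  show ?thesis
  proof (rule finite_lat_bounded[OF *(1)])
    fix i assume "i < N"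
    then show "\<exists>K. \<forall>l\<in>{l \<in> L. ip l l \<le> R}. \<bar>ip l (b' i)\<bar> \<le> K"
      using lattice_closed(5)[OF assms] dual_pairD(2)[OF *(1)] by (intro ip_bounded[of _ R]) auto
  qed (use * in auto)
qed

lemma ip_double_sum:
  "ip (\<Sum>i\<in>I. t i *\<^sub>R b i) (\<Sum>j\<in>J. u j *\<^sub>R c j) = (\<Sum>i\<in>I. \<Sum>j\<in>J. t i * u j * ip (b i) (c j))"
  unfolding ip_sum_left ip_scale_left
  by (simp add: ip_sum_right ip_scale_right sum_distrib_left mult.assoc)

lemma fund_bounded:
  assumes "dual_pair b b'"
  shows "\<forall>w\<in>fund b. w \<in> V \<and> ip w w \<le> (\<Sum>i<N. \<Sum>j<N. \<bar>ip (b i) (b j)\<bar>)"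
proof (intro ballI conjI)
  fix w assume w: "w \<in> fund b"
  then show "w \<in> V" by (simp add: fund_alt[OF assms])
  obtain t where t: "w = (\<Sum>i<N. t i *\<^sub>R b i)" "\<And>i. i < N \<Longrightarrow> 0 \<le> t i \<and> t i < 1"
    using w by (auto simp: fund_def)
  have "ip w w = (\<Sum>i<N. \<Sum>j<N. t i * t j * ip (b i) (b j))"
    unfolding t(1) by (rule ip_double_sum)
  also have "\<dots> \<le> (\<Sum>i<N. \<Sum>j<N. \<bar>ip (b i) (b j)\<bar>)"
  proof (intro sum_mono)
    fix i j assume "i \<in> {..<N}" "j \<in> {..<N}"
    then have "0 \<le> t i * t j" "t i * t j \<le> 1" using t(2)[of i] t(2)[of j] mult_le_one[of "t i" "t j"] by auto
    then have "t i * t j * \<bar>ip (b i) (b j)\<bar> \<le> 1 * \<bar>ip (b i) (b j)\<bar>" by (intro mult_right_mono) auto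
    moreover have "t i * t j * ip (b i) (b j) \<le> t i * t j * \<bar>ip (b i) (b j)\<bar>"
      using \<open>0 \<le> t i * t j\<close> by (intro mult_left_mono) auto
    ultimately show "t i * t j * ip (b i) (b j) \<le> \<bar>ip (b i) (b j)\<bar>" by linarith
  qed
  finally show "ip w w \<le> (\<Sum>i<N. \<Sum>j<N. \<bar>ip (b i) (b j)\<bar>)" .
qed

lemma finite_lat_translates:
  assumes b: "dual_pair b b'" and A: "\<forall>x\<in>A. x \<in> V \<and> ip x x \<le> R"
  shows "finite {l \<in> lat b. \<exists>w\<in>fund b. l + w \<in> A}" "w \<in> V \<Longrightarrow> finite {l \<in> lat b. l + w \<in> A}"
proof -
  show "finite {l \<in> lat b. \<exists>w\<in>fund b. l + w \<in> A}"
  proof (rule finite_lat_bounded[OF b])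
    fix i assume i: "i < N"
    obtain K where K: "\<forall>x\<in>A. \<bar>ip x (b' i)\<bar> \<le> K"
      using ip_bounded[OF A, of "b' i"] dual_pairD(2)[OF b i] by auto
    have "\<bar>ip l (b' i)\<bar> \<le> K + 1" if l: "w \<in> fund b" "l + w \<in> A" for l w
    proof -
      have "\<bar>ip w (b' i)\<bar> \<le> 1" using l(1) i by (auto simp: fund_alt[OF b])
      moreover have "\<bar>ip l (b' i) + ip w (b' i)\<bar> \<le> K" using bspec[OF K l(2)] by (simp add: ip_add_left)
      ultimately show ?thesis by linarith
    qed
    then show "\<exists>K. \<forall>l\<in>{l \<in> lat b. \<exists>w\<in>fund b. l + w \<in> A}. \<bar>ip l (b' i)\<bar> \<le> K" by auto
  qed auto
  show "finite {l \<in> lat b. l + w \<in> A}" if "w \<in> V"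
  proof (rule finite_lat_bounded[OF b])
    fix i assume i: "i < N"
    obtain K where K: "\<forall>x\<in>A. \<bar>ip x (b' i)\<bar> \<le> K"
      using ip_bounded[OF A, of "b' i"] dual_pairD(2)[OF b i] by auto
    have "\<bar>ip l (b' i)\<bar> \<le> K + \<bar>ip w (b' i)\<bar>" if l: "l + w \<in> A" for l
      using bspec[OF K l] by (simp add: ip_add_left)
    then show "\<exists>K. \<forall>l\<in>{l \<in> lat b. l + w \<in> A}. \<bar>ip l (b' i)\<bar> \<le> K" by auto
  qed auto
qed

text \<open>Cutting \<open>A\<close> along the translates of a fundamental parallelepiped and moving the pieces back.\<close>
lemma vol_eq_integral_count:
  assumes b: "dual_pair b b'" and A: "\<forall>x\<in>A. x \<in> V \<and> ip x x \<le> R" and m: "mble A"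
  shows "vol A = (\<integral>\<^sup>+c. of_nat (card {l \<in> lat b. l + comb c \<in> A}) * indicator (pre (fund b)) c \<partial>M)"
proof -
  define F where "F = {l \<in> lat b. \<exists>w\<in>fund b. l + w \<in> A}"
  have finF: "finite F" unfolding F_def by (rule finite_lat_translates(1)[OF b A])
  define S where "S l = {w \<in> fund b. l + w \<in> A}" for l
  define Al where "Al l = A \<inter> {x \<in> V. - l + x \<in> fund b}" for l
  have fV: "fund b \<subseteq> V" by (auto simp: fund_alt[OF b])
  have lV: "l \<in> V" if "l \<in> F" for l using that lat_closed(4)[OF b] by (auto simp: F_def)
  have mAl: "mble (Al l)" if "l \<in> F" for l
    unfolding Al_def using A m translate(1)[of "- l" "fund b"] gram_det(1)[OF b] lV[OF that]
    by (intro mble_subset_level) auto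
  have SAl: "S l = {x \<in> V. l + x \<in> Al l}" if "l \<in> F" for l
    using fV lV[OF that] by (auto simp: S_def Al_def)
  have mS: "mble (S l)" and vS: "vol (S l) = vol (Al l)" if "l \<in> F" for l
    unfolding SAl[OF that] using translate[OF lV[OF that] mAl[OF that]] by auto
  have "pre A = (\<Union>l\<in>F. pre (Al l))"
  proof -
    have "A = (\<Union>l\<in>F. Al l)"
    proof (intro subset_antisym subsetI)
      fix x assume x: "x \<in> A"
      then obtain l where l: "l \<in> lat b" "x - l \<in> fund b" using fund_covers[OF b, of x] A by blast
      then have "l + (x - l) \<in> A" using x by simp
      then have "l \<in> F" using l unfolding F_def by blast
      then show "x \<in> (\<Union>l\<in>F. Al l)" using x l A by (auto simp: Al_def)
    qed (auto simp: Al_def)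
    then show ?thesis by (auto simp: pre_def)
  qed
  moreover have "disjoint_family_on (\<lambda>l. pre (Al l)) F"
    unfolding disjoint_family_on_def
  proof (intro ballI impI)
    fix l l' assume ll: "l \<in> F" "l' \<in> F" "l \<noteq> l'"
    show "pre (Al l) \<inter> pre (Al l') = {}"
    proof (rule ccontr)
      assume "pre (Al l) \<inter> pre (Al l') \<noteq> {}"
      then obtain x where "x \<in> Al l" "x \<in> Al l'" by (auto simp: pre_def)
      then have "x \<in> V" "x - l \<in> fund b" "x - l' \<in> fund b" by (auto simp: Al_def)
      then show False using fund_covers[OF b, of x] ll by (auto simp: F_def)
    qed
  qed
  ultimately have "vol A = (\<Sum>l\<in>F. vol (Al l))"
    unfolding vol_def using mAl finF by (subst sum_emeasure) (auto simp: mble_def)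
  also have "\<dots> = (\<Sum>l\<in>F. vol (S l))" using vS by simp
  also have "\<dots> = (\<Sum>l\<in>F. \<integral>\<^sup>+c. indicator (pre (S l)) c \<partial>M)"
    unfolding vol_def using mS by (intro sum.cong) (auto simp: mble_def)
  also have "\<dots> = (\<integral>\<^sup>+c. (\<Sum>l\<in>F. indicator (pre (S l)) c) \<partial>M)"
    using mS by (subst nn_integral_sum) (auto simp: mble_def)
  also have "\<dots> = (\<integral>\<^sup>+c. of_nat (card {l \<in> lat b. l + comb c \<in> A}) * indicator (pre (fund b)) c \<partial>M)"
  proof (rule nn_integral_cong)
    fix c assume "c \<in> space M"
    show "(\<Sum>l\<in>F. indicator (pre (S l)) c) =
      (of_nat (card {l \<in> lat b. l + comb c \<in> A}) * indicator (pre (fund b)) c :: ennreal)"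
    proof (cases "c \<in> pre (fund b)")
      case True
      then have eq: "{l \<in> lat b. l + comb c \<in> A} = {l \<in> F. l + comb c \<in> A}" by (auto simp: F_def pre_def)
      have "(\<Sum>l\<in>F. indicator (pre (S l)) c) = (\<Sum>l\<in>F. if l + comb c \<in> A then 1 else 0 :: ennreal)"
        using True by (intro sum.cong) (auto simp: pre_def S_def indicator_def)
      also have "\<dots> = of_nat (card {l \<in> F. l + comb c \<in> A})"
        using finF by (simp add: sum.If_cases Int_def)
      finally show ?thesis using True eq by simp
    next
      case False
      then show ?thesis by (auto simp: pre_def S_def indicator_def)
    qed
  qed
  finally show ?thesis .
qed

text \<open>The integral of \<open>vol_eq_integral_count\<close> runs over a parallelepiped, so a
  bound on the count in every translate bounds the volume. All later volume arguments take this
  form.\<close>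

lemma vol_count_bounds:
  assumes b: "dual_pair b b'" and A: "\<forall>x\<in>A. x \<in> V \<and> ip x x \<le> R" "mble A"
  shows "(\<And>w. w \<in> V \<Longrightarrow> card {l \<in> lat b. l + w \<in> A} \<le> k) \<Longrightarrow> vol A \<le> of_nat k * vol (fund b)"
    and "(\<And>w. w \<in> V \<Longrightarrow> k \<le> card {l \<in> lat b. l + w \<in> A}) \<Longrightarrow> of_nat k * vol (fund b) \<le> vol A"
proof -
  have m: "pre (fund b) \<in> sets M" using gram_det(1)[OF b] by (simp add: mble_def)
  then have k: "of_nat k * vol (fund b) = (\<integral>\<^sup>+c. of_nat k * indicator (pre (fund b)) c \<partial>M)"
    unfolding vol_def by (simp add: nn_integral_cmult_indicator)
  note vA = vol_eq_integral_count[OF b A]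
  show "vol A \<le> of_nat k * vol (fund b)" if *: "\<And>w. w \<in> V \<Longrightarrow> card {l \<in> lat b. l + w \<in> A} \<le> k"
    unfolding vA k by (intro nn_integral_mono mult_right_mono, use * in auto)
  show "of_nat k * vol (fund b) \<le> vol A" if *: "\<And>w. w \<in> V \<Longrightarrow> k \<le> card {l \<in> lat b. l + w \<in> A}"
    unfolding vA k by (intro nn_integral_mono mult_right_mono, use * in auto)
qed

lemma card_translates_fund:
  assumes "dual_pair b b'" "w \<in> V"
  shows "card {l \<in> lat b. l + w \<in> fund b} = 1"
proof -
  obtain l where l: "l \<in> lat b" "w - l \<in> fund b" "\<And>l'. l' \<in> lat b \<Longrightarrow> w - l' \<in> fund b \<Longrightarrow> l' = l"
    using fund_covers[OF assms] by blast
  have neg: "- x \<in> lat b" if "x \<in> lat b" for x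
    using lat_closed(3)[OF assms(1) lat_closed(1)[OF assms(1)] that] by simp
  have *: "x = - l" if "x \<in> lat b" "x + w \<in> fund b" for x
  proof -
    have "w - (- x) \<in> fund b" using that(2) by (simp add: add.commute)
    then have "- x = l" by (rule l(3)[OF neg[OF that(1)]])
    then show ?thesis by (metis minus_minus)
  qed
  have "{l \<in> lat b. l + w \<in> fund b} = {- l}"
  proof (intro subset_antisym subsetI)
    fix x assume "x \<in> {l \<in> lat b. l + w \<in> fund b}"
    then show "x \<in> {- l}" using *[of x] by simp
  next
    fix x assume "x \<in> {- l}"
    then have "x = - l" by simp
    then show "x \<in> {l \<in> lat b. l + w \<in> fund b}" using neg[OF l(1)] l(2) by (simp add: add.commute)
  qed
  then show ?thesis by simp
qed

text \<open>Every translate of the lattice has exactly one point in \<open>fund b\<close>, so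
  counting with \<open>k = 1\<close> in both directions compares it with \<open>fund c\<close>. This
  frees \<open>covolume\<close> from its choice of a basis.\<close>

lemma vol_fund_unique:
  assumes "dual_pair b b'" "dual_pair c c'" "lat b = lat c"
  shows "vol (fund b) = vol (fund c)"
proof -
  have A: "\<forall>x\<in>fund b. x \<in> V \<and> ip x x \<le> (\<Sum>i<N. \<Sum>j<N. \<bar>ip (b i) (b j)\<bar>)"
    by (rule fund_bounded[OF assms(1)])
  have card: "card {l \<in> lat c. l + w \<in> fund b} = 1" if "w \<in> V" for w
    using card_translates_fund[OF assms(1) that] assms(3) by simp
  show ?thesis
    using vol_count_bounds(1)[OF assms(2) A gram_det(1)[OF assms(1)], of 1]
      vol_count_bounds(2)[OF assms(2) A gram_det(1)[OF assms(1)], of 1] card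
    by (intro antisym) auto
qed

section \<open>Covolumes, indices and short vectors\<close>

lemma covolume_lat:
  assumes "dual_pair b b'"
  shows "covolume V ip (lat b) = sqrt (Determinant.det (gram b))"
    "covolume V ip (lat b) > 0" "vol (fund b) = ennreal (covolume V ip (lat b))"
proof -
  define B where "B = (SOME B. lattice_basis V (lat b) B)"
  have "lattice_basis V (lat b) B"
    unfolding B_def using dual_pair_lattice_basis[OF assms] by (rule someI)
  then obtain c c' where c: "dual_pair c c'" "bij_betw c {..<N} B" "lat b = lat c"
    by (rule lattice_basis_imp_dual_pair)
  have im: "B = c ` {..<N}" "inj_on c {..<N}" using c(2) by (auto simp: bij_betw_def)
  have "{\<Sum>b\<in>B. t b *\<^sub>R b | t. \<forall>b\<in>B. 0 \<le> t b \<and> t b < (1::real)} = fund c"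
  proof (intro subset_antisym subsetI)
    fix x assume "x \<in> {\<Sum>b\<in>B. t b *\<^sub>R b | t. \<forall>b\<in>B. 0 \<le> t b \<and> t b < (1::real)}"
    then obtain t where t: "x = (\<Sum>b\<in>B. t b *\<^sub>R b)" "\<forall>b\<in>B. 0 \<le> t b \<and> t b < 1" by auto
    have "x = (\<Sum>i<N. t (c i) *\<^sub>R c i)"
      using t(1) sum.reindex_bij_betw[OF c(2), of "\<lambda>v. t v *\<^sub>R v"] by simp
    then show "x \<in> fund c" using t(2) im(1) by (auto simp: fund_def intro!: exI[of _ "t \<circ> c"])
  next
    fix x assume "x \<in> fund c"
    then obtain t where t: "x = (\<Sum>i<N. t i *\<^sub>R c i)" "\<forall>i<N. 0 \<le> t i \<and> t i < 1" by (auto simp: fund_def)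
    define t' where "t' v = t (the_inv_into {..<N} c v)" for v
    have t': "t' (c i) = t i" if "i < N" for i using the_inv_into_f_f[OF im(2)] that by (simp add: t'_def)
    have "(\<Sum>b\<in>B. t' b *\<^sub>R b) = (\<Sum>i<N. t' (c i) *\<^sub>R c i)"
      by (rule sum.reindex_bij_betw[OF c(2), symmetric])
    also have "\<dots> = x" using t' t(1) by simp
    finally have "x = (\<Sum>b\<in>B. t' b *\<^sub>R b)" ..
    moreover have "\<forall>b\<in>B. 0 \<le> t' b \<and> t' b < 1" using im(1) t' t(2) by auto
    ultimately show "x \<in> {\<Sum>b\<in>B. t b *\<^sub>R b | t. \<forall>b\<in>B. 0 \<le> t b \<and> t b < (1::real)}" by blast
  qed
  then have "covolume V ip (lat b) = volume V ip (fund c)"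
    by (simp add: covolume_def B_def Let_def)
  also have "\<dots> = enn2real (vol (fund c))"
    using volume_eq[OF gram_det(1)[OF c(1)]] by (simp add: vol_def measure_def)
  also have "\<dots> = sqrt (Determinant.det (gram b))"
    using vol_fund_unique[OF assms c(1,3)] gram_det(2,3)[OF assms] by simp
  finally show *: "covolume V ip (lat b) = sqrt (Determinant.det (gram b))" .
  show "covolume V ip (lat b) > 0" "vol (fund b) = ennreal (covolume V ip (lat b))"
    using gram_det(2,3)[OF assms] * by auto
qed

lemma covolume_pos: "is_lattice V L \<Longrightarrow> covolume V ip L > 0"
  unfolding is_lattice_iff using covolume_lat(2) by (elim exE conjE) simp

lemma lattice_count_bounds:
  assumes L: "is_lattice V L" and A: "\<forall>x\<in>A. x \<in> V \<and> ip x x \<le> R" "mble A"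
  shows "(\<And>w. w \<in> V \<Longrightarrow> card {l \<in> L. l + w \<in> A} \<le> k) \<Longrightarrow> vol A \<le> ennreal (real k * covolume V ip L)"
    and "(\<And>w. w \<in> V \<Longrightarrow> k \<le> card {l \<in> L. l + w \<in> A}) \<Longrightarrow> ennreal (real k * covolume V ip L) \<le> vol A"
    and "w \<in> V \<Longrightarrow> finite {l \<in> L. l + w \<in> A}"
proof -
  obtain b b' where *: "dual_pair b b'" "L = lat b" using L is_lattice_iff by blast
  have eq: "of_nat k * vol (fund b) = ennreal (real k * covolume V ip L)"
    using covolume_lat(2,3)[OF *(1)] *(2) by (simp add: ennreal_mult ennreal_of_nat_eq_real_of_nat)
  show "vol A \<le> ennreal (real k * covolume V ip L)" if "\<And>w. w \<in> V \<Longrightarrow> card {l \<in> L. l + w \<in> A} \<le> k"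
    using vol_count_bounds(1)[OF *(1) A, of k] that *(2) eq by simp
  show "ennreal (real k * covolume V ip L) \<le> vol A" if "\<And>w. w \<in> V \<Longrightarrow> k \<le> card {l \<in> L. l + w \<in> A}"
    using vol_count_bounds(2)[OF *(1) A, of k] that *(2) eq by simp
  show "w \<in> V \<Longrightarrow> finite {l \<in> L. l + w \<in> A}"
    using finite_lat_translates(2)[OF *(1) A(1)] *(2) by blast
qed

text \<open>Each translate of \<open>L\<close> meets a fundamental parallelepiped of
  \<open>L'\<close> in one point per class modulo \<open>L'\<close>, so the number of classes is the
  ratio of the covolumes. Incomplete and redundant systems of representatives give the two
  inequalities.\<close>

lemma
  assumes L: "is_lattice V L" and L': "is_lattice V L'" "L' \<subseteq> L" and R: "finite R" "R \<subseteq> L"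
  shows covolume_separated: "(\<And>x y. x \<in> R \<Longrightarrow> y \<in> R \<Longrightarrow> x - y \<in> L' \<Longrightarrow> x = y) \<Longrightarrow>
      real (card R) * covolume V ip L \<le> covolume V ip L'"
    and covolume_covered: "(\<And>x. x \<in> L \<Longrightarrow> \<exists>r\<in>R. x - r \<in> L') \<Longrightarrow>
      covolume V ip L' \<le> real (card R) * covolume V ip L"
proof -
  obtain b b' where b: "dual_pair b b'" "L' = lat b" using L' is_lattice_iff by blast
  have A: "\<forall>x\<in>fund b. x \<in> V \<and> ip x x \<le> (\<Sum>i<N. \<Sum>j<N. \<bar>ip (b i) (b j)\<bar>)"
    by (rule fund_bounded[OF b(1)])
  note cb = lattice_count_bounds[OF L A gram_det(1)[OF b(1)]]
  have v: "vol (fund b) = ennreal (covolume V ip L')" "covolume V ip L' > 0" "covolume V ip L > 0"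
    using covolume_lat[OF b(1)] b(2) covolume_pos[OF L] by auto
  note cl = lattice_closed[OF L] and cl' = lattice_closed[OF L'(1)]
  show "real (card R) * covolume V ip L \<le> covolume V ip L'"
    if sep: "\<And>x y. x \<in> R \<Longrightarrow> y \<in> R \<Longrightarrow> x - y \<in> L' \<Longrightarrow> x = y"
  proof -
    have "card R \<le> card {l \<in> L. l + w \<in> fund b}" if w: "w \<in> V" for w
    proof -
      have "\<exists>l. l \<in> L' \<and> w + r - l \<in> fund b" if "r \<in> R" for r
        using fund_covers[OF b(1), of "w + r"] b(2) w that R cl(5) by blast
      then obtain l where l: "\<And>r. r \<in> R \<Longrightarrow> l r \<in> L' \<and> w + r - l r \<in> fund b" by metis
      \<comment> \<open>The point \<open>w + r\<close> is moved into the parallelepiped by an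
        element of \<open>L'\<close>, which keeps its class; distinct classes therefore give
        distinct points.\<close>
      have "inj_on (\<lambda>r. r - l r) R"
      proof (rule inj_onI)
        fix x y assume xy: "x \<in> R" "y \<in> R" "x - l x = y - l y"
        then have "x - y = l x - l y" by (simp add: algebra_simps)
        then show "x = y" using sep[OF xy(1,2)] l[OF xy(1)] l[OF xy(2)] cl'(3) by simp
      qed
      moreover have "(\<lambda>r. r - l r) ` R \<subseteq> {l \<in> L. l + w \<in> fund b}"
      proof (intro image_subsetI CollectI conjI)
        fix r assume r: "r \<in> R"
        show "r - l r \<in> L" using l[OF r] L'(2) R r cl(3) by blast
        show "r - l r + w \<in> fund b" using l[OF r] by (simp add: algebra_simps)
      qed
      ultimately show ?thesis using card_inj_on_le cb(3)[OF w] by blast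
    qed
    then have "ennreal (real (card R) * covolume V ip L) \<le> ennreal (covolume V ip L')"
      using cb(2)[of "card R"] v(1) by simp
    then show ?thesis using v by simp
  qed
  show "covolume V ip L' \<le> real (card R) * covolume V ip L"
    if cov: "\<And>x. x \<in> L \<Longrightarrow> \<exists>r\<in>R. x - r \<in> L'"
  proof -
    have "card {l \<in> L. l + w \<in> fund b} \<le> card R" if w: "w \<in> V" for w
    proof -
      obtain r where r: "\<And>x. x \<in> L \<Longrightarrow> r x \<in> R \<and> x - r x \<in> L'" using cov by metis
      have "inj_on r {l \<in> L. l + w \<in> fund b}"
      proof (rule inj_onI)
        fix x y assume xy: "x \<in> {l \<in> L. l + w \<in> fund b}" "y \<in> {l \<in> L. l + w \<in> fund b}" "r x = r y"
        then have "(x - r x) - (y - r y) \<in> L'" using r cl'(3) by blast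
        then have 1: "x - y \<in> L'" using xy(3) by simp
        have 2: "x + w - (x - y) \<in> fund b" "x + w - 0 \<in> fund b" using xy by (auto simp: algebra_simps)
        have "x + w \<in> V" using xy cl(5) w by auto
        then have "x - y = 0" using fund_covers[OF b(1), of "x + w"] 1 2 b(2) cl'(1) by blast
        then show "x = y" by simp
      qed
      moreover have "r ` {l \<in> L. l + w \<in> fund b} \<subseteq> R" using r by auto
      ultimately show ?thesis using card_inj_on_le R(1) by blast
    qed
    then have "ennreal (covolume V ip L') \<le> ennreal (real (card R) * covolume V ip L)"
      using cb(1)[of "card R"] v(1) by simp
    then show ?thesis using v by (simp add: ennreal_le_iff)
  qed
qed

lemma covolume_sublattice:
  assumes "is_lattice V L" "is_lattice V L'" "L' \<subseteq> L"
  shows "covolume V ip L \<le> covolume V ip L'"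
  using covolume_separated[OF assms, of "{0}"] lattice_closed(1)[OF assms(1)] by simp

text \<open>A maximal set of pairwise incongruent elements represents all classes, and its size is bounded by the
  quotient of the covolumes.\<close>
lemma finite_representatives:
  assumes L: "is_lattice V L" and L': "is_lattice V L'" "L' \<subseteq> L"
  obtains R where "finite R" "R \<subseteq> L" "\<And>x. x \<in> L \<Longrightarrow> \<exists>r\<in>R. x - r \<in> L'"
    "\<And>x y. x \<in> R \<Longrightarrow> y \<in> R \<Longrightarrow> x - y \<in> L' \<Longrightarrow> x = y"
proof -
  define sep where "sep R \<longleftrightarrow> finite R \<and> R \<subseteq> L \<and> (\<forall>x\<in>R. \<forall>y\<in>R. x - y \<in> L' \<longrightarrow> x = y)" for R
  have bound: "card R \<le> nat \<lceil>covolume V ip L' / covolume V ip L\<rceil>" if "sep R" for R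
  proof -
    have "real (card R) * covolume V ip L \<le> covolume V ip L'"
      using covolume_separated[OF L L', of R] that by (auto simp: sep_def)
    then have "real (card R) \<le> covolume V ip L' / covolume V ip L"
      using covolume_pos[OF L] by (simp add: field_simps)
    then show ?thesis by linarith
  qed
  have "sep {}" by (simp add: sep_def)
  then obtain R where R: "sep R" "\<And>R'. sep R' \<Longrightarrow> card R' \<le> card R"
    using ex_has_greatest_nat[of sep "{}" card] bound by (metis le_imp_less_Suc)
  have "\<exists>r\<in>R. x - r \<in> L'" if x: "x \<in> L" for x
  proof (rule ccontr)
    assume no: "\<not> ?thesis"
    then have "x \<notin> R" using lattice_closed(1)[OF L'(1)] by auto
    have "r - x \<notin> L'" if "r \<in> R" for r
      using no that lattice_closed(4)[OF L'(1), of "r - x"] by auto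
    then have "sep (insert x R)" using R(1) x no by (auto simp: sep_def)
    then show False using R(2)[of "insert x R"] R(1) \<open>x \<notin> R\<close> by (auto simp: sep_def)
  qed
  then show ?thesis using that R(1) by (auto simp: sep_def)
qed

text \<open>Pigeonhole: among infinitely many multiples of \<open>v\<close>, two lie in one of the
  finitely many classes modulo \<open>L'\<close>.\<close>

lemma multiple_in_sublattice:
  assumes L: "is_lattice V L" and L': "is_lattice V L'" "L' \<subseteq> L" and v: "v \<in> L"
  shows "\<exists>k\<ge>1. of_nat k *\<^sub>R v \<in> L'"
proof (rule ccontr)
  assume no: "\<not> ?thesis"
  have mult: "of_nat k *\<^sub>R v \<in> L" for k
    by (induction k) (auto simp: scaleR_add_left lattice_closed[OF L] v)
  obtain R where R: "finite R" "\<And>x. x \<in> L \<Longrightarrow> \<exists>r\<in>R. x - r \<in> L'"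
    using finite_representatives[OF L L'] by metis
  have "\<forall>k. \<exists>r. r \<in> R \<and> real k *\<^sub>R v - r \<in> L'" using R(2)[OF mult] by blast
  then obtain r where r: "\<And>k. r k \<in> R \<and> real k *\<^sub>R v - r k \<in> L'" by metis
  have "range r \<subseteq> R" using r by blast
  then have "\<not> inj r" using R(1) finite_subset[of "range r" R] finite_imageD[of r UNIV] by auto
  then obtain i j :: nat where ij: "r i = r j" "i < j" by (metis injI linorder_neqE_nat)
  have "(of_nat j *\<^sub>R v - r j) - (of_nat i *\<^sub>R v - r i) \<in> L'" using r lattice_closed(3)[OF L'(1)] by blast
  then have "of_nat (j - i) *\<^sub>R v \<in> L'" using ij by (simp add: of_nat_diff scaleR_diff_left)
  then show False using no ij by (metis One_nat_def Suc_leI zero_less_diff)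
qed

text \<open>Minkowski's argument for a cube: a volume \<open>s ^ N\<close> above the covolume forces
  some translate of \<open>L\<close> to have two points in the cube \<open>A\<close>, and their
  difference has all coordinates at most \<open>s\<close> in absolute value.\<close>

lemma short_vector:
  assumes L: "is_lattice V L" and s: "s > 0" "s ^ N > covolume V ip L"
  shows "\<exists>v\<in>L. v \<noteq> 0 \<and> ip v v \<le> real N * s\<^sup>2"
proof (rule ccontr)
  assume no: "\<not> ?thesis"
  define A where "A = {x \<in> V. \<forall>i<N. 0 \<le> ip x (e i) \<and> ip x (e i) < s}"
  have small: "ip x x \<le> real N * s\<^sup>2" if "x \<in> V" "\<And>i. i < N \<Longrightarrow> \<bar>ip x (e i)\<bar> \<le> s" for x
  proof -
    have "ip x x = (\<Sum>i<N. (ip x (e i))\<^sup>2)" using parseval[OF that(1), of x] by (simp add: power2_eq_square)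
    also have "\<dots> \<le> (\<Sum>i<N. s\<^sup>2)"
      using that(2) s(1) by (intro sum_mono) (metis abs_le_square_iff abs_of_pos lessThan_iff)
    finally show ?thesis by simp
  qed
  have A: "\<forall>x\<in>A. x \<in> V \<and> ip x x \<le> real N * s\<^sup>2"
  proof
    fix x assume "x \<in> A"
    then have "x \<in> V" "\<And>i. i < N \<Longrightarrow> \<bar>ip x (e i)\<bar> \<le> s" by (auto simp: A_def abs_if)
    then show "x \<in> V \<and> ip x x \<le> real N * s\<^sup>2" using small by blast
  qed
  have preA: "pre A = Pi\<^sub>E {..<N} (\<lambda>_. {0..<s})"
  proof (intro Set.set_eqI)
    fix c show "c \<in> pre A \<longleftrightarrow> c \<in> Pi\<^sub>E {..<N} (\<lambda>_. {0..<s})"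
      unfolding pre_def A_def PiE_iff by (auto simp: ip_comb_e)
  qed
  have mA: "mble A" unfolding mble_def preA M_def by (intro sets_PiM_I_finite) auto
  have "vol A = (\<Prod>i<N. emeasure lborel {0..<s})"
    unfolding vol_def preA M_def by (intro lborel_product.emeasure_PiM) auto
  also have "\<dots> = ennreal (s ^ N)" using s(1) by (simp add: ennreal_power)
  finally have vA: "vol A = ennreal (s ^ N)" .
  have "card {l \<in> L. l + w \<in> A} \<le> 1" if w: "w \<in> V" for w
  proof -
    have "x = y" if xy: "x \<in> L" "y \<in> L" "x + w \<in> A" "y + w \<in> A" for x y
    proof (rule ccontr)
      assume "x \<noteq> y"
      have "ip (x - y) (x - y) \<le> real N * s\<^sup>2"
      proof (rule small)
        show "x - y \<in> V" using xy lattice_closed(5)[OF L] by auto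
        fix i assume i: "i < N"
        then have "0 \<le> ip (x + w) (e i)" "ip (x + w) (e i) < s" "0 \<le> ip (y + w) (e i)" "ip (y + w) (e i) < s"
          using xy by (auto simp: A_def)
        moreover have "ip (x - y) (e i) = ip (x + w) (e i) - ip (y + w) (e i)" by (simp add: ip_linear)
        ultimately show "\<bar>ip (x - y) (e i)\<bar> \<le> s" by linarith
      qed
      moreover have "x - y \<in> L" "x - y \<noteq> 0" using xy lattice_closed(3)[OF L] \<open>x \<noteq> y\<close> by auto
      ultimately show False using no by blast
    qed
    then show ?thesis using lattice_count_bounds(3)[OF L A mA w] by (auto simp: card_le_Suc0_iff_eq)
  qed
  then have "ennreal (s ^ N) \<le> ennreal (1 * covolume V ip L)"
    using lattice_count_bounds(1)[OF L A mA, of 1] vA by simp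
  then show False using s covolume_pos[OF L] by (simp add: ennreal_le_iff)
qed

text \<open>Every translate of \<open>L\<close> has a point within distance \<open>t\<close> of the
  origin and carries a copy of \<open>F\<close> around it. That copy lies in the ball of radius
  \<open>r + t\<close>, so each translate has at least \<open>card F\<close> points there.\<close>

lemma card_ball_points:
  assumes L: "is_lattice V L" and F: "F \<subseteq> L" "\<And>x. x \<in> F \<Longrightarrow> ip x x \<le> r\<^sup>2"
    and cov: "\<And>y. y \<in> V \<Longrightarrow> \<exists>l\<in>L. ip (y - l) (y - l) \<le> t\<^sup>2" and rt: "r > 0" "t \<ge> 0"
  shows "real (card F) * covolume V ip L \<le> unit_ball_vol N * (r + t) ^ N"
proof -
  define A where "A = {x \<in> V. ip x x \<le> (r + t)\<^sup>2}"
  have A: "\<forall>x\<in>A. x \<in> V \<and> ip x x \<le> (r + t)\<^sup>2" by (simp add: A_def)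
  have mA: "mble A" and vA: "vol A = ennreal (unit_ball_vol N * (r + t) ^ N)"
    unfolding A_def using vol_ball[of "r + t"] rt by auto
  have "card F \<le> card {l \<in> L. l + w \<in> A}" if w: "w \<in> V" for w
  proof -
    obtain l where l: "l \<in> L" "ip (- w - l) (- w - l) \<le> t\<^sup>2" using cov[of "- w"] w by auto
    have lV: "l \<in> V" using l lattice_closed(5)[OF L] by blast
    have "(\<lambda>z. z + l) ` F \<subseteq> {x \<in> L. x + w \<in> A}"
    proof (intro image_subsetI CollectI conjI)
      fix z assume z: "z \<in> F"
      then show "z + l \<in> L" using F l lattice_closed(2)[OF L] by blast
      have zV: "z \<in> V" using z F lattice_closed(5)[OF L] by blast
      have "ip (w + l) (w + l) \<le> t\<^sup>2"
      proof -
        have "w + l = - (- w - l)" by simp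
        then show ?thesis using l(2) by (metis ip_minus_left ip_minus_right minus_minus)
      qed
      then have zw: "ip (z + (w + l)) (z + (w + l)) \<le> (r + t)\<^sup>2"
        using norm_triangle[OF zV, of "w + l" r t] F(2)[OF z] w lV rt by auto
      have eq: "z + l + w = z + (w + l)" by (simp add: algebra_simps)
      show "z + l + w \<in> A" unfolding A_def eq using zw zV w lV by auto
    qed
    moreover have "inj_on (\<lambda>z. z + l) F" by (auto simp: inj_on_def)
    ultimately show ?thesis using card_inj_on_le lattice_count_bounds(3)[OF L A mA w] by blast
  qed
  then have "ennreal (real (card F) * covolume V ip L) \<le> ennreal (unit_ball_vol N * (r + t) ^ N)"
    using lattice_count_bounds(2)[OF L A mA, of "card F"] vA by simp
  then show ?thesis using rt by (simp add: ennreal_le_iff)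
qed

section \<open>Balls, dual lattices, isometries and covering radii\<close>

lemma volume_ball:
  assumes "r > 0"
  shows "volume V ip {x \<in> V. ip_norm ip x \<le> r} = unit_ball_vol N * r ^ N"
proof -
  have "ip_norm ip x \<le> r \<longleftrightarrow> ip x x \<le> r\<^sup>2" for x
    unfolding ip_norm_def using assms by (metis less_eq_real_def real_sqrt_le_iff real_sqrt_unique)
  then have "{x \<in> V. ip_norm ip x \<le> r} = {x \<in> V. ip x x \<le> r\<^sup>2}" by simp
  then show ?thesis
    using volume_eq[OF vol_ball(1)[OF assms]] vol_ball(2)[OF assms] assms by (simp add: vol_def measure_def)
qed

lemma dual_lattice_lat:
  assumes "dual_pair b b'"
  shows "dual_lattice V ip (lat b) = lat b'"
proof (intro subset_antisym subsetI)
  fix x assume x: "x \<in> dual_lattice V ip (lat b)"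
  then have "\<forall>i<N. ip x (b i) \<in> \<int>" using lat_closed(5)[OF assms] by (auto simp: dual_lattice_def)
  then show "x \<in> lat b'" using x lat_alt[OF dual_pair_sym[OF assms]] by (auto simp: dual_lattice_def)
next
  fix x assume x: "x \<in> lat b'"
  then have *: "x \<in> V" "\<And>i. i < N \<Longrightarrow> ip x (b i) \<in> \<int>" using lat_alt[OF dual_pair_sym[OF assms]] by auto
  show "x \<in> dual_lattice V ip (lat b)"
    unfolding dual_lattice_def
  proof (intro CollectI conjI ballI)
    fix y assume "y \<in> lat b"
    then obtain c where "y = (\<Sum>i<N. real_of_int (c i) *\<^sub>R b i)" by (auto simp: lat_def)
    then have "ip x y = (\<Sum>i<N. real_of_int (c i) * ip x (b i))" by (simp add: ip_sum_right ip_scale_right)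
    then show "ip x y \<in> \<int>" using *(2) by (auto intro!: Ints_sum Ints_mult)
  qed (use * in simp)
qed

lemma dual_lattice_facts:
  assumes "is_lattice V L"
  shows "is_lattice V (dual_lattice V ip L)" "dual_lattice V ip (dual_lattice V ip L) = L"
    "covolume V ip (dual_lattice V ip L) * covolume V ip L = 1"
proof -
  obtain b b' where b: "dual_pair b b'" "L = lat b" using assms is_lattice_iff by blast
  show "is_lattice V (dual_lattice V ip L)" "dual_lattice V ip (dual_lattice V ip L) = L"
    using dual_lattice_lat[OF b(1)] dual_lattice_lat[OF dual_pair_sym[OF b(1)]] b is_lattice_iff
      dual_pair_sym[OF b(1)] by auto
  show "covolume V ip (dual_lattice V ip L) * covolume V ip L = 1"
    unfolding b(2) dual_lattice_lat[OF b(1)] covolume_lat(1)[OF b(1)] covolume_lat(1)[OF dual_pair_sym[OF b(1)]]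
    using gram_det(4)[OF b(1)] by (simp add: real_sqrt_mult[symmetric] mult.commute)
qed

lemma isometry_lattice:
  assumes L: "is_lattice V L" and s: "linear_isometry V ip s"
  shows "is_lattice V (s ` L)" "covolume V ip (s ` L) = covolume V ip L"
proof -
  obtain b b' where b: "dual_pair b b'" "L = lat b" using L is_lattice_iff by blast
  have s_in: "s x \<in> V" if "x \<in> V" for x using s that by (auto simp: linear_isometry_def bij_betw_def)
  have s_add: "s (x + y) = s x + s y" if "x \<in> V" "y \<in> V" for x y using s that by (auto simp: linear_isometry_def)
  have s_scale: "s (r *\<^sub>R x) = r *\<^sub>R s x" if "x \<in> V" for r x using s that by (auto simp: linear_isometry_def)
  have s_ip: "ip (s x) (s y) = ip x y" if "x \<in> V" "y \<in> V" for x y using s that by (auto simp: linear_isometry_def)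
  have s0: "s 0 = 0" using s_scale[of 0 0] by simp
  have s_sum: "s (\<Sum>i\<in>I. f i) = (\<Sum>i\<in>I. s (f i))" if "finite I" "\<And>i. i \<in> I \<Longrightarrow> f i \<in> V" for I and f :: "nat \<Rightarrow> 'v"
    using that by (induction I rule: finite_induct) (auto simp: s0 s_add V_sum)
  have p: "dual_pair (\<lambda>i. s (b i)) (\<lambda>i. s (b' i))"
    using dual_pairD[OF b(1)] s_in s_ip by (auto simp: dual_pair_def)
  have im: "s ` L = lat (\<lambda>i. s (b i))"
  proof -
    have "s (\<Sum>i<N. real_of_int (c i) *\<^sub>R b i) = (\<Sum>i<N. real_of_int (c i) *\<^sub>R s (b i))" for c :: "nat \<Rightarrow> int"
      using dual_pairD(1)[OF b(1)] by (subst s_sum) (auto simp: s_scale)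
    then show ?thesis unfolding b(2) lat_def by (auto simp: image_image)
  qed
  show "is_lattice V (s ` L)" using p im is_lattice_iff by blast
  have "gram (\<lambda>i. s (b i)) = gram b" unfolding gram_def using s_ip dual_pairD(1)[OF b(1)] by (intro eq_matI) auto
  then show "covolume V ip (s ` L) = covolume V ip L"
    using covolume_lat(1)[OF p] covolume_lat(1)[OF b(1)] im b(2) by simp
qed

text \<open>Rounding the coefficients one by one, up or down; a random choice with mean zero shows that
  each step can be done at a cost of at most \<open>|v i|\<^sup>2 / 4\<close>.\<close>
lemma integer_rounding:
  fixes v :: "nat \<Rightarrow> 'v" and t :: "nat \<Rightarrow> real"
  assumes "\<And>i. i < k \<Longrightarrow> v i \<in> V"
  shows "\<exists>c::nat \<Rightarrow> int. ip (\<Sum>i<k. (t i - real_of_int (c i)) *\<^sub>R v i) (\<Sum>i<k. (t i - real_of_int (c i)) *\<^sub>R v i)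
     \<le> (\<Sum>i<k. ip (v i) (v i)) / 4"
  using assms
proof (induction k)
  case (Suc k)
  then obtain c :: "nat \<Rightarrow> int" where c: "ip (\<Sum>i<k. (t i - real_of_int (c i)) *\<^sub>R v i) (\<Sum>i<k. (t i - real_of_int (c i)) *\<^sub>R v i)
     \<le> (\<Sum>i<k. ip (v i) (v i)) / 4" by auto
  define w where "w = (\<Sum>i<k. (t i - real_of_int (c i)) *\<^sub>R v i)"
  define f where "f = t k - real_of_int \<lfloor>t k\<rfloor>"
  have f: "0 \<le> f" "f < 1" unfolding f_def by linarith+
  define q where "q \<epsilon> = ip (w + \<epsilon> *\<^sub>R v k) (w + \<epsilon> *\<^sub>R v k)" for \<epsilon>
  have q: "q \<epsilon> = ip w w + 2 * \<epsilon> * ip w (v k) + \<epsilon>\<^sup>2 * ip (v k) (v k)" for \<epsilon>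
    unfolding q_def using ip_commute[of "v k" w] by (simp add: ip_linear algebra_simps power2_eq_square)
  \<comment> \<open>The weights \<open>1 - f\<close> and \<open>f\<close> give the two errors
    \<open>f\<close> and \<open>f - 1\<close> mean zero, so the linear term of \<open>q\<close>
    drops out and only the variance \<open>f * (1 - f)\<close> remains.\<close>
  have "(1 - f) * q f + f * q (f - 1) = ip w w + f * (1 - f) * ip (v k) (v k)"
    unfolding q by (simp add: algebra_simps power2_eq_square)
  also have "\<dots> \<le> ip w w + 1 / 4 * ip (v k) (v k)"
  proof -
    have "f * (1 - f) \<le> 1 / 4" using zero_le_power2[of "f - 1/2"] by (simp add: power2_eq_square algebra_simps)
    then show ?thesis using ip_nonneg[of "v k"] Suc.prems by (intro add_left_mono mult_right_mono) auto
  qed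
  finally have "(1 - f) * q f + f * q (f - 1) \<le> ip w w + ip (v k) (v k) / 4" (is "_ \<le> ?r") by simp
  then have "q f \<le> ?r \<or> q (f - 1) \<le> ?r"
  proof -
    have False if "?r < q f" "?r < q (f - 1)"
    proof -
      have "(1 - f) * ?r + f * ?r < (1 - f) * q f + f * q (f - 1)"
      proof (cases "f = 0")
        case False
        then show ?thesis using that f by (intro add_less_le_mono mult_strict_left_mono mult_left_mono) auto
      qed (use that in auto)
      moreover have "(1 - f) * ?r + f * ?r = ?r" using distrib_right[of "1 - f" f ?r] by simp
      ultimately show False using \<open>(1 - f) * q f + f * q (f - 1) \<le> ?r\<close> by linarith
    qed
    then show ?thesis using not_le_imp_less by blast
  qed
  then obtain z :: int where z: "q (t k - real_of_int z) \<le> ?r"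
    by (metis f_def diff_diff_eq of_int_1 of_int_add)
  have "(\<Sum>i<Suc k. (t i - real_of_int ((c(k := z)) i)) *\<^sub>R v i) = w + (t k - real_of_int z) *\<^sub>R v k"
    by (simp add: w_def)
  then show ?case using z c by (intro exI[of _ "c(k := z)"]) (simp add: q_def w_def)
qed simp

text \<open>Round the coefficients of \<open>y\<close> with respect to \<open>v\<close>. The vectors
  only have to span \<open>V\<close> and may generate a proper sublattice, which leaves the freedom
  to take vectors of equal length.\<close>

lemma covering_radius:
  assumes L: "is_lattice V L" and v: "\<And>i. i < N \<Longrightarrow> v i \<in> L" "Real_Vector_Spaces.span (v ` {..<N}) = V"
    and y: "y \<in> V" and bound: "\<And>i. i < N \<Longrightarrow> ip (v i) (v i) \<le> r"
  shows "\<exists>l\<in>L. ip (y - l) (y - l) \<le> real N * r / 4"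
proof -
  note cl = lattice_closed[OF L]
  have vV: "v i \<in> V" if "i < N" for i using v(1)[OF that] cl(5) by blast
  then obtain v' where v': "dual_pair v v'" using spanning_dual_pair[OF _ v(2)] by auto
  obtain c :: "nat \<Rightarrow> int" where
    c: "ip (\<Sum>i<N. (ip y (v' i) - real_of_int (c i)) *\<^sub>R v i) (\<Sum>i<N. (ip y (v' i) - real_of_int (c i)) *\<^sub>R v i)
     \<le> (\<Sum>i<N. ip (v i) (v i)) / 4"
    using integer_rounding[of N v "\<lambda>i. ip y (v' i)", OF vV] by blast
  define l where "l = (\<Sum>i<N. real_of_int (c i) *\<^sub>R v i)"
  have natmul: "real k *\<^sub>R x \<in> L" if "x \<in> L" for k x
    by (induction k) (auto simp: scaleR_add_left cl that)
  have intmul: "real_of_int k *\<^sub>R x \<in> L" if "x \<in> L" for k x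
    using natmul[OF that] cl(4)[OF natmul[OF that]] by (cases k rule: int_cases2) auto
  have "(\<Sum>i<k. real_of_int (c i) *\<^sub>R v i) \<in> L" if "k \<le> N" for k
    using that by (induction k) (auto simp: cl v(1) intmul)
  then have "l \<in> L" unfolding l_def by blast
  moreover have "y - l = (\<Sum>i<N. (ip y (v' i) - real_of_int (c i)) *\<^sub>R v i)"
  proof -
    have "y - l = (\<Sum>i<N. ip y (v' i) *\<^sub>R v i) - l" using expand_dual[OF v' y] by simp
    then show ?thesis by (simp add: l_def scaleR_diff_left sum_subtractf)
  qed
  moreover have "(\<Sum>i<N. ip (v i) (v i)) \<le> real N * r"
    using sum_bounded_above[of "{..<N}" "\<lambda>i. ip (v i) (v i)" r] bound by simp
  ultimately show ?thesis using c by (intro bexI[of _ l]) auto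
qed

text \<open>Points in one cell of a grid of mesh \<open>1 / m\<close> have squared distance at most
  \<open>N / m^2\<close>, which is below \<open>\<epsilon>\<close>, and a bounded region meets
  finitely many cells.\<close>

lemma finite_discrete_bounded:
  assumes S: "S \<subseteq> V" "\<epsilon> > 0" "\<And>x y. x \<in> S \<Longrightarrow> y \<in> S \<Longrightarrow> x \<noteq> y \<Longrightarrow> ip (x - y) (x - y) \<ge> \<epsilon>"
    and R: "\<And>x. x \<in> S \<Longrightarrow> ip x x \<le> R"
  shows "finite S"
proof -
  obtain K :: nat where K: "real N / \<epsilon> < real K" using reals_Archimedean2 by blast
  define m where "m = Suc K"
  have m: "real N < \<epsilon> * (real m)\<^sup>2" "m \<ge> 1"
  proof -
    have "real N < \<epsilon> * real m" using K S(2) by (simp add: m_def field_simps)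
    also have "\<dots> \<le> \<epsilon> * (real m)\<^sup>2" using S(2) by (simp add: m_def power2_eq_square)
    finally show "real N < \<epsilon> * (real m)\<^sup>2" .
  qed (simp add: m_def)
  define g where "g x = (\<lambda>i\<in>{..<N}. \<lfloor>real m * ip x (e i)\<rfloor>)" for x
  have "inj_on g S"
  proof (rule inj_onI, rule ccontr)
    fix x y assume xy: "x \<in> S" "y \<in> S" "g x = g y" "x \<noteq> y"
    have xyV: "x - y \<in> V" using xy S(1) by auto
    have "(ip (x - y) (e i))\<^sup>2 \<le> 1 / (real m)\<^sup>2" if "i < N" for i
    proof -
      have "\<lfloor>real m * ip x (e i)\<rfloor> = \<lfloor>real m * ip y (e i)\<rfloor>"
        using fun_cong[OF xy(3), of i] that by (simp add: g_def)
      then have "\<bar>real m * ip x (e i) - real m * ip y (e i)\<bar> \<le> 1" by linarith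
      then have "\<bar>real m * ip (x - y) (e i)\<bar> \<le> 1" by (simp add: ip_diff_left algebra_simps)
      then have "(real m * ip (x - y) (e i))\<^sup>2 \<le> 1" by (simp add: abs_square_le_1)
      then show ?thesis using m(2) by (simp add: power_mult_distrib field_simps)
    qed
    then have "(\<Sum>i<N. (ip (x - y) (e i))\<^sup>2) \<le> real N * (1 / (real m)\<^sup>2)"
      using sum_bounded_above[of "{..<N}" "\<lambda>i. (ip (x - y) (e i))\<^sup>2" "1 / (real m)\<^sup>2"] by simp
    then have "ip (x - y) (x - y) \<le> real N / (real m)\<^sup>2"
      using parseval[OF xyV, of "x - y"] by (simp add: power2_eq_square)
    also have "\<dots> < \<epsilon>" using m by (simp add: field_simps)
    finally show False using S(3)[OF xy(1,2,4)] by simp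
  qed
  have "\<forall>i. \<exists>K. i < N \<longrightarrow> (\<forall>x\<in>S. \<bar>ip x (e i)\<bar> \<le> K)"
    using ip_bounded[of S R] S(1) R by (metis e_in_V subsetD)
  then obtain K where K: "\<And>i x. i < N \<Longrightarrow> x \<in> S \<Longrightarrow> \<bar>ip x (e i)\<bar> \<le> K i" by metis
  have "g ` S \<subseteq> Pi\<^sub>E {..<N} (\<lambda>i. {\<lfloor>real m * - K i\<rfloor>..\<lfloor>real m * K i\<rfloor>})"
  proof (intro image_subsetI)
    fix x assume x: "x \<in> S"
    have "\<lfloor>real m * - K i\<rfloor> \<le> \<lfloor>real m * ip x (e i)\<rfloor> \<and> \<lfloor>real m * ip x (e i)\<rfloor> \<le> \<lfloor>real m * K i\<rfloor>" if "i < N" for i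
      using K[OF that x] by (intro conjI floor_mono mult_left_mono) (auto simp: abs_le_iff)
    then show "g x \<in> Pi\<^sub>E {..<N} (\<lambda>i. {\<lfloor>real m * - K i\<rfloor>..\<lfloor>real m * K i\<rfloor>})" by (auto simp: g_def)
  qed
  then have "finite (g ` S)" by (rule finite_subset) (intro finite_PiE, auto)
  then show ?thesis using \<open>inj_on g S\<close> finite_imageD by blast
qed

lemma ip_dual_partial_sum:
  assumes "dual_pair b b'" "j < N" "k \<le> N"
  shows "ip (\<Sum>i<k. c i *\<^sub>R b i) (b' j) = (if j < k then c j else 0)"
proof -
  have "ip (\<Sum>i<k. c i *\<^sub>R b i) (b' j) = (\<Sum>i<k. if i = j then c i else 0)"
    unfolding ip_sum_left ip_scale_left
  proof (intro sum.cong refl)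
    fix i assume "i \<in> {..<k}"
    then show "c i * ip (b i) (b' j) = (if i = j then c i else 0)"
      using dual_pairD(3)[OF assms(1), of i j] assms(2,3) by simp
  qed
  then show ?thesis by simp
qed

text \<open>A triangular basis along the flag of independent vectors \<open>v\<close> of
  \<open>L\<close>: \<open>Lk k\<close> is the part of \<open>L\<close> in the span of the first
  \<open>k\<close> of them, and the next basis vector is one with the least positive coordinate at
  \<open>v k\<close>. Discreteness makes this minimum exist.\<close>

lemma discrete_subgroup_is_lattice:
  assumes L: "L \<subseteq> V" "0 \<in> L" "\<And>x y. x \<in> L \<Longrightarrow> y \<in> L \<Longrightarrow> x - y \<in> L"
    and \<epsilon>: "\<epsilon> > 0" "\<And>x. x \<in> L \<Longrightarrow> x \<noteq> 0 \<Longrightarrow> ip x x \<ge> \<epsilon>"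
    and span: "Real_Vector_Spaces.span L = V"
  shows "is_lattice V L"
proof -
  have neg: "- x \<in> L" if "x \<in> L" for x using L(3)[OF L(2) that] by simp
  have add: "x + y \<in> L" if "x \<in> L" "y \<in> L" for x y using L(3)[OF that(1) neg[OF that(2)]] by simp
  have natmul: "real k *\<^sub>R x \<in> L" if "x \<in> L" for k x
    by (induction k) (auto simp: scaleR_add_left L(2) add that)
  have intmul: "real_of_int k *\<^sub>R x \<in> L" if "x \<in> L" for k x
    using natmul[OF that] neg[OF natmul[OF that]] by (cases k rule: int_cases2) auto
  have Lsum: "(\<Sum>i\<in>I. f i) \<in> L" if "\<And>i. i \<in> I \<Longrightarrow> f i \<in> L" for I and f :: "nat \<Rightarrow> 'v"
    using that by (induction I rule: infinite_finite_induct) (auto simp: L(2) add)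
  obtain B where B: "B \<subseteq> L" "\<not> Real_Vector_Spaces.dependent B" "L \<subseteq> Real_Vector_Spaces.span B"
    using real_vector.maximal_independent_subset by blast
  have spB: "Real_Vector_Spaces.span B = V"
    using span real_vector.span_mono[OF B(1)] real_vector.span_minimal[OF B(3) real_vector.subspace_span] by auto
  have "finite B"
    using real_vector.independent_span_bound[OF _ B(2), of E] orthonormal_basis_E spB real_vector.span_superset[of B]
    by (auto simp: orthonormal_basis_def)
  moreover have "card B = N"
    using real_vector.dim_span_eq_card_independent[OF B(2)] spB dim_V by simp
  ultimately obtain v where v: "bij_betw v {..<N} B"
    using ex_bij_betw_nat_finite[of B] by (auto simp: atLeast0LessThan)
  then have vim: "v ` {..<N} = B" by (simp add: bij_betw_def)
  then have vL: "v i \<in> L" if "i < N" for i using that B(1) by auto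
  obtain v' where v': "dual_pair v v'"
    using spanning_dual_pair[of v] vim spB B(1) L(1) by auto
  define Lk where "Lk k = {x \<in> L. \<forall>i<N. k \<le> i \<longrightarrow> ip x (v' i) = 0}" for k
  have "\<exists>w. (\<forall>i<k. w i \<in> L \<and> ip (w i) (v' i) > 0 \<and> (\<forall>j<N. j > i \<longrightarrow> ip (w i) (v' j) = 0)) \<and>
      (\<forall>x\<in>Lk k. \<exists>c::nat \<Rightarrow> int. x = (\<Sum>i<k. real_of_int (c i) *\<^sub>R w i))" if "k \<le> N" for k
    using that
  proof (induction k)
    case 0
    have "x = 0" if "x \<in> Lk 0" for x
      using expand_dual[OF v', of x] that L(1) by (auto simp: Lk_def)
    then show ?case by simp
  next
    case (Suc k)
    then obtain w where W: "\<forall>i<k. w i \<in> L \<and> ip (w i) (v' i) > 0 \<and> (\<forall>j<N. j > i \<longrightarrow> ip (w i) (v' j) = 0)"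
      "\<forall>x\<in>Lk k. \<exists>c::nat \<Rightarrow> int. x = (\<Sum>i<k. real_of_int (c i) *\<^sub>R w i)"
      using Suc_leD by blast
    have w: "w i \<in> L" "ip (w i) (v' i) > 0" "\<And>j. j < N \<Longrightarrow> j > i \<Longrightarrow> ip (w i) (v' j) = 0" if "i < k" for i
      using W(1) that by blast+
    have k: "k < N" using Suc by simp
    \<comment> \<open>The candidates for the next basis vector, confined to a box so that
      discreteness makes the set finite; \<open>v k\<close> is one of them.\<close>
    define T where "T = {x \<in> Lk (Suc k). (\<forall>i<k. 0 \<le> ip x (v' i) \<and> ip x (v' i) \<le> 1) \<and> 0 < ip x (v' k) \<and> ip x (v' k) \<le> 1}"
    have "finite T"
    proof (rule finite_discrete_bounded[OF _ \<epsilon>(1)])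
      show "T \<subseteq> V" using L(1) by (auto simp: T_def Lk_def)
      fix x assume x: "x \<in> T"
      have xi: "\<forall>i<k. 0 \<le> ip x (v' i) \<and> ip x (v' i) \<le> 1" "0 < ip x (v' k)" "ip x (v' k) \<le> 1"
        "\<forall>i<N. Suc k \<le> i \<longrightarrow> ip x (v' i) = 0"
        using x unfolding T_def Lk_def by blast+
      have c: "0 \<le> ip x (v' i) \<and> ip x (v' i) \<le> 1" if "i < N" for i
        using xi that by (cases i k rule: linorder_cases) auto
      have xV: "x \<in> V" using x L(1) by (auto simp: T_def Lk_def)
      have "ip x x = (\<Sum>i<N. \<Sum>j<N. ip x (v' i) * ip x (v' j) * ip (v i) (v j))"
        using ip_double_sum[of "\<lambda>i. ip x (v' i)" v "{..<N}" "\<lambda>i. ip x (v' i)" v "{..<N}"]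
          expand_dual[OF v' xV] by simp
      also have "\<dots> \<le> (\<Sum>i<N. \<Sum>j<N. \<bar>ip (v i) (v j)\<bar>)"
      proof (intro sum_mono)
        fix i j assume ij: "i \<in> {..<N}" "j \<in> {..<N}"
        have "\<bar>ip x (v' i) * ip x (v' j) * ip (v i) (v j)\<bar> \<le> 1 * \<bar>ip (v i) (v j)\<bar>"
          unfolding abs_mult using c[of i] c[of j] ij by (intro mult_right_mono mult_le_one) auto
        then show "ip x (v' i) * ip x (v' j) * ip (v i) (v j) \<le> \<bar>ip (v i) (v j)\<bar>" by linarith
      qed
      finally show "ip x x \<le> (\<Sum>i<N. \<Sum>j<N. \<bar>ip (v i) (v j)\<bar>)" .
    qed (use \<epsilon>(2) L(3) in \<open>auto simp: T_def Lk_def\<close>)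
    moreover have "v k \<in> T"
      using dual_pairD(3)[OF v'] vL k by (auto simp: T_def Lk_def)
    ultimately obtain z where z: "z \<in> T" "\<And>y. y \<in> T \<Longrightarrow> ip z (v' k) \<le> ip y (v' k)"
      using ex_is_arg_min_if_finite[of T "\<lambda>y. ip y (v' k)"] unfolding is_arg_min_linorder by blast
    define \<delta> where "\<delta> = ip z (v' k)"
    have \<delta>: "\<delta> > 0" using z by (simp add: \<delta>_def T_def)
    define w' where "w' = w(k := z)"
    have "\<exists>c::nat \<Rightarrow> int. x = (\<Sum>i<Suc k. real_of_int (c i) *\<^sub>R w' i)" if x: "x \<in> Lk (Suc k)" for x
    proof -
      define a where "a = \<lfloor>ip x (v' k) / \<delta>\<rfloor>"
      define y where "y = x - real_of_int a *\<^sub>R z"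
      have zL: "z \<in> Lk (Suc k)" using z by (simp add: T_def)
      have "y \<in> L" using x zL intmul[of z a] L(3) unfolding y_def Lk_def by simp
      moreover have "ip y (v' i) = 0" if "i < N" "Suc k \<le> i" for i
        using x zL that unfolding y_def Lk_def by (simp add: ip_linear)
      ultimately have yL: "y \<in> Lk (Suc k)" unfolding Lk_def by simp
      have yk: "0 \<le> ip y (v' k)" "ip y (v' k) < \<delta>"
      proof -
        have "real_of_int a \<le> ip x (v' k) / \<delta>" "ip x (v' k) / \<delta> < real_of_int a + 1" unfolding a_def by linarith+
        then have "real_of_int a * \<delta> \<le> ip x (v' k)" "ip x (v' k) < (real_of_int a + 1) * \<delta>"
          using \<delta> by (simp_all add: pos_le_divide_eq pos_divide_less_eq)
        moreover have "ip y (v' k) = ip x (v' k) - real_of_int a * \<delta>"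
          by (simp add: y_def ip_linear \<delta>_def)
        ultimately show "0 \<le> ip y (v' k)" "ip y (v' k) < \<delta>" by (simp_all add: algebra_simps)
      qed
      have "ip y (v' k) = 0"
      proof (rule ccontr)
        assume "ip y (v' k) \<noteq> 0"
        \<comment> \<open>A remainder with a smaller positive coordinate at \<open>v k\<close>,
          brought back into the box by integer multiples of the \<open>v i\<close> with
          \<open>i < k\<close>, would contradict the minimality of \<open>z\<close>.\<close>
        define u where "u = y - (\<Sum>i<k. real_of_int \<lfloor>ip y (v' i)\<rfloor> *\<^sub>R v i)"
        have "(\<Sum>i<k. real_of_int \<lfloor>ip y (v' i)\<rfloor> *\<^sub>R v i) \<in> L"
        proof (rule Lsum)
          fix i assume "i \<in> {..<k}"
          then have "i < N" using k by simp
          then show "real_of_int \<lfloor>ip y (v' i)\<rfloor> *\<^sub>R v i \<in> L" by (rule intmul[OF vL])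
        qed
        from L(3)[OF \<open>y \<in> L\<close> this] have uL: "u \<in> L" by (simp add: u_def)
        have s: "ip (\<Sum>i<k. real_of_int \<lfloor>ip y (v' i)\<rfloor> *\<^sub>R v i) (v' j) = (if j < k then real_of_int \<lfloor>ip y (v' j)\<rfloor> else 0)"
          if "j < N" for j
          by (rule ip_dual_partial_sum[OF v' that less_imp_le[OF k]])
        have "0 \<le> ip u (v' i) \<and> ip u (v' i) \<le> 1" if "i < k" for i
        proof -
          have "ip u (v' i) = ip y (v' i) - real_of_int \<lfloor>ip y (v' i)\<rfloor>"
            using s[of i] that k by (simp add: u_def ip_diff_left)
          then show ?thesis by linarith
        qed
        moreover have uk: "ip u (v' k) = ip y (v' k)" using s[OF k] by (simp add: u_def ip_diff_left)
        moreover have "ip u (v' i) = 0" if "i < N" "Suc k \<le> i" for i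
          using s[OF that(1)] yL that by (simp add: u_def ip_diff_left Lk_def)
        moreover have "\<delta> \<le> 1" using z(1) by (simp add: \<delta>_def T_def)
        ultimately have "u \<in> T" using uL yk \<open>ip y (v' k) \<noteq> 0\<close> by (auto simp: T_def Lk_def)
        then show False using z(2)[of u] uk yk by (simp add: \<delta>_def)
      qed
      then have "y \<in> Lk k" using yL by (auto simp: Lk_def le_less Suc_le_eq)
      then obtain c :: "nat \<Rightarrow> int" where c: "y = (\<Sum>i<k. real_of_int (c i) *\<^sub>R w i)" using W(2) by blast
      have "x = (\<Sum>i<Suc k. real_of_int ((c(k := a)) i) *\<^sub>R w' i)"
        using c by (simp add: y_def w'_def algebra_simps)
      then show ?thesis by blast
    qed
    moreover have "\<forall>i<Suc k. w' i \<in> L \<and> ip (w' i) (v' i) > 0 \<and> (\<forall>j<N. j > i \<longrightarrow> ip (w' i) (v' j) = 0)"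
      using w z(1) by (auto simp: w'_def T_def Lk_def less_Suc_eq)
    ultimately show ?case by blast
  qed
  from this[of N] obtain w where W: "\<forall>i<N. w i \<in> L \<and> ip (w i) (v' i) > 0 \<and> (\<forall>j<N. j > i \<longrightarrow> ip (w i) (v' j) = 0)"
    "\<forall>x\<in>Lk N. \<exists>c::nat \<Rightarrow> int. x = (\<Sum>i<N. real_of_int (c i) *\<^sub>R w i)" by blast
  have "Lk N = L" by (auto simp: Lk_def)
  with W have w: "\<And>i. i < N \<Longrightarrow> w i \<in> L"
    "\<And>x. x \<in> L \<Longrightarrow> \<exists>c::nat \<Rightarrow> int. x = (\<Sum>i<N. real_of_int (c i) *\<^sub>R w i)"
    by simp_all
  have Leq: "L = lat w"
  proof (intro subset_antisym subsetI)
    fix x assume "x \<in> lat w"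
    then show "x \<in> L" using w(1) intmul by (auto simp: lat_def intro!: Lsum)
  qed (use w(2) in \<open>auto simp: lat_def\<close>)
  have "Real_Vector_Spaces.span (w ` {..<N}) = V"
  proof
    show "Real_Vector_Spaces.span (w ` {..<N}) \<subseteq> V"
      using w(1) L(1) subspace_V by (intro real_vector.span_minimal) auto
    have "L \<subseteq> Real_Vector_Spaces.span (w ` {..<N})"
    proof
      fix x assume "x \<in> L"
      then obtain c :: "nat \<Rightarrow> int" where c: "x = (\<Sum>i<N. real_of_int (c i) *\<^sub>R w i)" using w(2) by blast
      show "x \<in> Real_Vector_Spaces.span (w ` {..<N})"
        unfolding c by (intro real_vector.span_sum real_vector.span_scale real_vector.span_base) simp
    qed
    then show "V \<subseteq> Real_Vector_Spaces.span (w ` {..<N})"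
      using real_vector.span_minimal[OF _ real_vector.subspace_span] span by blast
  qed
  moreover have "w ` {..<N} \<subseteq> V" using w(1) L(1) by auto
  ultimately obtain w' where "dual_pair w w'" using spanning_dual_pair[of w] by blast
  then show ?thesis using Leq is_lattice_iff by blast
qed

lemma lattice_min_pos:
  assumes "is_lattice V L"
  shows "\<exists>\<epsilon>>0. \<forall>x\<in>L. x \<noteq> 0 \<longrightarrow> ip x x \<ge> \<epsilon>"
proof -
  define F where "F = {l \<in> L. ip l l \<le> 1} - {0}"
  have F: "finite F" unfolding F_def using finite_lattice_ball[OF assms, of 1] by simp
  define \<epsilon> where "\<epsilon> = Min (insert 1 ((\<lambda>x. ip x x) ` F))"
  have "\<epsilon> > 0" unfolding \<epsilon>_def using F ip_pos lattice_closed(5)[OF assms] by (auto simp: F_def)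
  moreover have "ip x x \<ge> \<epsilon>" if "x \<in> L" "x \<noteq> 0" for x
  proof (cases "ip x x \<le> 1")
    case True
    then have "x \<in> F" using that by (simp add: F_def)
    then show ?thesis unfolding \<epsilon>_def using F by (intro Min_le) auto
  next
    case False
    moreover have "\<epsilon> \<le> 1" unfolding \<epsilon>_def using F by (intro Min_le) auto
    ultimately show ?thesis by simp
  qed
  ultimately show ?thesis by blast
qed

lemma lattice_span: "is_lattice V L \<Longrightarrow> Real_Vector_Spaces.span L = V"
proof -
  assume L: "is_lattice V L"
  then obtain b b' where b: "dual_pair b b'" "L = lat b" using is_lattice_iff by blast
  have "b ` {..<N} \<subseteq> L" using lat_closed(5)[OF b(1)] b(2) by auto
  then have "V \<subseteq> Real_Vector_Spaces.span L"
    using real_vector.span_mono dual_pair_span[OF b(1)] by blast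
  moreover have "Real_Vector_Spaces.span L \<subseteq> V"
    using real_vector.span_minimal[OF lattice_closed(6)[OF L] subspace_V] .
  ultimately show ?thesis by blast
qed

end

section \<open>Algebraic integers\<close>

definition int_span :: "complex set \<Rightarrow> complex set" where
  "int_span W = {\<Sum>v\<in>W. of_int (c v) * v | c :: complex \<Rightarrow> int. True}"

lemma int_span_add: "x \<in> int_span W \<Longrightarrow> y \<in> int_span W \<Longrightarrow> x + y \<in> int_span W"
proof -
  assume "x \<in> int_span W" "y \<in> int_span W"
  then obtain c d :: "complex \<Rightarrow> int" where "x = (\<Sum>v\<in>W. of_int (c v) * v)" "y = (\<Sum>v\<in>W. of_int (d v) * v)"
    by (auto simp: int_span_def)
  then have "x + y = (\<Sum>v\<in>W. of_int (c v + d v) * v)" by (simp add: sum.distrib distrib_right)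
  then show ?thesis unfolding int_span_def by (intro CollectI exI[of _ "\<lambda>v. c v + d v"]) auto
qed

lemma int_span_mult_int: "x \<in> int_span W \<Longrightarrow> of_int k * x \<in> int_span W"
proof -
  assume "x \<in> int_span W"
  then obtain c :: "complex \<Rightarrow> int" where "x = (\<Sum>v\<in>W. of_int (c v) * v)" by (auto simp: int_span_def)
  then have "of_int k * x = (\<Sum>v\<in>W. of_int (k * c v) * v)" by (simp add: sum_distrib_left mult.assoc)
  then show ?thesis unfolding int_span_def by (intro CollectI exI[of _ "\<lambda>v. k * c v"]) auto
qed

lemma int_span_zero: "0 \<in> int_span W"
  unfolding int_span_def by (intro CollectI exI[of _ "\<lambda>_. 0"]) auto

lemma int_span_base: "finite W \<Longrightarrow> v \<in> W \<Longrightarrow> v \<in> int_span W"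
  unfolding int_span_def by (intro CollectI exI[of _ "\<lambda>w. if w = v then 1 else 0"]) (simp add: if_distrib[of of_int] if_distrib[of "\<lambda>x. x * _"] cong: if_cong)

lemma int_span_sum: "(\<And>i. i \<in> I \<Longrightarrow> f i \<in> int_span W) \<Longrightarrow> (\<Sum>i\<in>I. f i) \<in> int_span W"
  by (induction I rule: infinite_finite_induct) (auto intro: int_span_add int_span_zero)

text \<open>The Cayley--Hamilton argument: \<open>x\<close> is a root of the characteristic polynomial of the integer matrix
  by which it acts on generators of a finitely generated module.\<close>
lemma algebraic_int_of_module:
  assumes W: "finite W" "1 \<in> W" and act: "\<And>v. v \<in> W \<Longrightarrow> x * v \<in> int_span W"
  shows "algebraic_int x"
proof -
  define n where "n = card W"
  obtain b where b: "bij_betw b {..<n} W"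
    using ex_bij_betw_nat_finite[OF W(1)] by (auto simp: n_def atLeast0LessThan)
  have "\<forall>v\<in>W. \<exists>c::complex \<Rightarrow> int. x * v = (\<Sum>w\<in>W. of_int (c w) * w)"
    using act by (auto simp: int_span_def)
  then obtain c :: "complex \<Rightarrow> complex \<Rightarrow> int" where c: "\<And>v. v \<in> W \<Longrightarrow> x * v = (\<Sum>w\<in>W. of_int (c v w) * w)" by metis
  define A :: "int Matrix.mat" where "A = Matrix.mat n n (\<lambda>(i,j). c (b i) (b j))"
  have A: "A \<in> carrier_mat n n" by (simp add: A_def)
  define A' :: "complex Matrix.mat" where "A' = map_mat of_int A"
  have A': "A' \<in> carrier_mat n n" using A by (simp add: A'_def)
  define v where "v = Matrix.vec n b"
  have "A' *\<^sub>v v = x \<cdot>\<^sub>v v"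
  proof (rule eq_vecI)
    fix i assume "i < dim_vec (x \<cdot>\<^sub>v v)"
    then have i: "i < n" by (simp add: v_def)
    then have bi: "b i \<in> W" using bij_betwE[OF b] by auto
    have "vec_index (A' *\<^sub>v v) i = (\<Sum>j<n. of_int (c (b i) (b j)) * b j)"
      using i by (simp add: A'_def A_def v_def scalar_prod_def atLeast0LessThan)
    also have "\<dots> = x * b i" unfolding c[OF bi] by (rule sum.reindex_bij_betw[OF b])
    finally show "vec_index (A' *\<^sub>v v) i = vec_index (x \<cdot>\<^sub>v v) i" using i by (simp add: v_def)
  qed (simp add: A'_def A_def v_def)
  moreover have "v \<noteq> 0\<^sub>v n"
  proof
    assume v0: "v = 0\<^sub>v n"
    obtain i where "i < n" "b i = 1" using b W(2) by (auto simp: bij_betw_def image_iff)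
    then show False using arg_cong[OF v0, of "\<lambda>v. vec_index v i"] by (simp add: v_def)
  qed
  ultimately have "eigenvalue A' x"
    unfolding eigenvalue_def eigenvector_def using A' by (intro exI[of _ v]) (simp add: v_def)
  then have "poly (char_poly A') x = 0" using eigenvalue_root_char_poly[OF A'] by simp
  moreover have "char_poly A' = map_poly of_int (char_poly A)"
    unfolding A'_def by (rule of_int_hom.char_poly_hom[OF A])
  moreover have "lead_coeff (char_poly A) = 1" using degree_monic_char_poly[OF A] by auto
  ultimately show ?thesis unfolding algebraic_int_altdef_ipoly by metis
qed

text \<open>The monic equations rewrite the first power beyond the range, so the group generated by
  the monomials x^i y^j is stable under multiplication by \<open>x\<close> and by
  \<open>y\<close>.\<close>

lemma algebraic_int_add_mult:
  fixes x y :: complex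
  assumes "algebraic_int x" "algebraic_int y"
  shows "algebraic_int (x + y)" "algebraic_int (x * y)"
proof -
  obtain p where p: "poly (map_poly of_int p) x = 0" "lead_coeff p = 1"
    using assms(1) algebraic_int_altdef_ipoly by metis
  obtain q where q: "poly (map_poly of_int q) y = 0" "lead_coeff q = 1"
    using assms(2) algebraic_int_altdef_ipoly by metis
  \<comment> \<open>One more than the degrees, so that both index ranges are nonempty and 1 is among
    the generators whatever \<open>p\<close> and \<open>q\<close> are.\<close>
  define n where "n = Suc (Polynomial.degree p)" define m where "m = Suc (Polynomial.degree q)"
  define W where "W = (\<lambda>(i,j). x ^ i * y ^ j) ` ({..<n} \<times> {..<m})"
  have W: "finite W" "1 \<in> W" by (auto simp: W_def n_def m_def intro!: image_eqI[of _ _ "(0,0)"])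
  have power: "\<exists>c::nat \<Rightarrow> int. z ^ Suc (Polynomial.degree r) = (\<Sum>i<Suc (Polynomial.degree r). of_int (c i) * z ^ i)"
    if r: "poly (map_poly of_int r) z = 0" "lead_coeff r = 1" for r and z :: complex
  proof -
    define k where "k = Polynomial.degree r"
    have "0 = (\<Sum>i\<le>k. of_int (Polynomial.coeff r i) * z ^ i)"
      using r(1) by (simp add: poly_altdef k_def degree_map_poly coeff_map_poly)
    also have "\<dots> = (\<Sum>i<k. of_int (Polynomial.coeff r i) * z ^ i) + z ^ k"
      using r(2) by (simp add: lessThan_Suc_atMost[symmetric] k_def)
    finally have "z ^ k = - (\<Sum>i<k. of_int (Polynomial.coeff r i) * z ^ i)"
      by (simp add: eq_neg_iff_add_eq_0 add.commute)
    then have "z ^ Suc k = z * - (\<Sum>i<k. of_int (Polynomial.coeff r i) * z ^ i)" by simp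
    also have "\<dots> = (\<Sum>i<k. of_int (- Polynomial.coeff r i) * z ^ Suc i)"
      by (simp add: sum_distrib_left sum_negf mult_ac)
    also have "\<dots> = (\<Sum>i<Suc k. of_int (case i of 0 \<Rightarrow> 0 | Suc j \<Rightarrow> - Polynomial.coeff r j) * z ^ i)"
      by (subst sum.lessThan_Suc_shift) simp
    finally show ?thesis unfolding k_def by blast
  qed
  obtain cx :: "nat \<Rightarrow> int" where cx: "x ^ n = (\<Sum>i<n. of_int (cx i) * x ^ i)" using power[OF p] unfolding n_def by blast
  obtain cy :: "nat \<Rightarrow> int" where cy: "y ^ m = (\<Sum>i<m. of_int (cy i) * y ^ i)" using power[OF q] unfolding m_def by blast
  have Wij: "x ^ i * y ^ j \<in> int_span W" if "i < n" "j < m" for i j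
    using that W(1) by (intro int_span_base) (auto simp: W_def)
  have Wij_x: "x ^ i * y ^ j \<in> int_span W" if "i \<le> n" "j < m" for i j
  proof (cases "i = n")
    case True
    have "x ^ n * y ^ j = (\<Sum>i<n. of_int (cx i) * (x ^ i * y ^ j))"
      unfolding cx by (simp add: sum_distrib_right mult.assoc)
    then show ?thesis using True Wij that by (auto intro!: int_span_sum int_span_mult_int)
  qed (use that Wij in auto)
  have Wij_y: "x ^ i * y ^ j \<in> int_span W" if "i < n" "j \<le> m" for i j
  proof (cases "j = m")
    case True
    have "x ^ i * y ^ m = (\<Sum>j<m. of_int (cy j) * (x ^ i * y ^ j))"
      unfolding cy by (simp add: sum_distrib_left mult_ac)
    then show ?thesis using True Wij that by (auto intro!: int_span_sum int_span_mult_int)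
  qed (use that Wij in auto)
  have mx: "x * v \<in> int_span W" and my: "y * v \<in> int_span W" if "v \<in> W" for v
  proof -
    obtain i j where ij: "i < n" "j < m" "v = x ^ i * y ^ j" using \<open>v \<in> W\<close> by (auto simp: W_def)
    have xv: "x * v = x ^ Suc i * y ^ j" and yv: "y * v = x ^ i * y ^ Suc j" using ij(3) by (auto simp: mult_ac)
    show "x * v \<in> int_span W" unfolding xv by (rule Wij_x) (use ij in auto)
    show "y * v \<in> int_span W" unfolding yv by (rule Wij_y) (use ij in auto)
  qed
  have my': "y * v \<in> int_span W" if "v \<in> int_span W" for v
  proof -
    obtain c :: "complex \<Rightarrow> int" where "v = (\<Sum>w\<in>W. of_int (c w) * w)" using \<open>v \<in> int_span W\<close> by (auto simp: int_span_def)
    then have "y * v = (\<Sum>w\<in>W. of_int (c w) * (y * w))" by (simp add: sum_distrib_left mult_ac)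
    then show ?thesis using my by (auto intro!: int_span_sum int_span_mult_int)
  qed
  show "algebraic_int (x + y)"
    by (rule algebraic_int_of_module[OF W]) (use mx my in \<open>auto simp: distrib_right intro: int_span_add\<close>)
  show "algebraic_int (x * y)"
    by (rule algebraic_int_of_module[OF W]) (use my'[OF mx] in \<open>simp add: mult_ac\<close>)
qed

lemma algebraic_int_of_int [simp]: "algebraic_int (of_int k :: complex)"
  by (rule int_imp_algebraic_int) simp

lemma algebraic_int_of_nat [simp]: "algebraic_int (of_nat k :: complex)"
  by (rule int_imp_algebraic_int) simp

lemma algebraic_int_1 [simp]: "algebraic_int (1 :: complex)"
  by (rule int_imp_algebraic_int) simp

lemma algebraic_int_diff: "algebraic_int (x :: complex) \<Longrightarrow> algebraic_int y \<Longrightarrow> algebraic_int (x - y)"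
  using algebraic_int_add_mult(1)[of x "- y"] by auto

lemma algebraic_int_sum: "(\<And>i. i \<in> I \<Longrightarrow> algebraic_int (f i :: complex)) \<Longrightarrow> algebraic_int (\<Sum>i\<in>I. f i)"
  by (induction I rule: infinite_finite_induct) (auto intro: algebraic_int_add_mult)

lemma algebraic_int_power: "algebraic_int (x :: complex) \<Longrightarrow> algebraic_int (x ^ k)"
  by (induction k) (auto intro: algebraic_int_add_mult)

lemma algebraic_int_of_power_eq_1: "n > 0 \<Longrightarrow> x ^ n = 1 \<Longrightarrow> algebraic_int (x :: complex)"
  using algebraic_int_root[of 1 "Polynomial.monom 1 n" x] by (simp add: poly_monom degree_monom_eq)

text \<open>Congruence modulo \<open>p\<close> in the ring of all algebraic integers, so that
  Frobenius arguments can be made before any number field or ideal enters.\<close>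

definition acong :: "nat \<Rightarrow> complex \<Rightarrow> complex \<Rightarrow> bool" where
  "acong p x y \<longleftrightarrow> algebraic_int ((x - y) / of_nat p)"

lemma acong_refl [simp]: "acong p x x"
  by (simp add: acong_def)

lemma acong_add: "acong p x y \<Longrightarrow> acong p z w \<Longrightarrow> acong p (x + z) (y + w)"
  using algebraic_int_add_mult(1)[of "(x - y) / of_nat p" "(z - w) / of_nat p"]
  by (simp add: acong_def add_divide_distrib[symmetric] algebra_simps)

lemma acong_sum: "(\<And>i. i \<in> I \<Longrightarrow> acong p (f i) (g i)) \<Longrightarrow> acong p (\<Sum>i\<in>I. f i) (\<Sum>i\<in>I. g i)"
  by (induction I rule: infinite_finite_induct) (auto intro: acong_add)

lemma acong_sym: "acong p x y \<Longrightarrow> acong p y x"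
  using algebraic_int_minus[of "(x - y) / of_nat p"]
  by (simp add: acong_def minus_divide_left)

lemma acong_trans: "acong p x y \<Longrightarrow> acong p y z \<Longrightarrow> acong p x z"
  using acong_add[of p x y y z] by (simp add: acong_def)

lemma acong_cmult: "algebraic_int z \<Longrightarrow> acong p x y \<Longrightarrow> acong p (z * x) (z * y)"
  using algebraic_int_add_mult(2)[of z "(x - y) / of_nat p"]
  by (simp add: acong_def right_diff_distrib)

lemma acong_mult:
  "algebraic_int x \<Longrightarrow> algebraic_int w \<Longrightarrow> acong p x y \<Longrightarrow> acong p z w \<Longrightarrow> acong p (x * z) (y * w)"
  using acong_cmult[of x p z w] acong_cmult[of w p x y] acong_trans by (simp add: mult.commute)

lemma acong_power:
  "algebraic_int x \<Longrightarrow> algebraic_int y \<Longrightarrow> acong p x y \<Longrightarrow> acong p (x ^ k) (y ^ k)"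
  by (induction k) (auto intro!: acong_mult algebraic_int_power)

lemma acong_of_int: "[a = b] (mod int p) \<Longrightarrow> acong p (of_int a) (of_int b)"
proof (cases "p = 0")
  case False
  assume "[a = b] (mod int p)"
  then obtain k where "a - b = int p * k" by (auto simp: cong_iff_dvd_diff)
  then have "(of_int a - of_int b :: complex) = of_nat p * of_int k"
    by (metis of_int_diff of_int_mult of_int_of_nat_eq)
  then show ?thesis using False by (simp add: acong_def)
qed (simp add: acong_def)

text \<open>The inner binomial coefficients are divisible by \<open>p\<close>.\<close>

lemma acong_power_add:
  assumes p: "prime p" and x: "algebraic_int x" and y: "algebraic_int y"
  shows "acong p ((x + y) ^ p) (x ^ p + y ^ p)"
proof -
  have p1: "p \<ge> 1" using prime_ge_1_nat[OF p] .
  have "(x + y) ^ p = (\<Sum>k\<le>p. of_nat (p choose k) * x ^ k * y ^ (p - k))" by (rule binomial_ring)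
  also have "acong p \<dots> (\<Sum>k\<le>p. (if k = 0 then y ^ p else 0) + (if k = p then x ^ p else 0))"
  proof (rule acong_sum)
    fix k assume k: "k \<in> {..p}"
    show "acong p (of_nat (p choose k) * x ^ k * y ^ (p - k)) ((if k = 0 then y ^ p else 0) + (if k = p then x ^ p else 0))"
    proof (cases "k = 0 \<or> k = p")
      case False
      then have "p dvd p choose k" using k p p1 by (intro dvd_choose_prime) auto
      then obtain c where c: "p choose k = p * c" by (auto simp: dvd_def)
      have "algebraic_int (of_nat c * x ^ k * y ^ (p - k))"
        by (intro algebraic_int_add_mult algebraic_int_power x y) simp
      moreover have "of_nat (p choose k) * x ^ k * y ^ (p - k) / of_nat p = of_nat c * x ^ k * y ^ (p - k)"
        using p1 by (simp add: c)
      ultimately show ?thesis using False by (simp add: acong_def)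
    qed (use p1 in auto)
  qed
  also have "(\<Sum>k\<le>p. (if k = 0 then y ^ p else 0) + (if k = p then x ^ p else 0)) = x ^ p + y ^ p"
    by (simp add: sum.distrib)
  finally show ?thesis .
qed

abbreviation ipoly :: "int poly \<Rightarrow> complex \<Rightarrow> complex" where
  "ipoly g z \<equiv> poly (map_poly of_int g) z"

lemma ipoly_pCons: "ipoly (pCons a g) z = of_int a + z * ipoly g z"
  by (simp add: of_int_hom.map_poly_pCons_hom)

lemma algebraic_int_ipoly: "algebraic_int z \<Longrightarrow> algebraic_int (ipoly g z)"
  by (induction g) (auto simp: ipoly_pCons intro!: algebraic_int_add_mult)

text \<open>Additivity of the p-th power modulo \<open>p\<close>, together with Fermat's little
  theorem for the coefficients.\<close>

lemma ipoly_frobenius: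
  assumes p: "prime p" and z: "algebraic_int z"
  shows "acong p (ipoly g z ^ p) (ipoly g (z ^ p))"
proof (induction g)
  case (pCons a g)
  have "acong p (ipoly (pCons a g) z ^ p) (of_int a ^ p + (z * ipoly g z) ^ p)"
    unfolding ipoly_pCons by (intro acong_power_add p algebraic_int_add_mult z algebraic_int_ipoly) simp
  moreover have "acong p (of_int a ^ p) (of_int a)"
  proof -
    \<comment> \<open>\<open>fermat_theorem\<close> speaks about natural numbers, so the coefficient
      is first replaced by its nonnegative residue.\<close>
    define b where "b = nat (a mod int p)"
    have p0: "p > 0" using prime_gt_0_nat[OF p] .
    have ab: "[a = int b] (mod int p)" using p0 by (simp add: b_def cong_def)
    have "[b ^ p = b] (mod p)"
    proof (cases "p dvd b")
      case True
      then have "p dvd b ^ p" using p0 dvd_trans[OF True dvd_power[of p b]] by simp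
      with True show ?thesis by (simp add: cong_def mod_eq_0_iff_dvd)
    next
      case False
      then have "[b * b ^ (p - 1) = b * 1] (mod p)" using fermat_theorem[OF p] by (intro cong_mult) auto
      moreover have "b * b ^ (p - 1) = b ^ p" using p0 by (simp add: power_eq_if)
      ultimately show ?thesis by simp
    qed
    then have "[int b ^ p = int b] (mod int p)" using cong_int_iff[of "b ^ p" b p] by simp
    then have "[a ^ p = a] (mod int p)" using cong_pow[OF ab, of p] ab cong_sym cong_trans by metis
    then show ?thesis using acong_of_int[of "a ^ p" a p] by simp
  qed
  moreover have "acong p ((z * ipoly g z) ^ p) (z ^ p * ipoly g (z ^ p))"
    unfolding power_mult_distrib by (intro acong_cmult algebraic_int_power z pCons.IH)
  ultimately show ?case
    unfolding ipoly_pCons by (meson acong_add acong_trans)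
qed (use prime_gt_0_nat[OF p] in \<open>simp add: zero_power\<close>)

lemma ipoly_frobenius_iterate:
  assumes p: "prime p" and z: "algebraic_int z"
  shows "acong p (ipoly g z ^ (p ^ k)) (ipoly g (z ^ (p ^ k)))"
proof (induction k)
  case (Suc k)
  have "acong p ((ipoly g z ^ (p ^ k)) ^ p) (ipoly g (z ^ (p ^ k)) ^ p)"
    by (intro acong_power algebraic_int_power algebraic_int_ipoly z Suc)
  moreover have "acong p (ipoly g (z ^ (p ^ k)) ^ p) (ipoly g ((z ^ (p ^ k)) ^ p))"
    by (intro ipoly_frobenius p algebraic_int_power z)
  ultimately have "acong p ((ipoly g z ^ (p ^ k)) ^ p) (ipoly g ((z ^ (p ^ k)) ^ p))"
    by (rule acong_trans)
  then show ?case by (simp add: power_mult[symmetric] mult.commute)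
qed simp

text \<open>The coefficients of a monic polynomial are integral over its roots.\<close>
lemma monic_rat_poly_integral:
  fixes f :: "rat poly"
  assumes "lead_coeff f = 1" and roots: "\<And>z::complex. poly (map_poly of_rat f) z = 0 \<Longrightarrow> algebraic_int z"
  shows "\<exists>g::int poly. f = map_poly of_int g"
proof -
  define F :: "complex poly" where "F = map_poly of_rat f"
  define AP where "AP q \<longleftrightarrow> (\<forall>i. algebraic_int (Polynomial.coeff q i))" for q :: "complex poly"
  have AP_mult: "AP (q * r)" if "AP q" "AP r" for q r
    unfolding AP_def coeff_mult using that by (auto simp: AP_def intro!: algebraic_int_sum algebraic_int_add_mult)
  have AP_1: "AP 1" by (simp add: AP_def)
  have AP_prod: "AP (\<Prod>i\<in>I. h i)" if "\<And>i. i \<in> I \<Longrightarrow> AP (h i)" for I and h :: "complex \<Rightarrow> complex poly"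
    using that by (induction I rule: infinite_finite_induct) (auto intro: AP_mult AP_1)
  have AP_power: "AP (q ^ k)" if "AP q" for q k
    by (induction k) (auto intro: AP_mult AP_1 that)
  have "lead_coeff F = 1" using assms(1) by (simp add: F_def lead_coeff_map_poly_nz coeff_map_poly degree_map_poly)
  then have "F = (\<Prod>z|poly F z = 0. [:- z, 1:] ^ Polynomial.order z F)" using complex_poly_decompose[of F] by simp
  moreover have "AP (\<Prod>z|poly F z = 0. [:- z, 1:] ^ Polynomial.order z F)"
  proof (intro AP_prod AP_power)
    fix z assume "z \<in> {z. poly F z = 0}"
    then have "algebraic_int z" using roots by (simp add: F_def)
    then show "AP [:- z, 1:]" unfolding AP_def
      by (auto simp: coeff_pCons split: nat.splits)
  qed
  ultimately have "AP F" by simp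
  have "\<exists>k. Polynomial.coeff f i = of_int k" for i
  proof -
    have "algebraic_int (of_rat (Polynomial.coeff f i) :: complex)"
      using \<open>AP F\<close> by (simp add: AP_def F_def coeff_map_poly)
    then have "(of_rat (Polynomial.coeff f i) :: complex) \<in> \<int>" by (intro rational_algebraic_int_is_int) auto
    then obtain k where "(of_rat (Polynomial.coeff f i) :: complex) = of_int k" by (elim Ints_cases)
    then have "(of_rat (Polynomial.coeff f i) :: complex) = of_rat (of_int k)" by simp
    then show ?thesis unfolding of_rat_eq_iff by blast
  qed
  then obtain k where k: "\<And>i. Polynomial.coeff f i = of_int (k i)" by metis
  have k0: "k i = 0" if "i > Polynomial.degree f" for i using k[of i] coeff_eq_0[OF that] by simp
  define g where "g = Abs_poly k"
  have g: "Polynomial.coeff g i = k i" for i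
  proof -
    have "finite {i. k i \<noteq> 0}"
      by (rule finite_subset[of _ "{..Polynomial.degree f}"]) (use k0 not_le in auto)
    then show ?thesis unfolding g_def by (subst Abs_poly_inverse) (auto simp: eventually_cofinite)
  qed
  have "f = map_poly of_int g" by (rule poly_eqI) (simp add: coeff_map_poly g k)
  then show ?thesis ..
qed

section \<open>Cyclotomic fields\<close>

interpretation rat_poly_hom: map_poly_comm_ring_hom "of_rat :: rat \<Rightarrow> complex" ..

abbreviation rpoly :: "rat poly \<Rightarrow> complex \<Rightarrow> complex" where
  "rpoly g z \<equiv> poly (map_poly of_rat g) z"

lemma rpoly_simps [simp]:
  "rpoly (g + h) z = rpoly g z + rpoly h z" "rpoly (g - h) z = rpoly g z - rpoly h z"
  "rpoly (- g) z = - rpoly g z" "rpoly (g * h) z = rpoly g z * rpoly h z"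
  "rpoly (pCons a g) z = of_rat a + z * rpoly g z" "rpoly (Polynomial.smult a g) z = of_rat a * rpoly g z"
proof -
  show "rpoly (Polynomial.smult a g) z = of_rat a * rpoly g z"
    using rat_poly_hom.hom_mult[of "[:a:]" g] by (simp add: of_rat_hom.map_poly_pCons_hom)
qed (simp_all add: rat_poly_hom.hom_add rat_poly_hom.hom_minus rat_poly_hom.hom_uminus rat_poly_hom.hom_mult
    of_rat_hom.map_poly_pCons_hom)

lemma rpoly_sum: "rpoly (\<Sum>i\<in>I. g i) z = (\<Sum>i\<in>I. rpoly (g i) z)"
  by (induction I rule: infinite_finite_induct) auto

lemma rpoly_pcompose: "rpoly (pcompose g h) z = rpoly g (rpoly h z)"
  by (induction g) (auto simp: pcompose_pCons)

lemma rpoly_altdef: "Polynomial.degree g < n \<Longrightarrow> rpoly g z = (\<Sum>i<n. of_rat (Polynomial.coeff g i) * z ^ i)"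
proof -
  assume d: "Polynomial.degree g < n"
  have "rpoly g z = (\<Sum>i\<le>Polynomial.degree g. of_rat (Polynomial.coeff g i) * z ^ i)"
    by (simp add: poly_altdef degree_map_poly coeff_map_poly)
  also have "\<dots> = (\<Sum>i<n. of_rat (Polynomial.coeff g i) * z ^ i)"
    using d by (intro sum.mono_neutral_left) (auto simp: coeff_eq_0)
  finally show ?thesis .
qed

lemma rpoly_of_int_poly: "rpoly (map_poly of_int g) z = ipoly g z"
  by (simp add: map_poly_map_poly o_def)

lemma poly_eq_0_many_roots:
  fixes p :: "complex poly"
  assumes "\<And>z. z \<in> S \<Longrightarrow> poly p z = 0" "finite S" "Polynomial.degree p < card S"
  shows "p = 0"
proof (rule ccontr)
  assume "p \<noteq> 0"
  then have "card S \<le> card {z. poly p z = 0}"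
    using assms poly_roots_finite by (intro card_mono) auto
  also have "\<dots> \<le> Polynomial.degree p" using \<open>p \<noteq> 0\<close> by (rule poly_roots_degree)
  finally show False using assms(3) by simp
qed

locale cyclotomic =
  fixes m :: nat
  assumes m_pos: "m > 0"
begin

definition zeta :: complex where "zeta = cis (2 * pi / real m)"
definition K where "K = cyclotomic_field m"

lemma K_def': "K = range (\<lambda>g. rpoly g zeta)"
  by (simp add: K_def cyclotomic_field_def zeta_def)

lemma rpoly_in_K [simp]: "rpoly g zeta \<in> K"
  by (simp add: K_def')

lemma zeta_power: "zeta ^ k = cis (2 * pi * real k / real m)"
  by (simp add: zeta_def Complex.DeMoivre field_simps)

lemma zeta_power_m [simp]: "zeta ^ m = 1"
  using m_pos by (simp add: zeta_power)

lemma inj_zeta: "inj_on (\<lambda>k. zeta ^ k) {..<m}"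
  using bij_betw_imp_inj_on[OF Complex.bij_betw_roots_unity[OF m_pos]] by (simp add: zeta_power)

lemma zeta_root: "z ^ m = 1 \<Longrightarrow> \<exists>k<m. z = zeta ^ k"
  using Complex.bij_betw_roots_unity[OF m_pos] by (fastforce simp: zeta_power bij_betw_def image_iff)

lemma zeta_power_eq_1: "zeta ^ k = 1 \<longleftrightarrow> m dvd k"
proof
  assume k: "zeta ^ k = 1"
  have "zeta ^ k = zeta ^ (m * (k div m) + k mod m)" by simp
  also have "\<dots> = zeta ^ (k mod m)" unfolding power_add power_mult by simp
  finally have "zeta ^ (k mod m) = zeta ^ 0" using k by simp
  then have "k mod m = 0" using inj_onD[OF inj_zeta, of "k mod m" 0] m_pos by simp
  then show "m dvd k" by auto
qed (auto simp: power_mult)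

section \<open>The minimal polynomial of zeta and its roots\<close>

definition X_m_1 :: "rat poly" where "X_m_1 = Polynomial.monom 1 m - 1"

lemma rpoly_X_m_1: "rpoly X_m_1 z = z ^ m - 1"
  unfolding X_m_1_def one_pCons by (simp add: poly_monom)

lemma X_m_1_nz: "X_m_1 \<noteq> 0"
  using rpoly_X_m_1[of 0] m_pos by (auto simp: zero_power)

lemma minpoly_exists:
  assumes "rpoly g z = 0" "g \<noteq> 0"
  shows "\<exists>f. Polynomial.lead_coeff f = 1 \<and> rpoly f z = 0 \<and> (\<forall>h. rpoly h z = 0 \<longrightarrow> f dvd h)"
proof -
  obtain h where h: "rpoly h z = 0" "h \<noteq> 0" "\<And>h'. rpoly h' z = 0 \<Longrightarrow> h' \<noteq> 0 \<Longrightarrow> Polynomial.degree h \<le> Polynomial.degree h'"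
    using ex_has_least_nat[of "\<lambda>h. rpoly h z = 0 \<and> h \<noteq> 0" g Polynomial.degree] assms by blast
  define f where "f = Polynomial.smult (inverse (Polynomial.lead_coeff h)) h"
  have f: "Polynomial.lead_coeff f = 1" "rpoly f z = 0" "f \<noteq> 0" "Polynomial.degree f = Polynomial.degree h"
    using h(1,2) by (auto simp: f_def)
  have "f dvd h'" if "rpoly h' z = 0" for h'
  proof -
    have "rpoly (f * (h' div f) + h' mod f) z = 0" using that by simp
    then have "rpoly (h' mod f) z = 0" using f(2) by (simp only: rpoly_simps) simp
    then have "h' mod f = 0"
      using h(3)[of "h' mod f"] degree_mod_less[OF f(3), of h'] f(4) by fastforce
    then show ?thesis by auto
  qed
  then show ?thesis using f by blast
qed

definition minp :: "rat poly" where
  "minp = (SOME f. Polynomial.lead_coeff f = 1 \<and> rpoly f zeta = 0 \<and> (\<forall>h. rpoly h zeta = 0 \<longrightarrow> f dvd h))"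

lemma minp: "Polynomial.lead_coeff minp = 1" "rpoly minp zeta = 0" "rpoly h zeta = 0 \<Longrightarrow> minp dvd h"
proof -
  have "\<exists>f. Polynomial.lead_coeff f = 1 \<and> rpoly f zeta = 0 \<and> (\<forall>h. rpoly h zeta = 0 \<longrightarrow> f dvd h)"
    using minpoly_exists[of X_m_1 zeta] X_m_1_nz by (simp add: rpoly_X_m_1)
  from someI_ex[OF this] show "Polynomial.lead_coeff minp = 1" "rpoly minp zeta = 0" "rpoly h zeta = 0 \<Longrightarrow> minp dvd h"
    unfolding minp_def by blast+
qed

lemma minp_nz: "minp \<noteq> 0"
  using minp(1) by auto

lemma rpoly_dvd: "f dvd g \<Longrightarrow> rpoly f z = 0 \<Longrightarrow> rpoly g z = 0"
  by (auto simp: dvd_def)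

definition R where "R = {z. rpoly minp z = 0}"

lemma zeta_in_R: "zeta \<in> R"
  by (simp add: R_def minp)

lemma R_unity: "z \<in> R \<Longrightarrow> z ^ m = 1"
  using rpoly_dvd[OF minp(3)[of X_m_1], of z] by (simp add: R_def rpoly_X_m_1)

lemma algebraic_int_unity: "z ^ m = 1 \<Longrightarrow> algebraic_int (z :: complex)"
  by (rule algebraic_int_of_power_eq_1[OF m_pos])

text \<open>Irreducibility in the form used below: every root of \<open>minp\<close> has
  \<open>minp\<close> as its minimal polynomial. If \<open>minp = h * u\<close> with
  \<open>h\<close> minimal for \<open>z\<close>, then \<open>u\<close> cannot vanish at
  \<open>zeta\<close>, since \<open>minp\<close> would divide it and make \<open>h\<close> a unit;
  so \<open>h\<close> vanishes there and is a multiple of \<open>minp\<close>.\<close>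

lemma minp_dvd:
  assumes "z \<in> R" "rpoly g z = 0"
  shows "minp dvd g"
proof -
  obtain h where h: "Polynomial.lead_coeff h = 1" "rpoly h z = 0" "\<And>g. rpoly g z = 0 \<Longrightarrow> h dvd g"
    using minpoly_exists[of minp z] assms(1) minp_nz by (auto simp: R_def)
  then obtain u where u: "minp = h * u" using assms(1) by (auto simp: R_def dvd_def)
  have "rpoly u zeta \<noteq> 0"
  proof
    assume "rpoly u zeta = 0"
    then obtain w where "u = minp * w" using minp(3) by (auto simp: dvd_def)
    then have "minp * 1 = minp * (h * w)" using u by (simp add: mult_ac)
    then have hw: "h * w = 1" using minp_nz by (metis mult_left_cancel)
    then have "rpoly h z * rpoly w z = rpoly 1 z" by (metis rpoly_simps(4))
    then show False using h(2) by (simp add: one_pCons)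
  qed
  moreover have "rpoly h zeta * rpoly u zeta = 0" using minp(2) u by simp
  ultimately have "minp dvd h" using minp(3) by simp
  then show ?thesis using h(3)[OF assms(2)] dvd_trans by blast
qed

lemma X_m_1_factor:
  obtains h where "X_m_1 = minp * h" "\<And>z. rpoly h z = 0 \<Longrightarrow> algebraic_int z" "Polynomial.lead_coeff h = 1"
proof -
  have "minp dvd X_m_1" by (rule minp(3)) (simp add: rpoly_X_m_1)
  then obtain h where h: "X_m_1 = minp * h" by (auto simp: dvd_def)
  have "algebraic_int z" if "rpoly h z = 0" for z
  proof -
    have "rpoly X_m_1 z = 0" unfolding h using that by simp
    then show ?thesis by (intro algebraic_int_unity) (simp add: rpoly_X_m_1)
  qed
  moreover have "Polynomial.lead_coeff X_m_1 = 1"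
  proof -
    have "Polynomial.degree (1 :: rat poly) < Polynomial.degree (Polynomial.monom 1 m :: rat poly)"
      using m_pos by (simp add: degree_monom_eq)
    then show ?thesis
      using lead_coeff_add_le[of "- 1" "Polynomial.monom (1::rat) m"] m_pos
      by (simp add: X_m_1_def degree_monom_eq)
  qed
  then have "Polynomial.lead_coeff h = 1" using minp(1) unfolding h lead_coeff_mult by simp
  ultimately show ?thesis using that h by blast
qed

lemma pderiv_X_m_1: "poly (pderiv (map_poly of_rat X_m_1)) z = of_nat m * z ^ (m - 1)" for z :: complex
proof -
  have "map_poly of_rat X_m_1 = Polynomial.monom 1 m - (1 :: complex poly)"
    by (simp add: X_m_1_def rat_poly_hom.hom_minus map_poly_monom)
  then show ?thesis by (simp add: pderiv_diff pderiv_monom poly_monom)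
qed

lemma pderiv_factor:
  assumes "X_m_1 = minp * h"
  shows "of_nat m * z ^ (m - 1) = rpoly minp z * poly (pderiv (map_poly of_rat h)) z +
    rpoly h z * poly (pderiv (map_poly of_rat minp)) z"
  using pderiv_X_m_1[of z] unfolding assms by (simp add: rat_poly_hom.hom_mult pderiv_mult)

text \<open>If \<open>minp\<close> did not vanish at \<open>z\<^sup>p\<close>, then \<open>minp (z\<^sup>p)\<close> would divide the derivative \<open>m x\<^bsup>m-1\<^esup>\<close>
  of \<open>x\<^sup>m - 1\<close> at \<open>z\<^sup>p\<close>, hence \<open>m\<close>, although it is divisible by \<open>p\<close>.\<close>
lemma R_prime_power:
  assumes z: "z \<in> R" and p: "prime p" "\<not> p dvd m"
  shows "z ^ p \<in> R"
proof (rule ccontr)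
  assume no: "z ^ p \<notin> R"
  obtain h where h: "X_m_1 = minp * h" "\<And>z. rpoly h z = 0 \<Longrightarrow> algebraic_int z" "Polynomial.lead_coeff h = 1"
    using X_m_1_factor by blast
  obtain hi where hi: "h = map_poly of_int hi" using monic_rat_poly_integral[OF h(3,2)] by blast
  have "\<And>z. rpoly minp z = 0 \<Longrightarrow> algebraic_int z" using R_unity algebraic_int_unity by (simp add: R_def)
  then obtain fi where fi: "minp = map_poly of_int fi" using monic_rat_poly_integral[OF minp(1)] by blast
  define w where "w = z ^ p"
  have zm: "z ^ m = 1" using R_unity z .
  have wm: "w ^ m = 1" unfolding w_def using zm by (metis mult.commute power_mult power_one)
  have nz: "rpoly minp w \<noteq> 0" using no by (simp add: R_def w_def)
  have "rpoly minp w * rpoly h w = 0"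
    using rpoly_X_m_1[of w] wm unfolding h(1) by simp
  then have hw: "rpoly h w = 0" using nz by simp
  define D where "D = poly (pderiv (map_poly of_rat h)) w"
  have "map_poly of_rat h = (map_poly of_int hi :: complex poly)"
    by (simp add: hi map_poly_map_poly o_def)
  then have "D = ipoly (pderiv hi) w" unfolding D_def by (simp add: of_int_hom.map_poly_pderiv)
  then have D: "algebraic_int D" using algebraic_int_ipoly algebraic_int_unity[OF wm] by simp
  have "acong p (ipoly fi z ^ p) (ipoly fi w)"
    unfolding w_def by (intro ipoly_frobenius p algebraic_int_unity zm)
  moreover have "ipoly fi z = 0" using z by (simp add: R_def fi rpoly_of_int_poly)
  ultimately have "algebraic_int (- ipoly fi w / of_nat p)"
    using prime_gt_0_nat[OF p(1)] by (simp add: acong_def zero_power)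
  then have a: "algebraic_int (- rpoly minp w / of_nat p)" by (simp add: fi rpoly_of_int_poly)
  have mw: "of_nat m * w ^ (m - 1) = rpoly minp w * D"
    using pderiv_factor[OF h(1), of w] hw by (simp add: D_def)
  have "w ^ (m - 1) * w = 1" using wm m_pos power_minus_mult[of m w] by simp
  then have "(of_nat m :: complex) = (of_nat m * w ^ (m - 1)) * w" unfolding mult.assoc by simp
  then have "of_nat m / of_nat p = - rpoly minp w / of_nat p * (- (D * w))" unfolding mw by (simp add: mult.assoc)
  moreover have "algebraic_int (- rpoly minp w / of_nat p * (- (D * w)))"
    using a D algebraic_int_unity[OF wm] by (intro algebraic_int_add_mult algebraic_int_minus)
  ultimately have "algebraic_int (of_nat m / of_nat p :: complex)" by metis
  then have "(of_nat m / of_nat p :: complex) \<in> \<int>" by (rule rational_algebraic_int_is_int) simp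
  then obtain k :: int where "of_nat m / of_nat p = (of_int k :: complex)" by (elim Ints_cases)
  then have "(of_nat m :: complex) = of_int (k * int p)" using prime_gt_0_nat[OF p(1)] by (simp add: field_simps)
  then have "int m = k * int p" by (metis of_int_eq_iff of_int_of_nat_eq)
  then have "int p dvd int m" by simp
  then show False using p(2) by (simp only: int_dvd_int_iff)
qed

lemma R_coprime_power: "z \<in> R \<Longrightarrow> coprime k m \<Longrightarrow> k > 0 \<Longrightarrow> z ^ k \<in> R"
proof (induction k arbitrary: z rule: less_induct)
  case (less k)
  show ?case
  proof (cases "k = 1")
    case False
    then obtain p where p: "prime p" "p dvd k" using prime_factor_nat by blast
    then obtain k' where k': "k = p * k'" by (auto simp: dvd_def)
    have pm: "\<not> p dvd m"
    proof
      assume "p dvd m"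
      then have "is_unit p" using p(2) less.prems(2) by (meson coprime_common_divisor)
      then show False using p(1) by simp
    qed
    have c: "coprime k' m" using less.prems(2) by (simp add: k')
    have "k' > 0" "k' < k" using less.prems(3) prime_gt_1_nat[OF p(1)] k' by auto
    then have "(z ^ p) ^ k' \<in> R"
      by (intro less.IH R_prime_power less.prems(1) p(1) pm c)
    then show ?thesis by (simp add: k' power_mult)
  qed (use less in simp)
qed

text \<open>One inclusion is \<open>R_coprime_power\<close>. Conversely, a power of
  \<open>zeta\<close> whose exponent is not coprime to \<open>m\<close> is a root of X^m' - 1 for a
  proper divisor \<open>m'\<close> of \<open>m\<close>; by \<open>minp_dvd\<close> so would be
  \<open>zeta\<close>.\<close>

lemma R_eq: "R = (\<lambda>k. zeta ^ k) ` totatives m"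
proof (intro subset_antisym subsetI)
  fix z assume "z \<in> (\<lambda>k. zeta ^ k) ` totatives m"
  then obtain k where "k \<in> totatives m" "z = zeta ^ k" by auto
  then show "z \<in> R" using R_coprime_power[OF zeta_in_R, of k] by (auto simp: totatives_def)
next
  fix z assume z: "z \<in> R"
  then obtain k where k: "k < m" "z = zeta ^ k" using zeta_root R_unity by blast
  define d where "d = gcd k m"
  have d: "d > 0" "d dvd m" "d dvd k" using m_pos by (auto simp: d_def)
  then obtain m' k' where mk: "m = d * m'" "k = d * k'" by (auto simp: dvd_def)
  have m': "m' > 0" using mk(1) m_pos by (cases m') auto
  have "z ^ m' = 1"
  proof -
    have "z ^ m' = (zeta ^ m) ^ k'" unfolding k(2) power_mult[symmetric] using mk by (simp add: mult_ac)
    then show ?thesis by simp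
  qed
  then have "rpoly (Polynomial.monom 1 m' - 1) z = 0" by (simp add: poly_monom one_pCons)
  from rpoly_dvd[OF minp_dvd[OF z this], of zeta]
  have "zeta ^ m' = 1" using minp(2) by (simp add: poly_monom one_pCons)
  then have "m dvd m'" by (simp add: zeta_power_eq_1)
  then have "d * m' \<le> m'" using dvd_imp_le[OF _ m', of m] mk(1) by simp
  then have "d = 1" using m' d(1) by simp
  then have cop: "coprime k m" unfolding d_def by (simp only: coprime_iff_gcd_eq_1)
  show "z \<in> (\<lambda>k. zeta ^ k) ` totatives m"
  \<comment> \<open>\<open>totatives\<close> ranges over the numbers from 1 to m, so for
    \<open>m = 1\<close> the exponent 0 has to be replaced by 1.\<close>
  proof (cases "k = 0")
    case True
    then have "m = 1" using cop by simp
    then have "m \<in> totatives m" by (simp add: totatives_def)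
    then show ?thesis using k True by (intro image_eqI[of _ _ m]) simp_all
  next
    case False
    then show ?thesis using k cop by (intro image_eqI[of _ _ k]) (auto simp: totatives_def)
  qed
qed

lemma card_R: "card R = totient m"
proof -
  have "inj_on (\<lambda>k. zeta ^ k) (totatives m)"
  proof (cases "m = 1")
    case False
    then show ?thesis using inj_zeta m_pos totatives_less by (intro inj_on_subset[OF inj_zeta]) auto
  qed simp
  then show ?thesis unfolding R_eq by (simp add: card_image totient_def)
qed

lemma finite_R [simp]: "finite R"
  unfolding R_eq by simp

definition d where "d = totient m"

lemma d_pos: "d > 0"
  using m_pos by (simp add: d_def totient_gt_0_iff)

text \<open>A double root of \<open>minp\<close> would be a root of the derivative of X^m - 1, so
  the degree is the number of roots.\<close>

lemma degree_minp: "Polynomial.degree minp = d"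
proof -
  obtain h where h: "X_m_1 = minp * h" using X_m_1_factor by blast
  define F :: "complex poly" where "F = map_poly of_rat minp"
  have F0: "F \<noteq> 0" using minp_nz by (simp add: F_def)
  have "rsquarefree F"
    unfolding rsquarefree_roots
  proof (intro allI notI)
    fix a assume a: "poly F a = 0 \<and> poly (pderiv F) a = 0"
    then have "of_nat m * a ^ (m - 1) = 0" using pderiv_factor[OF h, of a] by (simp add: F_def)
    moreover have "a ^ m = 1" using a R_unity by (simp add: R_def F_def)
    ultimately show False using m_pos by (auto simp: zero_power)
  qed
  then have "Polynomial.smult (Polynomial.lead_coeff F) (\<Prod>z|poly F z = 0. [:-z, 1:]) = F" by (rule complex_poly_decompose_rsquarefree)
  then have "Polynomial.degree F = Polynomial.degree (\<Prod>z|poly F z = 0. [:-z, 1:])" using F0 by (metis degree_smult_eq leading_coeff_0_iff)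
  also have "\<dots> = card R"
    by (subst degree_prod_eq_sum_degree) (auto simp: R_def F_def)
  finally show ?thesis by (simp add: F_def degree_map_poly card_R d_def)
qed

section \<open>The field K and its embeddings\<close>

lemma K_repr:
  assumes "x \<in> K"
  obtains g where "x = rpoly g zeta" "Polynomial.degree g < d"
proof -
  obtain g where g: "x = rpoly g zeta" using assms by (auto simp: K_def')
  have "rpoly (minp * (g div minp) + g mod minp) zeta = rpoly (g mod minp) zeta"
    using minp(2) by (simp only: rpoly_simps) simp
  then have "x = rpoly (g mod minp) zeta" using g by simp
  moreover have "Polynomial.degree (g mod minp) < d"
    using degree_mod_less[OF minp_nz, of g] degree_minp d_pos by auto
  ultimately show ?thesis using that by blast
qed

lemma K_closed [simp, intro]:
  "x \<in> K \<Longrightarrow> y \<in> K \<Longrightarrow> x + y \<in> K" "x \<in> K \<Longrightarrow> y \<in> K \<Longrightarrow> x - y \<in> K" "x \<in> K \<Longrightarrow> y \<in> K \<Longrightarrow> x * y \<in> K"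
  "x \<in> K \<Longrightarrow> - x \<in> K" "of_rat q \<in> K" "zeta \<in> K" "x \<in> K \<Longrightarrow> x ^ k \<in> K"
proof -
  show add: "x + y \<in> K" "x - y \<in> K" "x * y \<in> K" if xy: "x \<in> K" "y \<in> K" for x y
  proof -
    obtain g h where "x = rpoly g zeta" "y = rpoly h zeta" using xy by (auto simp: K_def')
    then show "x + y \<in> K" "x - y \<in> K" "x * y \<in> K"
      using rpoly_in_K[of "g + h"] rpoly_in_K[of "g - h"] rpoly_in_K[of "g * h"] by simp_all
  qed
  show "- x \<in> K" if "x \<in> K" using add(2)[OF rpoly_in_K[of 0] that] by simp
  show q: "of_rat q \<in> K" for q using rpoly_in_K[of "[:q:]"] by simp
  show "zeta \<in> K" using rpoly_in_K[of "[:0,1:]"] by simp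
  show "x ^ k \<in> K" if "x \<in> K" using q[of 1] add(3) that by (induction k) auto
qed

lemma K_nums [simp]: "of_int k \<in> K" "of_nat n \<in> K" "0 \<in> K" "1 \<in> K"
  using K_closed(5)[of "of_int k"] K_closed(5)[of "of_nat n"] K_closed(5)[of 0] K_closed(5)[of 1] by simp_all

lemma K_sum: "(\<And>i. i \<in> I \<Longrightarrow> g i \<in> K) \<Longrightarrow> (\<Sum>i\<in>I. g i) \<in> K"
  by (induction I rule: infinite_finite_induct) auto

text \<open>The embedding of K that sends \<open>zeta\<close> to \<open>z\<close>, evaluated through
  an arbitrary polynomial representation of \<open>x\<close>. For \<open>z\<close> in
  \<open>R\<close> the choice is harmless, because two representations differ by a multiple of
  \<open>minp\<close>.\<close>

definition conjg :: "complex \<Rightarrow> complex \<Rightarrow> complex" where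
  "conjg z x = rpoly (SOME g. rpoly g zeta = x) z"

lemma conjg_rpoly:
  assumes "z \<in> R"
  shows "conjg z (rpoly g zeta) = rpoly g z"
proof -
  define h where "h = (SOME h. rpoly h zeta = rpoly g zeta)"
  have "rpoly h zeta = rpoly g zeta" unfolding h_def by (rule someI[of _ g]) simp
  then have "rpoly (h - g) zeta = 0" by simp
  then have "rpoly (h - g) z = 0" using minp(3) rpoly_dvd assms R_def by blast
  then show ?thesis by (simp add: conjg_def h_def)
qed

lemma conjg_hom:
  assumes "z \<in> R"
  shows "x \<in> K \<Longrightarrow> y \<in> K \<Longrightarrow> conjg z (x + y) = conjg z x + conjg z y"
    "x \<in> K \<Longrightarrow> y \<in> K \<Longrightarrow> conjg z (x - y) = conjg z x - conjg z y"
    "x \<in> K \<Longrightarrow> y \<in> K \<Longrightarrow> conjg z (x * y) = conjg z x * conjg z y"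
    "conjg z (of_rat q) = of_rat q" "conjg z zeta = z"
proof -
  show "conjg z (x + y) = conjg z x + conjg z y" "conjg z (x - y) = conjg z x - conjg z y"
    "conjg z (x * y) = conjg z x * conjg z y" if xy: "x \<in> K" "y \<in> K"
  proof -
    obtain g h where gh: "x = rpoly g zeta" "y = rpoly h zeta" using xy by (auto simp: K_def')
    show "conjg z (x + y) = conjg z x + conjg z y"
      using conjg_rpoly[OF assms, of "g + h"] by (simp add: gh conjg_rpoly[OF assms])
    show "conjg z (x - y) = conjg z x - conjg z y"
      using conjg_rpoly[OF assms, of "g - h"] by (simp add: gh conjg_rpoly[OF assms])
    show "conjg z (x * y) = conjg z x * conjg z y"
      using conjg_rpoly[OF assms, of "g * h"] by (simp add: gh conjg_rpoly[OF assms])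
  qed
  show "conjg z (of_rat q) = of_rat q" using conjg_rpoly[OF assms, of "[:q:]"] by simp
  show "conjg z zeta = z" using conjg_rpoly[OF assms, of "[:0,1:]"] by simp
qed

lemma conjg_nums [simp]:
  assumes "z \<in> R"
  shows "conjg z (of_int k) = of_int k" "conjg z (of_nat n) = of_nat n" "conjg z 0 = 0" "conjg z 1 = 1"
  using conjg_hom(4)[OF assms, of "of_int k"] conjg_hom(4)[OF assms, of "of_nat n"]
    conjg_hom(4)[OF assms, of 0] conjg_hom(4)[OF assms, of 1] by simp_all

lemma conjg_zeta [simp]: "x \<in> K \<Longrightarrow> conjg zeta x = x"
  using conjg_rpoly[OF zeta_in_R] by (auto simp: K_def')

lemma conjg_power: "z \<in> R \<Longrightarrow> x \<in> K \<Longrightarrow> conjg z (x ^ k) = conjg z x ^ k"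
  by (induction k) (auto simp: conjg_hom)

lemma conjg_ipoly: "z \<in> R \<Longrightarrow> x \<in> K \<Longrightarrow> ipoly g x \<in> K \<and> conjg z (ipoly g x) = ipoly g (conjg z x)"
  by (induction g) (auto simp: ipoly_pCons conjg_hom)

lemma conjg_nonzero:
  assumes "z \<in> R" "x \<in> K" "x \<noteq> 0"
  shows "conjg z x \<noteq> 0"
proof
  assume 0: "conjg z x = 0"
  obtain g where g: "x = rpoly g zeta" using assms by (auto simp: K_def')
  then have "rpoly g z = 0" using 0 conjg_rpoly[OF assms(1)] by simp
  then have "rpoly g zeta = 0" using minp_dvd[OF assms(1)] rpoly_dvd minp(2) by blast
  then show False using assms(3) g by simp
qed

lemma algebraic_int_conjg:
  assumes "z \<in> R" "x \<in> K" "algebraic_int x"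
  shows "algebraic_int (conjg z x)"
proof -
  obtain p where p: "ipoly p x = 0" "Polynomial.lead_coeff p = 1" using assms(3) algebraic_int_altdef_ipoly by metis
  then have "ipoly p (conjg z x) = 0" using conjg_ipoly[OF assms(1,2), of p] assms(1) by simp
  then show ?thesis using p(2) algebraic_int_altdef_ipoly by metis
qed

lemma cnj_unity: "z ^ m = 1 \<Longrightarrow> cnj z = z ^ (m - 1)"
proof -
  assume z: "z ^ m = 1"
  then have "cmod z ^ m = 1" by (metis norm_one norm_power)
  then have "cmod z = 1" using power_eq_iff_eq_base[of m "cmod z" 1] m_pos by simp
  then have "cnj z * z = 1" using complex_norm_square[of z] by (simp add: mult.commute)
  moreover have "z ^ (m - 1) * z = 1" using z m_pos power_minus_mult[of m z] by simp
  moreover have "z \<noteq> 0" using z m_pos by (auto simp: zero_power)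
  ultimately show ?thesis by (metis mult_right_cancel)
qed

lemma cnj_rpoly: "cnj (rpoly g z) = rpoly g (cnj z)"
proof -
  have "cnj (of_rat q) = of_rat q" for q by (cases q) (simp add: of_rat_rat)
  then show ?thesis by (induction g) auto
qed

text \<open>On m-th roots of unity conjugation is the power map with exponent \<open>m - 1\<close>,
  hence a polynomial substitution, which commutes with all embeddings.\<close>

lemma cnj_K:
  assumes "x \<in> K"
  shows "cnj x \<in> K" "z \<in> R \<Longrightarrow> conjg z (cnj x) = cnj (conjg z x)"
proof -
  obtain g where g: "x = rpoly g zeta" using assms by (auto simp: K_def')
  define h where "h = pcompose g (Polynomial.monom 1 (m - 1))"
  have h: "rpoly h z = rpoly g (z ^ (m - 1))" for z
    by (simp add: h_def rpoly_pcompose poly_monom)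
  have x: "cnj x = rpoly h zeta" unfolding g cnj_rpoly h by (simp add: cnj_unity)
  then show "cnj x \<in> K" by simp
  show "conjg z (cnj x) = cnj (conjg z x)" if "z \<in> R"
  proof -
    have "conjg z (cnj x) = rpoly h z" using conjg_rpoly[OF that, of h] x by simp
    also have "\<dots> = rpoly g (cnj z)" unfolding h cnj_unity[OF R_unity[OF that]] ..
    also have "\<dots> = cnj (conjg z x)" unfolding g conjg_rpoly[OF that] cnj_rpoly ..
    finally show ?thesis .
  qed
qed

definition emb where "emb z = restrict (conjg z) K"

text \<open>A homomorphism fixes the rationals, so it sends \<open>zeta\<close> to a root of
  \<open>minp\<close> and is determined by that root.\<close>

lemma bij_emb: "bij_betw emb R (embeddings K)"
proof (rule bij_betwI[where g = "\<lambda>\<sigma>. \<sigma> zeta"])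
  show "emb \<in> R \<rightarrow> embeddings K"
    by (auto simp: emb_def embeddings_def Ring.ring_hom_def complex_ring_def conjg_hom)
  have \<sigma>: "\<sigma> zeta \<in> R \<and> emb (\<sigma> zeta) = \<sigma>" if "\<sigma> \<in> embeddings K" for \<sigma>
  proof -
    have hom: "\<And>x y. x \<in> K \<Longrightarrow> y \<in> K \<Longrightarrow> \<sigma> (x + y) = \<sigma> x + \<sigma> y" "\<And>x y. x \<in> K \<Longrightarrow> y \<in> K \<Longrightarrow> \<sigma> (x * y) = \<sigma> x * \<sigma> y"
      "\<sigma> 1 = 1" "\<sigma> \<in> extensional K"
      using that by (auto simp: embeddings_def Ring.ring_hom_def complex_ring_def)
    have 0: "\<sigma> 0 = 0" using hom(1)[of 0 0] by simp
    have nat: "\<sigma> (of_nat n) = of_nat n" for n by (induction n) (auto simp: 0 hom)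
    have neg: "\<sigma> (- x) = - \<sigma> x" if "x \<in> K" for x using hom(1)[of x "- x"] that 0 by (simp add: eq_neg_iff_add_eq_0 add.commute)
    have int: "\<sigma> (of_int k) = of_int k" for k by (cases k rule: int_cases2) (auto simp: nat neg)
    have rat: "\<sigma> (of_rat q) = of_rat q" for q
    proof (cases q)
      case (Fract a b)
      then have *: "of_rat q * of_int b = (of_int a :: complex)" by (simp add: of_rat_rat)
      have "\<sigma> (of_rat q) * of_int b = of_int a"
        using hom(2)[of "of_rat q" "of_int b"] unfolding * int by simp
      then have "\<sigma> (of_rat q) * of_int b = of_rat q * of_int b" using * by simp
      then show ?thesis using Fract by simp
    qed
    have rp: "\<sigma> (rpoly g zeta) = rpoly g (\<sigma> zeta)" for g by (induction g) (auto simp: 0 hom rat)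
    then have R: "\<sigma> zeta \<in> R" using rp[of minp] by (simp add: R_def minp 0)
    have "emb (\<sigma> zeta) x = \<sigma> x" for x
      using hom(4) rp conjg_rpoly[OF R] by (cases "x \<in> K") (auto simp: emb_def extensional_def K_def')
    with R show ?thesis by auto
  qed
  show "(\<lambda>\<sigma>. \<sigma> zeta) \<in> embeddings K \<rightarrow> R" using \<sigma> by auto
  show "\<And>\<sigma>. \<sigma> \<in> embeddings K \<Longrightarrow> emb (\<sigma> zeta) = \<sigma>" using \<sigma> by auto
  show "\<And>z. z \<in> R \<Longrightarrow> emb z zeta = z" by (simp add: emb_def conjg_hom)
qed

section \<open>Traces and the integers of K\<close>

lemma field_trace_eq: "x \<in> K \<Longrightarrow> field_trace K x = (\<Sum>z\<in>R. conjg z x)"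
  unfolding field_trace_def using sum.reindex_bij_betw[OF bij_emb, of "\<lambda>\<sigma>. \<sigma> x"] by (simp add: emb_def)

definition OK where "OK = ring_of_integers K"

lemma O_alt: "x \<in> OK \<longleftrightarrow> x \<in> K \<and> algebraic_int x"
  by (simp add: OK_def ring_of_integers_def)

lemma O_closed [simp, intro]:
  "x \<in> OK \<Longrightarrow> y \<in> OK \<Longrightarrow> x + y \<in> OK" "x \<in> OK \<Longrightarrow> y \<in> OK \<Longrightarrow> x - y \<in> OK" "x \<in> OK \<Longrightarrow> y \<in> OK \<Longrightarrow> x * y \<in> OK"
  "x \<in> OK \<Longrightarrow> - x \<in> OK" "of_int i \<in> OK" "of_nat n \<in> OK" "0 \<in> OK" "1 \<in> OK" "zeta \<in> OK" "x \<in> OK \<Longrightarrow> x ^ k \<in> OK"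
  "x \<in> OK \<Longrightarrow> cnj x \<in> OK" "x \<in> OK \<Longrightarrow> x \<in> K"
  using algebraic_int_unity[of zeta]
  by (auto simp: O_alt algebraic_int_diff algebraic_int_power cnj_K intro: algebraic_int_add_mult)

text \<open>The power maps with exponents coprime to \<open>m\<close> permute \<open>R\<close>, so
  \<open>G\<close> takes the trace \<open>y\<close> as its value on all of \<open>R\<close>. The
  representative \<open>h\<close> of degree below \<open>d\<close> also has the value
  \<open>y\<close> at these \<open>d\<close> points; hence it is constant, and \<open>y\<close> is
  its rational coefficient.\<close>

lemma trace_rational: "rpoly g zeta \<in> K \<Longrightarrow> (\<Sum>z\<in>R. rpoly g z) \<in> \<rat>"
proof -
  define T where "T = totatives m"
  define G where "G = (\<Sum>k\<in>T. pcompose g (Polynomial.monom 1 k))"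
  have bij: "(\<Sum>k\<in>T. rpoly g (z ^ k)) = (\<Sum>z\<in>R. rpoly g z)" if z: "z \<in> R" for z
  proof (rule sum.reindex_bij_betw)
    obtain j where j: "j \<in> T" "z = zeta ^ j" using z R_eq by (auto simp: T_def)
    have "inj_on (\<lambda>k. z ^ k) T"
    proof (cases "m = 1")
      case False
      have less: "k < m" if "k \<in> T" for k using that totatives_less m_pos False by (auto simp: T_def)
      show ?thesis
      proof (rule inj_onI)
        fix k l assume kl: "k \<in> T" "l \<in> T" "z ^ k = z ^ l"
        have "zeta ^ ((j * k) mod m) = zeta ^ ((j * l) mod m)"
        proof -
          have r: "zeta ^ (n mod m) = zeta ^ n" for n
          proof -
            have "zeta ^ n = zeta ^ (m * (n div m) + n mod m)" by simp
            then show ?thesis unfolding power_add power_mult by simp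
          qed
          show ?thesis unfolding r using kl(3) by (simp add: j power_mult)
        qed
        then have "[j * k = j * l] (mod m)" using inj_onD[OF inj_zeta] m_pos by (simp add: cong_def)
        moreover have "coprime j m" using j by (simp add: T_def totatives_def)
        ultimately have "[k = l] (mod m)" by (simp add: cong_mult_lcancel_nat)
        then show "k = l" using less kl by (simp add: cong_def)
      qed
    qed (simp add: T_def)
    moreover have "(\<lambda>k. z ^ k) ` T \<subseteq> R" using R_coprime_power[OF z] by (auto simp: T_def totatives_def)
    moreover have "card T = card R" by (simp add: card_R T_def totient_def)
    ultimately show "bij_betw (\<lambda>k. z ^ k) T R"
      using card_subset_eq[of R "(\<lambda>k. z ^ k) ` T"] by (simp add: bij_betw_def card_image)
  qed
  define y where "y = (\<Sum>z\<in>R. rpoly g z)"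
  have G: "rpoly G z = y" if "z \<in> R" for z
    using bij[OF that] by (simp add: G_def rpoly_sum rpoly_pcompose poly_monom y_def)
  obtain h where h: "rpoly G zeta = rpoly h zeta" "Polynomial.degree h < d"
    using K_repr[of "rpoly G zeta"] by auto
  have hz: "rpoly h z = y" if "z \<in> R" for z
    using conjg_rpoly[OF that, of h] conjg_rpoly[OF that, of G] h(1) G[OF that] by simp
  have "map_poly of_rat h - [:y:] = 0"
  proof (rule poly_eq_0_many_roots[of R])
    show "Polynomial.degree (map_poly of_rat h - [:y:]) < card R"
      using h(2) d_pos by (simp add: card_R d_def[symmetric] degree_map_poly degree_diff_less)
  qed (use hz in auto)
  then have "map_poly of_rat h = [:y:]" by simp
  then have "y = of_rat (Polynomial.coeff h 0)" by (metis coeff_pCons_0 coeff_map_poly of_rat_0)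
  then show ?thesis by (simp add: y_def)
qed

lemma trace_integer: "x \<in> OK \<Longrightarrow> (\<Sum>z\<in>R. conjg z x) \<in> \<int>"
proof (rule rational_algebraic_int_is_int)
  assume x: "x \<in> OK"
  then obtain g where g: "x = rpoly g zeta" using O_closed(12) by (auto simp: K_def')
  show "(\<Sum>z\<in>R. conjg z x) \<in> \<rat>" using trace_rational[of g] conjg_rpoly by (simp add: g)
  show "algebraic_int (\<Sum>z\<in>R. conjg z x)"
    using x by (intro algebraic_int_sum algebraic_int_conjg) (auto simp: O_alt)
qed

text \<open>Orthogonality of the powers of \<open>zeta\<close> gives \<open>m x = (\<Sum>j. tr (x \<zeta>\<^bsup>-j\<^esup>) \<zeta>\<^sup>j)\<close>, so \<open>m\<close> clears the
  denominators of all integers of \<open>K\<close>.\<close>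
lemma m_mult_O:
  assumes "x \<in> OK"
  obtains g where "of_nat m * x = ipoly g zeta"
proof -
  define c where "c j = (\<Sum>z\<in>R. conjg z (x * cnj zeta ^ j))" for j
  have "c j \<in> \<int>" for j unfolding c_def using assms by (intro trace_integer) auto
  then have "\<forall>j. \<exists>k. c j = of_int k" by (metis Ints_cases)
  then obtain k where k: "\<And>j. c j = of_int (k j)" by metis
  have cz: "cnj zeta * zeta = 1" using cnj_unity[of zeta] m_pos power_minus_mult[of m zeta] by simp
  have "(\<Sum>j<m. c j * zeta ^ j) = (\<Sum>z\<in>R. \<Sum>j<m. conjg z x * (cnj z * zeta) ^ j)"
    unfolding c_def sum_distrib_right
    using assms by (subst sum.swap) (simp add: conjg_hom conjg_power cnj_K power_mult_distrib mult_ac)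
  also have "\<dots> = (\<Sum>z\<in>R. if z = zeta then of_nat m * x else 0)"
  proof (rule sum.cong[OF refl])
    fix z assume z: "z \<in> R"
    have zz: "cnj z * z = 1" using cnj_unity[OF R_unity[OF z]] R_unity[OF z] m_pos power_minus_mult[of m z] by simp
    define w where "w = cnj z * zeta"
    have wm: "w ^ m = 1" unfolding w_def power_mult_distrib using R_unity[OF z] by (metis complex_cnj_one complex_cnj_power mult_1 zeta_power_m)
    have "w = 1 \<longleftrightarrow> z = zeta"
    proof
      assume "w = 1"
      then have "z * (cnj z * zeta) = z" by (simp add: w_def)
      moreover have "z * (cnj z * zeta) = zeta" using zz by (metis mult.assoc mult.commute mult_1)
      ultimately show "z = zeta" by simp
    qed (use zz in \<open>simp add: w_def\<close>)
    moreover have "(\<Sum>j<m. w ^ j) = 0" if "w \<noteq> 1" using wm that by (simp add: geometric_sum)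
    ultimately have "(\<Sum>j<m. w ^ j) = (if z = zeta then of_nat m else 0)" by auto
    then show "(\<Sum>j<m. conjg z x * (cnj z * zeta) ^ j) = (if z = zeta then of_nat m * x else 0)"
      using assms by (auto simp: w_def sum_distrib_left[symmetric])
  qed
  also have "\<dots> = of_nat m * x" using zeta_in_R by simp
  finally have "of_nat m * x = (\<Sum>j<m. of_int (k j) * zeta ^ j)" by (simp add: k)
  also have "\<dots> = ipoly (\<Sum>j<m. Polynomial.monom (k j) j) zeta"
    by (simp add: of_int_poly_hom.hom_sum poly_sum map_poly_monom poly_monom)
  finally show ?thesis by (rule that)
qed

text \<open>By Euler's theorem \<open>p ^ d\<close> is 1 modulo \<open>m\<close>, so the iterated
  Frobenius map fixes \<open>zeta\<close> and with it, modulo \<open>p\<close>, every integer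
  polynomial in \<open>zeta\<close>. This applies to \<open>m\<close> times \<open>x\<close>, and
  \<open>m\<close> is invertible modulo \<open>p\<close>.\<close>

lemma O_frobenius:
  assumes p: "prime p" "\<not> p dvd m" and x: "x \<in> OK"
  shows "acong p (x ^ (p ^ d)) x"
proof -
  obtain g where g: "of_nat m * x = ipoly g zeta" using m_mult_O[OF x] .
  define Q where "Q = p ^ d"
  have cop: "coprime p m" using prime_imp_coprime[OF p] .
  have "[p ^ totient m = 1] (mod m)" using euler_theorem[OF cop] .
  then have "[Q = 1] (mod m)" by (simp add: Q_def d_def)
  moreover have "Q \<ge> 1" using prime_gt_0_nat[OF p(1)] by (simp add: Q_def)
  ultimately obtain k where k: "Q = 1 + m * k" by (metis cong_le_nat cong_sym mult.commute add.commute)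
  have zQ: "zeta ^ Q = zeta" unfolding k power_add power_mult by simp
  have ax: "algebraic_int x" using x by (simp add: O_alt)
  have 1: "acong p ((of_nat m * x) ^ Q) (of_nat m * x)"
    using ipoly_frobenius_iterate[OF p(1) algebraic_int_unity[OF zeta_power_m], of g d] zQ by (simp add: g Q_def)
  have "acong p (of_nat m ^ Q) (of_nat m)"
    using ipoly_frobenius_iterate[OF p(1) algebraic_int_1, of "[:int m:]" d] by (simp add: Q_def)
  from acong_cmult[OF algebraic_int_power[OF ax, of Q] acong_sym[OF this]]
  have "acong p (of_nat m * x ^ Q) (of_nat m ^ Q * x ^ Q)" by (simp only: mult.commute)
  then have 2: "acong p (of_nat m * x ^ Q) (of_nat m * x)" using acong_trans 1 by (simp add: power_mult_distrib)
  obtain u v where uv: "u * int p + v * int m = 1"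
    using cop bezout_int[of "int p" "int m"] by (metis coprime_imp_gcd_eq_1 coprime_int_iff)
  have vm: "acong p (of_int v * of_nat m) 1"
    using acong_of_int[of "v * int m" 1 p] uv
    by (simp add: cong_iff_dvd_diff) (metis diff_add_cancel dvd_minus_iff dvd_triv_right minus_diff_eq add_diff_cancel_right')
  have "acong p (of_int v * (of_nat m * x ^ Q)) (of_int v * (of_nat m * x))"
    using acong_cmult[OF algebraic_int_of_int 2] .
  moreover have "acong p (of_int v * (of_nat m * y)) y" if "algebraic_int y" for y
    using acong_cmult[OF that vm] by (simp add: mult_ac)
  ultimately show ?thesis
    using ax algebraic_int_power[OF ax, of Q] acong_trans acong_sym unfolding Q_def by meson
qed

end

section \<open>The space \<open>K \<otimes> \<real>\<close>\<close>

declare plus_fun_apply [simp del] times_fun_apply [simp del] zero_fun_apply [simp del]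

lemma fun_sum_apply: "(\<Sum>i\<in>I. f i) x = (\<Sum>i\<in>I. f i x)"
  by (induction I rule: infinite_finite_induct) (auto simp: plus_fun_apply zero_fun_apply)

lemma scaleR_fun_apply: "(r *\<^sub>R f) x = r *\<^sub>R f x"
  by (simp add: scaleR_fun_def)

lemmas fun_ops = scaleR_fun_apply fun_sum_apply plus_fun_apply times_fun_apply zero_fun_apply

text \<open>AM-GM, from ln x <= x - 1 applied to the quotients by the mean.\<close>

lemma prod_le_mean_power:
  fixes a :: "'i \<Rightarrow> real"
  assumes "finite I" "I \<noteq> {}" "\<And>i. i \<in> I \<Longrightarrow> a i > 0"
  shows "(\<Prod>i\<in>I. a i) \<le> ((\<Sum>i\<in>I. a i) / card I) ^ card I"
proof -
  define A where "A = (\<Sum>i\<in>I. a i) / card I"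
  have n: "card I > 0" using assms by (simp add: card_gt_0_iff)
  have A: "A > 0" unfolding A_def using assms n by (intro divide_pos_pos sum_pos) auto
  have "(\<Sum>i\<in>I. ln (a i / A)) \<le> (\<Sum>i\<in>I. a i / A - 1)"
    using assms(3) A by (intro sum_mono ln_le_minus_one) auto
  also have "\<dots> = (\<Sum>i\<in>I. a i) / A - card I" by (simp add: sum_subtractf sum_divide_distrib)
  also have "(\<Sum>i\<in>I. a i) = A * card I" using n by (simp add: A_def)
  also have "A * card I / A - card I = 0" using A by simp
  finally have "(\<Sum>i\<in>I. ln (a i / A)) \<le> 0" .
  then have "(\<Sum>i\<in>I. ln (a i)) \<le> card I * ln A"
  proof -
    have "(\<Sum>i\<in>I. ln (a i / A)) = (\<Sum>i\<in>I. ln (a i) - ln A)"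
      using assms(3) A by (intro sum.cong refl ln_divide_pos) auto
    then show ?thesis using \<open>(\<Sum>i\<in>I. ln (a i / A)) \<le> 0\<close> by (simp add: sum_subtractf)
  qed
  then have "ln (\<Prod>i\<in>I. a i) \<le> ln (A ^ card I)"
  proof -
    have "a i \<noteq> 0" if "i \<in> I" for i using assms(3)[OF that] by simp
    then show ?thesis using \<open>(\<Sum>i\<in>I. ln (a i)) \<le> card I * ln A\<close> A assms(1) by (simp add: ln_prod ln_realpow)
  qed
  then show ?thesis using assms A by (simp add: A_def prod_pos)
qed

interpretation cnj_hom: comm_ring_hom cnj
  by unfold_locales auto

context cyclotomic
begin

abbreviation S where "S \<equiv> embeddings K"
abbreviation \<mu> where "\<mu> \<equiv> mink_emb K"
abbreviation V where "V \<equiv> mink_space K"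
abbreviation ip where "ip \<equiv> mink_ip K"

lemma finite_S [simp]: "finite S"
  using bij_betw_finite[OF bij_emb] by simp

lemma card_S: "card S = d"
  using bij_betw_same_card[OF bij_emb] by (simp add: card_R d_def)

lemma S_emb: "\<sigma> \<in> S \<Longrightarrow> \<exists>z\<in>R. \<sigma> = emb z"
  using bij_emb by (auto simp: bij_betw_def)

lemma emb_S [simp]: "z \<in> R \<Longrightarrow> emb z \<in> S"
  using bij_betwE[OF bij_emb] by auto

lemma mu_emb [simp]: "z \<in> R \<Longrightarrow> x \<in> K \<Longrightarrow> \<mu> x (emb z) = conjg z x"
  using emb_S[of z] by (simp add: mink_emb_def) (simp add: emb_def)

lemma mu_outside: "\<sigma> \<notin> S \<Longrightarrow> \<mu> x \<sigma> = 0"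
  by (simp add: mink_emb_def)

lemma sum_S: "(\<Sum>\<sigma>\<in>S. g \<sigma>) = (\<Sum>z\<in>R. g (emb z))"
  by (rule sum.reindex_bij_betw[OF bij_emb, symmetric])

lemma mink_eqI: "(\<And>z. z \<in> R \<Longrightarrow> u (emb z) = v (emb z)) \<Longrightarrow> (\<And>\<sigma>. \<sigma> \<notin> S \<Longrightarrow> u \<sigma> = v \<sigma>) \<Longrightarrow> u = v"
  using S_emb by (metis ext)

lemma mu_hom:
  assumes "x \<in> K" "y \<in> K"
  shows "\<mu> (x + y) = \<mu> x + \<mu> y" "\<mu> (x - y) = \<mu> x - \<mu> y" "\<mu> (x * y) = \<mu> x * \<mu> y"
  by (rule mink_eqI; use assms in \<open>simp add: conjg_hom mu_outside fun_ops\<close>)+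

lemma mu_0 [simp]: "\<mu> 0 = 0"
  by (rule mink_eqI) (auto simp: mu_outside fun_ops)

lemma of_real_of_rat [simp]: "complex_of_real (of_rat q) = of_rat q"
  by (cases q) (simp add: of_rat_rat)

lemma mu_rat: "x \<in> K \<Longrightarrow> \<mu> (of_rat q * x) = of_rat q *\<^sub>R \<mu> x"
  by (rule mink_eqI) (auto simp: mu_outside conjg_hom scaleR_fun_apply scaleR_conv_of_real)

lemma mu_of_nat: "x \<in> K \<Longrightarrow> \<mu> (of_nat n * x) = of_nat n *\<^sub>R \<mu> x"
  using mu_rat[of x "of_nat n"] by simp

lemma mu_sum: "(\<And>i. i \<in> I \<Longrightarrow> g i \<in> K) \<Longrightarrow> \<mu> (\<Sum>i\<in>I. g i) = (\<Sum>i\<in>I. \<mu> (g i))"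
  by (induction I rule: infinite_finite_induct) (auto simp: mu_hom K_sum)

definition cnjf :: "mink \<Rightarrow> mink" where "cnjf v = (\<lambda>\<sigma>. cnj (v \<sigma>))"

lemma cnjf_simps [simp]:
  "cnjf (u + v) = cnjf u + cnjf v" "cnjf (u - v) = cnjf u - cnjf v" "cnjf (r *\<^sub>R v) = r *\<^sub>R cnjf v" "cnjf (cnjf v) = v"
  "cnjf (u * v) = cnjf u * cnjf v" "cnjf (- v) = - cnjf v" "cnjf 0 = 0"
  by (auto simp: cnjf_def fun_eq_iff fun_ops)

lemma cnjf_apply: "cnjf v \<sigma> = cnj (v \<sigma>)"
  by (simp add: cnjf_def)

lemmas fun_apply = cnjf_apply fun_ops

lemma mu_cnj: "x \<in> K \<Longrightarrow> \<mu> (cnj x) = cnjf (\<mu> x)"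
  by (rule mink_eqI) (auto simp: mu_outside cnj_K cnjf_apply)

lemma mu_eq_0: "x \<in> K \<Longrightarrow> \<mu> x (emb z) = 0 \<Longrightarrow> z \<in> R \<Longrightarrow> x = 0"
  using conjg_nonzero by auto

lemma mu_inj: "x \<in> K \<Longrightarrow> \<mu> x = 0 \<Longrightarrow> x = 0"
  using mu_eq_0[OF _ _ zeta_in_R] by (simp add: fun_ops)

lemma V_subspace: "Real_Vector_Spaces.subspace V"
  unfolding mink_space_def by (rule real_vector.subspace_span)

lemma mu_in_V [simp]: "x \<in> K \<Longrightarrow> \<mu> x \<in> V"
  unfolding mink_space_def by (intro real_vector.span_base) simp

lemma V_induct [consumes 1, case_names subspace base]:
  assumes "v \<in> V" "Real_Vector_Spaces.subspace {v. Q v}" "\<And>x. x \<in> K \<Longrightarrow> Q (\<mu> x)"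
  shows "Q v"
  using assms(1) unfolding mink_space_def
  by (induction v rule: real_vector.span_induct) (use assms(2,3) in auto)

lemma V_outside: "v \<in> V \<Longrightarrow> \<sigma> \<notin> S \<Longrightarrow> v \<sigma> = 0"
  by (induction v rule: V_induct) (auto simp: real_vector.subspace_def mu_outside fun_ops)

lemma scaleR_mult_fun: "(r *\<^sub>R u) * v = r *\<^sub>R (u * v)" "v * (r *\<^sub>R u) = r *\<^sub>R (v * u)" for u v :: mink
  by (simp_all add: fun_eq_iff fun_ops)

lemma V_mult: "u \<in> V \<Longrightarrow> v \<in> V \<Longrightarrow> u * v \<in> V"
proof (induction u rule: V_induct)
  case subspace
  then show ?case using V_subspace
    by (simp add: real_vector.subspace_def distrib_right scaleR_mult_fun)
next
  case (base x)
  show ?case using \<open>v \<in> V\<close>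
  proof (induction v rule: V_induct)
    case subspace
    show ?case using V_subspace by (simp add: real_vector.subspace_def distrib_left scaleR_mult_fun)
  next
    case (base y)
    then show ?case using mu_hom(3)[OF \<open>x \<in> K\<close> base] \<open>x \<in> K\<close> by (metis K_closed(3) mu_in_V)
  qed
qed

lemma V_cnjf: "v \<in> V \<Longrightarrow> cnjf v \<in> V"
proof (induction v rule: V_induct)
  case (base x)
  then show ?case using mu_cnj[OF base] mu_in_V[OF cnj_K(1)[OF base]] by simp
qed (use V_subspace in \<open>auto simp: real_vector.subspace_def\<close>)

text \<open>Traces of elements of K are rational, and the property passes to real combinations. On
  \<open>V\<close> the \<open>Re\<close> in \<open>mink_ip\<close> therefore discards
  nothing.\<close>

lemma V_sum_real: "v \<in> V \<Longrightarrow> Im (\<Sum>\<sigma>\<in>S. v \<sigma>) = 0"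
proof (induction v rule: V_induct)
  case (base x)
  then obtain g where "x = rpoly g zeta" by (auto simp: K_def')
  then have "(\<Sum>\<sigma>\<in>S. \<mu> x \<sigma>) \<in> \<rat>"
    using trace_rational[of g] conjg_rpoly base by (simp add: sum_S)
  then obtain q where "(\<Sum>\<sigma>\<in>S. \<mu> x \<sigma>) = of_rat q" by (elim Rats_cases)
  moreover have "Im (of_rat q) = 0" by (metis Im_complex_of_real of_real_of_rat)
  ultimately show ?case by (simp del: Im_sum)
qed (auto simp: real_vector.subspace_def sum.distrib sum_distrib_left[symmetric] fun_ops)

lemma of_real_ip: "u \<in> V \<Longrightarrow> v \<in> V \<Longrightarrow> complex_of_real (ip u v) = (\<Sum>\<sigma>\<in>S. u \<sigma> * cnj (v \<sigma>))"
  using V_sum_real[OF V_mult[OF _ V_cnjf], of u v] by (simp add: complex_eq_iff mink_ip_def fun_apply)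

lemma ip_self: "ip v v = (\<Sum>\<sigma>\<in>S. (cmod (v \<sigma>))\<^sup>2)"
  by (simp add: mink_ip_def complex_mult_cnj cmod_power2)

lemma ip_shift: "ip (u * w) v = ip u (cnjf w * v)"
  by (simp add: mink_ip_def mult_ac fun_apply)

lemma ip_cnjf: "ip (cnjf u) (cnjf v) = ip u v"
  by (simp add: mink_ip_def cnjf_apply)

definition bz where "bz i = \<mu> (zeta ^ i)"

lemma bz_V [simp]: "bz i \<in> V"
  by (simp add: bz_def)

lemma span_bz: "Real_Vector_Spaces.span (bz ` {..<d}) = V"
proof
  show "Real_Vector_Spaces.span (bz ` {..<d}) \<subseteq> V"
    using V_subspace by (intro real_vector.span_minimal) auto
  have "\<mu> x \<in> Real_Vector_Spaces.span (bz ` {..<d})" if xK: "x \<in> K" for x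
  proof -
    obtain g where g: "x = rpoly g zeta" "Polynomial.degree g < d" using K_repr[OF xK] by blast
    then have "\<mu> x = (\<Sum>i<d. of_rat (Polynomial.coeff g i) *\<^sub>R bz i)"
      by (simp add: rpoly_altdef bz_def mu_sum mu_rat)
    then show ?thesis
      by (simp only:) (intro real_vector.span_sum real_vector.span_scale real_vector.span_base, simp)
  qed
  then show "V \<subseteq> Real_Vector_Spaces.span (bz ` {..<d})"
    unfolding mink_space_def by (intro real_vector.span_minimal) auto
qed

text \<open>A real relation between the powers is a polynomial of degree below \<open>d\<close> that
  vanishes at the \<open>d\<close> elements of \<open>R\<close>.\<close>

lemma bz_lin_indep:
  assumes "(\<Sum>i<d. c i *\<^sub>R bz i) = 0" "i < d"
  shows "c i = 0"
proof -
  define p where "p = (\<Sum>i<d. Polynomial.monom (complex_of_real (c i)) i)"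
  have "poly p z = 0" if z: "z \<in> R" for z
  proof -
    have "(\<Sum>i<d. c i *\<^sub>R bz i) (emb z) = 0" using assms(1) by (simp add: zero_fun_apply)
    then show ?thesis using z
      by (simp add: p_def poly_sum poly_monom fun_apply bz_def conjg_power conjg_hom scaleR_conv_of_real)
  qed
  moreover have "Polynomial.degree p < card R"
    unfolding p_def card_R d_def[symmetric]
  proof (rule degree_sum_less)
    fix i assume "i \<in> {..<d}"
    then show "Polynomial.degree (Polynomial.monom (complex_of_real (c i)) i) < d"
      using degree_monom_le[of "complex_of_real (c i)" i] by simp
  qed (use d_pos in auto)
  ultimately have "p = 0" using poly_eq_0_many_roots[of R p] by simp
  moreover have "Polynomial.coeff p i = complex_of_real (c i)"
    unfolding p_def coeff_sum using assms(2) by (simp add: if_distrib cong: if_cong)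
  ultimately show ?thesis by simp
qed

end

sublocale cyclotomic \<subseteq> V: euclidean_subspace "mink_space K" "mink_ip K"
proof
  show "Real_Vector_Spaces.subspace V" by (rule V_subspace)
  show "\<exists>S. finite S \<and> Real_Vector_Spaces.span S = V" using span_bz by blast
  fix x y z :: mink and r :: real
  show "ip (x + y) z = ip x z + ip y z" by (simp add: mink_ip_def distrib_right sum.distrib fun_ops)
  show "ip (r *\<^sub>R x) z = r * ip x z" by (simp add: mink_ip_def sum_distrib_left algebra_simps fun_ops)
  show "ip x y = ip y x" by (simp add: mink_ip_def mult_ac)
  show "ip x x > 0" if "x \<in> V" "x \<noteq> 0"
  proof -
    obtain \<sigma> where "x \<sigma> \<noteq> 0" using \<open>x \<noteq> 0\<close> by (auto simp: fun_eq_iff fun_ops)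
    moreover from this have "\<sigma> \<in> S" using V_outside[OF that(1)] by auto
    ultimately show ?thesis unfolding ip_self by (intro sum_pos2[of _ \<sigma>]) auto
  qed
qed

context cyclotomic
begin

lemma V_N: "V.N = d"
proof -
  have inj: "inj_on bz {..<d}"
  proof (rule inj_onI, rule ccontr)
    fix i j assume ij: "i \<in> {..<d}" "j \<in> {..<d}" "bz i = bz j" "i \<noteq> j"
    have "(\<Sum>k<d. ((if k = i then 1 else 0) - (if k = j then 1 else 0)) *\<^sub>R bz k) =
        (\<Sum>k<d. (if k = i then bz i else 0) - (if k = j then bz j else 0))"
      by (intro sum.cong) auto
    also have "\<dots> = 0" using ij by (simp add: sum_subtractf)
    finally show False using bz_lin_indep[of "\<lambda>k. (if k = i then 1 else 0) - (if k = j then 1 else 0)" i] ij by simp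
  qed
  have "\<not> Real_Vector_Spaces.dependent (bz ` {..<d})"
  proof
    assume "Real_Vector_Spaces.dependent (bz ` {..<d})"
    then obtain u v where u: "(\<Sum>v\<in>bz ` {..<d}. u v *\<^sub>R v) = 0" "v \<in> bz ` {..<d}" "u v \<noteq> 0"
      using real_vector.dependent_finite[of "bz ` {..<d}"] by auto
    then show False using bz_lin_indep[of "\<lambda>i. u (bz i)"] sum.reindex[OF inj, of "\<lambda>v. u v *\<^sub>R v"] by auto
  qed
  then show ?thesis
    using real_vector.dim_span_eq_card_independent[of "bz ` {..<d}"] V.dim_V by (simp add: span_bz card_image[OF inj])
qed

lemma bz_dual: "\<exists>b'. V.dual_pair bz b'"
proof (rule V.spanning_dual_pair)
  show "bz ` {..<V.N} \<subseteq> V" by (rule image_subsetI) simp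
  show "Real_Vector_Spaces.span (bz ` {..<V.N}) = V" unfolding V_N by (rule span_bz)
qed

section \<open>The lattice of integers and ideal lattices\<close>

definition OV where "OV = \<mu> ` OK"

lemma ip_OV_int: "x \<in> OK \<Longrightarrow> y \<in> OK \<Longrightarrow> ip (\<mu> x) (\<mu> y) \<in> \<int>"
proof -
  assume xy: "x \<in> OK" "y \<in> OK"
  then have "(\<Sum>z\<in>R. conjg z (x * cnj y)) \<in> \<int>" by (intro trace_integer) auto
  then obtain k where "(\<Sum>z\<in>R. conjg z (x * cnj y)) = of_int k" by (elim Ints_cases)
  moreover have "complex_of_real (ip (\<mu> x) (\<mu> y)) = (\<Sum>z\<in>R. conjg z (x * cnj y))"
    using xy by (subst of_real_ip) (auto simp: sum_S conjg_hom cnj_K)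
  ultimately have "complex_of_real (ip (\<mu> x) (\<mu> y)) = complex_of_real (of_int k)" by simp
  then show ?thesis unfolding of_real_eq_iff by simp
qed

text \<open>Discrete because scalar products of integers are traces of integers, so that a nonzero
  squared length is at least 1.\<close>

lemma OV_lattice: "is_lattice V OV"
proof (rule V.discrete_subgroup_is_lattice[of _ 1])
  show "OV \<subseteq> V" by (auto simp: OV_def)
  show "0 \<in> OV" unfolding OV_def by (intro image_eqI[of _ _ 0]) auto
  show "x - y \<in> OV" if xy: "x \<in> OV" "y \<in> OV" for x y
  proof -
    obtain a b where "a \<in> OK" "x = \<mu> a" "b \<in> OK" "y = \<mu> b" using xy by (auto simp: OV_def)
    then show ?thesis unfolding OV_def by (intro image_eqI[of _ _ "a - b"]) (auto simp: mu_hom)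
  qed
  show "ip x x \<ge> 1" if x: "x \<in> OV" "x \<noteq> 0" for x
  proof -
    obtain a where a: "a \<in> OK" "x = \<mu> a" using x by (auto simp: OV_def)
    obtain k where k: "ip x x = of_int k" using ip_OV_int[OF a(1) a(1)] a(2) by (metis Ints_cases)
    have "ip x x > 0" using a x(2) by (intro V.ip_pos) auto
    then show ?thesis unfolding k by simp
  qed
  have "bz ` {..<d} \<subseteq> OV" by (auto simp: bz_def OV_def)
  then have "V \<subseteq> Real_Vector_Spaces.span OV" using real_vector.span_mono span_bz by blast
  moreover have "Real_Vector_Spaces.span OV \<subseteq> V"
    using V_subspace by (intro real_vector.span_minimal) (auto simp: OV_def)
  ultimately show "Real_Vector_Spaces.span OV = V" by blast
qed simp

text \<open>Gram determinants are computed as \<open>|det (\<sigma>\<^sub>j b\<^sub>i)|\<^sup>2\<close>.\<close>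
definition en where "en = (SOME h. bij_betw h {..<d} S)"

lemma bij_en: "bij_betw en {..<d} S"
proof -
  have "\<exists>h. bij_betw h {..<d} S" using ex_bij_betw_nat_finite[of S] by (simp add: card_S atLeast0LessThan)
  then show ?thesis unfolding en_def by (rule someI_ex)
qed

definition Sm where "Sm b = Matrix.mat d d (\<lambda>(i,j). b i (en j) :: complex)"

lemma Sm_carrier [simp]: "Sm b \<in> carrier_mat d d"
  by (simp add: Sm_def)

lemma det_gram:
  assumes "\<And>i. i < d \<Longrightarrow> b i \<in> V"
  shows "Determinant.det (V.gram b) = (cmod (Determinant.det (Sm b)))\<^sup>2"
proof -
  have "map_mat complex_of_real (V.gram b) = Sm b * transpose_mat (map_mat cnj (Sm b))"
  proof (rule eq_matI)
    fix i j assume "i < dim_row (Sm b * transpose_mat (map_mat cnj (Sm b)))"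
      "j < dim_col (Sm b * transpose_mat (map_mat cnj (Sm b)))"
    then have ij: "i < d" "j < d" by (auto simp: Sm_def)
    have "complex_of_real (ip (b i) (b j)) = (\<Sum>k<d. b i (en k) * cnj (b j (en k)))"
      using of_real_ip[OF assms assms, OF ij] sum.reindex_bij_betw[OF bij_en, of "\<lambda>\<sigma>. b i \<sigma> * cnj (b j \<sigma>)"] by simp
    then show "map_mat complex_of_real (V.gram b) $$ (i,j) = (Sm b * transpose_mat (map_mat cnj (Sm b))) $$ (i,j)"
      using ij by (simp add: V.gram_def V_N Sm_def scalar_prod_def atLeast0LessThan)
  qed (auto simp: V.gram_def V_N Sm_def)
  then have "complex_of_real (Determinant.det (V.gram b)) = Determinant.det (Sm b * transpose_mat (map_mat cnj (Sm b)))"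
    by (metis of_real_hom.hom_det)
  also have "\<dots> = Determinant.det (Sm b) * cnj (Determinant.det (Sm b))"
    by (subst det_mult[of _ d]) (auto simp: det_transpose[of _ d] cnj_hom.hom_det)
  also have "\<dots> = complex_of_real ((cmod (Determinant.det (Sm b)))\<^sup>2)"
    by (simp only: complex_norm_square[symmetric] of_real_power)
  finally show ?thesis unfolding of_real_eq_iff .
qed

text \<open>Multiplication by a vector without zero components is injective on \<open>V\<close>, so
  it preserves independence.\<close>

lemma mult_independent:
  assumes v: "v \<in> V" "\<And>\<sigma>. \<sigma> \<in> S \<Longrightarrow> v \<sigma> \<noteq> 0" and b: "V.dual_pair b b'"
  shows "\<exists>c'. V.dual_pair (\<lambda>i. v * b i) c'"
proof (rule V.spanning_dual_pair)
  have bV: "b i \<in> V" if "i < V.N" for i using V.dual_pairD(1)[OF b that] .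
  show sub: "(\<lambda>i. v * b i) ` {..<V.N} \<subseteq> V" using V_mult[OF v(1)] bV by auto
  have canc: "x = y" if "x \<in> V" "y \<in> V" "v * x = v * y" for x y
  proof (rule mink_eqI)
    fix z assume "z \<in> R"
    then show "x (emb z) = y (emb z)" using fun_cong[OF that(3), of "emb z"] v(2) by (simp add: fun_ops)
  next
    fix \<sigma> assume "\<sigma> \<notin> S"
    then show "x \<sigma> = y \<sigma>" using V_outside[OF that(1)] V_outside[OF that(2)] by simp
  qed
  have inj: "inj_on (\<lambda>i. v * b i) {..<V.N}"
    using canc bV V.dual_pair_inj[OF b] by (auto simp: inj_on_def)
  have "\<not> Real_Vector_Spaces.dependent ((\<lambda>i. v * b i) ` {..<V.N})"
  proof
    assume "Real_Vector_Spaces.dependent ((\<lambda>i. v * b i) ` {..<V.N})"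
    then obtain u w where u: "(\<Sum>w\<in>(\<lambda>i. v * b i) ` {..<V.N}. u w *\<^sub>R w) = 0" "w \<in> (\<lambda>i. v * b i) ` {..<V.N}" "u w \<noteq> 0"
      using real_vector.dependent_finite[of "(\<lambda>i. v * b i) ` {..<V.N}"] by auto
    then obtain j where j: "j < V.N" "w = v * b j" by auto
    have "(\<Sum>i<V.N. u (v * b i) *\<^sub>R (v * b i)) = 0"
      using u(1) sum.reindex[OF inj, of "\<lambda>w. u w *\<^sub>R w"] by simp
    moreover have "(\<Sum>i<V.N. u (v * b i) *\<^sub>R (v * b i)) = v * (\<Sum>i<V.N. u (v * b i) *\<^sub>R b i)"
      by (simp add: sum_distrib_left scaleR_mult_fun)
    ultimately have "v * (\<Sum>i<V.N. u (v * b i) *\<^sub>R b i) = v * 0" by simp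
    moreover have "(\<Sum>i<V.N. u (v * b i) *\<^sub>R b i) \<in> V"
      by (intro V.V_sum V.V_closed(4) bV) simp
    ultimately have "(\<Sum>i<V.N. u (v * b i) *\<^sub>R b i) = 0"
      using canc V.V_closed(1) by metis
    then have "u (v * b j) = 0" using V.ip_dual_sum[OF b j(1), of "\<lambda>i. u (v * b i)"] by simp
    then show False using u j by simp
  qed
  then show "Real_Vector_Spaces.span ((\<lambda>i. v * b i) ` {..<V.N}) = V"
    using V.independent_spans[OF sub inj] by simp
qed

text \<open>Multiplication by \<open>v\<close> multiplies the matrix of embeddings by the diagonal
  matrix of the components of \<open>v\<close>, so the covolume is scaled by the absolute norm of
  \<open>v\<close>.\<close>

lemma mult_lattice:
  assumes v: "v \<in> V" "\<And>\<sigma>. \<sigma> \<in> S \<Longrightarrow> v \<sigma> \<noteq> 0" and L: "is_lattice V L"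
  shows "is_lattice V ((*) v ` L)" "covolume V ip ((*) v ` L) = (\<Prod>\<sigma>\<in>S. cmod (v \<sigma>)) * covolume V ip L"
proof -
  obtain b b' where b: "V.dual_pair b b'" "L = V.lat b" using L V.is_lattice_iff by blast
  obtain c' where c: "V.dual_pair (\<lambda>i. v * b i) c'" using mult_independent[OF v b(1)] by blast
  have bV: "b i \<in> V" if "i < d" for i using V.dual_pairD(1)[OF b(1)] that by (simp add: V_N)
  have im: "(*) v ` L = V.lat (\<lambda>i. v * b i)"
  proof -
    have "v * (\<Sum>i<V.N. real_of_int (k i) *\<^sub>R b i) = (\<Sum>i<V.N. real_of_int (k i) *\<^sub>R (v * b i))" for k :: "nat \<Rightarrow> int"
      by (simp add: sum_distrib_left scaleR_mult_fun)
    then show ?thesis unfolding b(2) V.lat_def by (auto simp: image_image)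
  qed
  show "is_lattice V ((*) v ` L)" using im c V.is_lattice_iff by blast
  have "Sm (\<lambda>i. v * b i) = Sm b * Matrix.mat d d (\<lambda>(i,j). if i = j then v (en i) else 0)" (is "_ = _ * ?D")
  proof (rule eq_matI)
    fix i j assume "i < dim_row (Sm b * ?D)" "j < dim_col (Sm b * ?D)"
    then have ij: "i < d" "j < d" by (auto simp: Sm_def)
    have "(\<Sum>k<d. b i (en k) * (if k = j then v (en k) else 0)) = b i (en j) * v (en j)"
      using ij by (simp add: if_distrib cong: if_cong)
    then show "Sm (\<lambda>i. v * b i) $$ (i,j) = (Sm b * ?D) $$ (i,j)"
      using ij by (simp add: Sm_def fun_ops scalar_prod_def atLeast0LessThan mult.commute)
  qed (auto simp: Sm_def)
  moreover have "Determinant.det ?D = (\<Prod>\<sigma>\<in>S. v \<sigma>)"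
  proof -
    have "Determinant.det ?D = prod_list (diag_mat ?D)"
      by (rule det_upper_triangular[of _ d]) (auto simp: upper_triangular_def)
    also have "\<dots> = (\<Prod>i<d. v (en i))"
      by (simp add: diag_mat_def prod.list_conv_set_nth atLeast0LessThan)
    also have "\<dots> = (\<Prod>\<sigma>\<in>S. v \<sigma>)" by (rule prod.reindex_bij_betw[OF bij_en])
    finally show ?thesis .
  qed
  ultimately have "Determinant.det (Sm (\<lambda>i. v * b i)) = Determinant.det (Sm b) * (\<Prod>\<sigma>\<in>S. v \<sigma>)"
    using det_mult[of "Sm b" d ?D] by simp
  then have "cmod (Determinant.det (Sm (\<lambda>i. v * b i))) = (\<Prod>\<sigma>\<in>S. cmod (v \<sigma>)) * cmod (Determinant.det (Sm b))"
    by (simp add: norm_mult prod_norm mult.commute)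
  then show "covolume V ip ((*) v ` L) = (\<Prod>\<sigma>\<in>S. cmod (v \<sigma>)) * covolume V ip L"
    unfolding im V.covolume_lat(1)[OF c]
    using V.covolume_lat(1)[OF b(1)] b(2) det_gram[of "\<lambda>i. v * b i"] det_gram[of b] V_mult[OF v(1)] bV
    by (simp add: abs_mult prod_nonneg)
qed

lemma cnjf_isometry: "linear_isometry V ip cnjf"
  unfolding linear_isometry_def
proof (intro conjI)
  show "bij_betw cnjf V V"
    by (rule bij_betwI[where g = cnjf]) (auto simp: V_cnjf)
qed (auto simp: ip_cnjf)

text \<open>The powers of \<open>zeta\<close> generate a sublattice whose covolume is the modulus of
  a determinant with entries of modulus 1, and the Leibniz formula has d! terms. This is a crude
  bound for the square root of |d_K|.\<close>

lemma covolume_OV_le: "covolume V ip OV \<le> fact d"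
proof -
  obtain b' where b': "V.dual_pair bz b'" using bz_dual by blast
  have "bz i \<in> OV" for i by (auto simp: bz_def OV_def)
  have natmul: "real k *\<^sub>R x \<in> OV" if "x \<in> OV" for k x
    by (induction k) (auto simp: scaleR_add_left V.lattice_closed[OF OV_lattice] that)
  have intmul: "real_of_int k *\<^sub>R x \<in> OV" if "x \<in> OV" for k x
    using natmul[OF that] V.lattice_closed(4)[OF OV_lattice natmul[OF that]] by (cases k rule: int_cases2) auto
  have "(\<Sum>i<k. real_of_int (c i) *\<^sub>R bz i) \<in> OV" for k c
    by (induction k) (auto simp: V.lattice_closed[OF OV_lattice] intmul \<open>\<And>i. bz i \<in> OV\<close>)
  then have "V.lat bz \<subseteq> OV" by (auto simp: V.lat_def)
  moreover have "is_lattice V (V.lat bz)" using b' V.is_lattice_iff by blast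
  ultimately have "covolume V ip OV \<le> covolume V ip (V.lat bz)"
    by (intro V.covolume_sublattice OV_lattice)
  also have "\<dots> = cmod (Determinant.det (Sm bz))"
    using V.covolume_lat(1)[OF b'] det_gram[of bz] by simp
  also have "\<dots> \<le> (\<Sum>p\<in>{p. p permutes {0..<d}}. cmod (signof p * (\<Prod>i = 0..<d. Sm bz $$ (i, p i))))"
    unfolding det_def'[OF Sm_carrier] by (rule norm_sum)
  also have "\<dots> \<le> (\<Sum>p\<in>{p. p permutes {0..<d}}. 1)"
  proof (rule sum_mono)
    fix p assume p: "p \<in> {p. p permutes {0..<d}}"
    have "cmod (Sm bz $$ (i, p i)) = 1" if i: "i < d" for i
    proof -
      have pi: "p i < d" using p i permutes_in_image[of p "{0..<d}" i] by auto
      then obtain z where z: "z \<in> R" "en (p i) = emb z" using S_emb bij_betwE[OF bij_en] by blast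
      have "cmod z ^ m = 1" using R_unity[OF z(1)] by (metis norm_one norm_power)
      then have "cmod z = 1" using power_eq_iff_eq_base[of m "cmod z" 1] m_pos by simp
      then show ?thesis using z i pi by (simp add: Sm_def bz_def conjg_power conjg_hom norm_power)
    qed
    then have "cmod (\<Prod>i = 0..<d. Sm bz $$ (i, p i)) = 1" by (simp add: prod_norm[symmetric])
    moreover have "cmod (signof p) = 1" by (simp add: sign_def)
    ultimately show "cmod (signof p * (\<Prod>i = 0..<d. Sm bz $$ (i, p i))) \<le> 1" by (simp add: norm_mult)
  qed
  also have "\<dots> = fact d" by (simp add: card_permutations[of "{0..<d}" d])
  finally show ?thesis .
qed

lemma prod_le_ip:
  assumes "\<And>\<sigma>. \<sigma> \<in> S \<Longrightarrow> v \<sigma> \<noteq> 0"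
  shows "(\<Prod>\<sigma>\<in>S. cmod (v \<sigma>))\<^sup>2 \<le> (ip v v / d) ^ d"
proof -
  have "S \<noteq> {}" using card_S d_pos by force
  then have "(\<Prod>\<sigma>\<in>S. (cmod (v \<sigma>))\<^sup>2) \<le> (ip v v / d) ^ d"
    using prod_le_mean_power[of S "\<lambda>\<sigma>. (cmod (v \<sigma>))\<^sup>2"] assms by (simp add: card_S ip_self)
  then show ?thesis by (simp add: prod_power_distrib)
qed

text \<open>A multiple of \<open>v\<close> comes from an element of K, and embeddings are injective.
  This excludes the zero components that general vectors of \<open>V\<close> may have.\<close>

lemma multiple_nonzero:
  assumes "v \<noteq> 0" "real k *\<^sub>R v \<in> OV" "k \<ge> 1" "\<sigma> \<in> S"
  shows "v \<sigma> \<noteq> 0"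
proof
  assume 0: "v \<sigma> = 0"
  obtain a where a: "a \<in> OK" "real k *\<^sub>R v = \<mu> a" using assms(2) by (auto simp: OV_def)
  obtain z where z: "z \<in> R" "\<sigma> = emb z" using S_emb assms(4) by blast
  have "\<mu> a (emb z) = 0" using 0 z(2) fun_cong[OF a(2), of \<sigma>] by (simp add: fun_ops)
  then have "a = 0" using mu_eq_0[OF _ _ z(1)] a(1) by blast
  then show False using a(2) assms(1,3) by simp
qed

text \<open>The products of \<open>v\<close> with the integers of K form a sublattice of
  \<open>L\<close>. Comparing covolumes bounds the norm of \<open>v\<close> from below, hence by
  AM-GM its length.\<close>

lemma short_vectors_bound:
  assumes L: "is_lattice V L" "\<And>a x. a \<in> OK \<Longrightarrow> x \<in> L \<Longrightarrow> \<mu> a * x \<in> L"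
    and v: "v \<in> L" "\<And>\<sigma>. \<sigma> \<in> S \<Longrightarrow> v \<sigma> \<noteq> 0"
  shows "covolume V ip L \<le> sqrt ((ip v v / d) ^ d) * covolume V ip OV"
proof -
  have vV: "v \<in> V" using V.lattice_closed(5)[OF L(1) v(1)] .
  note ml = mult_lattice[OF vV v(2) OV_lattice]
  have "(*) v ` OV \<subseteq> L"
    using L(2) v(1) by (auto simp: OV_def mult.commute[of v])
  then have "covolume V ip L \<le> (\<Prod>\<sigma>\<in>S. cmod (v \<sigma>)) * covolume V ip OV"
    using V.covolume_sublattice[OF L(1) ml(1)] ml(2) by simp
  also have "(\<Prod>\<sigma>\<in>S. cmod (v \<sigma>)) \<le> sqrt ((ip v v / d) ^ d)"
    using prod_le_ip[OF v(2)] by (intro real_le_rsqrt) auto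
  finally show ?thesis using V.covolume_pos[OF OV_lattice] by (simp add: mult_right_mono)
qed

text \<open>Minkowski gives one short \<open>v\<close>. Its multiples by powers of
  \<open>zeta\<close> are equally long and independent, so rounding with respect to them bounds the
  distance to \<open>L\<close>: a single short vector does the work of a reduced basis.\<close>

lemma covering_bound:
  assumes L: "is_lattice V L" "\<And>a x. a \<in> OK \<Longrightarrow> x \<in> L \<Longrightarrow> \<mu> a * x \<in> L"
    and nz: "\<And>v \<sigma>. v \<in> L \<Longrightarrow> v \<noteq> 0 \<Longrightarrow> \<sigma> \<in> S \<Longrightarrow> v \<sigma> \<noteq> 0"
    and s: "s > 0" "s ^ d > covolume V ip L" and y: "y \<in> V"
  shows "\<exists>l\<in>L. ip (y - l) (y - l) \<le> (real d * s / 2)\<^sup>2"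
proof -
  obtain v where v: "v \<in> L" "v \<noteq> 0" "ip v v \<le> real d * s\<^sup>2"
    using V.short_vector[OF L(1), of s] s by (auto simp: V_N)
  have vV: "v \<in> V" using V.lattice_closed(5)[OF L(1) v(1)] .
  have vnz: "\<And>\<sigma>. \<sigma> \<in> S \<Longrightarrow> v \<sigma> \<noteq> 0" using nz v by blast
  obtain b' where b': "V.dual_pair bz b'" using bz_dual by blast
  obtain c' where c': "V.dual_pair (\<lambda>i. v * bz i) c'" using mult_independent[OF vV vnz b'] by blast
  have "v * bz i \<in> L" for i using L(2)[of "zeta ^ i" v] v(1) by (simp add: bz_def mult.commute[of v])
  moreover have "ip (v * bz i) (v * bz i) = ip v v" for i
  proof -
    have "cmod ((v * bz i) \<sigma>) = cmod (v \<sigma>)" if \<sigma>: "\<sigma> \<in> S" for \<sigma>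
    proof -
      obtain z where z: "z \<in> R" "\<sigma> = emb z" using S_emb \<sigma> by blast
      have "cmod z ^ m = 1" using R_unity[OF z(1)] by (metis norm_one norm_power)
      then have "cmod z = 1" using power_eq_iff_eq_base[of m "cmod z" 1] m_pos by simp
      then show ?thesis using z by (simp add: bz_def conjg_power conjg_hom norm_mult norm_power fun_ops)
    qed
    then show ?thesis by (simp add: ip_self)
  qed
  ultimately obtain l where "l \<in> L" "ip (y - l) (y - l) \<le> real d * (real d * s\<^sup>2) / 4"
    using V.covering_radius[OF L(1), of "\<lambda>i. v * bz i" y "real d * s\<^sup>2"] V.dual_pair_span[OF c'] v(3) y
    by (auto simp: V_N)
  then show ?thesis by (intro bexI[of _ l]) (auto simp: power_mult_distrib power_divide power2_eq_square mult_ac)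
qed

end

section \<open>Prime ideals and dual modules\<close>

locale cyclotomic_prime = cyclotomic +
  fixes P :: "complex set" and p :: nat
  assumes p: "prime p" "\<not> p dvd m" and P_over: "prime_over (cyclotomic_field m) P p"
begin

lemma P_prime: "primeideal P (complex_ring OK)"
  using P_over by (simp add: prime_over_def OK_def K_def)

lemma p_pos: "p > 0"
  using prime_gt_0_nat[OF p(1)] .

lemma P_facts:
  "P \<subseteq> OK" "0 \<in> P" "x \<in> P \<Longrightarrow> y \<in> P \<Longrightarrow> x + y \<in> P" "a \<in> OK \<Longrightarrow> x \<in> P \<Longrightarrow> a * x \<in> P" "1 \<notin> P"
  "a \<in> OK \<Longrightarrow> b \<in> OK \<Longrightarrow> a * b \<in> P \<Longrightarrow> a \<in> P \<or> b \<in> P"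
proof -
  interpret primeideal P "complex_ring OK" by (rule P_prime)
  show "P \<subseteq> OK" using a_subset by (simp add: complex_ring_def)
  show "0 \<in> P" using additive_subgroup.zero_closed[OF is_additive_subgroup] by (simp add: complex_ring_def)
  show "x \<in> P \<Longrightarrow> y \<in> P \<Longrightarrow> x + y \<in> P" using additive_subgroup.a_closed[OF is_additive_subgroup, of x y] by (simp add: complex_ring_def)
  show "a \<in> OK \<Longrightarrow> x \<in> P \<Longrightarrow> a * x \<in> P" using I_l_closed[of x a] by (simp add: complex_ring_def)
  show "1 \<notin> P" using one_imp_carrier I_notcarr by (auto simp: complex_ring_def)
  show "a \<in> OK \<Longrightarrow> b \<in> OK \<Longrightarrow> a * b \<in> P \<Longrightarrow> a \<in> P \<or> b \<in> P"
    using I_prime[of a b] by (simp add: complex_ring_def)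
qed

lemma P_OK [simp]: "x \<in> P \<Longrightarrow> x \<in> OK"
  using P_facts(1) by blast

lemma P_minus: "x \<in> P \<Longrightarrow> - x \<in> P"
  using P_facts(4)[of "-1" x] O_closed(4,8) by simp

lemma P_diff: "x \<in> P \<Longrightarrow> y \<in> P \<Longrightarrow> x - y \<in> P"
  using P_facts(3)[OF _ P_minus] by simp

lemma P_mult_right: "a \<in> OK \<Longrightarrow> x \<in> P \<Longrightarrow> x * a \<in> P"
  using P_facts(4) by (simp add: mult.commute)

lemma p_in_P: "of_nat p \<in> P"
proof -
  have "of_nat p * of_int 1 \<in> range (\<lambda>k::int. (of_nat p :: complex) * of_int k)" by (rule rangeI)
  then show ?thesis using P_over by (auto simp: prime_over_def)
qed

text \<open>An exponent with x^Q = x modulo \<open>p\<close> for all integers x of K; the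
  cardinality of the residue field is called \<open>q\<close> below.\<close>

definition Q where "Q = p ^ d"

lemma Q2: "Q \<ge> 2"
proof -
  have "p ^ 1 \<le> p ^ d" using d_pos p_pos by (intro power_increasing) auto
  then show ?thesis using prime_ge_2_nat[OF p(1)] by (simp add: Q_def)
qed

lemma power_Q: "x \<in> OK \<Longrightarrow> (x ^ Q - x) / of_nat p \<in> OK"
proof -
  assume x: "x \<in> OK"
  have "of_rat (1 / of_nat p) * (x ^ Q - x) \<in> K" using x by (intro K_closed O_closed(12)) auto
  then have "(x ^ Q - x) / of_nat p \<in> K" by (simp add: of_rat_divide)
  then show ?thesis using O_frobenius[OF p x] by (simp add: O_alt acong_def Q_def)
qed

lemma p_div_mult: "of_nat p * (x / of_nat p) = (x :: complex)"
  using p_pos by simp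

text \<open>The congruence x^Q = x makes \<open>a ^ (Q - 2)\<close> an inverse of \<open>a\<close>
  modulo \<open>P\<close>; that \<open>P\<close> is prime allows the factor \<open>a\<close> to be
  cancelled.\<close>

lemma P_inverse_mod:
  assumes "a \<in> OK" "a \<notin> P"
  shows "a * a ^ (Q - 2) - 1 \<in> P"
proof -
  obtain k where "Q = k + 2" using Q2 by (metis le_add_diff_inverse2)
  then have "a * (a * a ^ (Q - 2) - 1) = a ^ Q - a" by (simp add: algebra_simps)
  also have "\<dots> = of_nat p * ((a ^ Q - a) / of_nat p)" by (rule p_div_mult[symmetric])
  also have "\<dots> \<in> P" using power_Q[OF assms(1)] p_in_P by (intro P_mult_right)
  finally show ?thesis using P_facts(6)[of a "a * a ^ (Q - 2) - 1"] assms by auto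
qed

section \<open>The ideal P as a lattice, its inverse and its dual\<close>

definition PV where "PV = \<mu> ` P"

lemma mu_1_mult: "v \<in> V \<Longrightarrow> \<mu> 1 * v = v"
proof (rule mink_eqI)
  fix \<sigma> assume "v \<in> V" "\<sigma> \<notin> S"
  then show "(\<mu> 1 * v) \<sigma> = v \<sigma>" using V_outside[of v \<sigma>] by (simp add: fun_ops)
qed (simp add: fun_ops)

lemma scale_eq_mult: "v \<in> V \<Longrightarrow> r *\<^sub>R v = (r *\<^sub>R \<mu> 1) * v"
  using mu_1_mult by (simp add: scaleR_mult_fun)

lemma scaled_lattice:
  assumes L: "is_lattice V L" and r: "r > 0"
  shows "is_lattice V ((\<lambda>x. r *\<^sub>R x) ` L)" "covolume V ip ((\<lambda>x. r *\<^sub>R x) ` L) = r ^ d * covolume V ip L"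
proof -
  have im: "(\<lambda>x. r *\<^sub>R x) ` L = (*) (r *\<^sub>R \<mu> 1) ` L"
    by (intro image_cong refl scale_eq_mult V.lattice_closed(5)[OF L])
  have c: "(r *\<^sub>R \<mu> 1) \<sigma> = of_real r" if \<sigma>: "\<sigma> \<in> S" for \<sigma>
  proof -
    obtain z where "z \<in> R" "\<sigma> = emb z" using S_emb \<sigma> by blast
    then show ?thesis by (simp add: fun_ops scaleR_conv_of_real)
  qed
  have V1: "r *\<^sub>R \<mu> 1 \<in> V" by simp
  have nz: "(r *\<^sub>R \<mu> 1) \<sigma> \<noteq> 0" if "\<sigma> \<in> S" for \<sigma> using c[OF that] r by simp
  show "is_lattice V ((\<lambda>x. r *\<^sub>R x) ` L)" unfolding im by (rule mult_lattice(1)[OF V1 nz L])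
  have "(\<Prod>\<sigma>\<in>S. cmod ((r *\<^sub>R \<mu> 1) \<sigma>)) = r ^ d" using c r by (simp add: card_S)
  then show "covolume V ip ((\<lambda>x. r *\<^sub>R x) ` L) = r ^ d * covolume V ip L"
    unfolding im using mult_lattice(2)[OF V1 nz L] by simp
qed

lemma sublattice_of_OV:
  assumes L: "L \<subseteq> OV" "0 \<in> L" "\<And>x y. x \<in> L \<Longrightarrow> y \<in> L \<Longrightarrow> x - y \<in> L" and n: "n > 0" "\<And>x. x \<in> OV \<Longrightarrow> real n *\<^sub>R x \<in> L"
  shows "is_lattice V L"
proof (rule V.discrete_subgroup_is_lattice[of _ 1])
  show "L \<subseteq> V" using L(1) V.lattice_closed(6)[OF OV_lattice] by blast
  show "ip x x \<ge> 1" if x: "x \<in> L" "x \<noteq> 0" for x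
  proof -
    obtain a where a: "a \<in> OK" "x = \<mu> a" using x L(1) by (auto simp: OV_def)
    obtain k where k: "ip x x = of_int k" using ip_OV_int[OF a(1) a(1)] a(2) by (metis Ints_cases)
    have "ip x x > 0" using a x(2) by (intro V.ip_pos) auto
    then show ?thesis unfolding k by simp
  qed
  have "bz i \<in> Real_Vector_Spaces.span L" for i
  proof -
    have "real n *\<^sub>R bz i \<in> Real_Vector_Spaces.span L"
      by (rule real_vector.span_base[OF n(2)]) (auto simp: bz_def OV_def)
    from real_vector.span_scale[OF this, of "1 / real n"] show ?thesis using n(1) by simp
  qed
  then have "V \<subseteq> Real_Vector_Spaces.span L"
    using span_bz real_vector.span_minimal[OF _ real_vector.subspace_span, of "bz ` {..<d}" L] by auto
  moreover have "Real_Vector_Spaces.span L \<subseteq> V"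
    using V_subspace \<open>L \<subseteq> V\<close> by (rule real_vector.span_minimal[rotated])
  ultimately show "Real_Vector_Spaces.span L = V" by blast
qed (use L in auto)

lemma pOV_lattice: "is_lattice V (\<mu> ` (\<lambda>x. of_nat p * x) ` OK)"
proof (rule sublattice_of_OV[of _ p])
  show "\<mu> ` (\<lambda>x. of_nat p * x) ` OK \<subseteq> OV" by (auto simp: OV_def)
  show "0 \<in> \<mu> ` (\<lambda>x. of_nat p * x) ` OK"
    unfolding image_image by (rule image_eqI[of _ _ 0]) auto
  show "x - y \<in> \<mu> ` (\<lambda>x. of_nat p * x) ` OK" if xy: "x \<in> \<mu> ` (\<lambda>x. of_nat p * x) ` OK" "y \<in> \<mu> ` (\<lambda>x. of_nat p * x) ` OK" for x y
  proof -
    obtain a b where "a \<in> OK" "x = \<mu> (of_nat p * a)" "b \<in> OK" "y = \<mu> (of_nat p * b)" using xy by auto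
    then show ?thesis unfolding image_image
      by (intro image_eqI[of _ _ "a - b"]) (auto simp: mu_hom(2)[symmetric] right_diff_distrib)
  qed
  show "real p *\<^sub>R x \<in> \<mu> ` (\<lambda>x. of_nat p * x) ` OK" if x: "x \<in> OV" for x
  proof -
    obtain a where a: "a \<in> OK" "x = \<mu> a" using x by (auto simp: OV_def)
    then have "real p *\<^sub>R x = \<mu> (of_nat p * a)" by (simp add: mu_of_nat)
    then show ?thesis using a(1) by blast
  qed
qed (rule p_pos)

lemma PV_lattice: "is_lattice V PV"
proof (rule sublattice_of_OV[of _ p])
  show "PV \<subseteq> OV" by (auto simp: PV_def OV_def)
  show "0 \<in> PV" unfolding PV_def by (rule image_eqI[of _ _ 0]) (auto simp: P_facts)
  show "x - y \<in> PV" if xy: "x \<in> PV" "y \<in> PV" for x y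
  proof -
    obtain a b where "a \<in> P" "x = \<mu> a" "b \<in> P" "y = \<mu> b" using xy by (auto simp: PV_def)
    then show ?thesis unfolding PV_def by (intro image_eqI[of _ _ "a - b"]) (auto simp: mu_hom P_diff)
  qed
  show "real p *\<^sub>R x \<in> PV" if x: "x \<in> OV" for x
  proof -
    obtain a where "a \<in> OK" "x = \<mu> a" using x by (auto simp: OV_def)
    then show ?thesis unfolding PV_def
      by (intro image_eqI[of _ _ "of_nat p * a"]) (auto simp: mu_of_nat intro: P_mult_right p_in_P)
  qed
qed (rule p_pos)

lemma PV_OV: "PV \<subseteq> OV"
  by (auto simp: PV_def OV_def)

lemma mu_inj': "x \<in> K \<Longrightarrow> y \<in> K \<Longrightarrow> \<mu> x = \<mu> y \<Longrightarrow> x = y"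
  using mu_inj[of "x - y"] by (simp add: mu_hom)

lemma mu_mem: "x \<in> K \<Longrightarrow> A \<subseteq> K \<Longrightarrow> \<mu> x \<in> \<mu> ` A \<longleftrightarrow> x \<in> A"
  using mu_inj' by blast

text \<open>In \<open>\<O>/p\<close> every element equals its \<open>Q\<close>-th power, so the product of all \<open>1 - r\<^bsup>Q-1\<^esup>\<close> over representatives
  \<open>r\<close> of \<open>P/p\<close> annihilates \<open>P/p\<close>; this makes \<open>P\<close> invertible.\<close>
lemma P_annihilator:
  obtains b where "b \<in> OK" "1 - b \<in> P" "\<And>x. x \<in> P \<Longrightarrow> b * x / of_nat p \<in> OK"
proof -
  have sub: "\<mu> ` (\<lambda>x. of_nat p * x) ` OK \<subseteq> OV" by (auto simp: OV_def)
  obtain R0 where R0: "finite R0" "R0 \<subseteq> OV" "\<And>x. x \<in> OV \<Longrightarrow> \<exists>r\<in>R0. x - r \<in> \<mu> ` (\<lambda>x. of_nat p * x) ` OK"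
    using V.finite_representatives[OF OV_lattice pOV_lattice sub] by metis
  define R1 where "R1 = {r \<in> P. \<mu> r \<in> R0}"
  have "inj_on \<mu> R1" using mu_inj' by (auto simp: inj_on_def R1_def)
  moreover have "finite (\<mu> ` R1)" using R0(1) by (rule finite_subset[rotated]) (auto simp: R1_def)
  ultimately have finR1: "finite R1" using finite_imageD by blast
  define b where "b = (\<Prod>r\<in>R1. 1 - r ^ (Q - 1))"
  have prodOK: "(\<Prod>r\<in>I. 1 - r ^ (Q - 1)) \<in> OK" if "I \<subseteq> P" for I
    using that by (induction I rule: infinite_finite_induct) auto
  have "1 - (\<Prod>r\<in>I. 1 - r ^ (Q - 1)) \<in> P" if "finite I" "I \<subseteq> P" for I
    using that
  proof (induction I rule: finite_induct)
    case (insert r I)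
    define c where "c = (\<Prod>r\<in>I. 1 - r ^ (Q - 1))"
    have "r * r ^ (Q - 2) \<in> P" using insert.prems by (intro P_mult_right) auto
    moreover obtain k where "Q = k + 2" using Q2 by (metis le_add_diff_inverse2)
    then have "r * r ^ (Q - 2) = r ^ (Q - 1)" by simp
    ultimately have "r ^ (Q - 1) * c \<in> P" using prodOK[of I] insert.prems by (intro P_mult_right) (auto simp: c_def)
    moreover have "1 - c \<in> P" using insert unfolding c_def by simp
    ultimately have "(1 - c) + r ^ (Q - 1) * c \<in> P" using P_facts(3) by blast
    moreover have "1 - (\<Prod>r\<in>insert r I. 1 - r ^ (Q - 1)) = (1 - c) + r ^ (Q - 1) * c"
      using insert.hyps by (simp add: c_def left_diff_distrib)
    ultimately show ?case by metis
  qed (simp add: P_facts)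
  then have b1: "1 - b \<in> P" using finR1 by (auto simp: b_def R1_def)
  have bOK: "b \<in> OK" unfolding b_def by (rule prodOK) (auto simp: R1_def)
  have "b * x / of_nat p \<in> OK" if x: "x \<in> P" for x
  proof -
    obtain r' where r': "r' \<in> R0" "\<mu> x - r' \<in> \<mu> ` (\<lambda>x. of_nat p * x) ` OK"
      using R0(3)[of "\<mu> x"] x by (auto simp: OV_def)
    obtain r where r: "r \<in> OK" "r' = \<mu> r" using r'(1) R0(2) by (auto simp: OV_def)
    obtain y where y: "y \<in> OK" "\<mu> x - r' = \<mu> (of_nat p * y)" using r'(2) by auto
    have "\<mu> (x - r) = \<mu> (of_nat p * y)" using y(2) r x by (simp add: mu_hom)
    then have xr: "x - r = of_nat p * y" by (rule mu_inj'[rotated 2]) (use x r y in auto)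
    have "x - of_nat p * y \<in> P" using x y p_in_P by (intro P_diff P_mult_right)
    then have rR1: "r \<in> R1" using xr r r'(1) by (simp add: R1_def algebra_simps)
    define b' where "b' = (\<Prod>r\<in>R1 - {r}. 1 - r ^ (Q - 1))"
    have b': "b' \<in> OK" "b = (1 - r ^ (Q - 1)) * b'"
      using prodOK[of "R1 - {r}"] prod.remove[OF finR1 rR1, of "\<lambda>r. 1 - r ^ (Q - 1)"] by (auto simp: b'_def b_def R1_def)
    have "r ^ (Q - 1) * r = r ^ Q" using power_minus_mult[of Q r] Q2 by simp
    \<comment> \<open>The factor of \<open>b\<close> that belongs to \<open>r\<close> completes
      \<open>r ^ Q - r\<close>, a multiple of \<open>p\<close>.\<close>
    then have "b * r = - b' * (r ^ Q - r)" unfolding b'(2) by (simp add: algebra_simps)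
    then have "b * x = - b' * (r ^ Q - r) + of_nat p * (b * y)"
      using xr by (simp add: algebra_simps)
    then have "b * x / of_nat p = - b' * ((r ^ Q - r) / of_nat p) + b * y"
      using p_pos by (simp only: add_divide_distrib) simp
    also have "\<dots> \<in> OK" using b'(1) bOK y(1) power_Q[OF r(1)] by (intro O_closed(1,3,4)) auto
    finally show ?thesis .
  qed
  then show ?thesis using that bOK b1 by blast
qed

text \<open>A certificate that \<open>P\<close> is invertible: 1 = (1 - bb) 1 + p (bb / p) writes 1
  as a sum of two products of an element of \<open>P\<close> with an element of
  \<open>inverse_ideal K P\<close>.\<close>

definition bb where "bb = (SOME b. b \<in> OK \<and> 1 - b \<in> P \<and> (\<forall>x\<in>P. b * x / of_nat p \<in> OK))"

lemma bb: "bb \<in> OK" "1 - bb \<in> P" "x \<in> P \<Longrightarrow> bb * x / of_nat p \<in> OK"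
proof -
  have "\<exists>b. b \<in> OK \<and> 1 - b \<in> P \<and> (\<forall>x\<in>P. b * x / of_nat p \<in> OK)" by (rule P_annihilator) blast
  from someI_ex[OF this] show "bb \<in> OK" "1 - bb \<in> P" "x \<in> P \<Longrightarrow> bb * x / of_nat p \<in> OK"
    unfolding bb_def by blast+
qed

lemma bbp_K: "bb / of_nat p \<in> K"
proof -
  have "of_rat (1 / of_nat p) * bb \<in> K" using bb(1) by (intro K_closed O_closed(12)) auto
  then show ?thesis by (simp add: of_rat_divide)
qed

lemma inverse_ideal_iff: "x \<in> inverse_ideal K P \<longleftrightarrow> x \<in> K \<and> (\<forall>a\<in>P. x * a \<in> OK)"
  by (simp add: inverse_ideal_def OK_def)

lemma bbp_inverse: "bb / of_nat p \<in> inverse_ideal K P"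
  unfolding inverse_ideal_iff using bbp_K bb(3) by simp

lemma mu_decompose: "y \<in> V \<Longrightarrow> y = \<mu> (1 - bb) * y + \<mu> (of_nat p) * (\<mu> (bb / of_nat p) * y)"
proof -
  assume y: "y \<in> V"
  have K: "1 - bb \<in> K" "of_nat p * (bb / of_nat p) \<in> K" "bb / of_nat p \<in> K"
    using bb(1) bbp_K by (auto simp: p_div_mult)
  have "\<mu> (1 - bb) * y + \<mu> (of_nat p) * (\<mu> (bb / of_nat p) * y) = (\<mu> (1 - bb) + \<mu> (of_nat p * (bb / of_nat p))) * y"
    using K by (simp add: mu_hom(3) distrib_right mult.assoc del: times_divide_eq_right)
  also have "\<dots> = \<mu> (1 - bb + of_nat p * (bb / of_nat p)) * y"
    using K by (simp only: mu_hom(1))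
  also have "\<dots> = y" using y mu_1_mult by (simp only: p_div_mult) simp
  finally show ?thesis ..
qed

text \<open>The trace form \<open>tr (u v)\<close>; the scalar product is \<open>tr (u \<cdot> cnj v)\<close>.\<close>
definition tp where "tp u v = ip u (cnjf v)"

lemma tp_mult: "tp (u * w) v = tp u (w * v)"
  by (simp add: tp_def mink_ip_def fun_apply mult_ac)

lemma tp_linear: "tp (u + w) v = tp u v + tp w v" "tp (u - w) v = tp u v - tp w v" "tp (r *\<^sub>R u) v = r * tp u v"
  "tp v (u + w) = tp v u + tp v w" "tp v (u - w) = tp v u - tp v w" "tp v (r *\<^sub>R u) = r * tp v u"
  "tp 0 v = 0" "tp v 0 = 0"
  by (simp_all add: tp_def V.ip_linear)

text \<open>These are \<open>\<O>\<^sup>#\<close> and \<open>P\<^sup>-\<^sup>1\<O>\<^sup>#\<close>: the latter is the dual of \<open>P\<close> for the trace form, which explains the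
  conjugation.\<close>
definition OD where "OD = dual_lattice V ip OV"

definition PD where "PD = dual_lattice V ip (cnjf ` PV)"

lemma OD_iff: "y \<in> OD \<longleftrightarrow> y \<in> V \<and> (\<forall>a\<in>OK. tp y (\<mu> a) \<in> \<int>)"
proof -
  have "(\<forall>a\<in>OK. ip y (\<mu> a) \<in> \<int>) \<longleftrightarrow> (\<forall>a\<in>OK. ip y (\<mu> (cnj a)) \<in> \<int>)"
    using O_closed(11) complex_cnj_cnj by metis
  then show ?thesis by (auto simp: OD_def dual_lattice_def OV_def tp_def mu_cnj)
qed

lemma PD_iff: "y \<in> PD \<longleftrightarrow> y \<in> V \<and> (\<forall>a\<in>P. tp y (\<mu> a) \<in> \<int>)"
  by (auto simp: PD_def dual_lattice_def PV_def tp_def)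

lemma OD_lattice: "is_lattice V OD" "covolume V ip OD * covolume V ip OV = 1" "dual_lattice V ip OD = OV"
  unfolding OD_def using V.dual_lattice_facts[OF OV_lattice] by auto

lemma PD_lattice: "is_lattice V PD" "covolume V ip PD * covolume V ip PV = 1"
proof -
  note il = V.isometry_lattice[OF PV_lattice cnjf_isometry]
  show "is_lattice V PD" "covolume V ip PD * covolume V ip PV = 1"
    unfolding PD_def using V.dual_lattice_facts[OF il(1)] il(2) by auto
qed

lemma OD_V: "y \<in> OD \<Longrightarrow> y \<in> V" and PD_V: "y \<in> PD \<Longrightarrow> y \<in> V"
  by (auto simp: OD_iff PD_iff)

lemma OD_PD: "OD \<subseteq> PD"
  by (auto simp: OD_iff PD_iff)

lemma OV_OD: "OV \<subseteq> OD"
  using ip_OV_int by (auto simp: OD_def dual_lattice_def OV_def)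

lemma OD_mult: "a \<in> OK \<Longrightarrow> y \<in> OD \<Longrightarrow> \<mu> a * y \<in> OD"
  unfolding OD_iff
proof (intro conjI ballI; (elim conjE)?)
  fix c assume "a \<in> OK" "c \<in> OK" "y \<in> V" "\<forall>a\<in>OK. tp y (\<mu> a) \<in> \<int>"
  moreover from this have "tp (\<mu> a * y) (\<mu> c) = tp y (\<mu> (a * c))"
    by (subst mult.commute) (simp add: tp_mult mu_hom(3))
  ultimately show "tp (\<mu> a * y) (\<mu> c) \<in> \<int>" using O_closed(3)[of a c] by simp
qed (simp add: V_mult)

lemma PD_mult: "a \<in> OK \<Longrightarrow> y \<in> PD \<Longrightarrow> \<mu> a * y \<in> PD"
  unfolding PD_iff
proof (intro conjI ballI; (elim conjE)?)
  fix c assume "a \<in> OK" "c \<in> P" "y \<in> V" "\<forall>a\<in>P. tp y (\<mu> a) \<in> \<int>"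
  moreover from this have "tp (\<mu> a * y) (\<mu> c) = tp y (\<mu> (a * c))"
    by (subst mult.commute) (simp add: tp_mult mu_hom(3))
  ultimately show "tp (\<mu> a * y) (\<mu> c) \<in> \<int>" using P_facts(4)[of a c] by simp
qed (simp add: V_mult)

lemma P_PD: "a \<in> P \<Longrightarrow> y \<in> PD \<Longrightarrow> \<mu> a * y \<in> OD"
  unfolding PD_iff OD_iff
proof (intro conjI ballI; (elim conjE)?)
  fix c assume "a \<in> P" "c \<in> OK" "y \<in> V" "\<forall>a\<in>P. tp y (\<mu> a) \<in> \<int>"
  moreover from this have "tp (\<mu> a * y) (\<mu> c) = tp y (\<mu> (a * c))"
    by (subst mult.commute) (simp add: tp_mult mu_hom(3))
  ultimately show "tp (\<mu> a * y) (\<mu> c) \<in> \<int>" using P_mult_right[of c a] by simp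
qed (simp add: V_mult)

lemma inverse_OD: "a \<in> inverse_ideal K P \<Longrightarrow> y \<in> OD \<Longrightarrow> \<mu> a * y \<in> PD"
  unfolding PD_iff OD_iff inverse_ideal_iff
proof (intro conjI ballI; (elim conjE)?)
  fix c assume "a \<in> K" "\<forall>c\<in>P. a * c \<in> OK" "c \<in> P" "y \<in> V" "\<forall>a\<in>OK. tp y (\<mu> a) \<in> \<int>"
  moreover from this have "tp (\<mu> a * y) (\<mu> c) = tp y (\<mu> (a * c))"
    by (subst mult.commute) (simp add: tp_mult mu_hom(3))
  ultimately show "tp (\<mu> a * y) (\<mu> c) \<in> \<int>" by simp
qed (simp add: V_mult)

lemma module_prod_subset:
  assumes "\<And>a x. a \<in> A \<Longrightarrow> x \<in> X \<Longrightarrow> act a x \<in> L" "0 \<in> L" "\<And>x y. x \<in> L \<Longrightarrow> y \<in> L \<Longrightarrow> x + y \<in> L"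
  shows "module_prod act A X \<subseteq> L"
proof
  fix v assume "v \<in> module_prod act A X"
  then obtain ps where ps: "set ps \<subseteq> A \<times> X" "v = (\<Sum>(a, x)\<leftarrow>ps. act a x)" by (auto simp: module_prod_def)
  have "(\<Sum>(a, x)\<leftarrow>ps. act a x) \<in> L" using ps(1) by (induction ps) (use assms in auto)
  then show "v \<in> L" using ps(2) by simp
qed

lemma module_prod_2:
  assumes "a \<in> A" "x \<in> X" "b \<in> A" "y \<in> X"
  shows "act a x + act b y \<in> module_prod act A X"
  unfolding module_prod_def using assms by (intro CollectI exI[of _ "[(a,x),(b,y)]"]) simp

text \<open>Identifies the module product in \<open>Lambda0\<close> with the dual description
  \<open>PD\<close>. The decomposition of 1 given by \<open>bb\<close> writes each \<open>y\<close>
  in \<open>PD\<close> as a sum of two products of the required form.\<close>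

lemma inverse_ideal_OD: "module_prod (\<lambda>a x. \<mu> a * x) (inverse_ideal K P) OD = PD"
proof (intro subset_antisym subsetI)
  show "y \<in> PD" if "y \<in> module_prod (\<lambda>a x. \<mu> a * x) (inverse_ideal K P) OD" for y
    using that module_prod_subset[of "inverse_ideal K P" OD "\<lambda>a x. \<mu> a * x" PD] inverse_OD V.lattice_closed[OF PD_lattice(1)] by blast
  fix y assume y: "y \<in> PD"
  have 1: "1 \<in> inverse_ideal K P" by (simp add: inverse_ideal_iff)
  have "\<mu> 1 * (\<mu> (1 - bb) * y) + \<mu> (bb / of_nat p) * (\<mu> (of_nat p) * y) \<in> module_prod (\<lambda>a x. \<mu> a * x) (inverse_ideal K P) OD"
    by (rule module_prod_2[where act = "\<lambda>a x. \<mu> a * x", OF 1 P_PD[OF bb(2) y] bbp_inverse P_PD[OF p_in_P y]])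
  moreover have "\<mu> 1 * (\<mu> (1 - bb) * y) + \<mu> (bb / of_nat p) * (\<mu> (of_nat p) * y) = y"
    using mu_decompose[OF PD_V[OF y]] mu_1_mult[OF OD_V[OF P_PD[OF bb(2) y]]] by (simp add: mult.left_commute)
  ultimately show "y \<in> module_prod (\<lambda>a x. \<mu> a * x) (inverse_ideal K P) OD" by simp
qed

section \<open>The residue field and the index of P\<close>

definition q where "q = residue_card K P"

text \<open>Representatives are transferred from \<open>OV\<close> modulo \<open>PV\<close>, where
  covolumes make them finite in number, and matched with the cosets of the quotient ring.\<close>

lemma residues:
  obtains T where "finite T" "T \<subseteq> OK" "card T = q" "\<And>x. x \<in> OK \<Longrightarrow> \<exists>t\<in>T. x - t \<in> P"
    "\<And>x y. x \<in> T \<Longrightarrow> y \<in> T \<Longrightarrow> x - y \<in> P \<Longrightarrow> x = y"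
proof -
  obtain R0 where R0: "finite R0" "R0 \<subseteq> OV" "\<And>x. x \<in> OV \<Longrightarrow> \<exists>r\<in>R0. x - r \<in> PV"
    "\<And>x y. x \<in> R0 \<Longrightarrow> y \<in> R0 \<Longrightarrow> x - y \<in> PV \<Longrightarrow> x = y"
    using V.finite_representatives[OF OV_lattice PV_lattice PV_OV] by metis
  define T where "T = {t \<in> OK. \<mu> t \<in> R0}"
  have inj: "inj_on \<mu> T" using mu_inj' by (auto simp: inj_on_def T_def)
  have "finite (\<mu> ` T)" using R0(1) by (rule finite_subset[rotated]) (auto simp: T_def)
  then have finT: "finite T" using inj finite_imageD by blast
  have PK: "P \<subseteq> K" by auto
  have cov: "\<exists>t\<in>T. x - t \<in> P" if x: "x \<in> OK" for x
  proof -
    obtain r where r: "r \<in> R0" "\<mu> x - r \<in> PV" using R0(3)[of "\<mu> x"] x by (auto simp: OV_def)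
    obtain t where t: "t \<in> OK" "r = \<mu> t" using r(1) R0(2) by (auto simp: OV_def)
    have "\<mu> (x - t) \<in> \<mu> ` P" using r(2) t x by (simp add: mu_hom PV_def)
    then have "x - t \<in> P" using mu_mem[OF _ PK, of "x - t"] x t by auto
    then show ?thesis using t r(1) by (auto simp: T_def)
  qed
  have sep: "x = y" if "x \<in> T" "y \<in> T" "x - y \<in> P" for x y
  proof -
    have "\<mu> x - \<mu> y \<in> PV" using that by (auto simp: T_def PV_def mu_hom(2)[symmetric])
    then have "\<mu> x = \<mu> y" using R0(4) that by (auto simp: T_def)
    then show ?thesis using inj that by (auto simp: inj_on_def)
  qed
  interpret I: primeideal P "complex_ring OK" by (rule P_prime)
  have coset: "P +>\<^bsub>complex_ring OK\<^esub> x = (\<lambda>h. h + x) ` P" for x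
    by (auto simp: a_r_coset_def' complex_ring_def)
  have "bij_betw (\<lambda>t. P +>\<^bsub>complex_ring OK\<^esub> t) T (carrier (residue_field K P))"
    unfolding bij_betw_def
  proof
    show "inj_on (\<lambda>t. P +>\<^bsub>complex_ring OK\<^esub> t) T"
    proof (rule inj_onI)
      fix x y assume xy: "x \<in> T" "y \<in> T" "P +>\<^bsub>complex_ring OK\<^esub> x = P +>\<^bsub>complex_ring OK\<^esub> y"
      have "0 + x \<in> (\<lambda>h. h + y) ` P" using xy(3) P_facts(2) unfolding coset by blast
      then have "x - y \<in> P" by auto
      then show "x = y" using sep xy by blast
    qed
    show "(\<lambda>t. P +>\<^bsub>complex_ring OK\<^esub> t) ` T = carrier (residue_field K P)"
    proof (intro subset_antisym subsetI)
      fix C assume "C \<in> carrier (residue_field K P)"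
      then obtain x where x: "x \<in> OK" "C = (\<lambda>h. h + x) ` P"
        by (auto simp: residue_field_def FactRing_def A_RCOSETS_def' OK_def[symmetric] coset) (auto simp: complex_ring_def)
      obtain t where t: "t \<in> T" "x - t \<in> P" using cov[OF x(1)] by blast
      have "(\<lambda>h. h + x) ` P = (\<lambda>h. h + t) ` P"
      proof (intro subset_antisym image_subsetI)
        fix h assume "h \<in> P"
        then show "h + x \<in> (\<lambda>h. h + t) ` P" using P_facts(3)[OF _ t(2)]
          by (intro image_eqI[of _ _ "h + (x - t)"]) auto
        show "h + t \<in> (\<lambda>h. h + x) ` P" using P_diff[OF \<open>h \<in> P\<close> t(2)]
          by (intro image_eqI[of _ _ "h - (x - t)"]) auto
      qed
      then show "C \<in> (\<lambda>t. P +>\<^bsub>complex_ring OK\<^esub> t) ` T" using x(2) t(1) coset by auto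
    next
      fix C assume "C \<in> (\<lambda>t. P +>\<^bsub>complex_ring OK\<^esub> t) ` T"
      then show "C \<in> carrier (residue_field K P)"
        by (auto simp: residue_field_def FactRing_def A_RCOSETS_def' OK_def[symmetric] T_def complex_ring_def)
    qed
  qed
  then have "card T = q" unfolding q_def residue_card_def by (rule bij_betw_same_card)
  moreover have "T \<subseteq> OK" by (auto simp: T_def)
  ultimately show ?thesis using that[OF finT _ _ cov sep] by blast
qed

lemma covolume_PV: "covolume V ip PV = real q * covolume V ip OV" and q2: "q \<ge> 2"
proof -
  obtain T where T: "finite T" "T \<subseteq> OK" "card T = q" "\<And>x. x \<in> OK \<Longrightarrow> \<exists>t\<in>T. x - t \<in> P"
    "\<And>x y. x \<in> T \<Longrightarrow> y \<in> T \<Longrightarrow> x - y \<in> P \<Longrightarrow> x = y" using residues by blast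
  have PK: "P \<subseteq> K" by auto
  have TK: "t \<in> K" if "t \<in> T" for t using that T(2) by blast
  have "inj_on \<mu> T" using mu_inj' TK by (auto simp: inj_on_def)
  then have card: "card (\<mu> ` T) = q" using T(3) by (simp add: card_image)
  have sub: "\<mu> ` T \<subseteq> OV" using T(2) by (auto simp: OV_def)
  have diff: "\<mu> x - \<mu> y \<in> PV \<longleftrightarrow> x - y \<in> P" if "x \<in> K" "y \<in> K" for x y
    using mu_mem[OF K_closed(2)[OF that] PK] that by (simp add: PV_def mu_hom)
  have "covolume V ip PV \<le> real (card (\<mu> ` T)) * covolume V ip OV"
  proof (rule V.covolume_covered[OF OV_lattice PV_lattice PV_OV _ sub])
    fix x assume "x \<in> OV"
    then obtain a where a: "a \<in> OK" "x = \<mu> a" by (auto simp: OV_def)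
    then obtain t where t: "t \<in> T" "a - t \<in> P" using T(4) by blast
    then have "x - \<mu> t \<in> PV" using a(2) diff[of a t] TK[OF t(1)] a(1) by simp
    then show "\<exists>r\<in>\<mu> ` T. x - r \<in> PV" using t(1) by blast
  qed (use T(1) in simp)
  moreover have "real (card (\<mu> ` T)) * covolume V ip OV \<le> covolume V ip PV"
  proof (rule V.covolume_separated[OF OV_lattice PV_lattice PV_OV _ sub])
    fix x y assume "x \<in> \<mu> ` T" "y \<in> \<mu> ` T" "x - y \<in> PV"
    then obtain s t where "s \<in> T" "x = \<mu> s" "t \<in> T" "y = \<mu> t" "\<mu> s - \<mu> t \<in> PV" by blast
    then show "x = y" using diff[of s t] TK T(5)[of s t] by simp
  qed (use T(1) in simp)
  ultimately have "covolume V ip PV = real (card (\<mu> ` T)) * covolume V ip OV" by simp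
  then show "covolume V ip PV = real q * covolume V ip OV" unfolding card .
  obtain t0 where t0: "t0 \<in> T" "0 - t0 \<in> P" using T(4)[of 0] by auto
  obtain t1 where t1: "t1 \<in> T" "1 - t1 \<in> P" using T(4)[of 1] by auto
  have "t0 \<noteq> t1"
  proof
    assume "t0 = t1"
    then have "(1 - t1) - (0 - t0) \<in> P" using P_diff t0 t1 by blast
    then show False using \<open>t0 = t1\<close> P_facts(5) by simp
  qed
  then have "card {t0, t1} \<le> card T" using t0 t1 T(1) by (intro card_mono) auto
  then show "q \<ge> 2" using \<open>t0 \<noteq> t1\<close> T(3) by simp
qed

text \<open>\<open>P\<close> annihilates \<open>PD\<close> modulo \<open>OD\<close>, so
  multiplication by the inverse \<open>c\<close> of \<open>a\<close> modulo \<open>P\<close> undoes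
  multiplication by \<open>a\<close> there.\<close>

lemma mult_P_OD: "y \<in> PD \<Longrightarrow> a \<in> OK \<Longrightarrow> a \<notin> P \<Longrightarrow> \<mu> a * y \<in> OD \<Longrightarrow> y \<in> OD"
proof -
  assume y: "y \<in> PD" and a: "a \<in> OK" "a \<notin> P" "\<mu> a * y \<in> OD"
  define c where "c = a ^ (Q - 2)"
  have c: "c \<in> OK" "a * c - 1 \<in> P" using P_inverse_mod[OF a(1,2)] a(1) by (auto simp: c_def)
  have "\<mu> c * (\<mu> a * y) = \<mu> (a * c) * y" using a c by (simp add: mu_hom(3) mult_ac)
  also have "\<dots> = \<mu> (a * c - 1) * y + y"
    using a c mu_1_mult[OF PD_V[OF y]] by (simp add: mu_hom(2) left_diff_distrib)
  finally have "y = \<mu> c * (\<mu> a * y) - \<mu> (a * c - 1) * y" by simp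
  also have "\<dots> \<in> OD"
    using OD_mult[OF c(1) a(3)] P_PD[OF c(2) y] V.lattice_closed(3)[OF OD_lattice(1)] by blast
  finally show "y \<in> OD" .
qed

text \<open>\<open>PD/OD\<close> has as many elements as \<open>\<O>/P\<close>, hence is a line over the residue field.\<close>
lemma PD_generator:
  obtains y0 where "y0 \<in> PD" "\<And>a. a \<in> OK \<Longrightarrow> \<mu> a * y0 \<in> OD \<Longrightarrow> a \<in> P"
    "\<And>y. y \<in> PD \<Longrightarrow> \<exists>a\<in>OK. y - \<mu> a * y0 \<in> OD"
proof -
  define c where "c = covolume V ip OV"
  have c: "c > 0" unfolding c_def by (rule V.covolume_pos[OF OV_lattice])
  have cPD: "covolume V ip PD = 1 / (real q * c)"
    using PD_lattice(2) covolume_PV c q2 by (simp add: c_def field_simps)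
  have cOD: "covolume V ip OD = 1 / c" using OD_lattice(2) c by (simp add: c_def field_simps)
  have ratio: "covolume V ip OD = real q * covolume V ip PD" using cPD cOD q2 by simp
  have pos: "covolume V ip PD > 0" by (rule V.covolume_pos[OF PD_lattice(1)])
  have "PD \<noteq> OD"
  proof
    assume "PD = OD"
    then show False using ratio pos q2 by simp
  qed
  then obtain y0 where y0: "y0 \<in> PD" "y0 \<notin> OD" using OD_PD by blast
  have a: "a \<in> P" if "a \<in> OK" "\<mu> a * y0 \<in> OD" for a
    using mult_P_OD[OF y0(1)] that y0(2) by blast
  obtain T where T: "finite T" "T \<subseteq> OK" "card T = q" "\<And>x. x \<in> OK \<Longrightarrow> \<exists>t\<in>T. x - t \<in> P"
    "\<And>x y. x \<in> T \<Longrightarrow> y \<in> T \<Longrightarrow> x - y \<in> P \<Longrightarrow> x = y" using residues by blast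
  define g where "g t = \<mu> t * y0" for t
  have gd: "g s - g t = \<mu> (s - t) * y0" if "s \<in> T" "t \<in> T" for s t
    using that T(2) by (auto simp: g_def mu_hom left_diff_distrib subset_iff)
  have sep: "s = t" if "s \<in> T" "t \<in> T" "g s - g t \<in> OD" for s t
    using that a[of "s - t"] gd[OF that(1,2)] T(2,5) by auto
  have "\<exists>a\<in>OK. y - \<mu> a * y0 \<in> OD" if y: "y \<in> PD" for y
  proof (rule ccontr)
    assume no: "\<not> ?thesis"
    have no': "y - g t \<notin> OD" "g t - y \<notin> OD" if "t \<in> T" for t
      using no that T(2) V.lattice_closed(4)[OF OD_lattice(1), of "g t - y"] by (auto simp: g_def)
    have inj: "inj_on g T" using sep V.lattice_closed(1)[OF OD_lattice(1)] by (auto simp: inj_on_def)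
    have "y \<notin> g ` T"
    proof
      assume "y \<in> g ` T"
      then obtain t where "t \<in> T" "y = g t" by blast
      then show False using no'(1)[of t] V.lattice_closed(1)[OF OD_lattice(1)] by simp
    qed
    \<comment> \<open>A class that is no multiple of \<open>y0\<close> would together with the
      \<open>q\<close> multiples give \<open>q + 1\<close> classes modulo \<open>OD\<close>, while
      the covolumes show that the index is \<open>q\<close>.\<close>
    then have card: "card (insert y (g ` T)) = Suc q" using inj T(1,3) by (simp add: card_image)
    have "real (card (insert y (g ` T))) * covolume V ip PD \<le> covolume V ip OD"
    proof (rule V.covolume_separated[OF PD_lattice(1) OD_lattice(1) OD_PD])
      show "insert y (g ` T) \<subseteq> PD" using y y0(1) PD_mult T(2) by (auto simp: g_def)
      show "u = v" if "u \<in> insert y (g ` T)" "v \<in> insert y (g ` T)" "u - v \<in> OD" for u v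
        using that no' sep by auto
    qed (use T(1) in simp)
    then show False using card ratio pos by simp
  qed
  then show ?thesis using that y0(1) a by blast
qed

end

section \<open>The plane and its symplectic lattices\<close>

lemma span_product:
  fixes A :: "'a::real_vector set" and B :: "'b::real_vector set"
  shows "Real_Vector_Spaces.span ((\<lambda>x. (x, 0)) ` A \<union> (\<lambda>y. (0, y)) ` B) =
    Real_Vector_Spaces.span A \<times> Real_Vector_Spaces.span B" (is "?L = ?R")
proof
  have "Real_Vector_Spaces.subspace ?R"
    by (auto simp: real_vector.subspace_def real_vector.span_add real_vector.span_scale real_vector.span_zero zero_prod_def)
  then show "?L \<subseteq> ?R"
    by (intro real_vector.span_minimal) (auto simp: real_vector.span_base real_vector.span_zero)
  have 1: "(x, 0) \<in> ?L" if "x \<in> Real_Vector_Spaces.span A" for x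
    using that
  proof (induction x rule: real_vector.span_induct)
    show "Real_Vector_Spaces.subspace {x. (x, 0) \<in> ?L}"
      unfolding real_vector.subspace_def
    proof (intro conjI ballI allI; clarsimp)
      show "(0, 0) \<in> ?L" using real_vector.span_zero[of "(\<lambda>x. (x, 0)) ` A \<union> (\<lambda>y. (0, y)) ` B"] by (simp add: zero_prod_def)
      show "(x + y, 0) \<in> ?L" if "(x, 0) \<in> ?L" "(y, 0) \<in> ?L" for x y
        using real_vector.span_add[OF that] by simp
      show "(c *\<^sub>R x, 0) \<in> ?L" if "(x, 0) \<in> ?L" for c x
        using real_vector.span_scale[OF that, of c] by simp
    qed
  qed (simp add: real_vector.span_base)
  have 2: "(0, y) \<in> ?L" if "y \<in> Real_Vector_Spaces.span B" for y
    using that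
  proof (induction y rule: real_vector.span_induct)
    show "Real_Vector_Spaces.subspace {y. (0, y) \<in> ?L}"
      unfolding real_vector.subspace_def
    proof (intro conjI ballI allI; clarsimp)
      show "(0, 0) \<in> ?L" using real_vector.span_zero[of "(\<lambda>x. (x, 0)) ` A \<union> (\<lambda>y. (0, y)) ` B"] by (simp add: zero_prod_def)
      show "(0, x + y) \<in> ?L" if "(0, x) \<in> ?L" "(0, y) \<in> ?L" for x y
        using real_vector.span_add[OF that] by simp
      show "(0, c *\<^sub>R x) \<in> ?L" if "(0, x) \<in> ?L" for c x
        using real_vector.span_scale[OF that, of c] by simp
    qed
  qed (simp add: real_vector.span_base)
  show "?R \<subseteq> ?L"
  proof clarify
    fix x y assume "x \<in> Real_Vector_Spaces.span A" "y \<in> Real_Vector_Spaces.span B"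
    from real_vector.span_add[OF 1[OF this(1)] 2[OF this(2)]] show "(x, y) \<in> ?L" by simp
  qed
qed

context cyclotomic
begin

lemma mu_of_int: "x \<in> K \<Longrightarrow> \<mu> (of_int n * x) = of_int n *\<^sub>R \<mu> x"
  using mu_rat[of x "of_int n"] by simp

text \<open>A lattice basis of \<open>OV\<close> shows that integral bases exist, so the choice
  inside \<open>discriminant\<close> is one. It may differ from that lattice basis, and its length
  must be shown to be \<open>d\<close>. Then the discriminant is the square of the determinant of
  \<open>Sm c\<close>, and the Gram determinant is the square of its modulus.\<close>

lemma discriminant_covolume: "cmod (discriminant K) = (covolume V ip OV)\<^sup>2"
proof -
  obtain b b' where b: "V.dual_pair b b'" "OV = V.lat b" using OV_lattice V.is_lattice_iff by blast
  have "\<forall>i. \<exists>a. i < d \<longrightarrow> a \<in> OK \<and> b i = \<mu> a"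
    using V.lat_closed(5)[OF b(1)] b(2) by (auto simp: V_N OV_def)
  then obtain \<beta> where \<beta>: "\<And>i. i < d \<Longrightarrow> \<beta> i \<in> OK \<and> b i = \<mu> (\<beta> i)" by metis
  have mu_comb: "\<mu> (\<Sum>i<n. of_int (c i) * a i) = (\<Sum>i<n. of_int (c i) *\<^sub>R \<mu> (a i))"
    if "\<And>i. i < n \<Longrightarrow> a i \<in> OK" for n and c :: "nat \<Rightarrow> int" and a
    using that by (subst mu_sum) (auto simp: mu_of_int)
  have \<beta>_ex: "\<exists>c::nat \<Rightarrow> int. x = (\<Sum>i<d. of_int (c i) * \<beta> i)" if x: "x \<in> OK" for x
  proof -
    have "\<mu> x \<in> V.lat b" using x b(2) by (auto simp: OV_def)
    then obtain c :: "nat \<Rightarrow> int" where "\<mu> x = (\<Sum>i<d. of_int (c i) *\<^sub>R b i)" by (auto simp: V.lat_def V_N)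
    then have "\<mu> x = \<mu> (\<Sum>i<d. of_int (c i) * \<beta> i)" using \<beta> by (simp add: mu_comb)
    then have "\<mu> (x - (\<Sum>i<d. of_int (c i) * \<beta> i)) = 0"
      using x \<beta> by (subst mu_hom) (auto intro!: K_sum)
    then have "x - (\<Sum>i<d. of_int (c i) * \<beta> i) = 0" using x \<beta> by (intro mu_inj) (auto intro!: K_sum)
    then show ?thesis by auto
  qed
  have \<beta>_unique: "c j = c' j" if "(\<Sum>i<d. of_int (c i) * \<beta> i) = (\<Sum>i<d. of_int (c' i) * \<beta> i)" "j < d"
    for c c' :: "nat \<Rightarrow> int" and j
  proof -
    have "(\<Sum>i<d. of_int (c i) *\<^sub>R b i) = (\<Sum>i<d. of_int (c' i) *\<^sub>R b i)"
      using arg_cong[OF that(1), of \<mu>] \<beta> by (simp add: mu_comb)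
    then show ?thesis
      using V.ip_dual_sum[OF b(1), of j "\<lambda>i. of_int (c i)"] V.ip_dual_sum[OF b(1), of j "\<lambda>i. of_int (c' i)"] that(2)
      by (simp add: V_N)
  qed
  have "integral_basis K (map \<beta> [0..<d])"
    unfolding integral_basis_def OK_def[symmetric]
  proof (intro conjI ballI)
    show "set (map \<beta> [0..<d]) \<subseteq> OK" using \<beta> by auto
    fix x assume "x \<in> OK"
    then obtain c :: "nat \<Rightarrow> int" where c: "x = (\<Sum>i<d. of_int (c i) * \<beta> i)" using \<beta>_ex by blast
    show "\<exists>!c::int list. length c = length (map \<beta> [0..<d]) \<and>
        x = (\<Sum>i<length (map \<beta> [0..<d]). of_int (c ! i) * map \<beta> [0..<d] ! i)"
    proof (rule ex1I[of _ "map c [0..<d]"])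
      fix l :: "int list" assume l: "length l = length (map \<beta> [0..<d]) \<and>
        x = (\<Sum>i<length (map \<beta> [0..<d]). of_int (l ! i) * map \<beta> [0..<d] ! i)"
      then have "l ! j = c j" if "j < d" for j
        using \<beta>_unique[of "\<lambda>i. l ! i" c j] c that by simp
      then show "l = map c [0..<d]" using l by (intro nth_equalityI) auto
    qed (simp add: c)
  qed
  then have ib: "integral_basis K (SOME bs. integral_basis K bs)" by (rule someI)
  define bs where "bs = (SOME bs. integral_basis K bs)"
  define n where "n = length bs"
  have bs: "set bs \<subseteq> OK" "\<And>x. x \<in> OK \<Longrightarrow> \<exists>!c :: int list. length c = length bs \<and> x = (\<Sum>i<length bs. of_int (c ! i) * bs ! i)"
  proof -
    have ib': "integral_basis K bs" using ib by (simp only: bs_def)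
    show "set bs \<subseteq> OK" using ib' unfolding integral_basis_def OK_def[symmetric] by (rule conjunct1)
    show "\<And>x. x \<in> OK \<Longrightarrow> \<exists>!c :: int list. length c = length bs \<and> x = (\<Sum>i<length bs. of_int (c ! i) * bs ! i)"
      using ib' unfolding integral_basis_def OK_def[symmetric] by (rule conjunct2[THEN bspec])
  qed
  have bsi: "bs ! i \<in> OK" if "i < n" for i using bs(1) that by (auto simp: n_def)
  have bs_ex: "\<exists>c::nat \<Rightarrow> int. x = (\<Sum>i<n. of_int (c i) * bs ! i)" if "x \<in> OK" for x
    using bs(2)[OF that] unfolding n_def by blast
  have sumOK: "(\<Sum>i<k. of_int (c i) * a i) \<in> OK" if "\<And>i. i < k \<Longrightarrow> a i \<in> OK" for k and c :: "nat \<Rightarrow> int" and a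
    using that by (induction k) (auto intro!: O_closed(1,3,5))
  have bs_unique: "c j = c' j" if "(\<Sum>i<n. of_int (c i) * bs ! i) = (\<Sum>i<n. of_int (c' i) * bs ! i)" "j < n"
    for c c' :: "nat \<Rightarrow> int" and j
  proof -
    define x where "x = (\<Sum>i<n. of_int (c i) * bs ! i)"
    have "x \<in> OK" unfolding x_def by (rule sumOK) (rule bsi)
    have 1: "length (map c [0..<n]) = length bs \<and> x = (\<Sum>i<length bs. of_int (map c [0..<n] ! i) * bs ! i)"
      by (simp add: x_def n_def)
    have 2: "length (map c' [0..<n]) = length bs \<and> x = (\<Sum>i<length bs. of_int (map c' [0..<n] ! i) * bs ! i)"
      using that(1) by (simp add: x_def n_def)
    have "map c [0..<n] = map c' [0..<n]"
      using bs(2)[OF \<open>x \<in> OK\<close>] by (elim alt_ex1E, elim allE impE) (rule conjI[OF 1 2])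
    then show ?thesis using that(2) by (metis add_0 diff_zero nth_map_upt)
  qed
  have "\<forall>i. \<exists>c::nat \<Rightarrow> int. i < n \<longrightarrow> bs ! i = (\<Sum>j<d. of_int (c j) * \<beta> j)"
    using \<beta>_ex[OF bsi] by blast
  from choice[OF this] obtain X :: "nat \<Rightarrow> nat \<Rightarrow> int"
    where X: "i < n \<Longrightarrow> bs ! i = (\<Sum>j<d. of_int (X i j) * \<beta> j)" for i by blast
  have "\<forall>j. \<exists>c::nat \<Rightarrow> int. j < d \<longrightarrow> \<beta> j = (\<Sum>i<n. of_int (c i) * bs ! i)"
    using bs_ex \<beta> by blast
  from choice[OF this] obtain Y :: "nat \<Rightarrow> nat \<Rightarrow> int"
    where Y: "j < d \<Longrightarrow> \<beta> j = (\<Sum>i<n. of_int (Y j i) * bs ! i)" for j by blast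
  have XY: "(\<Sum>j<d. X i j * Y j i) = 1" if i: "i < n" for i
  proof -
    have "bs ! i = (\<Sum>j<d. \<Sum>k<n. of_int (X i j * Y j k) * bs ! k)"
      by (subst X[OF i]) (simp add: Y sum_distrib_left mult.assoc)
    also have "\<dots> = (\<Sum>k<n. of_int (\<Sum>j<d. X i j * Y j k) * bs ! k)"
      by (subst sum.swap) (simp add: sum_distrib_right)
    finally have "(\<Sum>k<n. of_int (\<Sum>j<d. X i j * Y j k) * bs ! k) = (\<Sum>k<n. of_int (if k = i then 1 else 0) * bs ! k)"
      using i by (simp add: if_distrib[of of_int] if_distrib[of "\<lambda>x. x * _"] cong: if_cong)
    from bs_unique[OF this i] show ?thesis by simp
  qed
  have YX: "(\<Sum>i<n. Y j i * X i j) = 1" if j: "j < d" for j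
  proof -
    have "\<beta> j = (\<Sum>i<n. \<Sum>k<d. of_int (Y j i * X i k) * \<beta> k)"
      by (subst Y[OF j]) (simp add: X sum_distrib_left mult.assoc)
    also have "\<dots> = (\<Sum>k<d. of_int (\<Sum>i<n. Y j i * X i k) * \<beta> k)"
      by (subst sum.swap) (simp add: sum_distrib_right)
    finally have "(\<Sum>k<d. of_int (\<Sum>i<n. Y j i * X i k) * \<beta> k) = (\<Sum>k<d. of_int (if k = j then 1 else 0) * \<beta> k)"
      using j by (simp add: if_distrib[of of_int] if_distrib[of "\<lambda>x. x * _"] cong: if_cong)
    from \<beta>_unique[OF this j] show ?thesis by simp
  qed
  \<comment> \<open>The base changes \<open>X\<close> and \<open>Y\<close> are inverse to each
    other, so the traces of the two products are the lengths of the two bases; these traces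
    agree.\<close>
  have "int n = (\<Sum>i<n. \<Sum>j<d. X i j * Y j i)" using XY by simp
  also have "\<dots> = (\<Sum>j<d. \<Sum>i<n. Y j i * X i j)" by (subst sum.swap) (simp add: mult.commute)
  also have "\<dots> = int d" using YX by simp
  finally have nd: "n = d" by simp
  define c where "c i = \<mu> (bs ! i)" for i
  have cV: "c i \<in> V" if "i < d" for i using bsi that by (simp add: c_def nd)
  have OVc: "OV = V.lat c"
  proof (intro subset_antisym subsetI)
    fix v assume "v \<in> OV"
    then obtain x where x: "x \<in> OK" "v = \<mu> x" by (auto simp: OV_def)
    obtain k :: "nat \<Rightarrow> int" where "x = (\<Sum>i<n. of_int (k i) * bs ! i)" using bs_ex[OF x(1)] by blast
    then have "v = (\<Sum>i<d. of_int (k i) *\<^sub>R c i)" using x(2) bsi by (simp add: mu_comb c_def nd)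
    then show "v \<in> V.lat c" by (auto simp: V.lat_def V_N)
  next
    fix v assume "v \<in> V.lat c"
    then obtain k :: "nat \<Rightarrow> int" where "v = (\<Sum>i<d. of_int (k i) *\<^sub>R c i)" by (auto simp: V.lat_def V_N)
    then have "v = \<mu> (\<Sum>i<d. of_int (k i) * bs ! i)" using bsi by (simp add: mu_comb c_def nd)
    then show "v \<in> OV" using sumOK[of d "\<lambda>i. bs ! i" k] bsi by (auto simp: OV_def nd)
  qed
  have "OV \<subseteq> Real_Vector_Spaces.span (c ` {..<d})"
  proof
    fix v assume "v \<in> OV"
    then obtain k :: "nat \<Rightarrow> int" where v: "v = (\<Sum>i<d. of_int (k i) *\<^sub>R c i)" unfolding OVc by (auto simp: V.lat_def V_N)
    show "v \<in> Real_Vector_Spaces.span (c ` {..<d})"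
      unfolding v by (intro real_vector.span_sum real_vector.span_scale real_vector.span_base) simp
  qed
  then have "Real_Vector_Spaces.span OV \<subseteq> Real_Vector_Spaces.span (c ` {..<d})"
    by (rule real_vector.span_minimal[OF _ real_vector.subspace_span])
  moreover have "Real_Vector_Spaces.span (c ` {..<d}) \<subseteq> V"
    using cV by (intro real_vector.span_minimal[OF _ V_subspace]) auto
  ultimately have "Real_Vector_Spaces.span (c ` {..<d}) = V" using V.lattice_span[OF OV_lattice] by blast
  then obtain c' where c': "V.dual_pair c c'" using V.spanning_dual_pair[of c] cV by (auto simp: V_N)
  have "discriminant K = Determinant.det (Matrix.mat d d (\<lambda>(i, j). field_trace K (bs ! i * bs ! j)))"
    unfolding discriminant_def bs_def[symmetric] Let_def n_def[symmetric] nd ..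
  also have "Matrix.mat d d (\<lambda>(i, j). field_trace K (bs ! i * bs ! j)) = Sm c * transpose_mat (Sm c)"
  proof (rule eq_matI)
    fix i j assume "i < dim_row (Sm c * transpose_mat (Sm c))" "j < dim_col (Sm c * transpose_mat (Sm c))"
    then have ij: "i < d" "j < d" by (auto simp: Sm_def)
    have "field_trace K (bs ! i * bs ! j) = (\<Sum>\<sigma>\<in>S. c i \<sigma> * c j \<sigma>)"
      using bsi[of i] bsi[of j] ij by (simp add: nd field_trace_eq sum_S conjg_hom c_def)
    also have "\<dots> = (\<Sum>k<d. c i (en k) * c j (en k))"
      by (rule sum.reindex_bij_betw[OF bij_en, symmetric])
    finally show "Matrix.mat d d (\<lambda>(i, j). field_trace K (bs ! i * bs ! j)) $$ (i, j) = (Sm c * transpose_mat (Sm c)) $$ (i, j)"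
      using ij by (simp add: Sm_def scalar_prod_def atLeast0LessThan)
  qed (auto simp: Sm_def)
  finally have "discriminant K = (Determinant.det (Sm c))\<^sup>2"
    by (simp add: det_mult[of _ d] det_transpose[of _ d] power2_eq_square)
  then have "cmod (discriminant K) = Determinant.det (V.gram c)"
    using det_gram[OF cV] by (simp add: norm_power)
  also have "\<dots> = (covolume V ip OV)\<^sup>2"
    unfolding OVc V.covolume_lat(1)[OF c'] using V.gram_det(3)[OF c'] by simp
  finally show ?thesis .
qed

section \<open>The Euclidean plane over K and its isometry\<close>

abbreviation PL where "PL \<equiv> plane K"
abbreviation pip where "pip \<equiv> plane_ip K"

lemma PL_alt: "PL = V \<times> V"
  by (simp add: plane_def)

end

sublocale cyclotomic \<subseteq> W: euclidean_subspace "plane K" "plane_ip K"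
proof
  show "Real_Vector_Spaces.subspace PL"
    using V_subspace by (auto simp: PL_alt real_vector.subspace_def zero_prod_def)
  obtain B where "finite B" "Real_Vector_Spaces.span B = V" using V.finite_dim by blast
  then show "\<exists>S. finite S \<and> Real_Vector_Spaces.span S = PL"
    using span_product[of B B] by (intro exI[of _ "(\<lambda>x. (x, 0)) ` B \<union> (\<lambda>y. (0, y)) ` B"]) (simp add: PL_alt)
  fix x y z :: "mink \<times> mink" and r :: real
  show "pip (x + y) z = pip x z + pip y z" by (simp add: plane_ip_def V.ip_linear)
  show "pip (r *\<^sub>R x) z = r * pip x z" by (simp add: plane_ip_def V.ip_linear distrib_left)
  show "pip x y = pip y x" by (simp add: plane_ip_def V.ip_commute)
  show "pip x x > 0" if "x \<in> PL" "x \<noteq> 0"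
  proof -
    have "fst x \<in> V" "snd x \<in> V" using that(1) by (auto simp: PL_alt)
    moreover have "fst x \<noteq> 0 \<or> snd x \<noteq> 0" using that(2) by (auto simp: prod_eq_iff)
    ultimately show ?thesis
      using V.ip_pos[of "fst x"] V.ip_pos[of "snd x"] V.ip_nonneg[of "fst x"] V.ip_nonneg[of "snd x"]
      unfolding plane_ip_def by (metis add_nonneg_pos add_pos_nonneg)
  qed
qed

context cyclotomic
begin

lemma W_N: "W.N = 2 * d"
proof -
  define B where "B = (\<lambda>x. (x, 0 :: mink)) ` V.E \<union> (\<lambda>y. (0 :: mink, y)) ` V.E"
  have E: "finite V.E" "Real_Vector_Spaces.span V.E = V" "\<And>x y. x \<in> V.E \<Longrightarrow> y \<in> V.E \<Longrightarrow> ip x y = (if x = y then 1 else 0)"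
    using V.orthonormal_basis_E by (auto simp: orthonormal_basis_def)
  have nz: "x \<noteq> 0" if "x \<in> V.E" for x using E(3)[OF that that] by auto
  have "card B = card ((\<lambda>x. (x, 0 :: mink)) ` V.E) + card ((\<lambda>y. (0 :: mink, y)) ` V.E)"
    unfolding B_def using E(1) nz by (intro card_Un_disjoint) auto
  also have "\<dots> = 2 * d" by (simp add: card_image inj_on_def V.N_def[symmetric] V_N)
  finally have card: "card B = 2 * d" .
  have "finite B" using E(1) by (simp add: B_def)
  moreover have "pip x y = (if x = y then 1 else 0)" if xy: "x \<in> B" "y \<in> B" for x y
    using xy nz E(3) unfolding B_def plane_ip_def by fastforce
  ultimately have "\<not> Real_Vector_Spaces.dependent B" by (intro W.orthonormal_independent)
  moreover have "Real_Vector_Spaces.span B = PL" using span_product[of V.E V.E] E(2) by (simp add: B_def PL_alt)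
  ultimately show ?thesis
    using real_vector.dim_span_eq_card_independent[of B] W.dim_V card by simp
qed

lemma product_lattice:
  assumes A: "is_lattice V A" and B: "is_lattice V B"
  shows "is_lattice PL (A \<times> B)"
proof -
  obtain \<epsilon> where \<epsilon>: "\<epsilon> > 0" "\<And>x. x \<in> A \<Longrightarrow> x \<noteq> 0 \<Longrightarrow> ip x x \<ge> \<epsilon>" using V.lattice_min_pos[OF A] by blast
  obtain \<delta> where \<delta>: "\<delta> > 0" "\<And>x. x \<in> B \<Longrightarrow> x \<noteq> 0 \<Longrightarrow> ip x x \<ge> \<delta>" using V.lattice_min_pos[OF B] by blast
  show ?thesis
  proof (rule W.discrete_subgroup_is_lattice[of _ "min \<epsilon> \<delta>"])
    show sub: "A \<times> B \<subseteq> PL" using V.lattice_closed(6)[OF A] V.lattice_closed(6)[OF B] by (auto simp: PL_alt)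
    show "0 \<in> A \<times> B" using V.lattice_closed(1)[OF A] V.lattice_closed(1)[OF B] by (simp add: zero_prod_def)
    show "x - y \<in> A \<times> B" if "x \<in> A \<times> B" "y \<in> A \<times> B" for x y
      using that V.lattice_closed(3)[OF A] V.lattice_closed(3)[OF B] by (simp add: mem_Times_iff)
    show "min \<epsilon> \<delta> \<le> pip x x" if x: "x \<in> A \<times> B" "x \<noteq> 0" for x
    proof -
      have V: "fst x \<in> V" "snd x \<in> V" using x(1) sub by (auto simp: PL_alt)
      have "fst x \<noteq> 0 \<or> snd x \<noteq> 0" using x(2) by (auto simp: prod_eq_iff)
      then have "ip (fst x) (fst x) \<ge> \<epsilon> \<or> ip (snd x) (snd x) \<ge> \<delta>" using x(1) \<epsilon>(2) \<delta>(2) by (auto simp: mem_Times_iff)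
      then show ?thesis using V.ip_nonneg[OF V(1)] V.ip_nonneg[OF V(2)] unfolding plane_ip_def by linarith
    qed
    have "(\<lambda>x. (x, 0)) ` A \<union> (\<lambda>y. (0, y)) ` B \<subseteq> A \<times> B"
      using V.lattice_closed(1)[OF A] V.lattice_closed(1)[OF B] by auto
    then have "PL \<subseteq> Real_Vector_Spaces.span (A \<times> B)"
      using real_vector.span_mono[of "(\<lambda>x. (x, 0)) ` A \<union> (\<lambda>y. (0, y)) ` B" "A \<times> B"]
      by (simp add: span_product V.lattice_span[OF A] V.lattice_span[OF B] PL_alt)
    moreover have "Real_Vector_Spaces.span (A \<times> B) \<subseteq> PL"
      using real_vector.span_minimal[OF sub W.subspace_V] .
    ultimately show "Real_Vector_Spaces.span (A \<times> B) = PL" by blast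
  qed (use \<epsilon>(1) \<delta>(1) in simp)
qed

definition symp :: "mink \<times> mink \<Rightarrow> mink \<times> mink" where
  "symp w = (- cnjf (snd w), cnjf (fst w))"

lemma symp_symp: "symp (symp w) = - w"
  by (simp add: symp_def prod_eq_iff)

lemma symp_PL: "w \<in> PL \<Longrightarrow> symp w \<in> PL"
  by (auto simp: PL_alt symp_def V_cnjf)

lemma symp_isometry: "linear_isometry PL pip symp"
  unfolding linear_isometry_def
proof (intro conjI ballI allI)
  have "- symp w \<in> PL" if "w \<in> PL" for w
    using symp_PL[OF that] by (auto simp: PL_alt)
  moreover have "symp (- w) = - symp w" for w by (simp add: symp_def prod_eq_iff)
  ultimately show "bij_betw symp PL PL"
    by (intro bij_betwI[where g = "\<lambda>w. - symp w"]) (auto simp: symp_PL symp_symp)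
  fix x y :: "mink \<times> mink" and r
  show "symp (x + y) = symp x + symp y" "symp (r *\<^sub>R x) = r *\<^sub>R symp x"
    by (simp_all add: symp_def prod_eq_iff)
  have "ip (- u) (- v) = ip u v" for u v by (simp add: mink_ip_def fun_ops)
  then show "pip (symp x) (symp y) = pip x y"
    by (simp add: plane_ip_def symp_def ip_cnjf)
qed

end

context cyclotomic_prime
begin

section \<open>The lattice Lambda_0, its sublattice P Lambda_0 and the lattices between them\<close>

definition alpha where "alpha = scaling m P"
definition cv where "cv = covolume V ip OV"

lemma cv_pos: "cv > 0"
  unfolding cv_def by (rule V.covolume_pos[OF OV_lattice])

lemma alpha_pos: "alpha > 0" and alpha_power: "alpha ^ d = sqrt (real q) * cv"
proof -
  have \<alpha>: "alpha = (real q * cv\<^sup>2) powr (1 / (2 * real d))"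
    unfolding alpha_def scaling_def K_def[symmetric] d_def[symmetric] q_def discriminant_covolume cv_def ..
  have pos: "real q * cv\<^sup>2 > 0" using q2 cv_pos by simp
  show "alpha > 0" unfolding \<alpha> using q2 cv_pos by simp
  then have "alpha ^ d = alpha powr real d" by (simp add: powr_realpow)
  also have "\<dots> = (real q * cv\<^sup>2) powr (1 / 2)" unfolding \<alpha> using d_pos by (simp add: powr_powr)
  also have "\<dots> = sqrt (real q * cv\<^sup>2)" using pos by (simp add: powr_half_sqrt)
  also have "\<dots> = sqrt (real q) * cv" using cv_pos by (simp add: real_sqrt_mult)
  finally show "alpha ^ d = sqrt (real q) * cv" .
qed

definition OA where "OA = (\<lambda>x. inverse alpha *\<^sub>R x) ` OV"
definition PA where "PA = (\<lambda>x. inverse alpha *\<^sub>R x) ` PV"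
definition DA where "DA = (\<lambda>x. alpha *\<^sub>R x) ` PD"
definition EA where "EA = (\<lambda>x. alpha *\<^sub>R x) ` OD"

text \<open>The purpose of \<open>alpha\<close>: both factors of Lambda_0 get covolume q^(-1/2) and
  both factors of P Lambda_0 get q^(1/2), so that the same estimates serve both coordinates.\<close>

lemma scaled_lattices:
  "is_lattice V OA" "is_lattice V PA" "is_lattice V DA" "is_lattice V EA"
  "covolume V ip OA = 1 / sqrt (real q)" "covolume V ip DA = 1 / sqrt (real q)"
  "covolume V ip PA = sqrt (real q)" "covolume V ip EA = sqrt (real q)"
proof -
  have i: "inverse alpha > 0" using alpha_pos by simp
  have q: "real q > 0" "sqrt (real q) > 0" using q2 by auto
  have PDc: "covolume V ip PD = 1 / (real q * cv)"
    using PD_lattice(2) covolume_PV cv_pos q by (simp add: cv_def field_simps)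
  have ODc: "covolume V ip OD = 1 / cv" using OD_lattice(2) cv_pos by (simp add: cv_def field_simps)
  have qq: "sqrt (real q) * sqrt (real q) = real q" by simp
  show "is_lattice V OA" "is_lattice V PA" "is_lattice V DA" "is_lattice V EA"
    unfolding OA_def PA_def DA_def EA_def
    using scaled_lattice(1)[OF _ i] scaled_lattice(1)[OF _ alpha_pos] OV_lattice PV_lattice PD_lattice(1) OD_lattice(1) by blast+
  show "covolume V ip OA = 1 / sqrt (real q)"
    unfolding OA_def scaled_lattice(2)[OF OV_lattice i] using cv_pos q
    by (simp add: power_inverse alpha_power cv_def[symmetric] field_simps)
  show "covolume V ip DA = 1 / sqrt (real q)"
    unfolding DA_def scaled_lattice(2)[OF PD_lattice(1) alpha_pos] alpha_power PDc using cv_pos q qq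
    by (simp add: divide_simps)
  show "covolume V ip PA = sqrt (real q)"
    unfolding PA_def scaled_lattice(2)[OF PV_lattice i] covolume_PV power_inverse alpha_power cv_def[symmetric]
    using cv_pos q qq by (simp add: divide_simps)
  show "covolume V ip EA = sqrt (real q)"
    unfolding EA_def scaled_lattice(2)[OF OD_lattice(1) alpha_pos] alpha_power ODc using cv_pos by simp
qed

text \<open>Points in unscaled coordinates, the first one a field element, so that conditions modulo
  \<open>P\<close> and modulo \<open>OD\<close> can be read off.\<close>

definition pt :: "complex \<Rightarrow> mink \<Rightarrow> mink \<times> mink" where "pt a y = (inverse alpha *\<^sub>R \<mu> a, alpha *\<^sub>R y)"

lemma pt_closed:
  assumes "a \<in> K" "b \<in> K"
  shows "pt a y + pt b z = pt (a + b) (y + z)" "pt a y - pt b z = pt (a - b) (y - z)"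
    "plane_smult K a (pt b z) = pt (a * b) (\<mu> a * z)"
  using assms by (simp_all add: pt_def mu_hom scaleR_add_right scaleR_diff_right plane_smult_def scaleR_mult_fun mult.commute)

lemma pt_inj: "a \<in> K \<Longrightarrow> b \<in> K \<Longrightarrow> pt a y = pt b z \<longleftrightarrow> a = b \<and> y = z"
  using alpha_pos mu_inj'[of a b] real_vector.scale_left_imp_eq[of alpha y z] by (auto simp: pt_def)

lemma pt_PL: "a \<in> K \<Longrightarrow> y \<in> V \<Longrightarrow> pt a y \<in> PL"
  using V_subspace by (simp add: pt_def PL_alt real_vector.subspace_def)

lemma pt_Collect:
  assumes A: "\<And>b z. A b z \<Longrightarrow> b \<in> K" and a: "a \<in> K"
  shows "pt a y \<in> {pt a y | a y. A a y} \<longleftrightarrow> A a y"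
proof
  assume "pt a y \<in> {pt a y | a y. A a y}"
  then obtain b z where bz: "pt a y = pt b z" "A b z" by (elim CollectE exE conjE)
  then show "A a y" using pt_inj[OF a A[OF bz(2)], of y z] by simp
next
  assume "A a y"
  then show "pt a y \<in> {pt a y | a y. A a y}" by (intro CollectI exI[of _ a] exI[of _ y] conjI refl)
qed

definition Lam0 where "Lam0 = Lambda0 m P"
definition N0 where "N0 = P_Lambda0 m P"

lemma Lam0_prod: "Lam0 = OA \<times> DA"
  unfolding Lam0_def Lambda0_def Let_def K_def[symmetric] OK_def[symmetric] OV_def[symmetric] OD_def[symmetric]
    inverse_ideal_OD OA_def DA_def alpha_def ..

lemma Lam0_alt: "Lam0 = {pt a y | a y. a \<in> OK \<and> y \<in> PD}"
  unfolding Lam0_prod OA_def DA_def OV_def pt_def by auto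

lemma Lam0_iff: "a \<in> K \<Longrightarrow> pt a y \<in> Lam0 \<longleftrightarrow> a \<in> OK \<and> y \<in> PD"
  unfolding Lam0_alt by (rule pt_Collect) auto

lemma Lam0_cases: "w \<in> Lam0 \<Longrightarrow> (\<And>a y. a \<in> OK \<Longrightarrow> y \<in> PD \<Longrightarrow> w = pt a y \<Longrightarrow> thesis) \<Longrightarrow> thesis"
  unfolding Lam0_alt by blast

lemma Lam0_lattice: "is_lattice PL Lam0"
  unfolding Lam0_prod by (intro product_lattice scaled_lattices)

text \<open>For the second inclusion a point w is written as (1 - bb) w + p ((bb / p) w). The point
  (bb / p) w lies in \<open>Lam0\<close> because \<open>bb / of_nat p\<close> maps \<open>P\<close>
  into the integers and \<open>OD\<close> into \<open>PD\<close>.\<close>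

lemma N0_prod: "N0 = PA \<times> EA"
proof (intro subset_antisym)
  have "module_prod (plane_smult K) P Lam0 \<subseteq> PA \<times> EA"
  proof (rule module_prod_subset)
    fix a w assume a: "a \<in> P" and "w \<in> Lam0"
    then obtain b y where w: "b \<in> OK" "y \<in> PD" "w = pt b y" using Lam0_cases by blast
    have "\<mu> (a * b) \<in> PV" using P_mult_right[OF w(1) a] a w(1) by (simp add: PV_def mult.commute)
    moreover have "\<mu> a * y \<in> OD" using P_PD[OF a w(2)] .
    ultimately show "plane_smult K a w \<in> PA \<times> EA"
      using w(1) a unfolding w(3) by (simp add: pt_closed(3)) (simp add: pt_def PA_def EA_def imageI)
  next
    show "0 \<in> PA \<times> EA"
      using V.lattice_closed(1)[OF scaled_lattices(2)] V.lattice_closed(1)[OF scaled_lattices(4)] by (simp add: zero_prod_def)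
    show "x + y \<in> PA \<times> EA" if "x \<in> PA \<times> EA" "y \<in> PA \<times> EA" for x y
      using that V.lattice_closed(2)[OF scaled_lattices(2)] V.lattice_closed(2)[OF scaled_lattices(4)] by (simp add: mem_Times_iff)
  qed
  then show "N0 \<subseteq> PA \<times> EA" by (simp add: N0_def P_Lambda0_def K_def Lam0_def)
  show "PA \<times> EA \<subseteq> N0"
  proof
    fix w assume "w \<in> PA \<times> EA"
    then obtain a y where w: "a \<in> P" "y \<in> OD" "w = pt a y" by (auto simp: PA_def EA_def PV_def pt_def)
    have aOK: "a \<in> OK" using w(1) by simp
    have yPD: "y \<in> PD" using w(2) OD_PD by blast
    have 1: "w \<in> Lam0" using w yPD aOK by (simp add: Lam0_iff)
    have 2: "pt (bb / of_nat p * a) (\<mu> (bb / of_nat p) * y) \<in> Lam0"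
      using bb(3)[OF w(1)] inverse_OD[OF bbp_inverse w(2)] by (auto simp: Lam0_alt)
    have b2: "of_nat p * (bb / of_nat p * a) = bb * a" using p_pos by simp
    have "plane_smult K (1 - bb) w + plane_smult K (of_nat p) (pt (bb / of_nat p * a) (\<mu> (bb / of_nat p) * y)) \<in> N0"
      unfolding N0_def P_Lambda0_def K_def[symmetric] Lam0_def[symmetric]
      by (rule module_prod_2[OF bb(2) 1 p_in_P 2])
    also have "plane_smult K (1 - bb) w = pt ((1 - bb) * a) (\<mu> (1 - bb) * y)"
      unfolding w(3) using bb(2) aOK by (intro pt_closed(3)) auto
    also have "plane_smult K (of_nat p) (pt (bb / of_nat p * a) (\<mu> (bb / of_nat p) * y)) =
        pt (bb * a) (\<mu> (of_nat p) * (\<mu> (bb / of_nat p) * y))"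
      unfolding b2[symmetric] using bbp_K aOK by (intro pt_closed(3) K_closed(3)) auto
    also have "pt ((1 - bb) * a) (\<mu> (1 - bb) * y) + pt (bb * a) (\<mu> (of_nat p) * (\<mu> (bb / of_nat p) * y)) =
        pt ((1 - bb) * a + bb * a) (\<mu> (1 - bb) * y + \<mu> (of_nat p) * (\<mu> (bb / of_nat p) * y))"
      using bb(1) aOK by (intro pt_closed(1) K_closed(3)) auto
    also have "\<dots> = w"
      unfolding w(3) mu_decompose[OF OD_V[OF w(2)], symmetric] by (simp add: algebra_simps)
    finally show "w \<in> N0" .
  qed
qed

lemma N0_lattice: "is_lattice PL N0"
  unfolding N0_prod by (intro product_lattice scaled_lattices)

lemma N0_alt: "N0 = {pt a y | a y. a \<in> P \<and> y \<in> OD}"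
  unfolding N0_prod PA_def EA_def PV_def pt_def by auto

lemma N0_iff: "a \<in> K \<Longrightarrow> pt a y \<in> N0 \<longleftrightarrow> a \<in> P \<and> y \<in> OD"
  unfolding N0_alt by (rule pt_Collect) auto

lemma N0_Lam0: "N0 \<subseteq> Lam0"
proof
  fix w assume "w \<in> N0"
  then obtain a y where "a \<in> P" "y \<in> OD" "w = pt a y" unfolding N0_alt by blast
  then show "w \<in> Lam0" using OD_PD by (simp add: Lam0_iff subset_iff)
qed

definition y0 where "y0 = (SOME y0. y0 \<in> PD \<and> (\<forall>a\<in>OK. \<mu> a * y0 \<in> OD \<longrightarrow> a \<in> P) \<and> (\<forall>y\<in>PD. \<exists>a\<in>OK. y - \<mu> a * y0 \<in> OD))"

lemma y0: "y0 \<in> PD" "a \<in> OK \<Longrightarrow> \<mu> a * y0 \<in> OD \<Longrightarrow> a \<in> P" "y \<in> PD \<Longrightarrow> \<exists>a\<in>OK. y - \<mu> a * y0 \<in> OD"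
proof -
  have "\<exists>y0. y0 \<in> PD \<and> (\<forall>a\<in>OK. \<mu> a * y0 \<in> OD \<longrightarrow> a \<in> P) \<and> (\<forall>y\<in>PD. \<exists>a\<in>OK. y - \<mu> a * y0 \<in> OD)"
    by (rule PD_generator) blast
  from someI_ex[OF this]
  show "y0 \<in> PD" "a \<in> OK \<Longrightarrow> \<mu> a * y0 \<in> OD \<Longrightarrow> a \<in> P" "y \<in> PD \<Longrightarrow> \<exists>a\<in>OK. y - \<mu> a * y0 \<in> OD"
    unfolding y0_def by blast+
qed

text \<open>As \<open>t\<close> runs through \<open>\<O>/P\<close>, these are the lattices of all lines except the second coordinate axis.\<close>
definition Lam where "Lam t = {pt a y | a y. a \<in> OK \<and> y \<in> PD \<and> y - \<mu> (t * a) * y0 \<in> OD}"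

lemma Lam_iff: "a \<in> K \<Longrightarrow> pt a y \<in> Lam t \<longleftrightarrow> a \<in> OK \<and> y \<in> PD \<and> y - \<mu> (t * a) * y0 \<in> OD"
  unfolding Lam_def by (rule pt_Collect) auto

lemma Lam_cases:
  "w \<in> Lam t \<Longrightarrow> (\<And>a y. a \<in> OK \<Longrightarrow> y \<in> PD \<Longrightarrow> y - \<mu> (t * a) * y0 \<in> OD \<Longrightarrow> w = pt a y \<Longrightarrow> thesis) \<Longrightarrow> thesis"
  unfolding Lam_def by blast

lemma Lam_Lam0: "Lam t \<subseteq> Lam0"
  unfolding Lam_def Lam0_alt by blast

lemma OD_add: "x \<in> OD \<Longrightarrow> y \<in> OD \<Longrightarrow> x + y \<in> OD" and OD_diff: "x \<in> OD \<Longrightarrow> y \<in> OD \<Longrightarrow> x - y \<in> OD"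
  and OD_0: "0 \<in> OD"
  using V.lattice_closed[OF OD_lattice(1)] by blast+

lemma PD_diff: "x \<in> PD \<Longrightarrow> y \<in> PD \<Longrightarrow> x - y \<in> PD"
  and PD_0: "0 \<in> PD"
  using V.lattice_closed[OF PD_lattice(1)] by blast+

lemma N0_Lam: "t \<in> OK \<Longrightarrow> N0 \<subseteq> Lam t"
proof
  fix w assume t: "t \<in> OK" and "w \<in> N0"
  then obtain a y where w: "a \<in> P" "y \<in> OD" "w = pt a y" unfolding N0_alt by blast
  have "\<mu> (t * a) * y0 \<in> OD" using P_PD[OF P_facts(4)[OF t w(1)] y0(1)] .
  then show "w \<in> Lam t" unfolding w(3) using w(1,2) OD_PD OD_diff by (simp add: Lam_iff subset_iff)
qed

lemma Lam_diff: "t \<in> OK \<Longrightarrow> x \<in> Lam t \<Longrightarrow> y \<in> Lam t \<Longrightarrow> x - y \<in> Lam t"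
proof -
  assume t: "t \<in> OK" and xy: "x \<in> Lam t" "y \<in> Lam t"
  obtain a u where x: "a \<in> OK" "u \<in> PD" "u - \<mu> (t * a) * y0 \<in> OD" "x = pt a u" using xy(1) by (rule Lam_cases)
  obtain b v where y: "b \<in> OK" "v \<in> PD" "v - \<mu> (t * b) * y0 \<in> OD" "y = pt b v" using xy(2) by (rule Lam_cases)
  have "(u - v) - \<mu> (t * (a - b)) * y0 = (u - \<mu> (t * a) * y0) - (v - \<mu> (t * b) * y0)"
    using t x(1) y(1) by (simp add: right_diff_distrib mu_hom(2) left_diff_distrib)
  also have "\<dots> \<in> OD" by (rule OD_diff[OF x(3) y(3)])
  finally have "(u - v) - \<mu> (t * (a - b)) * y0 \<in> OD" .
  then have "pt (a - b) (u - v) \<in> Lam t" using x y PD_diff by (subst Lam_iff) auto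
  then show ?thesis using x y by (simp add: pt_closed(2))
qed

text \<open>Squeezed between \<open>N0\<close>, which spans, and \<open>Lam0\<close>, which is
  discrete.\<close>

lemma Lam_lattice: "t \<in> OK \<Longrightarrow> is_lattice PL (Lam t)"
proof -
  assume t: "t \<in> OK"
  obtain \<epsilon> where \<epsilon>: "\<epsilon> > 0" "\<And>x. x \<in> Lam0 \<Longrightarrow> x \<noteq> 0 \<Longrightarrow> pip x x \<ge> \<epsilon>" using W.lattice_min_pos[OF Lam0_lattice] by blast
  have sub: "Lam t \<subseteq> PL" using Lam_Lam0 W.lattice_closed(6)[OF Lam0_lattice] by blast
  have "PL \<subseteq> Real_Vector_Spaces.span (Lam t)"
    using real_vector.span_mono[OF N0_Lam[OF t]] W.lattice_span[OF N0_lattice] by simp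
  moreover have "Real_Vector_Spaces.span (Lam t) \<subseteq> PL"
    using real_vector.span_minimal[OF sub W.subspace_V] .
  ultimately have sp: "Real_Vector_Spaces.span (Lam t) = PL" by blast
  show ?thesis
  proof (rule W.discrete_subgroup_is_lattice[OF sub _ _ \<epsilon>(1) _ sp])
    show "0 \<in> Lam t" using N0_Lam[OF t] W.lattice_closed(1)[OF N0_lattice] by blast
    show "x - y \<in> Lam t" if "x \<in> Lam t" "y \<in> Lam t" for x y using Lam_diff[OF t that] .
    show "\<epsilon> \<le> pip x x" if "x \<in> Lam t" "x \<noteq> 0" for x using \<epsilon>(2) that Lam_Lam0 by blast
  qed
qed

text \<open>\<open>alpha\<close> cancels against its inverse, and so do the conjugations; what
  remains is an alternating pairing of the unscaled coordinates in the trace form.\<close>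

lemma pip_symp: "pip (symp (inverse alpha *\<^sub>R u, alpha *\<^sub>R v)) (pt a y) = tp y u - tp v (\<mu> a)"
proof -
  have "ip (- cnjf (alpha *\<^sub>R v)) (inverse alpha *\<^sub>R \<mu> a) = - tp v (\<mu> a)"
  proof -
    have "ip (- cnjf (alpha *\<^sub>R v)) (inverse alpha *\<^sub>R \<mu> a) = - (alpha * inverse alpha) * ip (cnjf v) (\<mu> a)"
      by (simp add: V.ip_linear mult_ac)
    also have "\<dots> = - tp v (\<mu> a)" using alpha_pos ip_cnjf[of v "cnjf (\<mu> a)"] by (simp add: tp_def)
    finally show ?thesis .
  qed
  moreover have "ip (cnjf (inverse alpha *\<^sub>R u)) (alpha *\<^sub>R y) = tp y u"
  proof -
    have "ip (cnjf (inverse alpha *\<^sub>R u)) (alpha *\<^sub>R y) = (alpha * inverse alpha) * ip (cnjf u) y"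
      by (simp add: V.ip_linear mult_ac)
    also have "\<dots> = tp y u" using alpha_pos by (simp add: tp_def V.ip_commute[of y])
    finally show ?thesis .
  qed
  ultimately show ?thesis by (simp add: plane_ip_def symp_def pt_def)
qed

lemma OD_cnjf: "y \<in> OD \<Longrightarrow> cnjf y \<in> OD"
  unfolding OD_def dual_lattice_def OV_def
proof (clarsimp simp: V_cnjf)
  fix a assume "\<forall>a\<in>OK. ip y (\<mu> a) \<in> \<int>" "a \<in> OK"
  then have "ip y (\<mu> (cnj a)) \<in> \<int>" by auto
  moreover have "ip (cnjf y) (\<mu> a) = ip (cnjf y) (cnjf (\<mu> (cnj a)))"
    using mu_cnj[of "cnj a"] cnj_K \<open>a \<in> OK\<close> by auto
  ultimately show "ip (cnjf y) (\<mu> a) \<in> \<int>" by (simp add: ip_cnjf)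
qed

text \<open>The contributions of \<open>y0\<close> to the pairing of two points are symmetric in the
  points and cancel, while the remainders lie in \<open>OD\<close> and pair integrally. Conversely,
  testing an element of the dual against three kinds of points of \<open>Lam t\<close> recovers the
  three conditions that define \<open>Lam t\<close>.\<close>

lemma Lam_dual:
  assumes t: "t \<in> OK"
  shows "symp ` Lam t = dual_lattice PL pip (Lam t)"
proof (intro subset_antisym subsetI)
  fix w assume "w \<in> symp ` Lam t"
  then obtain a y where w: "a \<in> OK" "y \<in> PD" "y - \<mu> (t * a) * y0 \<in> OD" "w = symp (pt a y)"
    by (auto elim: Lam_cases)
  have "pip w z \<in> \<int>" if zL: "z \<in> Lam t" for z
  proof -
    obtain b u where z: "b \<in> OK" "u \<in> PD" "u - \<mu> (t * b) * y0 \<in> OD" "z = pt b u" using zL by (rule Lam_cases)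
    have *: "tp (\<mu> (t * c) * y0) (\<mu> e) = tp y0 (\<mu> (t * c * e))" if "c \<in> OK" "e \<in> OK" for c e
      using that t tp_mult[of y0 "\<mu> (t * c)" "\<mu> e"] by (simp add: mult.commute[of y0] mu_hom(3))
    have "pip w z = tp u (\<mu> a) - tp y (\<mu> b)" unfolding w(4) z(4) pt_def[of a] by (rule pip_symp)
    also have "\<dots> = tp (u - \<mu> (t * b) * y0) (\<mu> a) - tp (y - \<mu> (t * a) * y0) (\<mu> b)"
      using *[OF z(1) w(1)] *[OF w(1) z(1)] by (simp add: tp_linear mult_ac)
    also have "\<dots> \<in> \<int>" using w(1,3) z(1,3) by (intro Ints_diff) (auto simp: OD_iff)
    finally show ?thesis .
  qed
  moreover have "w \<in> PL" using w pt_PL[of a y] PD_V symp_PL by auto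
  ultimately show "w \<in> dual_lattice PL pip (Lam t)" by (simp add: dual_lattice_def)
next
  fix w assume w: "w \<in> dual_lattice PL pip (Lam t)"
  then have wPL: "w \<in> PL" by (simp add: dual_lattice_def)
  define X where "X = alpha *\<^sub>R fst (- symp w)"
  define Y where "Y = inverse alpha *\<^sub>R snd (- symp w)"
  have *: "(inverse alpha *\<^sub>R X, alpha *\<^sub>R Y) = - symp w"
    using alpha_pos by (simp add: X_def Y_def prod_eq_iff)
  have neg: "symp (- z) = - symp z" for z by (simp add: symp_def prod_eq_iff)
  have ws: "w = symp (inverse alpha *\<^sub>R X, alpha *\<^sub>R Y)" unfolding * neg symp_symp by simp
  have XY: "X \<in> V" "Y \<in> V"
    using symp_PL[OF wPL] V_subspace by (auto simp: X_def Y_def PL_alt real_vector.subspace_def)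
  have int: "tp y X - tp Y (\<mu> a) \<in> \<int>" if "a \<in> OK" "y \<in> PD" "y - \<mu> (t * a) * y0 \<in> OD" for a y
  proof -
    have "pt a y \<in> Lam t" using that by (auto simp: Lam_def)
    then have "pip w (pt a y) \<in> \<int>" using w by (simp add: dual_lattice_def)
    then show ?thesis unfolding ws pip_symp .
  qed
  have "ip X y \<in> \<int>" if y: "y \<in> OD" for y
  proof -
    have "cnjf y \<in> OD" using OD_cnjf y by blast
    \<comment> \<open>Points (0, y) with \<open>y\<close> in \<open>OD\<close> are the first test:
      they put \<open>X\<close> into the dual of \<open>OD\<close>, which is
      \<open>OV\<close>.\<close>
    then have "tp (cnjf y) X \<in> \<int>" using int[of 0 "cnjf y"] OD_PD by (auto simp: tp_linear)
    then show ?thesis by (simp add: tp_def ip_cnjf V.ip_commute)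
  qed
  then have "X \<in> OV" using XY(1) OD_lattice(3) by (auto simp: dual_lattice_def)
  then obtain a where a: "a \<in> OK" "X = \<mu> a" by (auto simp: OV_def)
  have YPD: "Y \<in> PD" unfolding PD_iff
  proof (intro conjI ballI XY)
    fix b assume b: "b \<in> P"
    \<comment> \<open>Second test: the points (b, 0) with \<open>b\<close> in
      \<open>P\<close>.\<close>
    have "0 - \<mu> (t * b) * y0 \<in> OD" by (rule OD_diff[OF OD_0 P_PD[OF P_facts(4)[OF t b] y0(1)]])
    then show "tp Y (\<mu> b) \<in> \<int>" using int[of b 0] b PD_0 by (simp add: tp_linear)
  qed
  have "Y - \<mu> (t * a) * y0 \<in> OD" unfolding OD_iff
  proof (intro conjI ballI)
    show "Y - \<mu> (t * a) * y0 \<in> V" using PD_V[OF PD_diff[OF YPD PD_mult[OF O_closed(3)[OF t a(1)] y0(1)]]] .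
    fix b assume b: "b \<in> OK"
    \<comment> \<open>Third test: the points with coordinates b and t b \<open>y0\<close>, for any
      integer \<open>b\<close>.\<close>
    have 1: "tp (\<mu> (t * b) * y0) X - tp Y (\<mu> b) \<in> \<int>"
      using b t y0(1) PD_mult[of "t * b" y0] OD_0 by (intro int) auto
    have "tp (\<mu> (t * b) * y0) X = tp y0 (\<mu> (t * b) * \<mu> a)"
      unfolding a(2) mult.commute[of _ y0] by (rule tp_mult)
    also have "\<mu> (t * b) * \<mu> a = \<mu> (t * a) * \<mu> b"
      using t a(1) b by (simp add: mu_hom(3) mult_ac)
    also have "tp y0 (\<mu> (t * a) * \<mu> b) = tp (\<mu> (t * a) * y0) (\<mu> b)"
      unfolding mult.commute[of _ y0] by (rule tp_mult[symmetric])
    finally have "tp (Y - \<mu> (t * a) * y0) (\<mu> b) = - (tp (\<mu> (t * b) * y0) X - tp Y (\<mu> b))"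
      by (simp add: tp_linear)
    then show "tp (Y - \<mu> (t * a) * y0) (\<mu> b) \<in> \<int>" using Ints_minus[OF 1] by simp
  qed
  then have "pt a Y \<in> Lam t" using a YPD by (auto simp: Lam_def)
  moreover have "w = symp (pt a Y)" unfolding ws a(2) pt_def ..
  ultimately show "w \<in> symp ` Lam t" by blast
qed

lemma Lam_symplectic: "t \<in> OK \<Longrightarrow> symplectic PL pip (Lam t)"
  unfolding symplectic_def using Lam_lattice Lam_dual symp_isometry symp_symp by blast

text \<open>\<open>symp\<close> maps the lattice isometrically onto its dual, and the covolumes of a
  lattice and its dual have product 1.\<close>

lemma covolume_Lam: "t \<in> OK \<Longrightarrow> covolume PL pip (Lam t) = 1"
proof -
  assume t: "t \<in> OK"
  have 1: "covolume PL pip (symp ` Lam t) = covolume PL pip (Lam t)"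
    by (rule W.isometry_lattice(2)[OF Lam_lattice[OF t] symp_isometry])
  have "covolume PL pip (symp ` Lam t) * covolume PL pip (Lam t) = 1"
    unfolding Lam_dual[OF t] by (rule W.dual_lattice_facts(3)[OF Lam_lattice[OF t]])
  then have "(covolume PL pip (Lam t))\<^sup>2 = 1" unfolding 1 by (simp add: power2_eq_square)
  then show ?thesis using W.covolume_pos[OF Lam_lattice[OF t]] by (simp add: power2_eq_1_iff)
qed

text \<open>The points (0, t \<open>y0\<close>), with \<open>t\<close> running through the residues
  modulo \<open>P\<close>, represent \<open>Lam0\<close> modulo \<open>Lam 0\<close>, which has
  covolume 1.\<close>

lemma covolume_Lam0: "covolume PL pip Lam0 = 1 / real q"
proof -
  obtain T where T: "finite T" "T \<subseteq> OK" "card T = q" "\<And>x. x \<in> OK \<Longrightarrow> \<exists>t\<in>T. x - t \<in> P"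
    "\<And>x y. x \<in> T \<Longrightarrow> y \<in> T \<Longrightarrow> x - y \<in> P \<Longrightarrow> x = y" using residues by blast
  define g where "g t = pt 0 (\<mu> t * y0)" for t
  have g_diff: "g s - g t = pt 0 (\<mu> (s - t) * y0)" if "s \<in> OK" "t \<in> OK" for s t
    using that by (simp add: g_def pt_closed(2) mu_hom(2) left_diff_distrib)
  have mem: "pt 0 (\<mu> s * y0) \<in> Lam 0 \<longleftrightarrow> s \<in> P" if "s \<in> OK" for s
    using that y0(2)[of s] P_PD[OF _ y0(1)] PD_mult[OF _ y0(1)] by (subst Lam_iff) auto
  have inj: "inj_on g T"
  proof (rule inj_onI)
    fix s t assume st: "s \<in> T" "t \<in> T" "g s = g t"
    have "g s - g t \<in> Lam 0" using st(3) W.lattice_closed(1)[OF Lam_lattice[of 0]] by simp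
    moreover have OK: "s \<in> OK" "t \<in> OK" using st T(2) by auto
    ultimately have "s - t \<in> P" using mem[of "s - t"] by (simp add: g_diff)
    then show "s = t" using st(1,2) T(5) by blast
  qed
  have sub: "g ` T \<subseteq> Lam0" using T(2) PD_mult[OF _ y0(1)] by (auto simp: g_def Lam0_iff)
  have card: "card (g ` T) = q" using inj T(3) by (simp add: card_image)
  note L = Lam0_lattice Lam_lattice[of 0, OF O_closed(7)] Lam_Lam0[of 0]
  have "covolume PL pip (Lam 0) \<le> real (card (g ` T)) * covolume PL pip Lam0"
  proof (rule W.covolume_covered[OF L _ sub])
    fix x assume "x \<in> Lam0"
    then obtain a y where x: "a \<in> OK" "y \<in> PD" "x = pt a y" using Lam0_cases by blast
    obtain b where b: "b \<in> OK" "y - \<mu> b * y0 \<in> OD" using y0(3)[OF x(2)] by blast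
    obtain t where t: "t \<in> T" "b - t \<in> P" using T(4)[OF b(1)] by blast
    have tOK: "t \<in> OK" using t T(2) by blast
    have "y - \<mu> t * y0 = (y - \<mu> b * y0) + \<mu> (b - t) * y0"
      using b(1) tOK by (simp add: mu_hom(2) left_diff_distrib)
    also have "\<dots> \<in> OD" by (rule OD_add[OF b(2) P_PD[OF t(2) y0(1)]])
    finally have "y - \<mu> t * y0 \<in> OD" .
    moreover have "x - g t = pt a (y - \<mu> t * y0)" using x(1) by (simp add: x(3) g_def pt_closed(2))
    ultimately have "x - g t \<in> Lam 0" using x(1) OD_PD by (auto simp: Lam_iff)
    then show "\<exists>r\<in>g ` T. x - r \<in> Lam 0" using t(1) by blast
  qed (use T(1) in simp)
  moreover have "real (card (g ` T)) * covolume PL pip Lam0 \<le> covolume PL pip (Lam 0)"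
  proof (rule W.covolume_separated[OF L _ sub])
    fix x y assume "x \<in> g ` T" "y \<in> g ` T" "x - y \<in> Lam 0"
    then obtain s t where st: "s \<in> T" "x = g s" "t \<in> T" "y = g t" "g s - g t \<in> Lam 0" by blast
    moreover have OK: "s \<in> OK" "t \<in> OK" using st T(2) by auto
    ultimately have "s - t \<in> P" using mem[of "s - t"] by (simp add: g_diff)
    then show "x = y" using st T(5) by blast
  qed (use T(1) in simp)
  ultimately have "real q * covolume PL pip Lam0 = 1" unfolding card by (simp add: covolume_Lam)
  then show ?thesis using q2 by (simp add: field_simps)
qed

text \<open>For a common point, \<open>OD\<close> contains (s - t) a \<open>y0\<close>, so
  \<open>P\<close> contains (s - t) a and therefore \<open>a\<close>; then \<open>y\<close> lies in
  \<open>OD\<close> too.\<close>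

lemma Lam_Int:
  assumes st: "s \<in> OK" "t \<in> OK" "s - t \<notin> P"
  shows "Lam s \<inter> Lam t \<subseteq> N0"
proof
  fix w assume w: "w \<in> Lam s \<inter> Lam t"
  then obtain a y where a: "a \<in> OK" "y \<in> PD" "y - \<mu> (s * a) * y0 \<in> OD" "w = pt a y"
    by (auto elim: Lam_cases)
  have t: "y - \<mu> (t * a) * y0 \<in> OD" using w a(1,4) Lam_iff[of a y t] by auto
  have "\<mu> ((s - t) * a) * y0 = (y - \<mu> (t * a) * y0) - (y - \<mu> (s * a) * y0)"
    using st a(1) by (simp add: left_diff_distrib mu_hom(2))
  also have "\<dots> \<in> OD" by (rule OD_diff[OF t a(3)])
  finally have "\<mu> ((s - t) * a) * y0 \<in> OD" .
  then have "(s - t) * a \<in> P" by (rule y0(2)[rotated]) (use st a(1) in auto)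
  then have aP: "a \<in> P" using P_facts(6)[of "s - t" a] st a(1) by blast
  have "y = (y - \<mu> (t * a) * y0) + \<mu> (t * a) * y0" by simp
  also have "\<dots> \<in> OD" by (rule OD_add[OF t P_PD[OF P_facts(4)[OF st(2) aP] y0(1)]])
  finally show "w \<in> N0" using aP a by (simp add: N0_iff)
qed

section \<open>Short vectors, covering radius and the action of the roots of unity\<close>

lemma PD_nonzero: "v \<in> PD \<Longrightarrow> v \<noteq> 0 \<Longrightarrow> \<sigma> \<in> S \<Longrightarrow> v \<sigma> \<noteq> 0"
proof -
  assume v: "v \<in> PD" "v \<noteq> 0" "\<sigma> \<in> S"
  have "OV \<subseteq> PD" using OV_OD OD_PD by blast
  then obtain k where "k \<ge> 1" "of_nat k *\<^sub>R v \<in> OV"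
    using V.multiple_in_sublattice[OF PD_lattice(1) OV_lattice _ v(1)] by blast
  then show "v \<sigma> \<noteq> 0" using multiple_nonzero[OF v(2) _ _ v(3)] by blast
qed

lemma scaled_nonzero:
  assumes "v \<in> OA \<or> v \<in> PA \<or> v \<in> DA \<or> v \<in> EA" "v \<noteq> 0" "\<sigma> \<in> S"
  shows "v \<sigma> \<noteq> 0"
proof -
  have "\<exists>r x. v = r *\<^sub>R x \<and> x \<in> PD"
  proof -
    have *: "\<exists>r x. v = r *\<^sub>R x \<and> x \<in> PD" if v: "v \<in> (\<lambda>x. s *\<^sub>R x) ` X" and X: "X \<subseteq> PD" for X and s :: real
    proof -
      obtain x where "x \<in> X" "v = s *\<^sub>R x" using v by (rule imageE)
      then show ?thesis using X by (intro exI[of _ s] exI[of _ x]) auto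
    qed
    have "OV \<subseteq> PD" "PV \<subseteq> PD" using OD_PD OV_OD PV_OV by auto
    then show ?thesis
      using assms(1) unfolding OA_def PA_def DA_def EA_def by (elim disjE) (erule *, simp add: OD_PD)+
  qed
  then obtain r x where v: "v = r *\<^sub>R x" "x \<in> PD" by blast
  then show ?thesis using assms(2,3) PD_nonzero[OF v(2) _ assms(3)] by (auto simp: fun_ops)
qed

lemma scaled_mult:
  assumes "a \<in> OK"
  shows "x \<in> OA \<Longrightarrow> \<mu> a * x \<in> OA" "x \<in> PA \<Longrightarrow> \<mu> a * x \<in> PA" "x \<in> DA \<Longrightarrow> \<mu> a * x \<in> DA" "x \<in> EA \<Longrightarrow> \<mu> a * x \<in> EA"
proof -
  have *: "\<mu> a * x \<in> (\<lambda>x. r *\<^sub>R x) ` X" if "x \<in> (\<lambda>x. r *\<^sub>R x) ` X" "\<forall>x\<in>X. \<mu> a * x \<in> X" for r :: real and X and x :: mink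
    using that by (auto simp: scaleR_mult_fun mult.commute[of _ "\<mu> a"])
  have "\<forall>x\<in>OV. \<mu> a * x \<in> OV" using assms by (auto simp: OV_def mu_hom(3)[symmetric])
  then show "x \<in> OA \<Longrightarrow> \<mu> a * x \<in> OA" unfolding OA_def using * by blast
  have "\<forall>x\<in>PV. \<mu> a * x \<in> PV" using assms P_facts(4) by (auto simp: PV_def mu_hom(3)[symmetric])
  then show "x \<in> PA \<Longrightarrow> \<mu> a * x \<in> PA" unfolding PA_def using * by blast
  show "x \<in> DA \<Longrightarrow> \<mu> a * x \<in> DA" unfolding DA_def using * PD_mult[OF assms] by blast
  show "x \<in> EA \<Longrightarrow> \<mu> a * x \<in> EA" unfolding EA_def using * OD_mult[OF assms] by blast
qed

text \<open>\<open>L\<close> has covolume sqrt q while that of the integers is at most d!; by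
  \<open>short_vectors_bound\<close> the length of \<open>v\<close> has to account for the
  ratio.\<close>

lemma component_bound:
  assumes L: "is_lattice V L" "covolume V ip L = sqrt (real q)" "\<And>a x. a \<in> OK \<Longrightarrow> x \<in> L \<Longrightarrow> \<mu> a * x \<in> L"
    and v: "v \<in> L" "\<And>\<sigma>. \<sigma> \<in> S \<Longrightarrow> v \<sigma> \<noteq> 0"
  shows "real q \<le> (ip v v / d) ^ d * (fact d)\<^sup>2"
proof -
  have nn: "(ip v v / d) ^ d \<ge> 0"
    using V.ip_nonneg[OF V.lattice_closed(5)[OF L(1) v(1)]] by (simp add: zero_le_divide_iff)
  have "sqrt (real q) \<le> sqrt ((ip v v / d) ^ d) * covolume V ip OV"
    using short_vectors_bound[OF L(1,3) v] L(2) by simp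
  also have "\<dots> \<le> sqrt ((ip v v / d) ^ d) * fact d"
    using nn by (intro mult_left_mono covolume_OV_le) simp
  finally have "(sqrt (real q))\<^sup>2 \<le> (sqrt ((ip v v / d) ^ d) * fact d)\<^sup>2" by (intro power_mono) auto
  then show ?thesis using nn by (simp add: power_mult_distrib)
qed

text \<open>A nonzero point has a nonzero coordinate, and both factors of \<open>N0\<close> have
  covolume sqrt q. This bound keeps the short vectors of different \<open>Lam t\<close>
  apart.\<close>

lemma N0_short:
  assumes w: "w \<in> N0" "w \<noteq> 0"
  shows "real q \<le> (pip w w / d) ^ d * (fact d)\<^sup>2"
proof -
  obtain u v where uv: "w = (u, v)" "u \<in> PA" "v \<in> EA" using w(1) unfolding N0_prod by blast
  have V: "ip u u \<ge> 0" "ip v v \<ge> 0"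
    using uv V.lattice_closed(5) scaled_lattices V.ip_nonneg by blast+
  have mono: "(x / d) ^ d * (fact d)\<^sup>2 \<le> (pip w w / d) ^ d * (fact d)\<^sup>2" if "0 \<le> x" "x \<le> pip w w" for x
    using that by (intro mult_right_mono power_mono divide_right_mono) auto
  show ?thesis
  proof (cases "u = 0")
    case True
    then have "v \<noteq> 0" using w(2) uv(1) by (simp add: zero_prod_def)
    then have "real q \<le> (ip v v / d) ^ d * (fact d)\<^sup>2"
      using component_bound[OF scaled_lattices(4,8) scaled_mult(4) uv(3)] scaled_nonzero[of v] uv(3) by blast
    also have "\<dots> \<le> (pip w w / d) ^ d * (fact d)\<^sup>2" using V by (intro mono) (auto simp: uv(1) plane_ip_def)
    finally show ?thesis .
  next
    case False
    then have "real q \<le> (ip u u / d) ^ d * (fact d)\<^sup>2"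
      using component_bound[OF scaled_lattices(2,7) scaled_mult(2) uv(2)] scaled_nonzero[of u] uv(2) by blast
    also have "\<dots> \<le> (pip w w / d) ^ d * (fact d)\<^sup>2" using V by (intro mono) (auto simp: uv(1) plane_ip_def)
    finally show ?thesis .
  qed
qed

text \<open>The two coordinates are approximated separately, which accounts for the factor
  2.\<close>

lemma Lam0_covering:
  assumes s: "s > 0" "s ^ d > 1 / sqrt (real q)" and w: "w \<in> PL"
  shows "\<exists>l\<in>Lam0. pip (w - l) (w - l) \<le> 2 * (real d * s / 2)\<^sup>2"
proof -
  have uv: "fst w \<in> V" "snd w \<in> V" using w by (auto simp: PL_alt)
  obtain k where k: "k \<in> OA" "ip (fst w - k) (fst w - k) \<le> (real d * s / 2)\<^sup>2"
    using covering_bound[OF scaled_lattices(1) scaled_mult(1) _ s(1) _ uv(1)] scaled_nonzero scaled_lattices(5) s(2) by auto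
  obtain l where l: "l \<in> DA" "ip (snd w - l) (snd w - l) \<le> (real d * s / 2)\<^sup>2"
    using covering_bound[OF scaled_lattices(3) scaled_mult(3) _ s(1) _ uv(2)] scaled_nonzero scaled_lattices(6) s(2) by auto
  show ?thesis
    using k l by (intro bexI[of _ "(k, l)"]) (auto simp: Lam0_prod plane_ip_def)
qed

lemma Lam_smult:
  assumes "t \<in> OK" "c \<in> OK" "w \<in> Lam t"
  shows "plane_smult K c w \<in> Lam t"
proof -
  obtain a y where w: "a \<in> OK" "y \<in> PD" "y - \<mu> (t * a) * y0 \<in> OD" "w = pt a y" using assms(3) by (rule Lam_cases)
  have "\<mu> c * y - \<mu> (t * (c * a)) * y0 = \<mu> c * (y - \<mu> (t * a) * y0)"
    using assms(1,2) w(1) by (simp add: mu_hom(3) right_diff_distrib mult_ac)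
  also have "\<dots> \<in> OD" by (rule OD_mult[OF assms(2) w(3)])
  finally have "\<mu> c * y - \<mu> (t * (c * a)) * y0 \<in> OD" .
  then show ?thesis using assms(1,2) w PD_mult by (simp add: pt_closed(3) Lam_iff)
qed

end

context cyclotomic
begin

lemma pip_zeta: "w \<in> PL \<Longrightarrow> pip (plane_smult K (zeta ^ i) w) (plane_smult K (zeta ^ i) w) = pip w w"
proof -
  assume w: "w \<in> PL"
  have Kz: "zeta ^ i \<in> K" by auto
  have "cnj zeta * zeta = 1" by (simp add: zeta_def cis_mult cis_cnj)
  then have "cnj (zeta ^ i) * zeta ^ i = 1" by (simp add: power_mult_distrib[symmetric])
  then have 1: "cnjf (\<mu> (zeta ^ i)) * \<mu> (zeta ^ i) = \<mu> 1"
    using mu_hom(3)[OF cnj_K(1)[OF Kz] Kz] mu_cnj[OF Kz] by simp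
  have "ip (\<mu> (zeta ^ i) * u) (\<mu> (zeta ^ i) * u) = ip u u" if u: "u \<in> V" for u
  proof -
    have "ip (\<mu> (zeta ^ i) * u) (\<mu> (zeta ^ i) * u) = ip u (cnjf (\<mu> (zeta ^ i)) * \<mu> (zeta ^ i) * u)"
      by (subst mult.commute) (simp add: ip_shift mult.assoc)
    also have "\<mu> 1 * u = u"
    proof (rule mink_eqI)
      show "(\<mu> 1 * u) \<sigma> = u \<sigma>" if "\<sigma> \<notin> S" for \<sigma> using V_outside[OF u that] by (simp add: fun_ops)
    qed (simp add: fun_ops)
    then have "ip u (cnjf (\<mu> (zeta ^ i)) * \<mu> (zeta ^ i) * u) = ip u u" unfolding 1 by simp
    finally show ?thesis .
  qed
  then show ?thesis using w by (auto simp: plane_ip_def plane_smult_def PL_alt)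
qed

text \<open>Equal images would make \<open>zeta ^ i - zeta ^ j\<close> vanish under an embedding at
  which a coordinate of \<open>w\<close> does not vanish.\<close>

lemma inj_zeta_orbit:
  assumes w: "w \<in> PL" "w \<noteq> 0"
  shows "inj_on (\<lambda>i. plane_smult K (zeta ^ i) w) {..<m}"
proof (rule inj_onI)
  fix i j assume ij: "i \<in> {..<m}" "j \<in> {..<m}" "plane_smult K (zeta ^ i) w = plane_smult K (zeta ^ j) w"
  have eq: "\<mu> (zeta ^ i) * u = \<mu> (zeta ^ j) * u" if "u \<in> {fst w, snd w}" for u
    using ij(3) that by (auto simp: plane_smult_def)
  have "\<exists>u\<in>{fst w, snd w}. u \<in> V \<and> u \<noteq> 0" using w by (auto simp: PL_alt zero_prod_def)
  then obtain u where u: "u \<in> {fst w, snd w}" "u \<in> V" "u \<noteq> 0" by blast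
  obtain \<sigma> where \<sigma>: "u \<sigma> \<noteq> 0" using u(3) by (auto simp: fun_eq_iff fun_ops)
  then have "\<sigma> \<in> S" using V_outside[OF u(2)] by blast
  then obtain z where z: "z \<in> R" "\<sigma> = emb z" using S_emb by blast
  have "\<mu> (zeta ^ i) \<sigma> = \<mu> (zeta ^ j) \<sigma>" using fun_cong[OF eq[OF u(1)], of \<sigma>] \<sigma> by (simp add: fun_ops)
  then have "\<mu> (zeta ^ i - zeta ^ j) (emb z) = 0"
    unfolding z(2) by (subst mu_hom(2)) (auto simp: fun_diff_def)
  then have "zeta ^ i = zeta ^ j" using mu_eq_0[OF _ _ z(1), of "zeta ^ i - zeta ^ j"] by auto
  then show "i = j" using inj_zeta ij(1,2) by (auto dest: inj_onD)
qed

end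

context cyclotomic_prime
begin

subsection \<open>Lines of \<open>\<Lambda>\<^sub>0 / P \<Lambda>\<^sub>0\<close>\<close>

definition F where "F = residue_field K P"
definition QV where "QV = quotient_space m P"
text \<open>The quotients are handled through representatives: the rules below express every
  operation of \<open>F\<close> and \<open>QV\<close> by \<open>rc\<close> and \<open>rd\<close>,
  and equality by membership of a difference.\<close>

definition rc where "rc a = P +>\<^bsub>complex_ring OK\<^esub> a"
definition rd where "rd x = (\<lambda>h. h + x) ` N0"

lemma rc_alt: "rc a = (\<lambda>h. h + a) ` P"
  by (auto simp: rc_def a_r_coset_def' complex_ring_def)

lemma F_simps:
  "carrier F = rc ` OK" "zero F = rc 0" "one F = rc 1"
  "a \<in> OK \<Longrightarrow> b \<in> OK \<Longrightarrow> add F (rc a) (rc b) = rc (a + b)"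
  "a \<in> OK \<Longrightarrow> b \<in> OK \<Longrightarrow> mult F (rc a) (rc b) = rc (a * b)"
proof -
  interpret primeideal P "complex_ring OK" by (rule P_prime)
  have F: "F = complex_ring OK Quot P" by (simp add: F_def residue_field_def OK_def)
  have c: "carrier (complex_ring OK) = OK" "add (complex_ring OK) = (+)" "mult (complex_ring OK) = (*)" "one (complex_ring OK) = 1"
    by (simp_all add: complex_ring_def)
  show "carrier F = rc ` OK"
    unfolding F FactRing_def A_RCOSETS_def' by (auto simp: c rc_def)
  show "zero F = rc 0" by (simp add: F FactRing_def rc_alt)
  show "one F = rc 1" by (simp add: F FactRing_def rc_def c)
  show "a \<in> OK \<Longrightarrow> b \<in> OK \<Longrightarrow> add F (rc a) (rc b) = rc (a + b)"
    using a_rcos_sum[of a b] by (simp add: F FactRing_def rc_def c)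
  show "a \<in> OK \<Longrightarrow> b \<in> OK \<Longrightarrow> mult F (rc a) (rc b) = rc (a * b)"
    using rcoset_mult_add[of a b] by (simp add: F FactRing_def rc_def c)
qed

lemma rc_eq_iff: "rc a = rc b \<longleftrightarrow> a - b \<in> P"
proof
  assume "rc a = rc b"
  moreover have "0 + a \<in> rc a" unfolding rc_alt using P_facts(2) by blast
  ultimately show "a - b \<in> P" by (auto simp: rc_alt)
next
  assume ab: "a - b \<in> P"
  show "rc a = rc b" unfolding rc_alt
  proof (intro subset_antisym image_subsetI)
    fix h assume h: "h \<in> P"
    show "h + a \<in> (\<lambda>h. h + b) ` P" using P_facts(3)[OF h ab] by (intro image_eqI[of _ _ "h + (a - b)"]) auto
    show "h + b \<in> (\<lambda>h. h + a) ` P" using P_diff[OF h ab] by (intro image_eqI[of _ _ "h - (a - b)"]) auto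
  qed
qed

lemma F_field: "field F"
proof -
  interpret I: primeideal P "complex_ring OK" by (rule P_prime)
  have "cring F"
    using I.quotient_is_cring[OF I.is_cring] by (simp add: F_def residue_field_def OK_def)
  then show ?thesis
  proof (rule cring.cring_fieldI2)
    show "zero F \<noteq> one F" using P_facts(5) P_minus[of "-1"] by (auto simp: F_simps rc_eq_iff)
    fix u assume u: "u \<in> carrier F" "u \<noteq> zero F"
    then obtain a where a: "a \<in> OK" "u = rc a" by (auto simp: F_simps)
    have "a \<notin> P" using u(2) a(2) by (simp add: F_simps rc_eq_iff)
    then have "mult F u (rc (a ^ (Q - 2))) = one F"
      using P_inverse_mod[OF a(1)] a by (simp add: F_simps rc_eq_iff)
    then show "\<exists>v\<in>carrier F. mult F u v = one F" using a(1) by (auto simp: F_simps)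
  qed
qed

lemma N0_closed: "0 \<in> N0" "x \<in> N0 \<Longrightarrow> y \<in> N0 \<Longrightarrow> x + y \<in> N0" "x \<in> N0 \<Longrightarrow> y \<in> N0 \<Longrightarrow> x - y \<in> N0"
  and Lam0_closed: "0 \<in> Lam0" "x \<in> Lam0 \<Longrightarrow> y \<in> Lam0 \<Longrightarrow> x + y \<in> Lam0" "x \<in> Lam0 \<Longrightarrow> - x \<in> Lam0" "x \<in> Lam0 \<Longrightarrow> x \<in> PL"
  using W.lattice_closed[OF N0_lattice] W.lattice_closed[OF Lam0_lattice] by auto

lemma rd_eq_iff: "rd x = rd y \<longleftrightarrow> x - y \<in> N0"
proof
  assume "rd x = rd y"
  moreover have "0 + x \<in> rd x" unfolding rd_def using N0_closed(1) by blast
  ultimately show "x - y \<in> N0" by (auto simp: rd_def)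
next
  assume xy: "x - y \<in> N0"
  show "rd x = rd y" unfolding rd_def
  proof (intro subset_antisym image_subsetI)
    fix h assume h: "h \<in> N0"
    show "h + x \<in> (\<lambda>h. h + y) ` N0" using N0_closed(2)[OF h xy] by (intro image_eqI[of _ _ "h + (x - y)"]) auto
    show "h + y \<in> (\<lambda>h. h + x) ` N0" using N0_closed(3)[OF h xy] by (intro image_eqI[of _ _ "h - (x - y)"]) auto
  qed
qed

lemma reduction_eq: "reduction m P x = rd x"
  unfolding reduction_def rd_def a_r_coset_def' N0_def Lambda0_module_def by auto

abbreviation psm where "psm \<equiv> plane_smult K"

lemma psm_simps:
  "a \<in> K \<Longrightarrow> b \<in> K \<Longrightarrow> psm (a + b) x = psm a x + psm b x" "psm a (x + y) = psm a x + psm a y"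
  "a \<in> K \<Longrightarrow> b \<in> K \<Longrightarrow> psm (a * b) x = psm a (psm b x)" "x \<in> PL \<Longrightarrow> psm 1 x = x"
  by (auto simp: plane_smult_def mu_hom distrib_right distrib_left mult.assoc PL_alt mu_1_mult)

lemma psm_closed:
  "a \<in> OK \<Longrightarrow> x \<in> Lam0 \<Longrightarrow> psm a x \<in> Lam0" "a \<in> P \<Longrightarrow> x \<in> Lam0 \<Longrightarrow> psm a x \<in> N0" "a \<in> OK \<Longrightarrow> x \<in> N0 \<Longrightarrow> psm a x \<in> N0"
proof -
  show "psm a x \<in> Lam0" if a: "a \<in> OK" and x: "x \<in> Lam0"
  proof -
    obtain b y where "b \<in> OK" "y \<in> PD" "x = pt b y" using x by (rule Lam0_cases)
    then show ?thesis using a PD_mult[OF a] by (simp add: pt_closed(3) Lam0_iff)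
  qed
  show "psm a x \<in> N0" if a: "a \<in> P" and x: "x \<in> Lam0"
  proof -
    obtain b y where "b \<in> OK" "y \<in> PD" "x = pt b y" using x by (rule Lam0_cases)
    then show ?thesis using a P_PD[OF a] P_mult_right by (simp add: pt_closed(3) N0_iff)
  qed
  show "psm a x \<in> N0" if a: "a \<in> OK" and x: "x \<in> N0"
  proof -
    obtain b y where "b \<in> P" "y \<in> OD" "x = pt b y" using x unfolding N0_alt by blast
    then show ?thesis using a OD_mult[OF a] P_facts(4) by (simp add: pt_closed(3) N0_iff)
  qed
qed

lemma QV_simps:
  "carrier QV = rd ` Lam0" "zero QV = rd 0" "add QV (rd x) (rd y) = rd (x + y)"
  "a \<in> OK \<Longrightarrow> x \<in> Lam0 \<Longrightarrow> smult QV (rc a) (rd x) = rd (psm a x)"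
proof -
  have "carrier QV = (\<Union>x\<in>Lam0. {reduction m P x})"
    unfolding QV_def quotient_space_def A_RCOSETS_def' reduction_def by (simp add: Lambda0_module_def Lam0_def)
  then show "carrier QV = rd ` Lam0" by (auto simp: reduction_eq)
  show "zero QV = rd 0" by (simp add: QV_def quotient_space_def N0_def[symmetric] rd_def)
  have add: "add QV (rd x) (rd y) = (\<Union>h\<in>rd x. \<Union>k\<in>rd y. {h + k})"
    by (simp add: QV_def quotient_space_def set_add_def' Lambda0_module_def)
  show "add QV (rd x) (rd y) = rd (x + y)" unfolding add
  proof (intro subset_antisym subsetI)
    fix z assume "z \<in> (\<Union>h\<in>rd x. \<Union>k\<in>rd y. {h + k})"
    then obtain h k where hk: "h \<in> N0" "k \<in> N0" "z = (h + x) + (k + y)" by (auto simp: rd_def)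
    then have "z = (h + k) + (x + y)" by (simp add: add_ac)
    then show "z \<in> rd (x + y)" unfolding rd_def using N0_closed(2)[OF hk(1,2)] by blast
  next
    fix z assume "z \<in> rd (x + y)"
    then obtain h where h: "h \<in> N0" "z = (h + x) + (0 + y)" by (auto simp: rd_def add_ac)
    have "h + x \<in> rd x" "0 + y \<in> rd y" unfolding rd_def using h(1) N0_closed(1) by blast+
    then show "z \<in> (\<Union>h\<in>rd x. \<Union>k\<in>rd y. {h + k})" unfolding h(2) by blast
  qed
  show "smult QV (rc a) (rd x) = rd (psm a x)" if ax: "a \<in> OK" "x \<in> Lam0"
  proof -
    have sm: "smult QV (rc a) (rd x) = (\<Union>a\<in>rc a. \<Union>x\<in>rd x. rd (psm a x))"
      by (simp add: QV_def quotient_space_def reduction_eq K_def)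
    have "rd (psm a' x') = rd (psm a x)" if mem: "a' \<in> rc a" "x' \<in> rd x" for a' x'
    proof -
      obtain h where h: "h \<in> P" "a' = h + a" using mem(1) by (auto simp: rc_alt)
      obtain n where n: "n \<in> N0" "x' = n + x" using mem(2) by (auto simp: rd_def)
      have "psm a' x' - psm a x = psm h (n + x) + psm a n"
        using h(1) ax(1) by (simp add: h(2) n(2) psm_simps)
      also have "\<dots> \<in> N0"
        using h(1) n(1) ax N0_Lam0 by (intro N0_closed(2) psm_closed Lam0_closed(2)) auto
      finally show ?thesis by (simp add: rd_eq_iff)
    qed
    moreover have "0 + a \<in> rc a" "0 + x \<in> rd x" unfolding rc_alt rd_def using P_facts(2) N0_closed(1) by blast+
    ultimately show ?thesis unfolding sm by (intro subset_antisym) blast+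
  qed
qed

lemma QV_vectorspace: "vectorspace F QV"
proof (rule vectorspace.intro)
  show "field F" by (rule F_field)
  interpret field F by (rule F_field)
  show "module F QV"
  proof (rule moduleI)
    show "cring F" ..
    show "abelian_group QV"
    proof (rule abelian_groupI)
      fix u assume "u \<in> carrier QV"
      then obtain x where x: "x \<in> Lam0" "u = rd x" by (auto simp: QV_simps)
      then have "rd (- x) \<in> carrier QV" "add QV (rd (- x)) u = zero QV"
        using Lam0_closed(3) by (auto simp: QV_simps)
      then show "\<exists>v\<in>carrier QV. add QV v u = zero QV" by blast
    qed (unfold QV_simps(1), (((erule imageE)+)?, simp add: QV_simps add_ac Lam0_closed imageI)+)
  qed (unfold QV_simps(1) F_simps(1), (((erule imageE)+)?, simp add: QV_simps F_simps psm_simps psm_closed Lam0_closed imageI)+)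
qed

lemma Lam_closed:
  assumes "t \<in> OK"
  shows "0 \<in> Lam t" "x \<in> Lam t \<Longrightarrow> y \<in> Lam t \<Longrightarrow> x + y \<in> Lam t"
  using W.lattice_closed[OF Lam_lattice[OF assms]] by auto

text \<open>The class of the point with coordinates 1 and t \<open>y0\<close> generates. Since the
  dimension is the least size of a generating set, the empty set also has to be ruled out, and it is
  because 1 is not in \<open>P\<close>.\<close>

lemma Lam_line:
  assumes t: "t \<in> OK"
  shows "rd ` Lam t \<in> lines m P"
proof -
  define C where "C = rd ` Lam t"
  have C0: "x \<in> Lam0" if "x \<in> Lam t" for x using that Lam_Lam0 by blast
  have vs: "vectorspace F QV" by (rule QV_vectorspace)
  have "submodule F C QV"
  proof (rule submodule.intro)
    show "module F QV" using vs by (simp add: vectorspace_def)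
    show "smult QV c v \<in> C" if "c \<in> carrier F" "v \<in> C" for c v
      using that Lam_smult[OF t] C0 by (auto simp: C_def F_simps QV_simps)
  qed (use Lam_closed[OF t] C0 in \<open>auto simp: C_def QV_simps\<close>)
  then have sub: "VectorSpace.subspace F C QV" using vs by (simp add: VectorSpace.subspace_def)
  interpret C: vectorspace F "QV\<lparr>carrier := C\<rparr>" by (rule vectorspace.subspace_is_vs[OF vs sub])
  define w where "w = pt 1 (\<mu> t * y0)"
  have w: "w \<in> Lam t" using t y0(1) PD_mult OD_0 by (simp add: w_def Lam_iff)
  define g where "g = rd w"
  have gC: "g \<in> C" using w by (simp add: g_def C_def)
  have lin: "C.lincomb f {g} = smult QV (f g) g" if "f g \<in> carrier F" for f
    using C.smult_closed[of "f g" g] C.M.r_zero[of "smult QV (f g) g"] that gC by (simp add: C.lincomb_def)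
  have gen: "C.span {g} = C"
  proof (intro subset_antisym subsetI)
    fix v assume "v \<in> C.span {g}"
    then obtain f where "f \<in> {g} \<rightarrow> carrier F" "v = C.lincomb f {g}"
      using C.finite_span[of "{g}"] gC by auto
    then show "v \<in> C" using C.lincomb_closed[of "{g}" f] gC by simp
  next
    fix v assume "v \<in> C"
    then obtain u where u: "u \<in> Lam t" "v = rd u" by (auto simp: C_def)
    obtain a y where a: "a \<in> OK" "y \<in> PD" "y - \<mu> (t * a) * y0 \<in> OD" "u = pt a y" using u(1) by (rule Lam_cases)
    have "u - psm a w = pt 0 (y - \<mu> (t * a) * y0)"
      using a(1) t by (simp add: a(4) w_def pt_closed mu_hom(3) mult_ac)
    also have "\<dots> \<in> N0" using a(3) P_facts(2) by (simp add: N0_iff)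
    finally have "v = smult QV (rc a) g"
      using a(1) C0[OF w] by (simp add: u(2) g_def QV_simps rd_eq_iff)
    also have "\<dots> = C.lincomb (\<lambda>_. rc a) {g}" using a(1) by (subst lin) (auto simp: F_simps)
    finally show "v \<in> C.span {g}" using C.finite_span[of "{g}"] gC a(1) by (auto simp: F_simps)
  qed
  have "C.dim = 1" unfolding C.dim_def
  proof (rule Least_equality)
    show "\<exists>A. finite A \<and> card A = 1 \<and> A \<subseteq> carrier (QV\<lparr>carrier := C\<rparr>) \<and> C.span A = carrier (QV\<lparr>carrier := C\<rparr>)"
      using gen gC by (intro exI[of _ "{g}"]) simp
    fix n assume "\<exists>A. finite A \<and> card A = n \<and> A \<subseteq> carrier (QV\<lparr>carrier := C\<rparr>) \<and> C.span A = carrier (QV\<lparr>carrier := C\<rparr>)"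
    then obtain A where A: "finite A" "card A = n" "C.span A = C" by auto
    show "1 \<le> n"
    proof (rule ccontr)
      assume "\<not> 1 \<le> n"
      then have "card A = 0" using A(2) by simp
      then have "A = {}" using A(1) by simp
      then have "C = {rd 0}" using A(3) C.span_empty by (simp add: QV_simps)
      then have "w \<in> N0" using gC by (simp add: g_def rd_eq_iff)
      then show False using P_facts(5) by (simp add: w_def N0_iff)
    qed
  qed
  then show ?thesis using sub
    unfolding lines_def Let_def K_def[symmetric] F_def[symmetric] QV_def[symmetric] C_def[symmetric] by simp
qed

text \<open>\<open>Lam t\<close> contains \<open>N0\<close>, so it is the full preimage of its
  image.\<close>

lemma Lam_family: "t \<in> OK \<Longrightarrow> Lam t \<in> lattice_family m P"
proof -
  assume t: "t \<in> OK"
  have "Lam t = {x \<in> Lambda0 m P. reduction m P x \<in> rd ` Lam t}"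
    unfolding reduction_eq Lam0_def[symmetric]
  proof (intro subset_antisym subsetI)
    fix x assume "x \<in> {x \<in> Lam0. rd x \<in> rd ` Lam t}"
    then obtain w where w: "w \<in> Lam t" "x - w \<in> N0" by (auto simp: rd_eq_iff)
    then have "(x - w) + w \<in> Lam t" using Lam_closed(2)[OF t] N0_Lam[OF t] by blast
    then show "x \<in> Lam t" by simp
  qed (use Lam_Lam0 in auto)
  then show ?thesis unfolding lattice_family_def using Lam_line[OF t] by blast
qed

end

section \<open>The Mertens product\<close>

definition primes_le :: "nat \<Rightarrow> nat set" where
  "primes_le n = {p. prime p \<and> p \<le> n}"

lemma finite_primes_le [simp]: "finite (primes_le n)"
  by (rule finite_subset[of _ "{..n}"]) (auto simp: primes_le_def)

lemma prime_primes_le: "p \<in> primes_le n \<Longrightarrow> prime p"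
  by (simp add: primes_le_def)

text \<open>A finite Euler product: when a prime \<open>p\<close> is added, each \<open>n\<close>
  splits into a power of \<open>p\<close> and a number composed of the other primes, and the powers
  contribute a geometric sum.\<close>

lemma euler_product_bound:
  fixes f :: "nat \<Rightarrow> real"
  assumes A: "finite A" "\<And>p. p \<in> A \<Longrightarrow> prime p" "\<And>p. p \<in> A \<Longrightarrow> f p < 1"
    and f: "f 1 = 1" "\<And>a b. f (a * b) = f a * f b" "\<And>n. 0 \<le> f n"
  shows "(\<Sum>n | n \<in> {1..N} \<and> prime_factors n \<subseteq> A. f n) \<le> (\<Prod>p\<in>A. 1 / (1 - f p))"
  using A
proof (induction A rule: finite_induct)
  case empty
  have "{n. n \<in> {1..N} \<and> prime_factors n \<subseteq> {}} \<subseteq> {1}"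
    by (auto simp: prime_factorization_empty_iff)
  then have "(\<Sum>n | n \<in> {1..N} \<and> prime_factors n \<subseteq> {}. f n) \<le> (\<Sum>n\<in>{1}. f n)"
    using f(3) by (intro sum_mono2) auto
  then show ?case using f(1) by simp
next
  case (insert p A)
  define S where "S B = {n. n \<in> {1..N} \<and> prime_factors n \<subseteq> B}" for B
  have fin: "finite (S B)" for B by (rule finite_subset[of _ "{1..N}"]) (auto simp: S_def)
  have p: "prime p" "f p < 1" using insert.prems by auto
  have fpow: "f (p ^ k) = f p ^ k" for k
    by (induction k) (use f in auto)
  have sub: "S (insert p A) \<subseteq> (\<lambda>(k, n). p ^ k * n) ` ({..N} \<times> S A)"
  proof
    fix n assume n: "n \<in> S (insert p A)"
    then have n0: "n > 0" "n \<le> N" by (auto simp: S_def)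
    obtain y where y: "n = p ^ multiplicity p n * y" "\<not> p dvd y"
      using multiplicity_decompose'[of n p] n0 p(1) not_prime_unit by blast
    have y0: "y > 0" using n0(1) y(1) by (metis gr0I mult_0_right)
    have "y dvd n" using y(1) by (metis dvd_triv_right)
    then have "y \<le> n" using n0(1) by (rule dvd_imp_le)
    moreover have "prime_factors y \<subseteq> A"
    proof
      fix r assume "r \<in> prime_factors y"
      then have r: "prime r" "r dvd y" by auto
      then have "r \<in> prime_factors n" using \<open>y dvd n\<close> n0(1) by (auto simp: prime_factors_dvd)
      then have "r \<in> insert p A" using n by (auto simp: S_def)
      then show "r \<in> A" using r(2) y(2) by auto
    qed
    ultimately have yS: "y \<in> S A" using y0 n0(2) by (simp add: S_def)
    \<comment> \<open>The exponent k satisfies k < p^k <= n <= N, so the geometric sum can stop at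
      \<open>N\<close>.\<close>
    have "multiplicity p n < p ^ multiplicity p n"
      using prime_gt_Suc_0_nat[OF p(1)] by (rule power_gt_expt)
    also have "\<dots> \<le> n" using y(1) n0(1) by (metis dvd_imp_le dvd_triv_left)
    finally have "multiplicity p n \<le> N" using n0(2) by simp
    then show "n \<in> (\<lambda>(k, n). p ^ k * n) ` ({..N} \<times> S A)"
      using y(1) yS by (intro image_eqI[of _ _ "(multiplicity p n, y)"]) auto
  qed
  have "(\<Sum>n\<in>S (insert p A). f n) \<le> (\<Sum>n\<in>(\<lambda>(k, n). p ^ k * n) ` ({..N} \<times> S A). f n)"
    using sub f(3) fin by (intro sum_mono2) auto
  also have "\<dots> \<le> (\<Sum>(k, n)\<in>{..N} \<times> S A. f (p ^ k * n))"
    using sum_image_le[of "{..N} \<times> S A" f "\<lambda>(k, n). p ^ k * n"] f(3) fin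
    by (simp add: case_prod_unfold o_def)
  also have "\<dots> = (\<Sum>k\<le>N. \<Sum>n\<in>S A. f p ^ k * f n)"
    by (simp add: sum.cartesian_product[symmetric] f(2) fpow)
  also have "\<dots> = (\<Sum>k\<le>N. f p ^ k) * (\<Sum>n\<in>S A. f n)"
    by (simp add: sum_product)
  also have "\<dots> \<le> (1 / (1 - f p)) * (\<Prod>p\<in>A. 1 / (1 - f p))"
  proof (intro mult_mono)
    have "(1 - f p) * (\<Sum>k\<le>N. f p ^ k) = 1 - f p ^ Suc N" by (rule sum_gp_basic)
    also have "\<dots> \<le> 1" using f(3) by simp
    finally show "(\<Sum>k\<le>N. f p ^ k) \<le> 1 / (1 - f p)" using p(2) by (simp add: field_simps)
    show "(\<Sum>n\<in>S A. f n) \<le> (\<Prod>p\<in>A. 1 / (1 - f p))" using insert by (simp add: S_def)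
  qed (use f(3) p(2) in \<open>auto intro: sum_nonneg\<close>)
  also have "\<dots> = (\<Prod>p\<in>insert p A. 1 / (1 - f p))" using insert.hyps by simp
  finally show ?case by (simp add: S_def)
qed

text \<open>Comparison with the integral of x^(-1-s) from 1 to N + 1 in telescoping form; the step
  x^(-s) - (x+1)^(-s) <= s x^(-1-s) comes from ln (1 + 1/x) <= 1/x.\<close>

lemma zeta_partial_sum_ge:
  assumes s: "s > 0"
  shows "(\<Sum>n=1..N. real n powr - (1 + s)) \<ge> (1 - real (N + 1) powr - s) / s"
proof (induction N)
  case (Suc N)
  define x where "x = real (Suc N)"
  have x: "x > 0" by (simp add: x_def)
  have "1 - s / x \<le> 1 - s * ln (1 + 1 / x)"
    using s x ln_add_one_self_le_self[of "1 / x"] mult_left_mono[of "ln (1 + 1 / x)" "1 / x" s] by simp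
  also have "\<dots> \<le> exp (- s * ln (1 + 1 / x))"
    using exp_ge_add_one_self[of "- s * ln (1 + 1 / x)"] by simp
  also have "\<dots> = (1 + 1 / x) powr - s" using x by (simp add: powr_def field_simps)
  finally have "x powr - s * (1 - s / x) \<le> x powr - s * (1 + 1 / x) powr - s"
    by (intro mult_left_mono) auto
  also have "\<dots> = (x * (1 + 1 / x)) powr - s" using x by (simp add: powr_mult)
  also have "x * (1 + 1 / x) = x + 1" using x by (simp add: field_simps)
  finally have "x powr - s - (x + 1) powr - s \<le> s * (x powr - s / x)" by (simp add: algebra_simps)
  also have "x powr - s / x = x powr (- s - 1)" using x by (simp add: powr_diff[of x "- s" 1])
  also have "- s - 1 = - (1 + s)" by simp
  finally have "(x powr - s - (x + 1) powr - s) / s \<le> x powr - (1 + s)" using s by (simp add: field_simps)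
  then have "(1 - real (N + 1) powr - s) / s + (x powr - s - (x + 1) powr - s) / s
      \<le> (\<Sum>n=1..N. real n powr - (1 + s)) + x powr - (1 + s)" using Suc.IH by (rule add_mono[rotated])
  moreover have "(1 - real (N + 1) powr - s) / s + (x powr - s - (x + 1) powr - s) / s = (1 - real (Suc N + 1) powr - s) / s"
    by (simp add: x_def add_divide_distrib[symmetric] add_ac)
  ultimately show ?case by (simp add: x_def)
qed simp

text \<open>The contribution of \<open>p\<close> to the logarithm of the Mertens product.\<close>

definition plog :: "nat \<Rightarrow> real" where "plog p = - ln (1 - 1 / real p)"

lemma plog_nonneg: "prime p \<Longrightarrow> plog p \<ge> 0"
  using prime_gt_1_nat[of p] by (simp add: plog_def)

text \<open>Concavity of ln for 1 - ab = b (1 - a) + (1 - b) 1, proved with the tangent line at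
  \<open>y\<close>.\<close>

lemma weighted_ln_le:
  assumes a: "0 \<le> a" "a < 1" and b: "0 \<le> b" "b \<le> (1::real)"
  shows "- ln (1 - a * b) \<le> b * - ln (1 - a)"
proof -
  define y where "y = 1 - a * b"
  have "a * b \<le> a * 1" using a b by (intro mult_left_mono) auto
  then have y: "y > 0" using a by (simp add: y_def)
  have "ln (1 - a) = ln ((1 - a) / y) + ln y" using y a by (simp add: ln_div)
  also have "\<dots> \<le> (1 - a) / y - 1 + ln y" using y a by (intro add_right_mono ln_le_minus_one) simp
  finally have 1: "b * ln (1 - a) \<le> b * ((1 - a) / y - 1 + ln y)" using b by (intro mult_left_mono)
  have "0 = ln (1 / y) + ln y" using y by (simp add: ln_div)
  also have "\<dots> \<le> 1 / y - 1 + ln y" using y by (intro add_right_mono ln_le_minus_one) simp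
  finally have 2: "0 \<le> (1 - b) * (1 / y - 1 + ln y)" using b by simp
  have "b * ((1 - a) / y - 1 + ln y) + (1 - b) * (1 / y - 1 + ln y) = (b * (1 - a) + (1 - b)) / y - 1 + ln y"
    using y by (simp add: field_simps)
  also have "b * (1 - a) + (1 - b) = y" by (simp add: y_def algebra_simps)
  finally show ?thesis using 1 2 y by (simp add: y_def)
qed

text \<open>The Euler product over the primes up to \<open>N\<close> dominates the partial zeta sum,
  and \<open>weighted_ln_le\<close> with a = 1/p and b = p^(-s) bounds each logarithm -ln (1 -
  p^(-1-s)) by p^(-s) times \<open>plog p\<close>.\<close>

lemma plog_sum_ge:
  assumes s: "s > 0" and N: "N > 0"
  shows "(\<Sum>p\<in>primes_le N. plog p * exp (- (s * ln p))) \<ge> ln ((1 - real (N + 1) powr - s) / s)"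
proof -
  define f where "f n = real n powr - (1 + s)" for n :: nat
  have f1: "f p < 1" if "prime p" for p
  proof -
    have "real p powr - (1 + s) < 1 powr - (1 + s)" using prime_gt_1_nat[OF that] s by (intro powr_less_mono2_neg) auto
    then show ?thesis by (simp add: f_def)
  qed
  have all: "{n. n \<in> {1..N} \<and> prime_factors n \<subseteq> primes_le N} = {1..N}"
  proof -
    have "prime_factors n \<subseteq> primes_le N" if "n \<in> {1..N}" for n
    proof
      fix r assume "r \<in> prime_factors n"
      then have "prime r" "r dvd n" by auto
      then show "r \<in> primes_le N" using that dvd_imp_le[of r n] by (auto simp: primes_le_def)
    qed
    then show ?thesis by blast
  qed
  have "(1 - real (N + 1) powr - s) / s \<le> (\<Sum>n=1..N. f n)"
    unfolding f_def by (rule zeta_partial_sum_ge[OF s])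
  also have "\<dots> \<le> (\<Prod>p\<in>primes_le N. 1 / (1 - f p))"
    using euler_product_bound[of "primes_le N" f N] f1 prime_primes_le
    unfolding all by (simp add: f_def powr_mult)
  finally have le: "(1 - real (N + 1) powr - s) / s \<le> (\<Prod>p\<in>primes_le N. 1 / (1 - f p))" .
  have "real (N + 1) powr - s < 1 powr - s" using N s by (intro powr_less_mono2_neg) auto
  then have "(1 - real (N + 1) powr - s) / s > 0" using s by simp
  then have "ln ((1 - real (N + 1) powr - s) / s) \<le> ln (\<Prod>p\<in>primes_le N. 1 / (1 - f p))" using le by simp
  also have "\<dots> = (\<Sum>p\<in>primes_le N. ln (1 / (1 - f p)))"
  proof (rule ln_prod)
    show "1 / (1 - f p) \<noteq> 0" if "p \<in> primes_le N" for p using f1[OF prime_primes_le[OF that]] by simp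
  qed simp
  also have "\<dots> \<le> (\<Sum>p\<in>primes_le N. plog p * exp (- (s * ln p)))"
  proof (rule sum_mono)
    fix p assume "p \<in> primes_le N"
    then have p: "prime p" "p > 1" using prime_primes_le prime_gt_1_nat by auto
    have "f p = 1 / real p * exp (- (s * ln p))"
      using p(2) by (simp add: f_def powr_def exp_add[symmetric] exp_minus exp_diff field_simps)
    then have "ln (1 / (1 - f p)) = - ln (1 - 1 / real p * exp (- (s * ln p)))"
      using f1[OF p(1)] by (simp add: ln_div)
    also have "\<dots> \<le> exp (- (s * ln p)) * - ln (1 - 1 / real p)"
      using p s by (intro weighted_ln_le) auto
    finally show "ln (1 / (1 - f p)) \<le> plog p * exp (- (s * ln p))" by (simp add: plog_def mult.commute)
  qed
  finally show ?thesis .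
qed

lemma has_integral_exp_tail:
  assumes "a \<ge> (0::real)"
  shows "((\<lambda>u. if u \<ge> a then exp (- u) else 0) has_integral exp (- a)) {0..}"
proof -
  have "((\<lambda>u. exp (- u)) has_integral exp (- a)) {a..}"
    using has_integral_exp_minus_to_infinity[of 1 a] by simp
  then have "((\<lambda>u. if u \<in> {a..} then exp (- u) else 0) has_integral exp (- a)) {0..}"
    using assms by (subst has_integral_restrict) auto
  then show ?thesis by simp
qed

text \<open>Write \<open>p\<^bsup>-s\<^esup>\<close> as the integral of \<open>exp (- u)\<close> over \<open>u \<ge> s ln p\<close>. The integral of \<open>exp (- u) ln u\<close> is the
  derivative of the Gamma function at 1; here \<open>ln u\<close> is replaced by the difference quotient \<open>(u\<^sup>t - 1) / t \<ge> ln u\<close>.\<close>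
lemma plog_sum_le:
  fixes x0 :: nat
  assumes s: "0 < s" "s \<le> 1" and t: "t > 0" and c: "c > 0" and x0: "x0 \<ge> 3"
    and bound: "\<And>n. n \<ge> x0 \<Longrightarrow> (\<Sum>p\<in>primes_le n. plog p) \<le> ln (c * ln n)"
  defines "B \<equiv> \<Sum>p\<in>primes_le x0. plog p"
  shows "(\<Sum>p\<in>primes_le N. plog p * exp (- (s * ln p))) \<le>
    (Gamma (1 + t) - 1) / t + ln c + ln (1 / s) + (B + 1 / t + \<bar>ln c\<bar>) * (s * ln x0)"
proof -
  define a where "a = s * ln x0"
  have lx0: "ln (real x0) > 0" using x0 by simp
  have a: "a > 0" using s lx0 by (simp add: a_def)
  define C where "C = ln c + ln (1 / s)"
  define D where "D = B + 1 / t + \<bar>ln c\<bar>"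
  have B0: "B \<ge> 0" unfolding B_def by (intro sum_nonneg plog_nonneg prime_primes_le)
  have D0: "D \<ge> 0" using B0 t by (simp add: D_def)
  define h where "h u p = (if u \<ge> s * ln (real p) then exp (- u) else (0::real))" for u and p :: nat
  have H1: "((\<lambda>u. \<Sum>p\<in>primes_le N. plog p * h u p) has_integral
      (\<Sum>p\<in>primes_le N. plog p * exp (- (s * ln p)))) {0..}"
    unfolding h_def using s prime_gt_1_nat[OF prime_primes_le]
    by (intro has_integral_sum has_integral_mult_right has_integral_exp_tail) (auto intro!: mult_nonneg_nonneg ln_ge_zero dest!: prime_primes_le prime_ge_1_nat)
  have E: "((\<lambda>u::real. exp (- u)) has_integral 1) {0..}"
    using has_integral_exp_minus_to_infinity[of 1 0] by simp
  have "((\<lambda>u. u powr t / exp u) has_integral Gamma (1 + t)) {0..}"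
    using Gamma_integral_real[of "1 + t"] t by simp
  then have Gam: "((\<lambda>u. u powr t * exp (- u)) has_integral Gamma (1 + t)) {0..}"
    by (simp add: exp_minus divide_inverse)
  have H2: "((\<lambda>u. ((u powr t * exp (- u) - exp (- u)) * (1 / t) + exp (- u) * C) +
        (exp (- u) - (if u \<ge> a then exp (- u) else 0)) * D) has_integral
      ((Gamma (1 + t) - 1) * (1 / t) + 1 * C) + (1 - exp (- a)) * D) {0..}"
    by (intro has_integral_add has_integral_mult_left has_integral_diff Gam E has_integral_exp_tail) (use a in simp)
  have "(\<Sum>p\<in>primes_le N. plog p * exp (- (s * ln p))) \<le>
      ((Gamma (1 + t) - 1) * (1 / t) + 1 * C) + (1 - exp (- a)) * D"
  proof (rule has_integral_le[OF H1 H2])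
    fix u :: real assume "u \<in> {0..}"
    then have u: "u \<ge> 0" by simp
    define I where "I = {p \<in> primes_le N. s * ln (real p) \<le> u}"
    have "(\<Sum>p\<in>primes_le N. plog p * h u p) = (\<Sum>p\<in>I. plog p) * exp (- u)"
      unfolding h_def I_def by (simp add: sum_distrib_right sum.inter_filter[symmetric] if_distrib cong: if_cong)
    also have "\<dots> \<le> ((u powr t - 1) * (1 / t) + C + (if u \<ge> a then 0 else D)) * exp (- u)"
    proof (rule mult_right_mono)
      show "(\<Sum>p\<in>I. plog p) \<le> (u powr t - 1) * (1 / t) + C + (if u \<ge> a then 0 else D)"
      proof (cases "u \<ge> a")
        case True
        \<comment> \<open>The primes with s ln p <= u are those up to exp (u / s), so the assumed
          bound is applied at this \<open>n\<close>.\<close>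
        define n where "n = nat \<lfloor>exp (u / s)\<rfloor>"
        have u0: "u > 0" using True a by simp
        have "ln (real x0) \<le> u / s" using True s by (simp add: a_def field_simps)
        then have "exp (ln (real x0)) \<le> exp (u / s)" by simp
        then have "real x0 \<le> exp (u / s)" using x0 by simp
        then have n: "n \<ge> x0" unfolding n_def by (simp add: le_nat_floor)
        have n': "real n \<le> exp (u / s)" unfolding n_def by simp
        have lnn: "ln (real n) > 0" "ln (real n) \<le> u / s"
        proof -
          have n1: "real n > 1" using n x0 by simp
          then show "ln (real n) > 0" by simp
          have "ln (real n) \<le> ln (exp (u / s))" using n1 n' by (subst ln_le_cancel_iff) auto
          then show "ln (real n) \<le> u / s" by simp
        qed
        have "I \<subseteq> primes_le n"
        proof
          fix p assume p: "p \<in> I"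
          then have "prime p" "s * ln (real p) \<le> u" by (auto simp: I_def primes_le_def)
          then have "ln (real p) \<le> u / s" using s by (simp add: field_simps)
          then have "real p \<le> exp (u / s)" using prime_gt_0_nat[OF \<open>prime p\<close>] by (metis exp_le_cancel_iff exp_ln of_nat_0_less_iff)
          then show "p \<in> primes_le n" using \<open>prime p\<close> by (simp add: primes_le_def n_def le_nat_floor)
        qed
        then have "(\<Sum>p\<in>I. plog p) \<le> (\<Sum>p\<in>primes_le n. plog p)"
          using plog_nonneg prime_primes_le by (intro sum_mono2) auto
        also have "\<dots> \<le> ln (c * ln n)" by (rule bound[OF n])
        also have "\<dots> \<le> ln (c * (u / s))" using lnn c u0 s mult_left_mono[OF lnn(2), of c] by (subst ln_le_cancel_iff) (auto intro!: mult_pos_pos divide_pos_pos)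
        also have "\<dots> = ln u + C" using c u0 s by (simp add: C_def ln_mult ln_div)
        also have "ln u \<le> (u powr t - 1) * (1 / t)"
          using ln_le_minus_one[of "u powr t"] u0 t by (simp add: ln_powr field_simps)
        finally show ?thesis using True by simp
      next
        case False
        have "I \<subseteq> primes_le x0"
        proof
          fix p assume p: "p \<in> I"
          then have pp: "prime p" "s * ln (real p) \<le> u" by (auto simp: I_def primes_le_def)
          then have "s * ln (real p) \<le> s * ln (real x0)" using False by (simp add: a_def)
          then have "ln (real p) \<le> ln (real x0)" using s by simp
          then show "p \<in> primes_le x0" using pp(1) prime_gt_0_nat[OF pp(1)] x0 by (simp add: primes_le_def)
        qed
        then have "(\<Sum>p\<in>I. plog p) \<le> B" unfolding B_def
          using plog_nonneg prime_primes_le by (intro sum_mono2) auto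
        moreover have "(u powr t - 1) * (1 / t) \<ge> - (1 / t)" using t by (simp add: field_simps)
        moreover have "ln (1 / s) \<ge> 0" using s by simp
        moreover have "ln c \<ge> - \<bar>ln c\<bar>" by simp
        ultimately show ?thesis using False unfolding C_def D_def by simp
      qed
    qed simp
    also have "\<dots> = ((u powr t * exp (- u) - exp (- u)) * (1 / t) + exp (- u) * C) +
        (exp (- u) - (if u \<ge> a then exp (- u) else 0)) * D" by (simp add: algebra_simps)
    finally show "(\<Sum>p\<in>primes_le N. plog p * h u p) \<le> \<dots>" .
  qed
  \<comment> \<open>The range below \<open>a\<close> has weight 1 - exp (- a), at most s ln x0, so
    its contribution vanishes as \<open>s\<close> tends to 0.\<close>
  also have "(1 - exp (- a)) * D \<le> a * D"
    using D0 exp_ge_add_one_self[of "- a"] by (intro mult_right_mono) auto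
  finally show ?thesis by (simp add: C_def D_def a_def mult.commute)
qed

text \<open>The lower and upper estimates clash after three limits: \<open>N\<close> to infinity,
  then \<open>s\<close> to 0, where the terms ln (1 / s) have cancelled, and finally
  \<open>t\<close> to 0, where the difference quotient tends to the derivative of Gamma at 1, which
  is minus the Euler constant.\<close>

lemma mertens_lower:
  fixes c :: real and x0 :: nat
  assumes c: "c > 0" "ln c < euler_mascheroni"
  shows "\<exists>n\<ge>x0. (\<Prod>p\<in>primes_le n. 1 / (1 - 1 / real p)) > c * ln n"
proof (rule ccontr)
  assume no: "\<not> ?thesis"
  define x1 where "x1 = max x0 3"
  have "(\<Sum>p\<in>primes_le n. plog p) \<le> ln (c * ln n)" if n: "n \<ge> x1" for n
  proof -
    have gt: "1 - 1 / real p > 0" if "p \<in> primes_le n" for p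
      using prime_gt_1_nat[OF prime_primes_le[OF that]] by simp
    have pos: "(\<Prod>p\<in>primes_le n. 1 / (1 - 1 / real p)) > 0"
      using gt by (intro prod_pos) simp
    have "(\<Sum>p\<in>primes_le n. plog p) = (\<Sum>p\<in>primes_le n. ln (1 / (1 - 1 / real p)))"
      using gt by (intro sum.cong refl) (simp add: plog_def ln_div)
    also have "\<dots> = ln (\<Prod>p\<in>primes_le n. 1 / (1 - 1 / real p))"
    proof (rule ln_prod[symmetric])
      show "1 / (1 - 1 / real p) \<noteq> 0" if "p \<in> primes_le n" for p
      proof -
        have "1 - 1 / real p \<noteq> 0" using gt[OF that] by linarith
        then show ?thesis by (metis divide_eq_0_iff zero_neq_one)
      qed
    qed simp
    also have "\<dots> \<le> ln (c * ln n)"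
    proof -
      have "(\<Prod>p\<in>primes_le n. 1 / (1 - 1 / real p)) \<le> c * ln n" using no n by (auto simp: x1_def not_less)
      then show ?thesis using pos by simp
    qed
    finally show ?thesis .
  qed
  then have up: "(\<Sum>p\<in>primes_le N. plog p * exp (- (s * ln p))) \<le>
    (Gamma (1 + t) - 1) / t + ln c + ln (1 / s) + ((\<Sum>p\<in>primes_le x1. plog p) + 1 / t + \<bar>ln c\<bar>) * (s * ln x1)"
    if "0 < s" "s \<le> 1" "t > 0" for s t N
    using that c(1) by (intro plog_sum_le) (auto simp: x1_def)
  define B where "B = (\<Sum>p\<in>primes_le x1. plog p)"
  have 1: "ln (1 / s) \<le> (Gamma (1 + t) - 1) / t + ln c + ln (1 / s) + (B + 1 / t + \<bar>ln c\<bar>) * (s * ln x1)"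
    if s: "0 < s" "s \<le> 1" and t: "t > 0" for s t
  proof (rule tendsto_upperbound)
    have "(\<lambda>N. real (N + 1) powr - s) \<longlonglongrightarrow> 0"
      using s by (intro tendsto_neg_powr filterlim_compose[OF filterlim_real_sequentially] filterlim_add_const_nat_at_top) auto
    from tendsto_diff[OF tendsto_const this]
    have "(\<lambda>N. (1 - real (N + 1) powr - s) / s) \<longlonglongrightarrow> (1 - 0) / s" by (rule tendsto_divide) (use s in auto)
    then show "(\<lambda>N. ln ((1 - real (N + 1) powr - s) / s)) \<longlonglongrightarrow> ln (1 / s)"
      using s by (intro tendsto_ln) auto
    show "\<forall>\<^sub>F N in sequentially. ln ((1 - real (N + 1) powr - s) / s) \<le>
        (Gamma (1 + t) - 1) / t + ln c + ln (1 / s) + (B + 1 / t + \<bar>ln c\<bar>) * (s * ln x1)"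
      using eventually_gt_at_top[of 0]
    proof eventually_elim
      case (elim N)
      show ?case using plog_sum_ge[OF s(1) elim] up[OF s t, of N] unfolding B_def by linarith
    qed
  qed simp
  have 2: "0 \<le> (Gamma (1 + t) - 1) / t + ln c" if t: "t > 0" for t
  proof (rule tendsto_lowerbound)
    define M where "M = (B + 1 / t + \<bar>ln c\<bar>) * ln x1"
    have "(\<lambda>n. (Gamma (1 + t) - 1) / t + ln c + M * inverse (real (Suc n))) \<longlonglongrightarrow> (Gamma (1 + t) - 1) / t + ln c + M * 0"
      by (intro tendsto_intros LIMSEQ_inverse_real_of_nat)
    then show "(\<lambda>n. (Gamma (1 + t) - 1) / t + ln c + M * inverse (real (Suc n))) \<longlonglongrightarrow> (Gamma (1 + t) - 1) / t + ln c" by simp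
    have "0 \<le> (Gamma (1 + t) - 1) / t + ln c + M * inverse (real (Suc n))" for n
      using 1[of "inverse (real (Suc n))" t] t by (simp add: M_def inverse_le_1_iff mult_ac)
    then show "\<forall>\<^sub>F n in sequentially. 0 \<le> (Gamma (1 + t) - 1) / t + ln c + M * inverse (real (Suc n))" by simp
  qed simp
  have "(Gamma has_field_derivative - euler_mascheroni) (at (1::real))"
    using has_field_derivative_Gamma[of "1::real" UNIV] by (simp add: Digamma_1)
  then have "((\<lambda>t. (Gamma (1 + t) - 1) / t) \<longlongrightarrow> - euler_mascheroni) (at (0::real))" by (simp add: DERIV_def)
  then have "((\<lambda>t. (Gamma (1 + t) - 1) / t) \<longlongrightarrow> - euler_mascheroni) (at_right (0::real))"
    by (rule tendsto_within_subset) simp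
  then have "((\<lambda>t. (Gamma (1 + t) - 1) / t + ln c) \<longlongrightarrow> - euler_mascheroni + ln c) (at_right (0::real))"
    by (intro tendsto_add tendsto_const)
  moreover have "\<forall>\<^sub>F t in at_right (0::real). 0 \<le> (Gamma (1 + t) - 1) / t + ln c"
    using 2 by (auto simp: eventually_at_right_field intro: exI[of _ 1])
  ultimately have "0 \<le> - euler_mascheroni + ln c" by (rule tendsto_lowerbound) simp
  then show False using c(2) by simp
qed

text \<open>The bound H_15 - ln 16 + 1/32 <= gamma, with the 15th harmonic number, reduces the claim
  to 16 * 1.78 < exp (H_15 + 1/32). The margin is narrow: \<open>y\<close> is just below an eighth
  of this exponent, exp \<open>y\<close> is bounded below by six terms of its series, and the eighth
  power is taken.\<close>

lemma euler_mascheroni_bound: "ln (178 / 100 :: real) < euler_mascheroni"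
proof -
  define y :: real where "y = 41868 / 100000"
  define H :: real where "H = harm (Suc 14) + 1 / 32"
  have H: "8 * y \<le> H" by (simp add: y_def H_def harm_expand)
  have "(\<Sum>k<6. inverse (fact k) *\<^sub>R y ^ k) \<le> exp y"
    unfolding exp_def by (intro sum_le_suminf summable_exp_generic) (auto simp: y_def)
  moreover have "151993 / 100000 \<le> (\<Sum>k<6. inverse (fact k) *\<^sub>R y ^ k)"
    by (simp add: y_def lessThan_nat_numeral fact_numeral power_divide)
  ultimately have "(151993 / 100000) ^ 8 \<le> exp y ^ 8"
    by (intro power_mono) simp_all
  moreover have "(151993 / 100000 :: real) ^ 8 > 16 * (178 / 100)"
    by (simp add: power_divide)
  moreover have "exp y ^ 8 = exp (8 * y)" by (simp add: exp_of_nat_mult[symmetric])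
  ultimately have "16 * (178 / 100) < exp (8 * y)" by linarith
  then have "ln (16 * (178 / 100)) < ln (exp (8 * y))" by (subst ln_less_cancel_iff) auto
  then have "ln 16 + ln (178 / 100) < 8 * y" by (simp only: ln_exp) (subst (asm) ln_mult, simp_all)
  moreover have "harm (Suc 14) - ln (real (14 + 2)) + 1 / real (2 * (14 + 2)) \<le> (euler_mascheroni :: real)"
    by (rule euler_mascheroni_lower)
  ultimately show ?thesis using H by (simp add: H_def)
qed

section \<open>Averaging over the lines\<close>

context cyclotomic_prime
begin

text \<open>The hypotheses on \<open>s\<close> bound the covering radius of \<open>Lam0\<close> by
  \<open>\<tau>\<close>. \<open>short\<close> keeps nonzero points of \<open>N0\<close> out of the
  ball, so that orbits for different \<open>t\<close> are disjoint. \<open>vol\<close> leaves room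
  for fewer than q m points of \<open>Lam0\<close>, whose covolume is 1/q.\<close>

lemma exists_sparse:
  assumes r: "r > 0" and \<tau>: "\<tau> \<ge> 0" and s: "s > 0" "s ^ d > 1 / sqrt (real q)" "2 * (real d * s / 2)\<^sup>2 \<le> \<tau>\<^sup>2"
    and short: "real q > (r\<^sup>2 / d) ^ d * (fact d)\<^sup>2"
    and vol: "unit_ball_vol (real (2 * d)) * (r + \<tau>) ^ (2 * d) < real m"
  shows "\<exists>t\<in>OK. \<forall>w\<in>Lam t. w \<noteq> 0 \<longrightarrow> pip w w > r\<^sup>2"
proof (rule ccontr)
  assume "\<not> ?thesis"
  then have "\<forall>t. \<exists>w. t \<in> OK \<longrightarrow> w \<in> Lam t \<and> w \<noteq> 0 \<and> \<not> pip w w > r\<^sup>2" by blast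
  from choice[OF this] obtain w
    where w: "t \<in> OK \<Longrightarrow> w t \<in> Lam t \<and> w t \<noteq> 0 \<and> pip (w t) (w t) \<le> r\<^sup>2" for t
    unfolding not_less by blast
  obtain T where T: "finite T" "T \<subseteq> OK" "card T = q" "\<And>x. x \<in> OK \<Longrightarrow> \<exists>t\<in>T. x - t \<in> P"
    "\<And>x y. x \<in> T \<Longrightarrow> y \<in> T \<Longrightarrow> x - y \<in> P \<Longrightarrow> x = y" using residues by blast
  define Orb where "Orb t = (\<lambda>i. psm (zeta ^ i) (w t)) ` {..<m}" for t
  have wPL: "w t \<in> PL" if "t \<in> OK" for t
    using w[OF that] W.lattice_closed(5)[OF Lam_lattice[OF that]] by blast
  have orb: "x \<in> Lam t" "x \<noteq> 0" "pip x x \<le> r\<^sup>2" if t: "t \<in> OK" and x: "x \<in> Orb t" for t x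
  proof -
    obtain i where i: "x = psm (zeta ^ i) (w t)" using x by (auto simp: Orb_def)
    show "x \<in> Lam t" unfolding i using Lam_smult[OF t _ conjunct1[OF w[OF t]], of "zeta ^ i"] by auto
    have eq: "pip x x = pip (w t) (w t)" unfolding i by (rule pip_zeta[OF wPL[OF t]])
    then show "pip x x \<le> r\<^sup>2" using w[OF t] by simp
    show "x \<noteq> 0"
    proof
      assume "x = 0"
      then have "pip (w t) (w t) = 0" using eq by (simp add: W.ip_linear)
      then show False using W.ip_pos[OF wPL[OF t]] w[OF t] by simp
    qed
  qed
  have cardO: "card (Orb t) = m" if t: "t \<in> OK" for t
    unfolding Orb_def using inj_zeta_orbit[OF wPL[OF t]] w[OF t] by (simp add: card_image)
  have disj: "Orb t \<inter> Orb u = {}" if tu: "t \<in> T" "u \<in> T" "t \<noteq> u" for t u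
  proof (rule ccontr)
    assume "Orb t \<inter> Orb u \<noteq> {}"
    then obtain x where x: "x \<in> Orb t" "x \<in> Orb u" by blast
    have OK: "t \<in> OK" "u \<in> OK" using tu T(2) by auto
    have "t - u \<notin> P" using tu T(5) by blast
    then have xN: "x \<in> N0" using Lam_Int[OF OK] orb(1)[OF OK(1) x(1)] orb(1)[OF OK(2) x(2)] by blast
    have "pip x x \<ge> 0" by (rule W.ip_nonneg[OF W.lattice_closed(5)[OF N0_lattice xN]])
    then have "(pip x x / d) ^ d * (fact d)\<^sup>2 \<le> (r\<^sup>2 / d) ^ d * (fact d)\<^sup>2"
      using orb(3)[OF OK(1) x(1)] by (intro mult_right_mono power_mono divide_right_mono) auto
    then show False using N0_short[OF xN orb(2)[OF OK(1) x(1)]] short by linarith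
  qed
  define B where "B = (\<Union>t\<in>T. Orb t)"
  have "card B = (\<Sum>t\<in>T. card (Orb t))"
    unfolding B_def using T(1) disj by (intro card_UN_disjoint) (auto simp: Orb_def)
  also have "\<dots> = (\<Sum>t\<in>T. m)" using T(2) by (intro sum.cong refl cardO) auto
  also have "\<dots> = q * m" using T(3) by simp
  finally have cardB: "card B = q * m" .
  have "real (card B) * covolume PL pip Lam0 \<le> unit_ball_vol W.N * (r + \<tau>) ^ W.N"
  proof (rule W.card_ball_points[OF Lam0_lattice _ _ _ r \<tau>])
    show "B \<subseteq> Lam0" using orb(1) T(2) Lam_Lam0 by (force simp: B_def)
    show "pip x x \<le> r\<^sup>2" if x: "x \<in> B" for x
    proof -
      obtain t where t: "t \<in> T" "x \<in> Orb t" using x by (auto simp: B_def)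
      then show ?thesis using orb(3)[of t x] T(2) by blast
    qed
    show "\<exists>l\<in>Lam0. pip (y - l) (y - l) \<le> \<tau>\<^sup>2" if "y \<in> PL" for y
      using Lam0_covering[OF s(1,2) that] s(3) by (meson order_trans)
  qed
  then have "real m \<le> unit_ball_vol (real (2 * d)) * (r + \<tau>) ^ (2 * d)"
    using q2 by (simp add: cardB covolume_Lam0 W_N)
  then show False using vol by simp
qed

lemma packing_density_ge:
  assumes t: "t \<in> OK" and r: "r > 0" and min: "\<And>w. w \<in> Lam t \<Longrightarrow> w \<noteq> 0 \<Longrightarrow> pip w w \<ge> r\<^sup>2"
  shows "packing_density PL pip (Lam t) \<ge> unit_ball_vol (real (2 * d)) * r ^ (2 * d) / 2 ^ (2 * d)"
proof -
  define l where "l = lattice_min pip (Lam t)"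
  \<comment> \<open>\<open>cINF_greatest\<close> needs a nonzero lattice vector; (p, 0) is
    one.\<close>
  have "pt (of_nat p) 0 \<in> N0" using p_in_P OD_0 by (simp add: N0_iff)
  then have "pt (of_nat p) 0 \<in> Lam t" using N0_Lam[OF t] by blast
  moreover have "pt (of_nat p) 0 \<noteq> pt 0 0" using p_pos by (subst pt_inj) auto
  moreover have "pt 0 0 = 0" by (simp add: pt_def zero_prod_def)
  ultimately have "Lam t - {0} \<noteq> {}" by auto
  then have rl: "r \<le> l" unfolding l_def lattice_min_def
  proof (rule cINF_greatest)
    fix x assume "x \<in> Lam t - {0}"
    then have "r\<^sup>2 \<le> pip x x" using min by blast
    then show "r \<le> ip_norm pip x" unfolding ip_norm_def by (rule real_le_rsqrt)
  qed
  then have "volume PL pip {x \<in> PL. ip_norm pip x \<le> l} = unit_ball_vol W.N * l ^ W.N"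
    using r by (intro W.volume_ball) simp
  then have "packing_density PL pip (Lam t) = unit_ball_vol (real (2 * d)) * l ^ (2 * d) / 2 ^ (2 * d)"
    unfolding packing_density_def l_def[symmetric] W.dim_V covolume_Lam[OF t] by (simp add: W_N)
  moreover have "r ^ (2 * d) \<le> l ^ (2 * d)" using r rl by (intro power_mono) auto
  ultimately show ?thesis by (simp add: divide_right_mono mult_left_mono)
qed

text \<open>Origin of the constant: with X = q^(1/d) the squared covering radius is at most 2 d^2 /
  X, and it must not exceed the square of \<epsilon> r / (2 d). Since r^2 >= (1 - \<epsilon>) d /
  (pi e), it is enough that X >= 8 pi e d^3 / (\<epsilon>^2 (1 - \<epsilon>)). The hypothesis has
  d^2 m in place of d^3, and d <= m.\<close>

lemma dense_symplectic:
  assumes \<epsilon>: "0 < \<epsilon>" "\<epsilon> < 1"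
    and q_large: "8 * pi * exp 1 / (\<epsilon>\<^sup>2 * (1 - \<epsilon>)) * ((real d)\<^sup>2 * real m) \<le> real q powr (1 / real d)"
  shows "\<exists>\<Lambda>\<in>lattice_family m P. symplectic PL pip \<Lambda> \<and>
    packing_density PL pip \<Lambda> \<ge> (1 - \<epsilon>) * real m / 2 ^ (2 * d)"
proof -
  define \<omega> where "\<omega> = unit_ball_vol (real (2 * d))"
  have \<omega>: "\<omega> = pi ^ d / fact d" unfolding \<omega>_def by (rule unit_ball_vol_even)
  have \<omega>_pos: "\<omega> > 0" unfolding \<omega> by simp
  define C where "C = 8 * pi * exp 1 / (\<epsilon>\<^sup>2 * (1 - \<epsilon>))"
  define X where "X = real q powr (1 / real d)"
  have Xd: "X ^ d = real q" using q2 d_pos by (simp add: X_def powr_realpow[symmetric] powr_powr)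
  have X: "X > 0" using q2 by (simp add: X_def)
  have CX: "C * ((real d)\<^sup>2 * real m) \<le> X" using q_large by (simp add: C_def X_def)
  have d: "real d \<ge> 1" using d_pos by simp
  have m1: "real m \<ge> 1" using m_pos by simp
  have dm: "d \<le> m" by (simp add: d_def totient_le)
  have e: "exp (1::real) \<ge> 1" by simp
  have den: "\<epsilon>\<^sup>2 * (1 - \<epsilon>) \<le> 1 * 1" using \<epsilon> by (intro mult_mono power_le_one) auto
  have den2: "\<epsilon>\<^sup>2 * (1 - \<epsilon>) > 0" using \<epsilon> by simp
  have C1: "C \<ge> 1"
  proof -
    have "1 * 1 \<le> 8 * pi * exp 1" using pi_gt3 e by (intro mult_mono) auto
    then show ?thesis unfolding C_def using den den2 by (simp add: le_divide_eq)
  qed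
  \<comment> \<open>The ball of this radius in dimension 2 d has volume (1 - \<epsilon>) m.\<close>
  define r where "r = root (2 * d) ((1 - \<epsilon>) * real m / \<omega>)"
  have base: "(1 - \<epsilon>) * real m / \<omega> > 0" using \<epsilon> m1 \<omega>_pos by simp
  have r: "r > 0" unfolding r_def using base d_pos by simp
  have rd: "r ^ (2 * d) = (1 - \<epsilon>) * real m / \<omega>" unfolding r_def using base d_pos by (intro real_root_pow_pos2) auto
  have r2: "(r\<^sup>2) ^ d = (1 - \<epsilon>) * real m * fact d / pi ^ d"
    using rd by (simp add: power_mult \<omega>)
  \<comment> \<open>Comparison of d-th powers, with d^d / d! <= e^d from a single term of the
    exponential series.\<close>
  have r_lower: "r\<^sup>2 \<ge> (1 - \<epsilon>) * real d / (pi * exp 1)"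
  proof (rule power_le_imp_le_base[of _ "d - 1"])
    have "(\<Sum>k\<in>{d}. inverse (fact k) *\<^sub>R (real d) ^ k) \<le> exp (real d)"
      unfolding exp_def by (intro sum_le_suminf summable_exp_generic) auto
    then have "inverse (fact d) * real d ^ d \<le> exp (real d)" by simp
    also have "exp (real d) = exp 1 ^ d" using exp_of_nat_mult[of d "1::real"] by simp
    finally have "fact d * (inverse (fact d) * real d ^ d) \<le> fact d * exp 1 ^ d"
      by (rule mult_left_mono) simp
    then have fe: "real d ^ d \<le> fact d * exp 1 ^ d" by (simp add: mult.assoc[symmetric])
    have "((1 - \<epsilon>) * real d / (pi * exp 1)) ^ d = (1 - \<epsilon>) ^ d * (real d ^ d / exp 1 ^ d) / pi ^ d"
      by (simp add: power_divide power_mult_distrib)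
    also have "\<dots> \<le> ((1 - \<epsilon>) * real m) * fact d / pi ^ d"
    proof (intro divide_right_mono mult_mono)
      have "(1 - \<epsilon>) ^ d \<le> (1 - \<epsilon>) ^ 1" using \<epsilon> d_pos by (intro power_decreasing) auto
      also have "\<dots> \<le> (1 - \<epsilon>) * real m" using \<epsilon> m1 by simp
      finally show "(1 - \<epsilon>) ^ d \<le> (1 - \<epsilon>) * real m" .
      show "real d ^ d / exp 1 ^ d \<le> fact d" using fe by (subst pos_divide_le_eq) simp_all
    qed (use \<epsilon> in auto)
    also have "\<dots> = (r\<^sup>2) ^ d" by (simp add: r2)
    finally show "((1 - \<epsilon>) * real d / (pi * exp 1)) ^ Suc (d - 1) \<le> (r\<^sup>2) ^ Suc (d - 1)" using d_pos by simp
  qed simp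
  \<comment> \<open>Enlarging \<open>r\<close> by this amount multiplies the volume of the ball by
    at most exp \<epsilon>, and (1 - \<epsilon>) exp \<epsilon> < 1.\<close>
  define \<tau> where "\<tau> = \<epsilon> * r / (2 * d)"
  have \<tau>: "\<tau> > 0" using \<epsilon> r d_pos by (simp add: \<tau>_def)
  \<comment> \<open>The numerator 2 makes s^d = 2^d / sqrt q exceed the required 1 / sqrt q
    strictly.\<close>
  define s where "s = 2 / sqrt X"
  have s: "s > 0" using X by (simp add: s_def)
  have sd: "s ^ d > 1 / sqrt (real q)"
  proof -
    have "sqrt X ^ d = sqrt (real q)" unfolding Xd[symmetric] by (simp add: real_sqrt_power)
    then have "s ^ d = 2 ^ d / sqrt (real q)" by (simp add: s_def power_divide)
    moreover have "(2::real) ^ d > 1" using d_pos by simp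
    ultimately show ?thesis using q2 by (simp add: divide_strict_right_mono)
  qed
  have s\<tau>: "2 * (real d * s / 2)\<^sup>2 \<le> \<tau>\<^sup>2"
  proof -
    have s2: "s\<^sup>2 = 4 / X" using X by (simp add: s_def power_divide)
    have "8 * (real d) ^ 4 * (pi * exp 1) = (\<epsilon>\<^sup>2 * (1 - \<epsilon>)) * C * real d ^ 4"
      using \<epsilon> by (simp add: C_def)
    also have "\<dots> = (\<epsilon>\<^sup>2 * (1 - \<epsilon>) * real d) * (C * ((real d)\<^sup>2 * real d))"
      by (simp add: power2_eq_square power4_eq_xxxx)
    also have "\<dots> \<le> (\<epsilon>\<^sup>2 * (1 - \<epsilon>) * real d) * X"
    proof (rule mult_left_mono)
      have "C * ((real d)\<^sup>2 * real d) \<le> C * ((real d)\<^sup>2 * real m)"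
        using C1 dm by (intro mult_left_mono) auto
      then show "C * ((real d)\<^sup>2 * real d) \<le> X" using CX by linarith
    qed (use den2 in simp)
    finally have "8 * (real d) ^ 4 \<le> \<epsilon>\<^sup>2 * ((1 - \<epsilon>) * real d / (pi * exp 1)) * X"
      by (simp add: pos_le_divide_eq mult_ac)
    also have "\<dots> \<le> \<epsilon>\<^sup>2 * r\<^sup>2 * X" using r_lower X by (intro mult_right_mono mult_left_mono) auto
    finally have main: "8 * (real d) ^ 4 \<le> \<epsilon>\<^sup>2 * r\<^sup>2 * X" .
    have "2 * (real d * s / 2)\<^sup>2 = 2 * ((real d)\<^sup>2 * s\<^sup>2 / 4)"
      by (simp only: power_mult_distrib power_divide) simp
    also have "\<dots> = 8 * (real d) ^ 4 / (4 * (real d)\<^sup>2 * X)"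
      unfolding s2 using d X by (simp add: power2_eq_square power4_eq_xxxx divide_simps)
    also have "\<dots> \<le> \<epsilon>\<^sup>2 * r\<^sup>2 * X / (4 * (real d)\<^sup>2 * X)" using main X by (intro divide_right_mono) auto
    also have "\<dots> = \<tau>\<^sup>2" using X by (simp add: \<tau>_def power_divide power_mult_distrib)
    finally show ?thesis .
  qed
  \<comment> \<open>A generous estimate: inserting r^(2d) = (1 - \<epsilon>) m d! / pi^d and d! <=
    d^d reduces the claim to (d^2 m)^d <= q.\<close>
  have short: "real q > (r\<^sup>2 / d) ^ d * (fact d)\<^sup>2"
  proof -
    have pos: "(0::real) < d ^ d" using d_pos by simp
    have fd: "(fact d :: real) \<le> real d ^ d" using fact_le_power[of d, where ?'a = real] by simp
    have "(r\<^sup>2 / d) ^ d * (fact d)\<^sup>2 = (1 - \<epsilon>) * real m * (fact d) ^ 3 / (pi ^ d * real d ^ d)"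
      unfolding power_divide r2 by (simp add: power2_eq_square power3_eq_cube)
    also have "\<dots> < 1 * real m * (fact d) ^ 3 / (pi ^ d * real d ^ d)"
      using \<epsilon> m1 pos by (intro divide_strict_right_mono mult_strict_right_mono) auto
    also have "\<dots> \<le> real m * (real d ^ d) ^ 3 / (1 * real d ^ d)"
    proof (rule frac_le)
      show "1 * real m * (fact d) ^ 3 \<le> real m * (real d ^ d) ^ 3" using fd by (simp add: power_mono mult_left_mono)
      have "(1::real) \<le> pi ^ d" using pi_gt3 by (intro one_le_power) simp
      then show "1 * real d ^ d \<le> pi ^ d * real d ^ d" by (rule mult_right_mono) simp
    qed (use pos in auto)
    also have "\<dots> = real m * ((real d)\<^sup>2) ^ d"
      using pos by (simp add: power3_eq_cube power2_eq_square power_mult_distrib)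
    also have "\<dots> \<le> real m ^ d * ((real d)\<^sup>2) ^ d"
    proof (rule mult_right_mono)
      show "real m \<le> real m ^ d" using power_increasing[of 1 d "real m"] m1 d_pos by simp
    qed simp
    also have "\<dots> = ((real d)\<^sup>2 * real m) ^ d" by (simp add: power_mult_distrib mult.commute)
    also have "\<dots> \<le> X ^ d"
    proof (rule power_mono)
      have "1 * ((real d)\<^sup>2 * real m) \<le> C * ((real d)\<^sup>2 * real m)" using C1 by (rule mult_right_mono) simp
      then show "(real d)\<^sup>2 * real m \<le> X" using CX by linarith
    qed simp
    finally show ?thesis by (simp add: Xd)
  qed
  have vol: "unit_ball_vol (real (2 * d)) * (r + \<tau>) ^ (2 * d) < real m"
  proof -
    have "r + \<tau> = r * (1 + \<epsilon> / (2 * d))" using d_pos by (simp add: \<tau>_def field_simps)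
    then have "(r + \<tau>) ^ (2 * d) = r ^ (2 * d) * (1 + \<epsilon> / (2 * d)) ^ (2 * d)" by (simp only: power_mult_distrib)
    also have "\<dots> \<le> r ^ (2 * d) * exp \<epsilon>"
    proof (rule mult_left_mono)
      have "(1 + \<epsilon> / (2 * d)) ^ (2 * d) \<le> exp (\<epsilon> / (2 * d)) ^ (2 * d)"
        using \<epsilon> by (intro power_mono exp_ge_add_one_self) simp
      also have "\<dots> = exp \<epsilon>" using d_pos by (simp add: exp_of_nat_mult[symmetric])
      finally show "(1 + \<epsilon> / (2 * d)) ^ (2 * d) \<le> exp \<epsilon>" .
    qed (use r in simp)
    finally have "\<omega> * (r + \<tau>) ^ (2 * d) \<le> \<omega> * (r ^ (2 * d) * exp \<epsilon>)" using \<omega>_pos by simp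
    also have "\<dots> = ((1 - \<epsilon>) * exp \<epsilon>) * real m" using \<omega>_pos by (simp add: rd)
    also have "\<dots> < 1 * real m"
    proof (rule mult_strict_right_mono)
      have "1 - \<epsilon> < exp (- \<epsilon>)" using exp_minus_greater[of \<epsilon>] \<epsilon> by simp
      then have "(1 - \<epsilon>) * exp \<epsilon> < exp (- \<epsilon>) * exp \<epsilon>" by (rule mult_strict_right_mono) simp
      then show "(1 - \<epsilon>) * exp \<epsilon> < 1" by (simp add: exp_minus)
    qed (use m1 in simp)
    finally show ?thesis by (simp add: \<omega>_def)
  qed
  obtain t where t: "t \<in> OK" "\<And>w. w \<in> Lam t \<Longrightarrow> w \<noteq> 0 \<Longrightarrow> pip w w > r\<^sup>2"
    using exists_sparse[OF r less_imp_le[OF \<tau>] s sd s\<tau> short vol] by blast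
  have "packing_density PL pip (Lam t) \<ge> \<omega> * r ^ (2 * d) / 2 ^ (2 * d)"
    unfolding \<omega>_def using t by (intro packing_density_ge r) (auto intro: less_imp_le)
  also have "\<omega> * r ^ (2 * d) = (1 - \<epsilon>) * real m" using \<omega>_pos by (simp add: rd)
  finally show ?thesis using Lam_family[OF t(1)] Lam_symplectic[OF t(1)] by blast
qed

end

section \<open>Primorials and the choice of the dimension\<close>

definition primorial :: "nat \<Rightarrow> nat" where
  "primorial x = \<Prod>(primes_le x)"

lemma primorial_pos: "primorial x > 0"
  unfolding primorial_def by (intro prod_pos) (auto dest: prime_primes_le prime_gt_0_nat)

lemma prime_factors_primorial: "prime_factors (primorial x) = primes_le x"
proof (intro Set.set_eqI iffI)
  fix r assume "r \<in> prime_factors (primorial x)"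
  then have r: "prime r" "r dvd primorial x" by auto
  then obtain p where p: "p \<in> primes_le x" "r dvd p"
    unfolding primorial_def using prime_dvd_prod_iff[of "primes_le x" r "\<lambda>x. x"] by auto
  then have "r = p" using r(1) prime_primes_le primes_dvd_imp_eq by blast
  then show "r \<in> primes_le x" using p(1) by simp
next
  fix r assume r: "r \<in> primes_le x"
  have "r dvd primorial x" unfolding primorial_def using r by (intro dvd_prodI) auto
  then show "r \<in> prime_factors (primorial x)"
    using prime_primes_le[OF r] primorial_pos[of x] by (simp add: prime_factors_dvd)
qed

lemma totient_primorial:
  "real (primorial x) = real (totient (primorial x)) * (\<Prod>p\<in>primes_le x. 1 / (1 - 1 / real p))"
  "real (totient (primorial x)) = (\<Prod>p\<in>primes_le x. real p - 1)"
proof -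
  have p1: "real p > 1" if "p \<in> primes_le x" for p
    using prime_gt_1_nat[OF prime_primes_le[OF that]] by simp
  have tot: "real (totient (primorial x)) = real (primorial x) * (\<Prod>p\<in>primes_le x. 1 - 1 / real p)"
    using totient_formula2[of "primorial x"] by (simp only: prime_factors_primorial)
  have "(\<Prod>p\<in>primes_le x. 1 - 1 / real p) * (\<Prod>p\<in>primes_le x. 1 / (1 - 1 / real p)) = (\<Prod>p\<in>primes_le x. 1)"
    unfolding prod.distrib[symmetric]
  proof (rule prod.cong[OF refl])
    fix p assume "p \<in> primes_le x"
    then have "1 - 1 / real p \<noteq> 0" using p1[of p] by (simp add: field_simps)
    then show "(1 - 1 / real p) * (1 / (1 - 1 / real p)) = 1" by (metis divide_self times_divide_eq_right mult_1_right)
  qed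
  then show "real (primorial x) = real (totient (primorial x)) * (\<Prod>p\<in>primes_le x. 1 / (1 - 1 / real p))"
    unfolding tot by (simp only: mult.assoc) simp
  have "real (primorial x) * (\<Prod>p\<in>primes_le x. 1 - 1 / real p) = (\<Prod>p\<in>primes_le x. real p * (1 - 1 / real p))"
    by (simp only: primorial_def of_nat_prod prod.distrib)
  also have "\<dots> = (\<Prod>p\<in>primes_le x. real p - 1)"
    using p1 by (intro prod.cong refl) (fastforce simp: field_simps)
  finally show "real (totient (primorial x)) = (\<Prod>p\<in>primes_le x. real p - 1)" using tot by simp
qed

text \<open>All factors of the totient are at least 1, so a single large prime up to
  \<open>x\<close> already makes the dimension large.\<close>

lemma totient_primorial_ge:
  assumes "p0 \<in> primes_le x"
  shows "real (totient (primorial x)) \<ge> real p0 - 1"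
proof -
  have p2: "real p - 1 \<ge> 1" if "p \<in> primes_le x" for p
    using prime_ge_2_nat[OF prime_primes_le[OF that]] by simp
  have "(\<Prod>p\<in>primes_le x - {p0}. real p - 1) \<ge> 1" using p2 by (intro prod_ge_1) auto
  then have "(real p0 - 1) * 1 \<le> (real p0 - 1) * (\<Prod>p\<in>primes_le x - {p0}. real p - 1)"
    using p2[OF assms] by (intro mult_left_mono) auto
  also have "\<dots> = real (totient (primorial x))"
    unfolding totient_primorial(2) using assms by (intro prod.remove[symmetric]) auto
  finally show ?thesis by simp
qed

text \<open>Crude, but it is used under two logarithms, where it costs only a term ln (ln x +
  1).\<close>

lemma primorial_le: "x > 0 \<Longrightarrow> primorial x \<le> x ^ x"
proof -
  assume x: "x > 0"
  have "primorial x \<le> (\<Prod>p\<in>primes_le x. x)"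
    unfolding primorial_def by (intro prod_mono) (auto simp: primes_le_def)
  also have "\<dots> = x ^ card (primes_le x)" by simp
  also have "card (primes_le x) \<le> card {1..x}"
    by (intro card_mono) (auto simp: primes_le_def dest: prime_ge_1_nat)
  then have "x ^ card (primes_le x) \<le> x ^ x" using x by (intro power_increasing) auto
  finally show ?thesis .
qed

theorem corollary2:
  fixes P :: "nat \<Rightarrow> complex set"
  assumes "\<And>m. m > 0 \<Longrightarrow> \<exists>p. prime p \<and> \<not> p dvd m \<and> prime_over (cyclotomic_field m) (P m) p"
    and "(\<lambda>m. real (totient m) ^ 2 * real m)
           \<in> o(\<lambda>m. real (residue_card (cyclotomic_field m) (P m)) powr (1 / real (totient m)))"
  shows "infinite {n. \<exists>m>0. n = 2 * totient m \<and>
           (\<exists>\<Lambda>\<in>lattice_family m (P m).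
              symplectic (plane (cyclotomic_field m)) (plane_ip (cyclotomic_field m)) \<Lambda> \<and>
              packing_density (plane (cyclotomic_field m)) (plane_ip (cyclotomic_field m)) \<Lambda>
                \<ge> 0.89 * real n * ln (ln (real n)) / 2 ^ n)}"
  unfolding infinite_nat_iff_unbounded
proof
  fix N0 :: nat
  \<comment> \<open>Room between 1.78 = 2 * 0.89 and the exponential of the Euler constant is shared
    out by 1.78 < \<kappa> < c: the Mertens product exceeds c ln x, the gap between \<open>c\<close>
    and \<open>\<kappa>\<close> pays for the factor 1 - \<epsilon>, and the gap between
    \<open>\<kappa>\<close> and 1.78 absorbs the term ln (ln x + 1).\<close>
  define c where "c = exp ((ln (178 / 100) + euler_mascheroni) / 2 :: real)"
  have c: "c > 178 / 100" "ln c < euler_mascheroni"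
  proof -
    have "ln (178 / 100) < (ln (178 / 100) + euler_mascheroni) / (2::real)" using euler_mascheroni_bound by simp
    then have "exp (ln (178 / 100)) < c" unfolding c_def by (simp only: exp_less_cancel_iff)
    then show "c > 178 / 100" by simp
    show "ln c < euler_mascheroni" using euler_mascheroni_bound by (simp add: c_def)
  qed
  define \<kappa> where "\<kappa> = (178 / 100 + c) / 2"
  have \<kappa>: "178 / 100 < \<kappa>" "\<kappa> < c" using c(1) by (auto simp: \<kappa>_def)
  define \<epsilon> where "\<epsilon> = 1 - \<kappa> / c"
  have \<epsilon>: "0 < \<epsilon>" "\<epsilon> < 1" "(1 - \<epsilon>) * c = \<kappa>" using c(1) \<kappa> by (auto simp: \<epsilon>_def)
  define C where "C = 8 * pi * exp 1 / (\<epsilon>\<^sup>2 * (1 - \<epsilon>))"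
  have C: "C > 0" using \<epsilon> by (simp add: C_def)
  have "\<forall>\<^sub>F m in sequentially. norm (real (totient m) ^ 2 * real m) \<le>
      1 / C * norm (real (residue_card (cyclotomic_field m) (P m)) powr (1 / real (totient m)))"
    using C by (intro landau_o.smallD[OF assms(2)]) simp
  then obtain m0 where m0: "m \<ge> m0 \<Longrightarrow> real (totient m) ^ 2 * real m \<le>
      1 / C * real (residue_card (cyclotomic_field m) (P m)) powr (1 / real (totient m))" for m
    by (auto simp: eventually_sequentially)
  have \<kappa>0: "\<kappa> - 178 / 100 > 0" using \<kappa> by simp
  have "\<forall>\<^sub>F x::real in at_top. (\<kappa> - 178 / 100) * ln x \<ge> 178 / 100 * ln (ln x + 1)"
    using \<kappa>0 by real_asymp
  then have "\<forall>\<^sub>F x::nat in sequentially. (\<kappa> - 178 / 100) * ln (real x) \<ge> 178 / 100 * ln (ln (real x) + 1)"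
    using filterlim_real_sequentially by (rule eventually_compose_filterlim)
  then obtain x1 :: nat where x1: "x \<ge> x1 \<Longrightarrow> (\<kappa> - 178 / 100) * ln (real x) \<ge> 178 / 100 * ln (ln (real x) + 1)" for x
    by (auto simp: eventually_sequentially)
  \<comment> \<open>This prime will divide the primorial, so that \<open>totient m\<close> is at
    least p0 - 1 and exceeds both \<open>N0\<close> and \<open>m0\<close>.\<close>
  obtain p0 :: nat where p0: "prime p0" "p0 > N0 + m0 + 2" using bigger_prime[of "N0 + m0 + 2"] by blast
  obtain x where x: "x \<ge> max x1 p0" "(\<Prod>p\<in>primes_le x. 1 / (1 - 1 / real p)) > c * ln x"
    using mertens_lower[of c "max x1 p0"] c by auto
  define m where "m = primorial x"
  define \<phi> where "\<phi> = totient m"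
  have x3: "x \<ge> 3" using x(1) p0(2) by simp
  have "real \<phi> \<ge> real p0 - 1"
    unfolding \<phi>_def m_def using x(1) p0(1) by (intro totient_primorial_ge) (simp add: primes_le_def)
  then have \<phi>: "\<phi> > N0 + m0" using p0(2) by linarith
  have \<phi>m: "\<phi> \<le> m" by (simp add: \<phi>_def totient_le)
  have m: "m > 0" "m \<ge> m0" using \<phi> \<phi>m by auto
  have mc: "real m \<ge> real \<phi> * (c * ln x)"
  proof -
    have "real m = real \<phi> * (\<Prod>p\<in>primes_le x. 1 / (1 - 1 / real p))"
      unfolding m_def \<phi>_def by (rule totient_primorial(1))
    then show ?thesis using x(2) by (simp add: mult_left_mono)
  qed
  obtain p where p: "prime p" "\<not> p dvd m" "prime_over (cyclotomic_field m) (P m) p"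
    using assms(1)[OF m(1)] by blast
  interpret cyclotomic_prime m "P m" p
    by unfold_locales (use m p in auto)
  have "C * (real \<phi> ^ 2 * real m) \<le> real (residue_card (cyclotomic_field m) (P m)) powr (1 / real \<phi>)"
    using m0[OF m(2)] C by (simp add: \<phi>_def field_simps)
  then have "8 * pi * exp 1 / (\<epsilon>\<^sup>2 * (1 - \<epsilon>)) * ((real d)\<^sup>2 * real m) \<le> real q powr (1 / real d)"
    by (simp add: C_def d_def q_def K_def \<phi>_def)
  from dense_symplectic[OF \<epsilon>(1,2) this]
  obtain \<Lambda> where \<Lambda>: "\<Lambda> \<in> lattice_family m (P m)" "symplectic PL pip \<Lambda>"
    "packing_density PL pip \<Lambda> \<ge> (1 - \<epsilon>) * real m / 2 ^ (2 * d)" by blast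
  have dphi: "d = \<phi>" by (simp add: d_def \<phi>_def)
  define n where "n = 2 * \<phi>"
  have n2: "n \<ge> 2" using \<phi> by (simp add: n_def)
  have lx: "ln (real x) > 0" using x3 by simp
  have lnn: "ln (real n) \<le> x * (ln x + 1)"
  proof -
    have "n \<le> 2 * x ^ x" using \<phi>m primorial_le[of x] x3 by (simp add: n_def m_def)
    then have "real n \<le> real (2 * x ^ x)" by (simp only: of_nat_le_iff)
    then have "ln (real n) \<le> ln (2 * real x ^ x)" using n2 x3 by (subst ln_le_cancel_iff) auto
    also have "\<dots> = ln 2 + x * ln x" using x3 by (simp add: ln_mult ln_realpow)
    also have "ln 2 \<le> real x" using ln_le_minus_one[of 2] x3 by simp
    finally show ?thesis by (simp add: algebra_simps)
  qed
  have "real x * (ln x + 1) > 0" using x3 lx by (intro mult_pos_pos add_pos_pos) auto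
  then have "ln (ln (real n)) \<le> ln (x * (ln x + 1))" using lnn n2 by (subst ln_le_cancel_iff) auto
  also have "\<dots> = ln x + ln (ln x + 1)" using x3 \<open>real x * (ln x + 1) > 0\<close> by (subst ln_mult) auto
  finally have lnln: "ln (ln (real n)) \<le> ln x + ln (ln x + 1)" .
  have "178 / 100 * ln (ln (real n)) \<le> 178 / 100 * (ln x + ln (ln x + 1))" using lnln by simp
  also have "\<dots> \<le> \<kappa> * ln x" using x1[of x] x(1) by (simp add: algebra_simps)
  finally have "real \<phi> * (178 / 100 * ln (ln (real n))) \<le> real \<phi> * (\<kappa> * ln x)" by (intro mult_left_mono) auto
  also have "\<dots> = (1 - \<epsilon>) * (real \<phi> * (c * ln x))" by (simp add: \<epsilon>(3)[symmetric])
  also have "\<dots> \<le> (1 - \<epsilon>) * real m" using mc \<epsilon> by (intro mult_left_mono) auto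
  finally have "0.89 * real n * ln (ln (real n)) \<le> (1 - \<epsilon>) * real m" by (simp add: n_def)
  then have "0.89 * real n * ln (ln (real n)) / 2 ^ n \<le> (1 - \<epsilon>) * real m / 2 ^ n" by (rule divide_right_mono) simp
  also have "\<dots> \<le> packing_density PL pip \<Lambda>" using \<Lambda>(3) by (simp add: dphi n_def)
  finally show "\<exists>n>N0. n \<in> {n. \<exists>m>0. n = 2 * totient m \<and>
           (\<exists>\<Lambda>\<in>lattice_family m (P m).
              symplectic (plane (cyclotomic_field m)) (plane_ip (cyclotomic_field m)) \<Lambda> \<and>
              packing_density (plane (cyclotomic_field m)) (plane_ip (cyclotomic_field m)) \<Lambda>
                \<ge> 0.89 * real n * ln (ln (real n)) / 2 ^ n)}"
    using \<Lambda>(1,2) m(1) \<phi> unfolding K_def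
    by (intro exI[of _ n] conjI CollectI exI[of _ m] bexI[of _ \<Lambda>]) (auto simp: n_def \<phi>_def)
qed

end
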